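(* Assume the data assumption, the smallness assumption and the learning-rate assumption stated in the context. Let $(\theta_t)_{t\ge 0}$ be the parameters produced by the RTRL (online forward stochastic gradient descent) algorithm, and let $L$ be the limiting loss. Then $$\lim_{t\to\infty}\mathbb{E}\,\|\nabla_\theta L(\theta_t)\|_2=0,$$ where $\|\cdot\|_2$ is the Euclidean norm on $\mathbb{R}^{d_\theta}$.
   Context: Norms: $\|\cdot\|_{\max}$ is the largest absolute value of the entries of a vector/array; $\mathrm{Wass}_2$ is the 2-Wasserstein distance with respect to $\|\cdot\|_{\max}$. Data. Fix positive integers $d,N,d_Z$. $(X_t,Z_t)_{t\ge0}$ is a time-homogeneous Markov chain in $\mathbb{R}^d\times\mathbb{R}^{d_Z}$ with transition kernel $\wp$; $(\eta_t)_{t\ge0}$ are i.i.d. real random variables with law $\mu_\eta$, independent of $(X_t,Z_t)_{t\ge 0}$; $Y_t=f(X_t,Z_t,\eta_t)$. Data assumption: (i) $\mathrm{Wass}_2(\wp(w,\cdot),\wp(\tilde w,\cdot))\le L_\wp\|w-\tilde w\|_{\max}$ for all $w,\tilde w\in\mathbb{R}^{d+d_Z}$, with $L_\wp<1$; (ii) $|f(x,z,\eta)-f(\tilde x,\tilde z,\tilde\eta)|\le L_f\|(x,z,\eta)-(\tilde x,\tilde z,\tilde\eta)\|_{\max}$ for all arguments; (iii) $\|(X_t,Z_t)\|_{\max}\le1$ for all $t$, and $|f|\le L_f$. Network. Parameters $\theta=(A,W,B,c)$, $A\in\mathbb{R}^{N\times d}$, $W\in\mathbb{R}^{N\times N}$,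 $B\in\mathbb{R}^N$, $c\in\mathbb{R}$, identified with a vector in $\Theta=\mathbb{R}^{d_\theta}$, $d_\theta=Nd+N^2+N+1$. $\sigma(y)=1/(1+e^{-y})$. $\phi,\lambda:\mathbb{R}\to\mathbb{R}$ are infinitely differentiable, bounded, with all derivatives bounded, applied entrywise; $|\phi|\le C_\phi$, $|\phi'|\le C_{\phi'}$, $|\phi''|\le C_{\phi''}$, $|\lambda|\le C_\lambda$. $A^{k,:}$ denotes the $k$-th row of $A$. Smallness assumption. $C_\phi<4$; put $M_\phi=1+\frac{C_\phi}{4-C_\phi}$, $m=\min(N,d)$, $L_0=\max\big(\frac{3C_{\phi'}}{m}(\frac{C_\phi M_\phi}{10}+\frac14),\frac{3C_\phi}{4}\big)$, $L_2=\max\big(\frac{C_{\phi''}}{m},\frac{C_{\phi'}^2}{Nd(4-C_\phi)}\big)$, $T_1=\frac{M_\phi C_{\phi'}^2}{5m^2}+\frac{C_\phi M_\phi^2C_{\phi'}^2}{8m^2}+\frac{C_{\phi''}}{4m}+\frac{C_\phi}{10}\Big(L_2+\frac{C_\phi}{1-C_\phi/4}\big(\frac{C_{\phi'}^2M_\phi^2}{10m^2}+\frac14L_2\big)\Big)$, $T_2=\frac{C_\phi M_\phi C_{\phi'}}{5m}+\frac{C_{\phi'}}{4N}$, $L_1=\max(4T_1,4T_2,C_\phi)$, $\bar L=\max(L_0,L_1)$. It is assumed that $0<q:=\sqrt{\bar L^2+L_\wp^2}<1$. Limiting loss. For fixed $\theta$ let $S_0=0$ and $S^k_{t+1}=\sigma\big(\frac1d\langle\phi(A^{k,:}),X_t\rangle+\frac1N\langle\phi(W^{k,:}),S_t\rangle\big)$,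 $k=1,\dots,N$. Let $\mu^\theta$ be the stationary distribution to which the law of the Markov chain $(X_t,Z_t,S_t,\eta_t)$ converges as $t\to\infty$, and $$L(\theta)=\int\tfrac12\big(f(x,z,\eta)-\langle\lambda(B),s\rangle-\lambda(c)\big)^2\mu^\theta(dx,dz,ds,d\eta).$$ RTRL algorithm. Start from an arbitrary $\theta_0\in\Theta$ and $\bar S_0=0$, $\hat S_0=0$. With $\theta_t=(A_t,W_t,B_t,c_t)$ and $a^k_t=\frac1d\langle\phi(A_t^{k,:}),X_t\rangle+\frac1N\langle\phi(W_t^{k,:}),\bar S_t\rangle$, for all indices $i,j,k$: $\bar S^k_{t+1}=\sigma(a_t^k)$, $\hat S^{A^{ij},k}_{t+1}=\sigma'(a_t^k)\big(\frac1d\delta_{ik}\phi'(A_t^{ij})X_t^j+\frac1N\sum_{\ell=1}^N\phi(W_t^{k\ell})\hat S_t^{A^{ij},\ell}\big)$, $\hat S^{W^{ij},k}_{t+1}=\sigma'(a_t^k)\big(\frac1N\delta_{ik}\phi'(W_t^{ij})\bar S_t^j+\frac1N\sum_{\ell=1}^N\phi(W_t^{k\ell})\hat S_t^{W^{ij},\ell}\big)$, $\theta_{t+1}=\theta_t-\alpha_tG_t$, where $G_t=-(Y_t-\langle\lambda(B_t),\bar S_t\rangle-\lambda(c_t))\,D_t$ and $D_t\in\mathbb{R}^{d_\theta}$ has $A^{ij}$-entry $\sum_k\lambda(B_t^k)\hat S_t^{A^{ij},k}$, $W^{ij}$-entry $\sum_k\lambda(B_t^k)\hat S_t^{W^{ij},k}$,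 $B^k$-entry $\lambda'(B_t^k)\bar S_t^k$, and $c$-entry $\lambda'(c_t)$. Learning-rate assumption: $(\alpha_t)_{t\ge0}$ is a positive, monotonically decreasing sequence with $\sum_t\alpha_t=\infty$ and $\sum_t\alpha_t^2<\infty$. *)

theory Defs
  imports "HOL-Probability.Probability"
begin

section \<open>Wasserstein distance, Markov chains, gradients\<close>

text \<open>The maximum norm is the library's \<^const>\<open>infnorm\<close>: the basis of a product or array type
  consists of the scalar coordinate directions.\<close>

definition couplings :: "'a::euclidean_space measure \<Rightarrow> 'a measure \<Rightarrow> ('a \<times> 'a) measure set" where
  "couplings P Q = {\<pi>. prob_space \<pi> \<and> sets \<pi> = sets borel
     \<and> distr \<pi> borel fst = P \<and> distr \<pi> borel snd = Q}"

definition ennreal_sqrt :: "ennreal \<Rightarrow> ennreal" where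
  "ennreal_sqrt x = (if x = \<infinity> then \<infinity> else ennreal (sqrt (enn2real x)))"

definition Wass2 :: "'a::euclidean_space measure \<Rightarrow> 'a measure \<Rightarrow> ennreal" where
  "Wass2 P Q = (INF \<pi>\<in>couplings P Q.
     ennreal_sqrt (\<integral>\<^sup>+ (x, y). ennreal ((infnorm (x - y))\<^sup>2) \<partial>\<pi>))"

definition past_algebra ::
  "'w measure \<Rightarrow> (nat \<Rightarrow> 'w \<Rightarrow> 'a::topological_space) \<Rightarrow> nat \<Rightarrow> 'w measure" where
  "past_algebra M V t = sigma (space M) (\<Union>s\<in>{..t}. {V s -` C \<inter> space M | C. C \<in> sets borel})"

definition markov_chain ::
  "'w measure \<Rightarrow> ('a::topological_space \<Rightarrow> 'a measure) \<Rightarrow> (nat \<Rightarrow> 'w \<Rightarrow> 'a) \<Rightarrow> bool" where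
  "markov_chain M K V \<longleftrightarrow>
     K \<in> borel \<rightarrow>\<^sub>M prob_algebra borel \<and>
     (\<forall>t. V t \<in> borel_measurable M) \<and>
     (\<forall>t. \<forall>C\<in>sets borel. AE \<omega> in M.
        real_cond_exp M (past_algebra M V t) (\<lambda>\<omega>'. indicator C (V (Suc t) \<omega>')) \<omega>
          = measure (K (V t \<omega>)) C)"

text \<open>The library's \<open>indep_var\<close> requires both random variables to have the same codomain type;
  this is the same notion without that restriction.\<close>

definition independent_of ::
  "'w measure \<Rightarrow> 'a measure \<Rightarrow> ('w \<Rightarrow> 'a) \<Rightarrow> 'b measure \<Rightarrow> ('w \<Rightarrow> 'b) \<Rightarrow> bool" where
  "independent_of M A U B V \<longleftrightarrow> U \<in> M \<rightarrow>\<^sub>M A \<and> V \<in> M \<rightarrow>\<^sub>M B \<and>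
     prob_space.indep_set M {U -` E \<inter> space M | E. E \<in> sets A} {V -` E \<inter> space M | E. E \<in> sets B}"

definition weakly_converges ::
  "(nat \<Rightarrow> 'a::topological_space measure) \<Rightarrow> 'a measure \<Rightarrow> bool" where
  "weakly_converges P Q \<longleftrightarrow> (\<forall>g::'a \<Rightarrow> real. continuous_on UNIV g \<longrightarrow> bounded (range g) \<longrightarrow>
     (\<lambda>t. \<integral>x. g x \<partial>(P t)) \<longlonglongrightarrow> (\<integral>x. g x \<partial>Q))"

definition gradient :: "('a::real_inner \<Rightarrow> real) \<Rightarrow> 'a \<Rightarrow> 'a" where
  "gradient F x = (THE D. GDERIV F x :> D)"

definition smooth_bounded :: "(real \<Rightarrow> real) \<Rightarrow> bool" where
  "smooth_bounded g \<longleftrightarrow> (\<forall>k. (\<forall>x. (deriv ^^ k) g field_differentiable at x) \<and>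
     bounded (range ((deriv ^^ k) g)))"

section \<open>The recurrent network\<close>

text \<open>The norm of this product type is the Euclidean norm of the vector of all entries of
  \<open>(A, W, B, c)\<close>.\<close>

type_synonym ('d, 'n) params = "(real ^ 'd ^ 'n) \<times> (real ^ 'n ^ 'n) \<times> (real ^ 'n) \<times> real"

definition sigmoid :: "real \<Rightarrow> real" where
  "sigmoid y = 1 / (1 + exp (- y))"

definition entrywise :: "(real \<Rightarrow> real) \<Rightarrow> real ^ 'm \<Rightarrow> real ^ 'm" where
  "entrywise g v = (\<chi> i. g (v $ i))"

definition preactivation ::
  "(real \<Rightarrow> real) \<Rightarrow> real ^ 'd ^ 'n \<Rightarrow> real ^ 'n ^ 'n \<Rightarrow> real ^ 'd \<Rightarrow> real ^ 'n \<Rightarrow> real ^ 'n" where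
  "preactivation \<phi> A W x s = (\<chi> k.
     1 / real CARD('d) * (entrywise \<phi> (A $ k) \<bullet> x) + 1 / real CARD('n) * (entrywise \<phi> (W $ k) \<bullet> s))"

definition rnn_step ::
  "(real \<Rightarrow> real) \<Rightarrow> ('d::finite, 'n::finite) params \<Rightarrow> real ^ 'd \<Rightarrow> real ^ 'n \<Rightarrow> real ^ 'n" where
  "rnn_step \<phi> = (\<lambda>(A, W, B, c) x s. entrywise sigmoid (preactivation \<phi> A W x s))"

primrec rnn_state ::
  "(real \<Rightarrow> real) \<Rightarrow> ('d::finite, 'n::finite) params \<Rightarrow> (nat \<Rightarrow> real ^ 'd) \<Rightarrow> nat \<Rightarrow> real ^ 'n" where
  "rnn_state \<phi> \<theta> x 0 = 0"
| "rnn_state \<phi> \<theta> x (Suc t) = rnn_step \<phi> \<theta> (x t) (rnn_state \<phi> \<theta> x t)"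

section \<open>The limiting loss\<close>

definition joint_kernel ::
  "((real ^ 'd) \<times> (real ^ 'z) \<Rightarrow> ((real ^ 'd) \<times> (real ^ 'z)) measure) \<Rightarrow> real measure \<Rightarrow>
   (real \<Rightarrow> real) \<Rightarrow> ('d::finite, 'n::finite) params \<Rightarrow>
   (real ^ 'd) \<times> (real ^ 'z) \<times> (real ^ 'n) \<times> real \<Rightarrow>
   ((real ^ 'd) \<times> (real ^ 'z) \<times> (real ^ 'n) \<times> real) measure" where
  "joint_kernel K \<mu>\<eta> \<phi> \<theta> = (\<lambda>(x, z, s, e).
     distr (K (x, z) \<Otimes>\<^sub>M \<mu>\<eta>) borel (\<lambda>((x', z'), e'). (x', z', rnn_step \<phi> \<theta> x s, e')))"

definition joint_law ::
  "'w measure \<Rightarrow> (real \<Rightarrow> real) \<Rightarrow> (nat \<Rightarrow> 'w \<Rightarrow> real ^ 'd) \<Rightarrow> (nat \<Rightarrow> 'w \<Rightarrow> real ^ 'z) \<Rightarrow>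
   (nat \<Rightarrow> 'w \<Rightarrow> real) \<Rightarrow> ('d::finite, 'n::finite) params \<Rightarrow> nat \<Rightarrow>
   ((real ^ 'd) \<times> (real ^ 'z) \<times> (real ^ 'n) \<times> real) measure" where
  "joint_law M \<phi> X Z \<eta> \<theta> t =
     distr M borel (\<lambda>\<omega>. (X t \<omega>, Z t \<omega>, rnn_state \<phi> \<theta> (\<lambda>s. X s \<omega>) t, \<eta> t \<omega>))"

definition limit_law ::
  "'w measure \<Rightarrow> ((real ^ 'd) \<times> (real ^ 'z) \<Rightarrow> ((real ^ 'd) \<times> (real ^ 'z)) measure) \<Rightarrow>
   real measure \<Rightarrow> (real \<Rightarrow> real) \<Rightarrow> (nat \<Rightarrow> 'w \<Rightarrow> real ^ 'd) \<Rightarrow> (nat \<Rightarrow> 'w \<Rightarrow> real ^ 'z) \<Rightarrow>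
   (nat \<Rightarrow> 'w \<Rightarrow> real) \<Rightarrow> ('d::finite, 'n::finite) params \<Rightarrow>
   ((real ^ 'd) \<times> (real ^ 'z) \<times> (real ^ 'n) \<times> real) measure" where
  "limit_law M K \<mu>\<eta> \<phi> X Z \<eta> \<theta> = (THE \<mu>.
     prob_space \<mu> \<and> sets \<mu> = sets borel \<and>
     \<mu> \<bind> joint_kernel K \<mu>\<eta> \<phi> \<theta> = \<mu> \<and>
     weakly_converges (joint_law M \<phi> X Z \<eta> \<theta>) \<mu>)"

definition limiting_loss ::
  "'w measure \<Rightarrow> ((real ^ 'd) \<times> (real ^ 'z) \<Rightarrow> ((real ^ 'd) \<times> (real ^ 'z)) measure) \<Rightarrow>
   real measure \<Rightarrow> (real \<Rightarrow> real) \<Rightarrow> (real \<Rightarrow> real) \<Rightarrow>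
   (nat \<Rightarrow> 'w \<Rightarrow> real ^ 'd) \<Rightarrow> (nat \<Rightarrow> 'w \<Rightarrow> real ^ 'z) \<Rightarrow> (nat \<Rightarrow> 'w \<Rightarrow> real) \<Rightarrow>
   (real ^ 'd \<Rightarrow> real ^ 'z \<Rightarrow> real \<Rightarrow> real) \<Rightarrow> ('d::finite, 'n::finite) params \<Rightarrow> real" where
  "limiting_loss M K \<mu>\<eta> \<phi> lam X Z \<eta> f = (\<lambda>(A, W, B, c).
     \<integral>(x, z, s, e). 1 / 2 * (f x z e - entrywise lam B \<bullet> s - lam c)\<^sup>2
       \<partial>(limit_law M K \<mu>\<eta> \<phi> X Z \<eta> (A, W, B, c)))"

section \<open>The RTRL algorithm\<close>

text \<open>The state is \<open>(\<theta>, S, SA, SW)\<close>, where \<open>SA $ i $ j $ k\<close> and \<open>SW $ i $ j $ k\<close> are the estimated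
  sensitivities of the \<open>k\<close>-th memory unit with respect to the entries \<open>A $ i $ j\<close> and \<open>W $ i $ j\<close>.\<close>

type_synonym ('d, 'n) rtrl_state =
  "('d, 'n) params \<times> (real ^ 'n) \<times> (real ^ 'n ^ 'd ^ 'n) \<times> (real ^ 'n ^ 'n ^ 'n)"

definition sensitivity_A_step ::
  "(real \<Rightarrow> real) \<Rightarrow> real ^ 'd ^ 'n \<Rightarrow> real ^ 'n ^ 'n \<Rightarrow> real ^ 'd \<Rightarrow> real ^ 'n \<Rightarrow>
   real ^ 'n ^ 'd ^ 'n \<Rightarrow> real ^ 'n ^ 'd ^ 'n" where
  "sensitivity_A_step \<phi> A W x s SA = (\<chi> i j k.
     deriv sigmoid (preactivation \<phi> A W x s $ k) *
       (1 / real CARD('d) * (if i = k then 1 else 0) * deriv \<phi> (A $ i $ j) * x $ j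
        + 1 / real CARD('n) * (\<Sum>l\<in>UNIV. \<phi> (W $ k $ l) * SA $ i $ j $ l)))"

definition sensitivity_W_step ::
  "(real \<Rightarrow> real) \<Rightarrow> real ^ 'd ^ 'n \<Rightarrow> real ^ 'n ^ 'n \<Rightarrow> real ^ 'd \<Rightarrow> real ^ 'n \<Rightarrow>
   real ^ 'n ^ 'n ^ 'n \<Rightarrow> real ^ 'n ^ 'n ^ 'n" where
  "sensitivity_W_step \<phi> A W x s SW = (\<chi> i j k.
     deriv sigmoid (preactivation \<phi> A W x s $ k) *
       (1 / real CARD('n) * (if i = k then 1 else 0) * deriv \<phi> (W $ i $ j) * s $ j
        + 1 / real CARD('n) * (\<Sum>l\<in>UNIV. \<phi> (W $ k $ l) * SW $ i $ j $ l)))"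

definition output_direction ::
  "(real \<Rightarrow> real) \<Rightarrow> ('d::finite, 'n::finite) rtrl_state \<Rightarrow> ('d::finite, 'n::finite) params" where
  "output_direction lam = (\<lambda>((A, W, B, c), s, SA, SW).
     ((\<chi> i j. \<Sum>k\<in>UNIV. lam (B $ k) * SA $ i $ j $ k),
      (\<chi> i j. \<Sum>k\<in>UNIV. lam (B $ k) * SW $ i $ j $ k),
      (\<chi> k. deriv lam (B $ k) * s $ k),
      deriv lam c))"

definition rtrl_gradient ::
  "(real \<Rightarrow> real) \<Rightarrow> real \<Rightarrow> ('d::finite, 'n::finite) rtrl_state \<Rightarrow> ('d::finite, 'n::finite) params" where
  "rtrl_gradient lam y = (\<lambda>((A, W, B, c), s, SA, SW).
     - (y - entrywise lam B \<bullet> s - lam c) *\<^sub>R output_direction lam ((A, W, B, c), s, SA, SW))"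

definition rtrl_step ::
  "(real \<Rightarrow> real) \<Rightarrow> (real \<Rightarrow> real) \<Rightarrow> real \<Rightarrow> real ^ 'd \<Rightarrow> real \<Rightarrow>
   ('d::finite, 'n::finite) rtrl_state \<Rightarrow> ('d::finite, 'n::finite) rtrl_state" where
  "rtrl_step \<phi> lam a x y = (\<lambda>((A, W, B, c), s, SA, SW).
     ((A, W, B, c) - a *\<^sub>R rtrl_gradient lam y ((A, W, B, c), s, SA, SW),
      entrywise sigmoid (preactivation \<phi> A W x s),
      sensitivity_A_step \<phi> A W x s SA,
      sensitivity_W_step \<phi> A W x s SW))"

primrec rtrl ::
  "(real \<Rightarrow> real) \<Rightarrow> (real \<Rightarrow> real) \<Rightarrow> (nat \<Rightarrow> real) \<Rightarrow> ('d::finite, 'n::finite) params \<Rightarrow>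
   (nat \<Rightarrow> real ^ 'd) \<Rightarrow> (nat \<Rightarrow> real) \<Rightarrow> nat \<Rightarrow> ('d::finite, 'n::finite) rtrl_state" where
  "rtrl \<phi> lam \<alpha> \<theta>0 x y 0 = (\<theta>0, 0, 0, 0)"
| "rtrl \<phi> lam \<alpha> \<theta>0 x y (Suc t) = rtrl_step \<phi> lam (\<alpha> t) (x t) (y t) (rtrl \<phi> lam \<alpha> \<theta>0 x y t)"

definition rtrl_params ::
  "(real \<Rightarrow> real) \<Rightarrow> (real \<Rightarrow> real) \<Rightarrow> (nat \<Rightarrow> real) \<Rightarrow> ('d::finite, 'n::finite) params \<Rightarrow>
   (nat \<Rightarrow> real ^ 'd) \<Rightarrow> (nat \<Rightarrow> real) \<Rightarrow> nat \<Rightarrow> ('d::finite, 'n::finite) params" where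
  "rtrl_params \<phi> lam \<alpha> \<theta>0 x y t = fst (rtrl \<phi> lam \<alpha> \<theta>0 x y t)"

section \<open>The constants of the smallness assumption\<close>

text \<open>\<open>C\<close>, \<open>C1\<close>, \<open>C2\<close> bound \<open>\<phi>\<close> and its first two derivatives; \<open>N\<close> is the number of memory
  units and \<open>d\<close> the input dimension.\<close>

definition M_const :: "real \<Rightarrow> real" where
  "M_const C = 1 + C / (4 - C)"

definition L0_const :: "nat \<Rightarrow> nat \<Rightarrow> real \<Rightarrow> real \<Rightarrow> real" where
  "L0_const N d C C1 =
     max (3 * C1 / real (min N d) * (C * M_const C / 10 + 1 / 4)) (3 * C / 4)"

definition L2_const :: "nat \<Rightarrow> nat \<Rightarrow> real \<Rightarrow> real \<Rightarrow> real \<Rightarrow> real" where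
  "L2_const N d C C1 C2 =
     max (C2 / real (min N d)) (C1\<^sup>2 / (real N * real d * (4 - C)))"

definition T1_const :: "nat \<Rightarrow> nat \<Rightarrow> real \<Rightarrow> real \<Rightarrow> real \<Rightarrow> real" where
  "T1_const N d C C1 C2 = (let m = real (min N d) in
     M_const C * C1\<^sup>2 / (5 * m\<^sup>2) + C * (M_const C)\<^sup>2 * C1\<^sup>2 / (8 * m\<^sup>2) + C2 / (4 * m)
     + C / 10 * (L2_const N d C C1 C2
         + C / (1 - C / 4) * (C1\<^sup>2 * (M_const C)\<^sup>2 / (10 * m\<^sup>2) + 1 / 4 * L2_const N d C C1 C2)))"

definition T2_const :: "nat \<Rightarrow> nat \<Rightarrow> real \<Rightarrow> real \<Rightarrow> real" where
  "T2_const N d C C1 = C * M_const C * C1 / (5 * real (min N d)) + C1 / (4 * real N)"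

definition L1_const :: "nat \<Rightarrow> nat \<Rightarrow> real \<Rightarrow> real \<Rightarrow> real \<Rightarrow> real" where
  "L1_const N d C C1 C2 = max (max (4 * T1_const N d C C1 C2) (4 * T2_const N d C C1)) C"

definition Lbar_const :: "nat \<Rightarrow> nat \<Rightarrow> real \<Rightarrow> real \<Rightarrow> real \<Rightarrow> real" where
  "Lbar_const N d C C1 C2 = max (L0_const N d C C1) (L1_const N d C C1 C2)"

end

theory Submission
  imports Defs
begin

text \<open>For frozen parameters \<open>\<theta>\<close> let \<open>l k \<theta> s v\<close> be the expected loss \<open>k\<close> steps ahead of the state \<open>s\<close> and the datum
  \<open>v\<close>. The memory contracts with factor \<open>C / 4 < 1\<close> and the data kernel with factor \<open>Lp < 1\<close>, so \<open>l k\<close> tends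
  geometrically to a constant in \<open>(s, v)\<close>, the limiting loss. Second and third order increments of \<open>l k\<close>
  in \<open>(\<theta>, s)\<close> are bounded uniformly in \<open>k\<close>; interpolating between these bounds and the geometric
  decay of \<open>l (k + 1) - l k\<close>, the derivatives \<open>D k\<close> of \<open>l k\<close> converge geometrically to the gradient of the
  limiting loss, together with their Lipschitz constants in \<open>\<theta>\<close>.

  The sensitivities of the algorithm propagate a tangent vector by the same linear recursion that
  defines \<open>D (k + 1)\<close> from \<open>D k\<close>. Hence the Markov property shifts the error \<open>D k - \<nabla>L\<close> along the trajectory one
  step forward while lowering \<open>k\<close> by one, up to \<open>O(\<alpha> t)\<close> for the change of the parameters. Summation by parts turns
  this into \<open>\<Sum>t. \<alpha> t * E [norm (\<nabla>L (\<theta> t))\<^sup>2] < \<infinity>\<close>, which with \<open>\<Sum>t. \<alpha> t = \<infinity>\<close> and slowly varying gradients forces the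
  claim.\<close>

section \<open>Interpolation and weighted sums\<close>

text \<open>Wasserstein contraction acts on Lipschitz test functions and so controls the values
  \<open>l k\<close>; nothing comparable is assumed for derivatives in \<open>\<theta>\<close>,
  which are therefore extracted from the values. Second order increments would suffice to make the
  error of the derivative small. But the parameters move while this error is shifted along the
  trajectory, so its Lipschitz constant in \<open>\<theta>\<close> must decay as well, and this is
  what the third order bound is for. Writing the geometric error as a sixth power keeps both
  resulting decay rates integral powers of one number. A second obstacle is the limiting loss
  itself: its law is given by description as the invariant weak limit of the joint laws, so
  existence, invariance and uniqueness have to be established before the loss can be evaluated. The
  noise may be unbounded; compactness is therefore used only for the pair of datum and memory, which
  lives in a cube, and the noise is attached afterwards as an independent factor. Once the loss is
  identified with the limit of \<open>l k\<close>, the gradient analysis works with finite horizons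
  only.\<close>

lemma tendsto_zero_of_weighted_summable:
  fixes a \<alpha> :: "nat \<Rightarrow> real"
  assumes pos: "\<And>t. 0 < \<alpha> t" and div: "\<not> summable \<alpha>" and lim: "\<alpha> \<longlonglongrightarrow> 0"
    and a0: "\<And>t. 0 \<le> a t" and inc: "\<And>t. a (Suc t) \<le> a t + C * \<alpha> t"
    and C: "0 \<le> C" and summ: "summable (\<lambda>t. \<alpha> t * a t)"
  shows "a \<longlonglongrightarrow> 0"
proof -
  have main: "\<exists>T. \<forall>t\<ge>T. a t \<le> e + 2 * C * e" if e: "0 < e" for e
  proof -
    \<comment> \<open>\<open>\<beta>\<close> collects the step sizes spent above the level
      \<open>e\<close>. As \<open>\<beta> t\<close> is at most \<open>\<alpha> t * a t / e\<close>,
      only a finite amount is spent there.\<close>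
    define \<beta> where "\<beta> t = (if e \<le> a t then \<alpha> t else 0)" for t
    have \<beta>0: "0 \<le> \<beta> t" for t using pos[of t] by (simp add: \<beta>_def)
    have "\<beta> t \<le> (1 / e) * (\<alpha> t * a t)" for t
    proof (cases "e \<le> a t")
      case True
      then have "\<alpha> t * e \<le> \<alpha> t * a t" using pos[of t] by (intro mult_left_mono) auto
      then show ?thesis using True e by (simp add: \<beta>_def field_simps)
    next
      case False
      then show ?thesis using a0[of t] pos[of t] e by (simp add: \<beta>_def)
    qed
    then have s\<beta>: "summable \<beta>"
      by (intro summable_comparison_test'[OF summable_mult[OF summ, of "1/e"], of 0]) (use \<beta>0 in auto)
    have "(\<lambda>n. sum \<beta> {..<n}) \<longlonglongrightarrow> suminf \<beta>" using s\<beta> by (rule summable_LIMSEQ)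
    then obtain T1 where T1: "\<And>n. n \<ge> T1 \<Longrightarrow> suminf \<beta> - sum \<beta> {..<n} \<le> e"
      using e by (force simp: LIMSEQ_iff abs_less_iff)
    obtain T2 where T2: "\<And>n. n \<ge> T2 \<Longrightarrow> \<alpha> n \<le> e"
      using lim e by (force simp: LIMSEQ_iff abs_less_iff)
    \<comment> \<open>Past \<open>T1\<close> the remaining mass of \<open>\<beta>\<close> is at most
      \<open>e\<close>, past \<open>T2\<close> every step size is. Some later value of
      \<open>a\<close> lies below \<open>e\<close>, since otherwise \<open>\<alpha>\<close> would
      eventually equal the summable \<open>\<beta>\<close>.\<close>
    have "\<exists>T\<ge>max T1 T2. a T < e"
    proof (rule ccontr)
      assume "\<not> ?thesis"
      then have "\<And>t. t \<ge> max T1 T2 \<Longrightarrow> \<beta> t = \<alpha> t" by (auto simp: \<beta>_def)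
      then have "summable \<alpha>"
        using s\<beta> by (subst summable_cong[where g = \<beta>]) (auto simp: eventually_sequentially intro!: exI[of _ "max T1 T2"])
      with div show False by simp
    qed
    then obtain T where T: "T \<ge> T1" "T \<ge> T2" "a T < e" by auto
    \<comment> \<open>From below, the level \<open>e\<close> is exceeded by one step of at most
      \<open>C * e\<close>; any further increase happens above the level and is charged to
      \<open>\<beta>\<close>.\<close>
    have 1: "a t \<le> e + C * e + C * (sum \<beta> {..<t} - sum \<beta> {..<T})" if "t \<ge> T" for t
      using that
    proof (induction t rule: dec_induct)
      case base
      then show ?case using T C e by (simp add: add_increasing2)
    next
      case (step t)
      show ?case
      proof (cases "e \<le> a t")
        case True
        then have "\<beta> t = \<alpha> t" by (simp add: \<beta>_def)
        then have "C * (sum \<beta> {..<Suc t} - sum \<beta> {..<T}) = C * (sum \<beta> {..<t} - sum \<beta> {..<T}) + C * \<alpha> t"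
          by (simp add: distrib_left right_diff_distrib)
        with inc[of t] step.IH show ?thesis by linarith
      next
        case False
        have "C * \<alpha> t \<le> C * e" using T2[of t] T step C by (intro mult_left_mono) auto
        moreover have "sum \<beta> {..<T} \<le> sum \<beta> {..<Suc t}"
          using step \<beta>0 by (intro sum_mono2) auto
        then have "0 \<le> C * (sum \<beta> {..<Suc t} - sum \<beta> {..<T})" using C by simp
        ultimately show ?thesis using inc[of t] False by linarith
      qed
    qed
    have 2: "C * (sum \<beta> {..<t} - sum \<beta> {..<T}) \<le> C * e" for t
    proof -
      have "sum \<beta> {..<t} \<le> suminf \<beta>" using s\<beta> \<beta>0 by (intro sum_le_suminf) auto
      then show ?thesis using T1[OF T(1)] C by (intro mult_left_mono) auto
    qed
    have "a t \<le> e + 2 * C * e" if "T \<le> t" for t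
      using 1[OF that] 2[of t] by simp
    then show ?thesis by blast
  qed
  show ?thesis
  proof (rule LIMSEQ_I)
    fix r :: real assume r: "0 < r"
    define e where "e = r / 2 / (1 + 2 * C)"
    have nz: "1 + 2 * C \<noteq> 0" using C by linarith
    have "0 < e" using r C by (simp add: e_def)
    moreover have "e * (1 + 2 * C) = r / 2" unfolding e_def using nz by (rule nonzero_eq_divide_eq[THEN iffD1]) simp
    then have "e + 2 * C * e = r / 2" by (simp add: algebra_simps)
    ultimately obtain T where "\<forall>t\<ge>T. a t \<le> r / 2" using main by metis
    then show "\<exists>no. \<forall>n\<ge>no. norm (a n - 0) < r" using a0 r by (intro exI[of _ T]) force
  qed
qed

text \<open>A Landau--Kolmogorov type interpolation: a function of size \<open>\<kappa>\<^sup>6\<close> with bounded second and third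
  order increments has a derivative of order \<open>\<kappa>\<^sup>3\<close> and second order increments of order \<open>\<kappa>\<close>. Here
  \<open>A h\<close> stands for the first order Taylor remainder; the combination \<open>A (2 h) - 4 A h\<close> is of third order.\<close>

lemma interpolation:
  fixes A :: "real \<Rightarrow> real"
  assumes third: "\<And>h. 0 \<le> h \<Longrightarrow> \<bar>A (2 * h) - 4 * A h\<bar> \<le> C * h ^ 3"
    and small: "\<And>h. 0 \<le> h \<Longrightarrow> \<bar>A h + h * D\<bar> \<le> 2 * \<kappa> ^ 6"
    and second: "\<And>h. 0 \<le> h \<Longrightarrow> \<bar>A h\<bar> \<le> C * h ^ 2"
    and \<kappa>: "0 < \<kappa>" "\<kappa> \<le> 1"
  shows "\<bar>D\<bar> \<le> (2 + C) * \<kappa> ^ 3"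
    and "0 \<le> h \<Longrightarrow> \<bar>A h\<bar> \<le> (4 + 2 * C) * \<kappa> * h ^ 2"
proof -
  have C: "0 \<le> C" using second[of 1] by simp
  \<comment> \<open>At \<open>h = \<kappa> ^ 3\<close> the size bound
    \<open>2 * \<kappa> ^ 6\<close> and the quadratic bound \<open>C * h ^ 2\<close> are of the same
    order, the best choice before dividing by \<open>h\<close>.\<close>
  have "\<bar>\<kappa> ^ 3 * D\<bar> \<le> \<bar>A (\<kappa> ^ 3) + \<kappa> ^ 3 * D\<bar> + \<bar>A (\<kappa> ^ 3)\<bar>" by linarith
  also have "\<dots> \<le> 2 * \<kappa> ^ 6 + C * (\<kappa> ^ 3) ^ 2"
    using small[of "\<kappa> ^ 3"] second[of "\<kappa> ^ 3"] \<kappa> by simp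
  also have "\<dots> = \<kappa> ^ 3 * ((2 + C) * \<kappa> ^ 3)" by (simp add: algebra_simps flip: power_mult power_add)
  finally have "\<kappa> ^ 3 * \<bar>D\<bar> \<le> \<kappa> ^ 3 * ((2 + C) * \<kappa> ^ 3)" using \<kappa> by (simp add: abs_mult)
  then show D: "\<bar>D\<bar> \<le> (2 + C) * \<kappa> ^ 3" using \<kappa> by simp
  \<comment> \<open>For \<open>h \<ge> \<kappa> ^ 2\<close> the bounds on the size and on
    \<open>D\<close> already give the claim; below this threshold the estimate is carried down by
    halving \<open>h\<close>.\<close>
  have large: "\<bar>A h\<bar> \<le> (4 + C) * \<kappa> * h ^ 2" if h: "\<kappa> ^ 2 \<le> h" for h
  proof -
    have h0: "0 < h" using h \<kappa> by (smt (verit) zero_less_power)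
    have "\<kappa> ^ 4 \<le> h ^ 2" using power_mono[OF h, of 2] \<kappa> by (simp flip: power_mult)
    then have 1: "\<kappa> ^ 2 * \<kappa> ^ 4 \<le> \<kappa> * h ^ 2"
      using \<kappa> power_decreasing[of 1 2 \<kappa>] by (intro mult_mono) auto
    have 2: "h * \<kappa> ^ 3 \<le> \<kappa> * h ^ 2"
    proof -
      have "h * \<kappa> * \<kappa> ^ 2 \<le> h * \<kappa> * h" using h h0 \<kappa> by (intro mult_left_mono) auto
      then show ?thesis by (simp add: power2_eq_square power3_eq_cube algebra_simps)
    qed
    have "\<bar>A h\<bar> \<le> \<bar>A h + h * D\<bar> + \<bar>h * D\<bar>" by linarith
    also have "\<bar>h * D\<bar> = h * \<bar>D\<bar>" using h0 by (simp add: abs_mult)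
    also have "\<bar>A h + h * D\<bar> + h * \<bar>D\<bar> \<le> 2 * \<kappa> ^ 6 + h * ((2 + C) * \<kappa> ^ 3)"
      using small[of h] D h0 by (intro add_mono mult_left_mono) auto
    also have "\<dots> = 2 * (\<kappa> ^ 2 * \<kappa> ^ 4) + (2 + C) * (h * \<kappa> ^ 3)" by (simp add: algebra_simps flip: power_add)
    also have "\<dots> \<le> 2 * (\<kappa> * h ^ 2) + (2 + C) * (\<kappa> * h ^ 2)" using 1 2 C by (intro add_mono mult_left_mono) auto
    finally show ?thesis by (simp add: algebra_simps)
  qed
  \<comment> \<open>The extra term makes the induction close: by \<open>third\<close> the left side
    at \<open>h\<close> is at most a quarter of its value at \<open>2 * h\<close>, which is the
    scaling of \<open>h ^ 2\<close>. The number \<open>n\<close> counts the doublings that bring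
    \<open>h\<close> up to \<open>\<kappa> ^ 2\<close>.\<close>
  have sm: "\<bar>A h\<bar> + C / 4 * h ^ 3 \<le> (4 + 2 * C) * \<kappa> * h ^ 2"
    if "0 < h" "h < 2 * \<kappa> ^ 2" "\<kappa> ^ 2 \<le> 2 ^ n * h" for n h
    using that
  proof (induction n arbitrary: h)
    have base: "\<bar>A h\<bar> + C / 4 * h ^ 3 \<le> (4 + 2 * C) * \<kappa> * h ^ 2"
      if h: "h < 2 * \<kappa> ^ 2" "\<kappa> ^ 2 \<le> h" "0 < h" for h
    proof -
      have "h \<le> 2 * \<kappa>" using h \<kappa> power_decreasing[of 1 2 \<kappa>] by simp
      then have "C / 4 * h ^ 2 * h \<le> C / 4 * h ^ 2 * (2 * \<kappa>)" using C by (intro mult_left_mono) auto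
      moreover have "0 \<le> C * \<kappa> * h ^ 2" using C \<kappa> by simp
      ultimately show ?thesis using large[OF h(2)] by (simp add: algebra_simps power2_eq_square power3_eq_cube)
    qed
    {
      case 0
      then show ?case using base by simp
    next
      case (Suc n)
      show ?case
      proof (cases "\<kappa> ^ 2 \<le> h")
        case True
        then show ?thesis using base Suc by simp
      next
        case False
        then have "\<bar>A (2 * h)\<bar> + C / 4 * (2 * h) ^ 3 \<le> (4 + 2 * C) * \<kappa> * (2 * h) ^ 2"
          using Suc.prems by (intro Suc.IH) (auto simp: algebra_simps)
        moreover have "4 * \<bar>A h\<bar> \<le> \<bar>A (2 * h)\<bar> + C * h ^ 3" using third[of h] Suc.prems by linarith
        ultimately show ?thesis by (simp add: power_mult_distrib algebra_simps)
      qed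
    }
  qed
  assume h: "0 \<le> h"
  show "\<bar>A h\<bar> \<le> (4 + 2 * C) * \<kappa> * h ^ 2"
  proof (cases "h = 0")
    case True
    then show ?thesis using second[of 0] by simp
  next
    case False
    then have h0: "0 < h" using h by simp
    show ?thesis
    proof (cases "\<kappa> ^ 2 \<le> h")
      case True
      have "(4 + C) * (\<kappa> * h ^ 2) \<le> (4 + 2 * C) * (\<kappa> * h ^ 2)" using C \<kappa> by (intro mult_right_mono) auto
      then show ?thesis using large[OF True] by (simp add: mult.assoc)
    next
      case False
      obtain n where "\<kappa> ^ 2 / h < 2 ^ n" using real_arch_pow[of 2 "\<kappa> ^ 2 / h"] by auto
      then have "\<kappa> ^ 2 \<le> 2 ^ n * h" using h0 by (simp add: field_simps)
      moreover have "h < 2 * \<kappa> ^ 2" using False \<kappa> by (smt (verit) zero_less_power)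
      ultimately have "\<bar>A h\<bar> + C / 4 * h ^ 3 \<le> (4 + 2 * C) * \<kappa> * h ^ 2" using sm h0 by blast
      moreover have "0 \<le> C / 4 * h ^ 3" using C h0 by simp
      ultimately show ?thesis by linarith
    qed
  qed
qed

section \<open>Bounds on the first three derivatives of functions of one variable\<close>

definition C3_bdd :: "real \<Rightarrow> real \<Rightarrow> real \<Rightarrow> real \<Rightarrow> (real \<Rightarrow> real) \<Rightarrow> bool" where
  "C3_bdd M0 M1 M2 M3 g \<longleftrightarrow> (\<exists>g1 g2 g3. \<forall>r.
     (g has_real_derivative g1 r) (at r) \<and> (g1 has_real_derivative g2 r) (at r) \<and>
     (g2 has_real_derivative g3 r) (at r) \<and>
     \<bar>g r\<bar> \<le> M0 \<and> \<bar>g1 r\<bar> \<le> M1 \<and> \<bar>g2 r\<bar> \<le> M2 \<and> \<bar>g3 r\<bar> \<le> M3)"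

lemma abs_add_le: "\<bar>x\<bar> \<le> X \<Longrightarrow> \<bar>y\<bar> \<le> Y \<Longrightarrow> \<bar>x + y\<bar> \<le> X + Y" for x y X Y :: real
  by (rule order_trans[OF abs_triangle_ineq add_mono])

lemma abs_mult_le: "\<bar>x\<bar> \<le> X \<Longrightarrow> \<bar>y\<bar> \<le> Y \<Longrightarrow> \<bar>x * y\<bar> \<le> X * Y" for x y X Y :: real
  by (simp add: abs_mult mult_mono)

lemma C3_bdd_nonneg:
  assumes "C3_bdd M0 M1 M2 M3 g"
  shows "0 \<le> M0" "0 \<le> M1" "0 \<le> M2" "0 \<le> M3"
  using assms unfolding C3_bdd_def by (meson abs_ge_zero order_trans)+

lemma C3_bdd_le: "C3_bdd M0 M1 M2 M3 g \<Longrightarrow> \<bar>g r\<bar> \<le> M0"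
  unfolding C3_bdd_def by blast

lemma C3_bdd_mono:
  assumes "C3_bdd M0 M1 M2 M3 g" "M0 \<le> N0" "M1 \<le> N1" "M2 \<le> N2" "M3 \<le> N3"
  shows "C3_bdd N0 N1 N2 N3 g"
  using assms unfolding C3_bdd_def by (meson order_trans)

lemma C3_bdd_const: "C3_bdd \<bar>c\<bar> 0 0 0 (\<lambda>_. c)"
  unfolding C3_bdd_def
  by (rule exI[of _ "\<lambda>_. 0"])+ (auto intro!: derivative_eq_intros)

lemma C3_bdd_add:
  assumes "C3_bdd M0 M1 M2 M3 g" "C3_bdd N0 N1 N2 N3 k"
  shows "C3_bdd (M0 + N0) (M1 + N1) (M2 + N2) (M3 + N3) (\<lambda>r. g r + k r)"
proof -
  from assms obtain g1 g2 g3 k1 k2 k3 where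
    *: "\<And>r. (g has_real_derivative g1 r) (at r)" "\<And>r. (g1 has_real_derivative g2 r) (at r)"
    "\<And>r. (g2 has_real_derivative g3 r) (at r)"
    "\<And>r. \<bar>g r\<bar> \<le> M0 \<and> \<bar>g1 r\<bar> \<le> M1 \<and> \<bar>g2 r\<bar> \<le> M2 \<and> \<bar>g3 r\<bar> \<le> M3"
    "\<And>r. (k has_real_derivative k1 r) (at r)" "\<And>r. (k1 has_real_derivative k2 r) (at r)"
    "\<And>r. (k2 has_real_derivative k3 r) (at r)"
    "\<And>r. \<bar>k r\<bar> \<le> N0 \<and> \<bar>k1 r\<bar> \<le> N1 \<and> \<bar>k2 r\<bar> \<le> N2 \<and> \<bar>k3 r\<bar> \<le> N3"
    unfolding C3_bdd_def by blast
  show ?thesis unfolding C3_bdd_def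
    apply (rule exI[of _ "\<lambda>r. g1 r + k1 r"], rule exI[of _ "\<lambda>r. g2 r + k2 r"], rule exI[of _ "\<lambda>r. g3 r + k3 r"])
    apply (intro allI conjI)
    apply (rule DERIV_add[OF *(1) *(5)] DERIV_add[OF *(2) *(6)] DERIV_add[OF *(3) *(7)])+
    subgoal for r using *(4)[of r] *(8)[of r] by (intro order_trans[OF abs_triangle_ineq] add_mono) auto
    subgoal for r using *(4)[of r] *(8)[of r] by (intro order_trans[OF abs_triangle_ineq] add_mono) auto
    subgoal for r using *(4)[of r] *(8)[of r] by (intro order_trans[OF abs_triangle_ineq] add_mono) auto
    subgoal for r using *(4)[of r] *(8)[of r] by (intro order_trans[OF abs_triangle_ineq] add_mono) auto
    done
qed

lemma C3_bdd_mult: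
  assumes g: "C3_bdd M0 M1 M2 M3 g" and k: "C3_bdd N0 N1 N2 N3 k"
  shows "C3_bdd (M0 * N0) (M1 * N0 + M0 * N1) (M2 * N0 + 2 * (M1 * N1) + M0 * N2)
      (M3 * N0 + 3 * (M2 * N1) + 3 * (M1 * N2) + M0 * N3) (\<lambda>r. g r * k r)"
proof -
  from assms obtain g1 g2 g3 k1 k2 k3 where
    *: "\<And>r. (g has_real_derivative g1 r) (at r)" "\<And>r. (g1 has_real_derivative g2 r) (at r)"
    "\<And>r. (g2 has_real_derivative g3 r) (at r)"
    "\<And>r. \<bar>g r\<bar> \<le> M0 \<and> \<bar>g1 r\<bar> \<le> M1 \<and> \<bar>g2 r\<bar> \<le> M2 \<and> \<bar>g3 r\<bar> \<le> M3"
    "\<And>r. (k has_real_derivative k1 r) (at r)" "\<And>r. (k1 has_real_derivative k2 r) (at r)"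
    "\<And>r. (k2 has_real_derivative k3 r) (at r)"
    "\<And>r. \<bar>k r\<bar> \<le> N0 \<and> \<bar>k1 r\<bar> \<le> N1 \<and> \<bar>k2 r\<bar> \<le> N2 \<and> \<bar>k3 r\<bar> \<le> N3"
    unfolding C3_bdd_def by blast
  note nn = C3_bdd_nonneg[OF g] C3_bdd_nonneg[OF k]
  have b: "\<bar>g r * k r\<bar> \<le> M0 * N0" "\<bar>g1 r * k r\<bar> \<le> M1 * N0" "\<bar>g2 r * k r\<bar> \<le> M2 * N0" "\<bar>g3 r * k r\<bar> \<le> M3 * N0"
    "\<bar>g r * k1 r\<bar> \<le> M0 * N1" "\<bar>g1 r * k1 r\<bar> \<le> M1 * N1" "\<bar>g2 r * k1 r\<bar> \<le> M2 * N1"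
    "\<bar>g r * k2 r\<bar> \<le> M0 * N2" "\<bar>g1 r * k2 r\<bar> \<le> M1 * N2" "\<bar>g r * k3 r\<bar> \<le> M0 * N3" for r
    using *(4)[of r] *(8)[of r] by (auto intro!: abs_mult_le)
  show ?thesis unfolding C3_bdd_def
    apply (rule exI[of _ "\<lambda>r. g1 r * k r + g r * k1 r"],
        rule exI[of _ "\<lambda>r. g2 r * k r + 2 * (g1 r * k1 r) + g r * k2 r"],
        rule exI[of _ "\<lambda>r. g3 r * k r + 3 * (g2 r * k1 r) + 3 * (g1 r * k2 r) + g r * k3 r"])
    apply (intro allI conjI)
    subgoal by (rule DERIV_cong[OF DERIV_mult'[OF *(1) *(5)]]) simp
    subgoal by (rule DERIV_cong[OF DERIV_add[OF DERIV_mult'[OF *(2) *(5)] DERIV_mult'[OF *(1) *(6)]]]) simp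
    subgoal by (rule DERIV_cong[OF DERIV_add[OF DERIV_add[OF DERIV_mult'[OF *(3) *(5)]
          DERIV_cmult[OF DERIV_mult'[OF *(2) *(6)]]] DERIV_mult'[OF *(1) *(7)]]]) (simp add: algebra_simps)
    subgoal for r by (rule b)
    subgoal for r by (intro abs_add_le b)
    subgoal for r by (intro abs_add_le b abs_mult_le[of 2 2] ) simp
    subgoal for r by (intro abs_add_le b abs_mult_le[of 3 3] ) simp_all
    done
qed

text \<open>The chain rule up to order three. At each order the highest inner bound enters only with
  the factor \<open>S1\<close>; for the sigmoid this factor is \<open>1 / 4\<close>, and it is what
  makes the bounds reproducible under a network step.\<close>

lemma C3_bdd_compose:
  assumes g: "C3_bdd S0 S1 S2 S3 g" and k: "C3_bdd A0 A1 A2 A3 a"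
  shows "C3_bdd S0 (S1 * A1) (S2 * A1\<^sup>2 + S1 * A2) (S3 * A1 ^ 3 + 3 * (S2 * A1 * A2) + S1 * A3) (\<lambda>r. g (a r))"
proof -
  from assms obtain g1 g2 g3 k1 k2 k3 where
    *: "\<And>r. (g has_real_derivative g1 r) (at r)" "\<And>r. (g1 has_real_derivative g2 r) (at r)"
    "\<And>r. (g2 has_real_derivative g3 r) (at r)"
    "\<And>r. \<bar>g r\<bar> \<le> S0 \<and> \<bar>g1 r\<bar> \<le> S1 \<and> \<bar>g2 r\<bar> \<le> S2 \<and> \<bar>g3 r\<bar> \<le> S3"
    "\<And>r. (a has_real_derivative k1 r) (at r)" "\<And>r. (k1 has_real_derivative k2 r) (at r)"
    "\<And>r. (k2 has_real_derivative k3 r) (at r)"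
    "\<And>r. \<bar>a r\<bar> \<le> A0 \<and> \<bar>k1 r\<bar> \<le> A1 \<and> \<bar>k2 r\<bar> \<le> A2 \<and> \<bar>k3 r\<bar> \<le> A3"
    unfolding C3_bdd_def by blast
  note nn = C3_bdd_nonneg[OF g] C3_bdd_nonneg[OF k]
  note ch = DERIV_chain'[OF *(5)]
  have p: "\<bar>k1 r ^ 2\<bar> \<le> A1 ^ 2" "\<bar>k1 r ^ 3\<bar> \<le> A1 ^ 3" for r
    using power_mono[of "\<bar>k1 r\<bar>" A1 2] power_mono[of "\<bar>k1 r\<bar>" A1 3] *(8)[of r] by (simp_all add: power_abs)
  have b: "\<bar>g1 (a r) * k1 r\<bar> \<le> S1 * A1" "\<bar>g2 (a r) * (k1 r)\<^sup>2\<bar> \<le> S2 * A1\<^sup>2" "\<bar>g1 (a r) * k2 r\<bar> \<le> S1 * A2"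
    "\<bar>g3 (a r) * (k1 r) ^ 3\<bar> \<le> S3 * A1 ^ 3" "\<bar>g2 (a r) * k1 r * k2 r\<bar> \<le> S2 * A1 * A2" "\<bar>g1 (a r) * k3 r\<bar> \<le> S1 * A3" for r
    using *(4)[of "a r"] *(8)[of r] p[of r] by (auto intro!: abs_mult_le)
  show ?thesis unfolding C3_bdd_def
    apply (rule exI[of _ "\<lambda>r. g1 (a r) * k1 r"],
        rule exI[of _ "\<lambda>r. g2 (a r) * (k1 r)\<^sup>2 + g1 (a r) * k2 r"],
        rule exI[of _ "\<lambda>r. g3 (a r) * (k1 r) ^ 3 + 3 * (g2 (a r) * k1 r * k2 r) + g1 (a r) * k3 r"])
    apply (intro allI conjI)
    subgoal by (rule ch[OF *(1)])
    subgoal by (rule DERIV_cong[OF DERIV_mult'[OF ch[OF *(2)] *(6)]]) (simp add: power2_eq_square)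
    subgoal by (rule DERIV_cong[OF DERIV_add[OF DERIV_mult'[OF ch[OF *(3)] DERIV_power[OF *(6), of 2]]
            DERIV_mult'[OF ch[OF *(2)] *(7)]]]) (simp add: power2_eq_square power3_eq_cube)
    subgoal for r using *(4)[of "a r"] by simp
    subgoal for r by (rule b)
    subgoal for r by (intro abs_add_le b)
    subgoal for r by (intro abs_add_le b abs_mult_le[of 3 3]) simp
    done
qed

text \<open>Along a line of speed at most one the derivatives are only multiplied by powers of
  \<open>\<tau>\<close>, so no constant grows.\<close>

lemma C3_bdd_affine:
  assumes g: "C3_bdd S0 S1 S2 S3 g" and \<tau>: "\<bar>\<tau>\<bar> \<le> 1"
  shows "C3_bdd S0 S1 S2 S3 (\<lambda>r. g (x + r * \<tau>))"
proof -
  from g obtain g1 g2 g3 where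
    *: "\<And>r. (g has_real_derivative g1 r) (at r)" "\<And>r. (g1 has_real_derivative g2 r) (at r)"
    "\<And>r. (g2 has_real_derivative g3 r) (at r)"
    "\<And>r. \<bar>g r\<bar> \<le> S0 \<and> \<bar>g1 r\<bar> \<le> S1 \<and> \<bar>g2 r\<bar> \<le> S2 \<and> \<bar>g3 r\<bar> \<le> S3"
    unfolding C3_bdd_def by blast
  have d: "((\<lambda>r. x + r * \<tau>) has_real_derivative \<tau>) (at r)" for r
    by (auto intro!: derivative_eq_intros)
  have p: "\<bar>y * \<tau> ^ n\<bar> \<le> Y" if "\<bar>y\<bar> \<le> Y" for y Y n
  proof -
    have "\<bar>\<tau> ^ n\<bar> \<le> 1" using \<tau> by (simp add: power_abs power_le_one)
    then have "\<bar>y\<bar> * \<bar>\<tau> ^ n\<bar> \<le> \<bar>y\<bar> * 1" by (intro mult_left_mono) auto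
    then show ?thesis using that by (simp add: abs_mult)
  qed
  show ?thesis unfolding C3_bdd_def
    apply (rule exI[of _ "\<lambda>r. g1 (x + r * \<tau>) * \<tau> ^ 1"],
        rule exI[of _ "\<lambda>r. g2 (x + r * \<tau>) * \<tau> ^ 2"],
        rule exI[of _ "\<lambda>r. g3 (x + r * \<tau>) * \<tau> ^ 3"])
    apply (intro allI conjI)
    subgoal using DERIV_chain'[OF d *(1)] by simp
    subgoal using DERIV_cmult_right[OF DERIV_chain'[OF d *(2)], of "\<tau> ^ 1"] by (simp add: power2_eq_square mult.assoc)
    subgoal using DERIV_cmult_right[OF DERIV_chain'[OF d *(3)], of "\<tau> ^ 2"] by (simp add: power2_eq_square power3_eq_cube mult.assoc)
    subgoal using *(4) by blast
    using *(4) by (blast intro: p)+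
qed

lemma C3_bdd_sum:
  assumes "finite I" "\<And>i. i \<in> I \<Longrightarrow> C3_bdd M0 M1 M2 M3 (g i)"
  shows "C3_bdd (real (card I) * M0) (real (card I) * M1) (real (card I) * M2) (real (card I) * M3) (\<lambda>r. \<Sum>i\<in>I. g i r)"
  using assms
proof (induction I rule: finite_induct)
  case empty
  then show ?case using C3_bdd_const[of 0] by simp
next
  case (insert i I)
  then have "C3_bdd (M0 + real (card I) * M0) (M1 + real (card I) * M1) (M2 + real (card I) * M2)
      (M3 + real (card I) * M3) (\<lambda>r. g i r + (\<Sum>i\<in>I. g i r))"
    by (intro C3_bdd_add) auto
  then show ?case using insert by (simp add: algebra_simps)
qed

lemma C3_bdd_average:
  assumes "\<And>i. C3_bdd M0 M1 M2 M3 (g i)"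
  shows "C3_bdd M0 M1 M2 M3 (\<lambda>r. 1 / real CARD('i::finite) * (\<Sum>i::'i\<in>UNIV. g i r))"
  using C3_bdd_mult[OF C3_bdd_const[of "1 / real CARD('i)"] C3_bdd_sum[of "UNIV :: 'i set" M0 M1 M2 M3 g]] assms
  by simp

text \<open>In \<open>g (2 * h) - 4 * g h\<close> the second order Taylor terms cancel, both being
  \<open>2 * h\<^sup>2\<close> times the second derivative at 0. The Lagrange remainders of order
  three add up to \<open>8 / 6 + 4 / 6 = 2\<close> times \<open>M3 * h ^ 3\<close>.\<close>

lemma C3_bdd_Taylor:
  assumes g: "C3_bdd M0 M1 M2 M3 g" and d: "(g has_real_derivative d) (at 0)" and h: "0 \<le> h"
  shows "\<bar>g h - g 0 - h * d\<bar> \<le> M2 * h\<^sup>2"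
    and "\<bar>g (2 * h) - 4 * g h + 3 * g 0 + 2 * h * d\<bar> \<le> 2 * M3 * h ^ 3"
proof -
  from g obtain g1 g2 g3 where
    *: "\<And>r. (g has_real_derivative g1 r) (at r)" "\<And>r. (g1 has_real_derivative g2 r) (at r)"
    "\<And>r. (g2 has_real_derivative g3 r) (at r)"
    "\<And>r. \<bar>g r\<bar> \<le> M0 \<and> \<bar>g1 r\<bar> \<le> M1 \<and> \<bar>g2 r\<bar> \<le> M2 \<and> \<bar>g3 r\<bar> \<le> M3"
    unfolding C3_bdd_def by blast
  note nn = C3_bdd_nonneg[OF g]
  have d1: "g1 0 = d" using *(1) d DERIV_unique by blast
  define diff where "diff m = (if m = 0 then g else if m = 1 then g1 else if m = 2 then g2 else g3)" for m :: nat
  have DD: "m < 3 \<Longrightarrow> (diff m has_real_derivative diff (Suc m) t) (at t)" for m t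
    using *(1-3) by (auto simp: diff_def less_Suc_eq numeral_3_eq_3)
  have T2: "\<exists>t. g x = g 0 + d * x + g2 t / 2 * x ^ 2" for x
    using Maclaurin_bi_le[of diff g 2 x] DD d1
    by (auto simp: diff_def numeral_2_eq_2 lessThan_Suc)
  have T3: "\<exists>t. g x = g 0 + d * x + g2 0 / 2 * x ^ 2 + g3 t / 6 * x ^ 3" for x
    using Maclaurin_bi_le[of diff g 3 x] DD d1
    by (auto simp: diff_def numeral_3_eq_3 lessThan_Suc numeral_2_eq_2 fact_numeral)
  obtain t where "g h = g 0 + d * h + g2 t / 2 * h ^ 2" using T2 by blast
  then have "\<bar>g h - g 0 - h * d\<bar> = \<bar>g2 t\<bar> / 2 * h\<^sup>2" by (simp add: abs_mult)
  also have "\<dots> \<le> M2 * h\<^sup>2" using *(4)[of t] by (intro mult_right_mono) auto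
  finally show "\<bar>g h - g 0 - h * d\<bar> \<le> M2 * h\<^sup>2" .
  obtain t where t: "g h = g 0 + d * h + g2 0 / 2 * h ^ 2 + g3 t / 6 * h ^ 3" using T3 by blast
  obtain u where u: "g (2 * h) = g 0 + d * (2 * h) + g2 0 / 2 * (2 * h) ^ 2 + g3 u / 6 * (2 * h) ^ 3" using T3 by blast
  have "\<bar>g (2 * h) - 4 * g h + 3 * g 0 + 2 * h * d\<bar> = \<bar>(8 * g3 u / 6 - 4 * g3 t / 6) * h ^ 3\<bar>"
    unfolding t u by (simp add: algebra_simps power2_eq_square power3_eq_cube)
  also have "\<dots> = \<bar>8 * g3 u / 6 - 4 * g3 t / 6\<bar> * h ^ 3" using h by (simp add: abs_mult)
  also have "\<dots> \<le> (2 * M3) * h ^ 3"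
  proof (rule mult_right_mono)
    have "\<bar>g3 t\<bar> \<le> M3" "\<bar>g3 u\<bar> \<le> M3" using *(4) by blast+
    then show "\<bar>8 * g3 u / 6 - 4 * g3 t / 6\<bar> \<le> 2 * M3" by argo
  qed (use h in simp)
  finally show "\<bar>g (2 * h) - 4 * g h + 3 * g 0 + 2 * h * d\<bar> \<le> 2 * M3 * h ^ 3" .
qed

section \<open>Contractive recursions driven by a Markov kernel\<close>

text \<open>Pushing \<open>L x\<close> forward under \<open>y \<mapsto> (x, y)\<close> moves the
  parameter from the integrand into the measure, and the integral of a fixed function depends
  measurably on the measure.\<close>

lemma integral_measurable_kernel:
  fixes f :: "'a \<Rightarrow> 'b \<Rightarrow> 'c::{banach, second_countable_topology}"
  assumes f[measurable]: "(\<lambda>(x, y). f x y) \<in> borel_measurable (M \<Otimes>\<^sub>M N)"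
    and L: "L \<in> measurable M (prob_algebra N)"
  shows "(\<lambda>x. \<integral>y. f x y \<partial>L x) \<in> borel_measurable M"
proof -
  note integral_measurable_subprob_algebra[measurable] measurable_distr2[measurable]
  note L[THEN measurable_prob_algebraD, measurable]
  have "(\<lambda>x. integral\<^sup>L (distr (L x) (M \<Otimes>\<^sub>M N) (\<lambda>y. (x, y))) (\<lambda>(x, y). f x y)) \<in> borel_measurable M"
    by measurable
  moreover have "integral\<^sup>L (distr (L x) (M \<Otimes>\<^sub>M N) (\<lambda>y. (x, y))) (\<lambda>(x, y). f x y) = (\<integral>y. f x y \<partial>L x)"
    if "x \<in> space M" for x
  proof -
    have [measurable_cong]: "sets (L x) = sets N"
      using measurable_space[OF L that] by (simp add: space_prob_algebra)
    show ?thesis using that by (subst integral_distr) (auto simp: measurable_Pair1' cong: measurable_cong_sets)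
  qed
  ultimately show ?thesis by (simp cong: measurable_cong)
qed

locale contractive_system =
  fixes \<kappa> :: "'v::euclidean_space \<Rightarrow> 'v measure"
    and F :: "'p::euclidean_space \<Rightarrow> 'v \<Rightarrow> 's::euclidean_space \<Rightarrow> 's"
    and Lp qF cF :: real
  assumes \<kappa>_measurable[measurable]: "\<kappa> \<in> borel \<rightarrow>\<^sub>M prob_algebra borel"
    and \<kappa>_cube: "AE w in \<kappa> v. infnorm w \<le> 1"
    and \<kappa>_contraction: "\<And>(g :: 'v \<Rightarrow> real) B L v w. (\<And>x. \<bar>g x\<bar> \<le> B) \<Longrightarrow> 0 \<le> L \<Longrightarrow>
      (\<And>x y. \<bar>g x - g y\<bar> \<le> L * infnorm (x - y)) \<Longrightarrow> g \<in> borel_measurable borel \<Longrightarrow>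
      \<bar>(\<integral>x. g x \<partial>\<kappa> v) - (\<integral>x. g x \<partial>\<kappa> w)\<bar> \<le> Lp * L * infnorm (v - w)"
    and F_measurable_tuple: "(\<lambda>(\<theta>, v, s). F \<theta> v s) \<in> borel_measurable borel"
    and F_box: "infnorm (F \<theta> v s) \<le> 1"
    and F_Lipschitz: "infnorm (F \<theta> v s - F \<theta> w s') \<le> qF * infnorm (s - s') + cF * infnorm (v - w)"
    and Lp: "0 \<le> Lp" "Lp < 1" and qF: "0 \<le> qF" "qF < 1" and cF: "0 \<le> cF"
begin

lemma F_measurable[measurable (raw)]:
  assumes [measurable]: "f \<in> borel_measurable N" "g \<in> borel_measurable N" "h \<in> borel_measurable N"
  shows "(\<lambda>x. F (f x) (g x) (h x)) \<in> borel_measurable N"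
proof -
  have "(\<lambda>x. (\<lambda>(\<theta>, v, s). F \<theta> v s) (f x, g x, h x)) \<in> borel_measurable N"
    by (rule measurable_compose[OF _ F_measurable_tuple]) measurable
  then show ?thesis by simp
qed

lemma \<kappa>_prob: "prob_space (\<kappa> v)" and \<kappa>_sets[measurable_cong]: "sets (\<kappa> v) = sets borel"
  using measurable_space[OF \<kappa>_measurable, of v] by (auto simp: space_prob_algebra)

lemma \<kappa>_integrable:
  fixes g :: "'v \<Rightarrow> real"
  assumes [measurable]: "g \<in> borel_measurable borel" and "\<And>w. infnorm w \<le> 1 \<Longrightarrow> \<bar>g w\<bar> \<le> c"
  shows "integrable (\<kappa> v) g"
proof -
  interpret prob_space "\<kappa> v" by (rule \<kappa>_prob)
  have "AE w in \<kappa> v. \<bar>g w\<bar> \<le> c" using \<kappa>_cube[of v] assms(2) by auto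
  then show ?thesis by (intro integrable_const_bound[where B = c]) auto
qed

lemma \<kappa>_integral_abs_le:
  fixes g :: "'v \<Rightarrow> real"
  assumes [measurable]: "g \<in> borel_measurable borel" and b: "\<And>w. infnorm w \<le> 1 \<Longrightarrow> \<bar>g w\<bar> \<le> c"
  shows "\<bar>\<integral>w. g w \<partial>\<kappa> v\<bar> \<le> c"
proof -
  interpret prob_space "\<kappa> v" by (rule \<kappa>_prob)
  have i: "integrable (\<kappa> v) g" using assms by (rule \<kappa>_integrable)
  have "AE w in \<kappa> v. \<bar>g w\<bar> \<le> c" using \<kappa>_cube[of v] b by auto
  then have "AE w in \<kappa> v. g w \<le> c" "AE w in \<kappa> v. -c \<le> g w" by auto
  then have "(\<integral>w. g w \<partial>\<kappa> v) \<le> c" "-c \<le> (\<integral>w. g w \<partial>\<kappa> v)"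
    using i by (auto intro!: integral_le_const integral_ge_const)
  then show ?thesis by simp
qed

lemma \<kappa>_integral_measurable[measurable (raw)]:
  fixes g :: "'b \<Rightarrow> 'v \<Rightarrow> real"
  assumes [measurable]: "(\<lambda>(x, w). g x w) \<in> borel_measurable (N \<Otimes>\<^sub>M borel)" "h \<in> borel_measurable N"
  shows "(\<lambda>x. \<integral>w. g x w \<partial>\<kappa> (h x)) \<in> borel_measurable N"
  by (rule integral_measurable_kernel[where N = borel]) measurable

text \<open>The transition operator of the chain with frozen parameters: the memory is updated with
  the current datum \<open>v\<close>, and the next datum is then drawn from
  \<open>\<kappa> v\<close>.\<close>

definition evol :: "'p \<Rightarrow> ('s \<Rightarrow> 'v \<Rightarrow> real) \<Rightarrow> 's \<Rightarrow> 'v \<Rightarrow> real" where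
  "evol \<theta> h s v = (\<integral>w. h (F \<theta> v s) w \<partial>\<kappa> v)"

text \<open>Separate Lipschitz constants, \<open>b\<close> for the memory and \<open>a\<close> for
  the datum: under \<open>evol\<close> the constant \<open>a\<close> receives a contribution of
  \<open>b\<close>, but not conversely, and the two contract at different rates.\<close>

definition Lip_bdd :: "real \<Rightarrow> real \<Rightarrow> real \<Rightarrow> ('s \<Rightarrow> 'v \<Rightarrow> real) \<Rightarrow> bool" where
  "Lip_bdd B b a h \<longleftrightarrow> (\<lambda>(s, v). h s v) \<in> borel_measurable borel \<and>
     (\<forall>s v. infnorm s \<le> 2 \<longrightarrow> \<bar>h s v\<bar> \<le> B) \<and>
     (\<forall>s s' v w. infnorm s \<le> 2 \<longrightarrow> infnorm s' \<le> 2 \<longrightarrow>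
        \<bar>h s v - h s' w\<bar> \<le> b * infnorm (s - s') + a * infnorm (v - w))"

lemma Lip_bdd_measurable:
  assumes "Lip_bdd B b a h" and [measurable]: "f \<in> borel_measurable N" "g \<in> borel_measurable N"
  shows "(\<lambda>x. h (f x) (g x)) \<in> borel_measurable N"
proof -
  have "(\<lambda>(s, v). h s v) \<in> borel_measurable borel" using assms(1) unfolding Lip_bdd_def by blast
  then have "(\<lambda>x. (\<lambda>(s, v). h s v) (f x, g x)) \<in> borel_measurable N"
    by (rule measurable_compose[rotated]) measurable
  then show ?thesis by simp
qed

lemma F_box2: "infnorm (F \<theta> v s) \<le> 2"
  using F_box[of \<theta> v s] by simp

text \<open>The updated memory is changed first under the common kernel \<open>\<kappa> v\<close>,
  then the kernel is changed at a fixed memory. The first change depends on the datum through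
  \<open>cF\<close>, the second contracts by \<open>Lp\<close>.\<close>

lemma Lip_bdd_evol:
  assumes h: "Lip_bdd B b a h" and b: "0 \<le> b" and a: "0 \<le> a"
  shows "Lip_bdd B (qF * b) (Lp * a + b * cF) (evol \<theta> h)"
  unfolding Lip_bdd_def
proof (intro conjI allI impI)
  note [measurable] = Lip_bdd_measurable[OF h]
  have hB: "\<bar>h s v\<bar> \<le> B" if "infnorm s \<le> 2" for s v using h that unfolding Lip_bdd_def by blast
  have hL: "\<bar>h s v - h s' w\<bar> \<le> b * infnorm (s - s') + a * infnorm (v - w)"
    if "infnorm s \<le> 2" "infnorm s' \<le> 2" for s s' v w
    using h that unfolding Lip_bdd_def by blast
  show "(\<lambda>(s, v). evol \<theta> h s v) \<in> borel_measurable borel"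
    unfolding evol_def borel_prod[symmetric] by measurable
  show "\<bar>evol \<theta> h s v\<bar> \<le> B" for s v
    unfolding evol_def by (rule \<kappa>_integral_abs_le) (use hB F_box2 in auto)
  fix s s' v w
  let ?s = "F \<theta> v s" and ?s' = "F \<theta> w s'"
  have "\<bar>(\<integral>x. h ?s x \<partial>\<kappa> v) - (\<integral>x. h ?s' x \<partial>\<kappa> v)\<bar> = \<bar>\<integral>x. h ?s x - h ?s' x \<partial>\<kappa> v\<bar>"
    by (subst Bochner_Integration.integral_diff) (auto intro!: \<kappa>_integrable[where c = B] hB F_box2)
  also have "\<dots> \<le> b * infnorm (?s - ?s')"
  proof (rule \<kappa>_integral_abs_le)
    show "\<bar>h ?s x - h ?s' x\<bar> \<le> b * infnorm (?s - ?s')" for x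
      using hL[OF F_box2[of \<theta> v s] F_box2[of \<theta> w s'], of x x] by (simp add: infnorm_0)
  qed measurable
  also have "\<dots> \<le> b * (qF * infnorm (s - s') + cF * infnorm (v - w))"
    using F_Lipschitz b by (rule mult_left_mono)
  finally have 1: "\<bar>(\<integral>x. h ?s x \<partial>\<kappa> v) - (\<integral>x. h ?s' x \<partial>\<kappa> v)\<bar> \<le> \<dots>" .
  have 2: "\<bar>(\<integral>x. h ?s' x \<partial>\<kappa> v) - (\<integral>x. h ?s' x \<partial>\<kappa> w)\<bar> \<le> Lp * a * infnorm (v - w)"
  proof (rule \<kappa>_contraction[OF _ a])
    show "\<bar>h ?s' x\<bar> \<le> B" for x by (rule hB[OF F_box2])
    show "\<bar>h ?s' x - h ?s' y\<bar> \<le> a * infnorm (x - y)" for x y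
      using hL[OF F_box2[of \<theta> w s'] F_box2[of \<theta> w s'], of x y] by (simp add: infnorm_0)
  qed measurable
  from 1 2 show "\<bar>evol \<theta> h s v - evol \<theta> h s' w\<bar> \<le> qF * b * infnorm (s - s') + (Lp * a + b * cF) * infnorm (v - w)"
    unfolding evol_def by (simp add: algebra_simps)
qed

text \<open>Strictly above both contraction factors: the gap \<open>rate - Lp\<close> absorbs the
  coupling term \<open>b * cF\<close>, which for \<open>qF = Lp\<close> would otherwise cost a
  factor linear in the number of steps.\<close>

definition rate :: real where "rate = (1 + max qF Lp) / 2"

lemma rate: "qF < rate" "Lp < rate" "0 < rate" "rate < 1"
  using qF Lp unfolding rate_def by auto

text \<open>A number \<open>x \<ge> a\<close> with \<open>Lp * x + b * cF \<le> rate * x\<close>, so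
  that the triangular recursion of the two Lipschitz constants stays below multiples of
  \<open>rate ^ k\<close>.\<close>

definition Lip_gain :: "real \<Rightarrow> real \<Rightarrow> real" where
  "Lip_gain b a = a + b * cF / (rate - Lp)"

lemma Lip_gain_nonneg: "0 \<le> b \<Longrightarrow> 0 \<le> a \<Longrightarrow> 0 \<le> Lip_gain b a"
  unfolding Lip_gain_def using cF rate by (intro add_nonneg_nonneg divide_nonneg_pos mult_nonneg_nonneg) auto

lemma Lip_bdd_mono:
  assumes "Lip_bdd B b a h" "b \<le> b'" "a \<le> a'"
  shows "Lip_bdd B b' a' h"
  using assms unfolding Lip_bdd_def
  by (meson add_mono infnorm_pos_le mult_right_mono order_trans)

lemma Lip_bdd_evol_iterate:
  assumes h: "Lip_bdd B b a h" and b: "0 \<le> b" and a: "0 \<le> a"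
  shows "Lip_bdd B (b * rate ^ k) (Lip_gain b a * rate ^ k) ((evol \<theta> ^^ k) h)"
proof (induction k)
  case 0
  show ?case using Lip_bdd_mono[OF h, of b "Lip_gain b a"] b a cF rate
    by (simp add: Lip_gain_def)
next
  case (Suc k)
  let ?A = "Lip_gain b a"
  have "Lip_bdd B (qF * (b * rate ^ k)) (Lp * (?A * rate ^ k) + b * rate ^ k * cF) ((evol \<theta> ^^ Suc k) h)"
    using Lip_bdd_evol[OF Suc] b Lip_gain_nonneg[OF b a] rate by simp
  then show ?case
  proof (rule Lip_bdd_mono)
    have "qF * b \<le> rate * b" using rate b by (intro mult_right_mono) auto
    then have "qF * b * rate ^ k \<le> rate * b * rate ^ k" by (rule mult_right_mono) (use rate in simp)
    then show "qF * (b * rate ^ k) \<le> b * rate ^ Suc k" by (simp add: ac_simps)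
    have "(rate - Lp) * ?A = (rate - Lp) * a + b * cF" using rate by (simp add: Lip_gain_def field_simps)
    moreover have "0 \<le> (rate - Lp) * a" using rate a by simp
    ultimately have "Lp * ?A + b * cF \<le> rate * ?A" by (simp add: left_diff_distrib)
    then have "(Lp * ?A + b * cF) * rate ^ k \<le> rate * ?A * rate ^ k" by (rule mult_right_mono) (use rate in simp)
    then show "Lp * (?A * rate ^ k) + b * rate ^ k * cF \<le> ?A * rate ^ Suc k" by (simp add: algebra_simps)
  qed
qed

lemma evol_iterate_bound:
  assumes "Lip_bdd B b a h" "0 \<le> b" "0 \<le> a" "infnorm s \<le> 2"
  shows "\<bar>(evol \<theta> ^^ k) h s v\<bar> \<le> B"
  using Lip_bdd_evol_iterate[OF assms(1-3), of k \<theta>] assms(4) unfolding Lip_bdd_def by blast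

text \<open>The diameters 4 and 2 of the cubes of memories and data turn the decaying Lipschitz
  constants into a decaying oscillation.\<close>

lemma evol_iterate_forget:
  assumes h: "Lip_bdd B b a h" and b: "0 \<le> b" and a: "0 \<le> a"
    and s: "infnorm s \<le> 2" "infnorm s' \<le> 2" and v: "infnorm v \<le> 1" "infnorm w \<le> 1"
  shows "\<bar>(evol \<theta> ^^ k) h s v - (evol \<theta> ^^ k) h s' w\<bar> \<le> (4 * b + 2 * Lip_gain b a) * rate ^ k"
proof -
  have tri: "infnorm (x - y) \<le> infnorm x + infnorm y" for x y :: "'c::euclidean_space"
    using infnorm_triangle[of x "-y"] by (simp add: infnorm_neg)
  have "infnorm (s - s') \<le> 4" "infnorm (v - w) \<le> 2" using tri[of s s'] tri[of v w] s v by linarith+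
  then have "b * rate ^ k * infnorm (s - s') + Lip_gain b a * rate ^ k * infnorm (v - w)
      \<le> b * rate ^ k * 4 + Lip_gain b a * rate ^ k * 2"
    using rate b Lip_gain_nonneg[OF b a] by (intro add_mono mult_left_mono) auto
  moreover have "\<bar>(evol \<theta> ^^ k) h s v - (evol \<theta> ^^ k) h s' w\<bar>
      \<le> b * rate ^ k * infnorm (s - s') + Lip_gain b a * rate ^ k * infnorm (v - w)"
    using Lip_bdd_evol_iterate[OF h b a, of k \<theta>] s unfolding Lip_bdd_def by blast
  ultimately show ?thesis by (simp add: algebra_simps)
qed

text \<open>One more step only averages the \<open>k\<close>-step function over other points of the
  same cubes, so the increment is bounded by the oscillation.\<close>

lemma evol_iterate_Cauchy:
  assumes h: "Lip_bdd B b a h" and b: "0 \<le> b" and a: "0 \<le> a"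
    and s: "infnorm s \<le> 2" and v: "infnorm v \<le> 1"
  shows "\<bar>(evol \<theta> ^^ Suc k) h s v - (evol \<theta> ^^ k) h s v\<bar> \<le> (4 * b + 2 * Lip_gain b a) * rate ^ k"
proof -
  interpret prob_space "\<kappa> v" by (rule \<kappa>_prob)
  let ?H = "(evol \<theta> ^^ k) h"
  note H = Lip_bdd_evol_iterate[OF h b a, of k \<theta>]
  note [measurable] = Lip_bdd_measurable[OF H]
  have "(evol \<theta> ^^ Suc k) h s v - ?H s v = (\<integral>w. ?H (F \<theta> v s) w \<partial>\<kappa> v) - (\<integral>w. ?H s v \<partial>\<kappa> v)"
    using prob_space by (simp add: evol_def)
  also have "\<dots> = (\<integral>w. ?H (F \<theta> v s) w - ?H s v \<partial>\<kappa> v)"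
    by (subst Bochner_Integration.integral_diff)
      (auto intro!: \<kappa>_integrable[where c = B] evol_iterate_bound[OF h b a] F_box2)
  finally show ?thesis
    using \<kappa>_integral_abs_le[of "\<lambda>w. ?H (F \<theta> v s) w - ?H s v" _ v]
      evol_iterate_forget[OF h b a F_box2 s _ v] by simp
qed

end

section \<open>Derivatives of the finite-horizon losses\<close>

lemma borel_measurable_fst_borel[measurable (raw)]:
  fixes f :: "'x \<Rightarrow> 'a::second_countable_topology \<times> 'b::second_countable_topology"
  assumes "f \<in> borel_measurable N"
  shows "(\<lambda>x. fst (f x)) \<in> borel_measurable N" "(\<lambda>x. snd (f x)) \<in> borel_measurable N"
  using assms unfolding borel_prod[symmetric] by measurable

text \<open>\<open>curve \<tau> \<gamma> \<sigma>\<close> says that \<open>\<gamma>\<close> is an admissible path of states accompanying the parameters \<open>\<theta> + r *\<^sub>R \<tau>\<close>, with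
  velocity \<open>\<sigma>\<close> at \<open>r = 0\<close>; the straight line is replaced by \<open>s0 + sin r *\<^sub>R \<sigma>\<close> to keep it bounded for all \<open>r\<close>.
  As admissibility survives a step of the recursion, expansions of \<open>l0\<close> along such paths pass to all
  horizons without derivatives of \<open>F\<close> beyond the first. The combination in \<open>l0_third\<close> cancels the second order term.\<close>

locale smooth_system = contractive_system \<kappa> F Lp qF cF
  for \<kappa> :: "'v::euclidean_space \<Rightarrow> 'v measure"
    and F :: "'p::euclidean_space \<Rightarrow> 'v \<Rightarrow> 's::euclidean_space \<Rightarrow> 's"
    and Lp qF cF :: real +
  fixes F' :: "'p \<Rightarrow> 'v \<Rightarrow> 's \<Rightarrow> 'p \<times> 's \<Rightarrow> 's"
    and l0 :: "'p \<Rightarrow> 's \<Rightarrow> 'v \<Rightarrow> real"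
    and D0 :: "'p \<Rightarrow> 's \<Rightarrow> 'p \<times> 's \<Rightarrow> 'v \<Rightarrow> real"
    and curve :: "'p \<Rightarrow> (real \<Rightarrow> 's) \<Rightarrow> 's \<Rightarrow> bool"
    and Bl bl al C0 cD :: real
  assumes F'_measurable_tuple: "(\<lambda>(\<theta>, v, s, q). F' \<theta> v s q) \<in> borel_measurable borel"
    and l0_measurable_tuple: "(\<lambda>(\<theta>, s, v). l0 \<theta> s v) \<in> borel_measurable borel"
    and D0_measurable_tuple: "(\<lambda>(\<theta>, s, q, v). D0 \<theta> s q v) \<in> borel_measurable borel"
    and l0_Lip: "Lip_bdd Bl bl al (l0 \<theta>)" and bl: "0 \<le> bl" and al: "0 \<le> al"
    and F'_linear: "linear (F' \<theta> v s)"
    and D0_linear: "linear (\<lambda>q. D0 \<theta> s q v)"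
    and F'_bound: "infnorm s \<le> 2 \<Longrightarrow> infnorm v \<le> 1 \<Longrightarrow> norm (F' \<theta> v s q) \<le> cD * norm q"
    and D0_bound: "infnorm s \<le> 2 \<Longrightarrow> infnorm v \<le> 1 \<Longrightarrow> \<bar>D0 \<theta> s q v\<bar> \<le> cD * norm q"
    and curve_line: "norm \<tau> \<le> 1 \<Longrightarrow> norm \<sigma> \<le> 1 \<Longrightarrow> infnorm s0 \<le> 1 \<Longrightarrow>
      curve \<tau> (\<lambda>r. s0 + sin r *\<^sub>R \<sigma>) \<sigma>"
    and curve_step: "curve \<tau> \<gamma> \<sigma> \<Longrightarrow> infnorm v \<le> 1 \<Longrightarrow>
      curve \<tau> (\<lambda>r. F (\<theta> + r *\<^sub>R \<tau>) v (\<gamma> r)) (F' \<theta> v (\<gamma> 0) (\<tau>, \<sigma>))"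
    and curve_box: "curve \<tau> \<gamma> \<sigma> \<Longrightarrow> infnorm (\<gamma> r) \<le> 2"
    and l0_second: "curve \<tau> \<gamma> \<sigma> \<Longrightarrow> infnorm v \<le> 1 \<Longrightarrow> 0 \<le> h \<Longrightarrow>
      \<bar>l0 (\<theta> + h *\<^sub>R \<tau>) (\<gamma> h) v - l0 \<theta> (\<gamma> 0) v - h * D0 \<theta> (\<gamma> 0) (\<tau>, \<sigma>) v\<bar> \<le> C0 * h\<^sup>2"
    and l0_third: "curve \<tau> \<gamma> \<sigma> \<Longrightarrow> infnorm v \<le> 1 \<Longrightarrow> 0 \<le> h \<Longrightarrow>
      \<bar>l0 (\<theta> + (2 * h) *\<^sub>R \<tau>) (\<gamma> (2 * h)) v - 4 * l0 (\<theta> + h *\<^sub>R \<tau>) (\<gamma> h) v + 3 * l0 \<theta> (\<gamma> 0) v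
        + 2 * h * D0 \<theta> (\<gamma> 0) (\<tau>, \<sigma>) v\<bar> \<le> C0 * h ^ 3"
begin

lemma F'_measurable[measurable (raw)]:
  assumes [measurable]: "f \<in> borel_measurable N" "g \<in> borel_measurable N" "h \<in> borel_measurable N" "k \<in> borel_measurable N"
  shows "(\<lambda>x. F' (f x) (g x) (h x) (k x)) \<in> borel_measurable N"
proof -
  have "(\<lambda>x. (\<lambda>(\<theta>, v, s, q). F' \<theta> v s q) (f x, g x, h x, k x)) \<in> borel_measurable N"
    by (rule measurable_compose[OF _ F'_measurable_tuple]) measurable
  then show ?thesis by simp
qed

definition l :: "nat \<Rightarrow> 'p \<Rightarrow> 's \<Rightarrow> 'v \<Rightarrow> real" where
  "l k \<theta> = (evol \<theta> ^^ k) (l0 \<theta>)"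

text \<open>The chain rule written as a recursion: a tangent \<open>q\<close> of parameters and
  memory passes through \<open>F'\<close>, its parameter part unchanged, and is handed to the
  shorter horizon. That this differentiates \<open>l k\<close> is shown in
  \<open>curve_second\<close>, without differentiating under the integral.\<close>

primrec D :: "nat \<Rightarrow> 'p \<Rightarrow> 's \<Rightarrow> 'p \<times> 's \<Rightarrow> 'v \<Rightarrow> real" where
  "D 0 = D0"
| "D (Suc k) = (\<lambda>\<theta> s q v. \<integral>w. D k \<theta> (F \<theta> v s) (fst q, F' \<theta> v s q) w \<partial>\<kappa> v)"

lemma l_0: "l 0 \<theta> = l0 \<theta>" and l_Suc: "l (Suc k) \<theta> s v = (\<integral>w. l k \<theta> (F \<theta> v s) w \<partial>\<kappa> v)"
  by (simp_all add: l_def evol_def)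

lemma l_measurable[measurable (raw)]:
  assumes "f \<in> borel_measurable N" "g \<in> borel_measurable N" "h \<in> borel_measurable N"
  shows "(\<lambda>x. l k (f x) (g x) (h x)) \<in> borel_measurable N"
proof -
  have "(\<lambda>(\<theta>, s, v). l k \<theta> s v) \<in> borel_measurable borel"
  proof (induction k)
    case 0
    then show ?case using l0_measurable_tuple by (simp add: l_0)
  next
    case (Suc k)
    have [measurable (raw)]: "(\<lambda>x. l k (f x) (g x) (h x)) \<in> borel_measurable N"
      if [measurable]: "f \<in> borel_measurable N" "g \<in> borel_measurable N" "h \<in> borel_measurable N"
      for f g h and N :: "'x measure"
    proof -
      have "(\<lambda>x. (\<lambda>(\<theta>, s, v). l k \<theta> s v) (f x, g x, h x)) \<in> borel_measurable N"
        by (rule measurable_compose[OF _ Suc]) measurable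
      then show ?thesis by simp
    qed
    show ?case unfolding l_Suc case_prod_beta by measurable
  qed
  then have "(\<lambda>x. (\<lambda>(\<theta>, s, v). l k \<theta> s v) (f x, g x, h x)) \<in> borel_measurable N"
    by (rule measurable_compose[rotated]) (use assms in measurable)
  then show ?thesis by simp
qed

lemma D_measurable[measurable (raw)]:
  assumes "f \<in> borel_measurable N" "g \<in> borel_measurable N" "h \<in> borel_measurable N" "j \<in> borel_measurable N"
  shows "(\<lambda>x. D k (f x) (g x) (h x) (j x)) \<in> borel_measurable N"
proof -
  have "(\<lambda>(\<theta>, s, q, v). D k \<theta> s q v) \<in> borel_measurable borel"
  proof (induction k)
    case 0
    then show ?case using D0_measurable_tuple by simp
  next
    case (Suc k)
    have [measurable (raw)]: "(\<lambda>x. D k (f x) (g x) (h x) (j x)) \<in> borel_measurable N"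
      if [measurable]: "f \<in> borel_measurable N" "g \<in> borel_measurable N" "h \<in> borel_measurable N" "j \<in> borel_measurable N"
      for f g h j and N :: "'x measure"
    proof -
      have "(\<lambda>x. (\<lambda>(\<theta>, s, q, v). D k \<theta> s q v) (f x, g x, h x, j x)) \<in> borel_measurable N"
        by (rule measurable_compose[OF _ Suc]) measurable
      then show ?thesis by simp
    qed
    show ?case unfolding D.simps case_prod_beta by measurable
  qed
  then have "(\<lambda>x. (\<lambda>(\<theta>, s, q, v). D k \<theta> s q v) (f x, g x, h x, j x)) \<in> borel_measurable N"
    by (rule measurable_compose[rotated]) (use assms in measurable)
  then show ?thesis by simp
qed

lemma l_bound: "infnorm s \<le> 2 \<Longrightarrow> \<bar>l k \<theta> s v\<bar> \<le> Bl"
  unfolding l_def by (rule evol_iterate_bound[OF l0_Lip bl al])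

lemma cD: "0 \<le> cD"
proof -
  obtain b :: 'p where b: "b \<in> Basis" using nonempty_Basis by blast
  have "0 \<le> norm (F' 0 0 0 (b, 0))" by simp
  also have "\<dots> \<le> cD * norm (b, 0 :: 's)" by (rule F'_bound) (simp_all add: infnorm_0)
  finally show ?thesis using b by (simp add: norm_Pair)
qed

lemma norm_tangent_step:
  assumes "infnorm s \<le> 2" "infnorm v \<le> 1"
  shows "norm (fst q, F' \<theta> v s q) \<le> (1 + cD) * norm q"
proof -
  have "norm (fst q, F' \<theta> v s q) \<le> norm (fst q) + norm (F' \<theta> v s q)"
    by (simp add: norm_Pair sqrt_sum_squares_le_sum)
  also have "\<dots> \<le> norm q + cD * norm q" using norm_fst_le[of "fst q" "snd q"] F'_bound[OF assms] by (intro add_mono) auto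
  finally show ?thesis by (simp add: algebra_simps)
qed

text \<open>The growth in \<open>k\<close> is harmless: the bound provides integrability and
  boundedness at a fixed horizon, while the estimates uniform in \<open>k\<close> come from
  expansions along curves.\<close>

lemma D_bound: "infnorm s \<le> 2 \<Longrightarrow> infnorm v \<le> 1 \<Longrightarrow> \<bar>D k \<theta> s q v\<bar> \<le> cD * (1 + cD) ^ k * norm q"
proof (induction k arbitrary: s q v)
  case 0
  then show ?case using D0_bound by simp
next
  case (Suc k)
  have "\<bar>D k \<theta> (F \<theta> v s) (fst q, F' \<theta> v s q) w\<bar> \<le> cD * (1 + cD) ^ k * ((1 + cD) * norm q)" if "infnorm w \<le> 1" for w
    using order_trans[OF Suc.IH[OF F_box2 that] mult_left_mono[OF norm_tangent_step[OF Suc.prems]]] cD by simp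
  then show ?case using \<kappa>_integral_abs_le[of "\<lambda>w. D k \<theta> (F \<theta> v s) (fst q, F' \<theta> v s q) w"]
    by (simp add: algebra_simps)
qed

lemma D_integrable: "infnorm s \<le> 2 \<Longrightarrow> integrable (\<kappa> v) (\<lambda>w. D k \<theta> s q w)"
  by (rule \<kappa>_integrable[OF _ D_bound]) auto

lemma l_integrable: "infnorm s \<le> 2 \<Longrightarrow> integrable (\<kappa> v) (\<lambda>w. l k \<theta> s w)"
  by (rule \<kappa>_integrable) (use l_bound in auto)

lemma D_add: "infnorm s \<le> 2 \<Longrightarrow> infnorm v \<le> 1 \<Longrightarrow> D k \<theta> s (q + q') v = D k \<theta> s q v + D k \<theta> s q' v"
proof (induction k arbitrary: s q q' v)
  case 0
  then show ?case using linear_add[OF D0_linear] by simp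
next
  case (Suc k)
  have e: "(fst (q + q'), F' \<theta> v s (q + q')) = (fst q, F' \<theta> v s q) + (fst q', F' \<theta> v s q')"
    by (simp add: linear_add[OF F'_linear])
  have "D (Suc k) \<theta> s (q + q') v = (\<integral>w. D k \<theta> (F \<theta> v s) (fst q, F' \<theta> v s q) w + D k \<theta> (F \<theta> v s) (fst q', F' \<theta> v s q') w \<partial>\<kappa> v)"
    unfolding D.simps e
  proof (rule integral_cong_AE)
    show "AE w in \<kappa> v. D k \<theta> (F \<theta> v s) ((fst q, F' \<theta> v s q) + (fst q', F' \<theta> v s q')) w =
        D k \<theta> (F \<theta> v s) (fst q, F' \<theta> v s q) w + D k \<theta> (F \<theta> v s) (fst q', F' \<theta> v s q') w"
      using \<kappa>_cube[of v] by eventually_elim (rule Suc.IH[OF F_box2])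
  qed measurable
  also have "\<dots> = D (Suc k) \<theta> s q v + D (Suc k) \<theta> s q' v"
    unfolding D.simps by (intro Bochner_Integration.integral_add D_integrable F_box2)
  finally show ?case .
qed

lemma D_scale: "infnorm s \<le> 2 \<Longrightarrow> infnorm v \<le> 1 \<Longrightarrow> D k \<theta> s (c *\<^sub>R q) v = c * D k \<theta> s q v"
proof (induction k arbitrary: s q v)
  case 0
  then show ?case using linear_scale[OF D0_linear] by simp
next
  case (Suc k)
  have e: "(fst (c *\<^sub>R q), F' \<theta> v s (c *\<^sub>R q)) = c *\<^sub>R (fst q, F' \<theta> v s q)"
    by (simp add: linear_scale[OF F'_linear])
  have "D (Suc k) \<theta> s (c *\<^sub>R q) v = (\<integral>w. c * D k \<theta> (F \<theta> v s) (fst q, F' \<theta> v s q) w \<partial>\<kappa> v)"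
    unfolding D.simps e
  proof (rule integral_cong_AE)
    show "AE w in \<kappa> v. D k \<theta> (F \<theta> v s) (c *\<^sub>R (fst q, F' \<theta> v s q)) w = c * D k \<theta> (F \<theta> v s) (fst q, F' \<theta> v s q) w"
      using \<kappa>_cube[of v] by eventually_elim (rule Suc.IH[OF F_box2])
  qed measurable
  then show ?case by simp
qed

text \<open>The constant does not grow with \<open>k\<close>: a step maps admissible curves to
  admissible curves, so the expansion of \<open>l k\<close> along the image curve holds with the
  same \<open>C0\<close> for each next datum \<open>w\<close>, and averaging over \<open>w\<close>
  preserves it.\<close>

lemma curve_second:
  "curve \<tau> s \<sigma> \<Longrightarrow> infnorm v \<le> 1 \<Longrightarrow> 0 \<le> h \<Longrightarrow>
    \<bar>l k (\<theta> + h *\<^sub>R \<tau>) (s h) v - l k \<theta> (s 0) v - h * D k \<theta> (s 0) (\<tau>, \<sigma>) v\<bar> \<le> C0 * h\<^sup>2"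
proof (induction k arbitrary: s \<sigma> v)
  case 0
  then show ?case using l0_second by (simp add: l_0)
next
  case (Suc k)
  note c = curve_step[OF Suc.prems(1,2), of \<theta>]
  let ?s = "\<lambda>r. F (\<theta> + r *\<^sub>R \<tau>) v (s r)" and ?\<sigma> = "F' \<theta> v (s 0) (\<tau>, \<sigma>)"
  let ?G = "\<lambda>w. l k (\<theta> + h *\<^sub>R \<tau>) (?s h) w - l k \<theta> (?s 0) w - h * D k \<theta> (?s 0) (\<tau>, ?\<sigma>) w"
  have "\<bar>\<integral>w. ?G w \<partial>\<kappa> v\<bar> \<le> C0 * h\<^sup>2"
  proof (rule \<kappa>_integral_abs_le)
    show "\<bar>?G w\<bar> \<le> C0 * h\<^sup>2" if "infnorm w \<le> 1" for w
      using Suc.IH[OF c that Suc.prems(3)] by simp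
  qed measurable
  moreover have "(\<integral>w. ?G w \<partial>\<kappa> v) = (\<integral>w. l k (\<theta> + h *\<^sub>R \<tau>) (?s h) w \<partial>\<kappa> v)
      - (\<integral>w. l k \<theta> (?s 0) w \<partial>\<kappa> v) - h * (\<integral>w. D k \<theta> (?s 0) (\<tau>, ?\<sigma>) w \<partial>\<kappa> v)"
    using l_integrable[OF F_box2] D_integrable[OF F_box2] by simp
  ultimately show ?case by (simp add: l_Suc)
qed

lemma curve_third:
  "curve \<tau> s \<sigma> \<Longrightarrow> infnorm v \<le> 1 \<Longrightarrow> 0 \<le> h \<Longrightarrow>
    \<bar>l k (\<theta> + (2 * h) *\<^sub>R \<tau>) (s (2 * h)) v - 4 * l k (\<theta> + h *\<^sub>R \<tau>) (s h) v + 3 * l k \<theta> (s 0) v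
        + 2 * h * D k \<theta> (s 0) (\<tau>, \<sigma>) v\<bar> \<le> C0 * h ^ 3"
proof (induction k arbitrary: s \<sigma> v)
  case 0
  then show ?case using l0_third by (simp add: l_0)
next
  case (Suc k)
  note c = curve_step[OF Suc.prems(1,2), of \<theta>]
  let ?s = "\<lambda>r. F (\<theta> + r *\<^sub>R \<tau>) v (s r)" and ?\<sigma> = "F' \<theta> v (s 0) (\<tau>, \<sigma>)"
  let ?G = "\<lambda>w. l k (\<theta> + (2 * h) *\<^sub>R \<tau>) (?s (2 * h)) w - 4 * l k (\<theta> + h *\<^sub>R \<tau>) (?s h) w + 3 * l k \<theta> (?s 0) w
        + 2 * h * D k \<theta> (?s 0) (\<tau>, ?\<sigma>) w"
  have "\<bar>\<integral>w. ?G w \<partial>\<kappa> v\<bar> \<le> C0 * h ^ 3"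
  proof (rule \<kappa>_integral_abs_le)
    show "\<bar>?G w\<bar> \<le> C0 * h ^ 3" if "infnorm w \<le> 1" for w
      using Suc.IH[OF c that Suc.prems(3)] by simp
  qed measurable
  moreover have "(\<integral>w. ?G w \<partial>\<kappa> v) = (\<integral>w. l k (\<theta> + (2 * h) *\<^sub>R \<tau>) (?s (2 * h)) w \<partial>\<kappa> v)
      - 4 * (\<integral>w. l k (\<theta> + h *\<^sub>R \<tau>) (?s h) w \<partial>\<kappa> v)
      + 3 * (\<integral>w. l k \<theta> (?s 0) w \<partial>\<kappa> v) + 2 * h * (\<integral>w. D k \<theta> (?s 0) (\<tau>, ?\<sigma>) w \<partial>\<kappa> v)"
    using l_integrable[OF F_box2] D_integrable[OF F_box2] by simp
  ultimately show ?case by (simp add: l_Suc)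
qed

text \<open>Comparing the three expansions along the sides of a triangle shows that a quadratic Taylor
  remainder bound makes the derivative Lipschitz.\<close>

lemma Lipschitz_of_remainder:
  fixes e :: "'p \<Rightarrow> 's \<Rightarrow> real" and E :: "'p \<Rightarrow> 's \<Rightarrow> 'p \<times> 's \<Rightarrow> real"
  assumes add: "\<And>\<theta> q q'. E \<theta> s (q + q') = E \<theta> s q + E \<theta> s q'"
    and scale: "\<And>\<theta> q c. E \<theta> s (c *\<^sub>R q) = c * E \<theta> s q"
    and rem: "\<And>\<theta> \<tau> \<sigma> h. norm \<tau> \<le> 1 \<Longrightarrow> norm \<sigma> \<le> 1 \<Longrightarrow> 0 \<le> h \<Longrightarrow>
      \<bar>e (\<theta> + h *\<^sub>R \<tau>) (s + sin h *\<^sub>R \<sigma>) - e \<theta> s - h * E \<theta> s (\<tau>, \<sigma>)\<bar> \<le> c * h\<^sup>2"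
  shows "\<bar>E \<theta>' s q - E \<theta> s q\<bar> \<le> 12 * c * norm (\<theta>' - \<theta>) * norm q"
proof -
  have half: "\<bar>E \<theta>' s q - E \<theta> s q\<bar> \<le> 6 * c * norm (\<theta>' - \<theta>)" if q: "norm q = 1 / 2" for q
  proof (cases "\<theta>' = \<theta>")
    case False
    \<comment> \<open>With this length \<open>u\<close> has norm 1/2; as
      \<open>norm q = 1 / 2\<close>, the directions \<open>u\<close>, \<open>\<tau>\<close> and
      \<open>u + \<tau>\<close> all lie in the unit ball, and the three sides of the triangle are
      traversed with the same \<open>h\<close>.\<close>
    define h where "h = 2 * norm (\<theta>' - \<theta>)"
    have h: "0 < h" using False by (simp add: h_def)
    define u where "u = (1 / h) *\<^sub>R (\<theta>' - \<theta>)"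
    have hu: "h *\<^sub>R u = \<theta>' - \<theta>" and nu: "norm u = 1 / 2" using h by (simp_all add: u_def h_def)
    obtain \<tau> \<sigma> where qq: "q = (\<tau>, \<sigma>)" by (cases q)
    have n: "norm \<tau> \<le> 1 / 2" "norm \<sigma> \<le> 1 / 2" using q norm_fst_le[of \<tau> \<sigma>] norm_snd_le[of \<sigma> \<tau>] by (simp_all add: qq)
    have nt: "norm (u + \<tau>) \<le> 1" using norm_triangle_ineq[of u \<tau>] nu n by simp
    have eq: "\<theta> + h *\<^sub>R (u + \<tau>) = \<theta>' + h *\<^sub>R \<tau>" by (simp add: scaleR_add_right hu)
    have 1: "\<bar>e (\<theta>' + h *\<^sub>R \<tau>) (s + sin h *\<^sub>R \<sigma>) - e \<theta>' s - h * E \<theta>' s q\<bar> \<le> c * h\<^sup>2"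
      unfolding qq using n h by (intro rem) auto
    have 2: "\<bar>e (\<theta>' + h *\<^sub>R \<tau>) (s + sin h *\<^sub>R \<sigma>) - e \<theta> s - h * E \<theta> s (u + \<tau>, \<sigma>)\<bar> \<le> c * h\<^sup>2"
      using rem[of "u + \<tau>" \<sigma> h \<theta>] n nt h by (simp add: eq)
    have 3: "\<bar>e \<theta>' s - e \<theta> s - h * E \<theta> s (u, 0)\<bar> \<le> c * h\<^sup>2"
      using rem[of u 0 h \<theta>] nu h by (simp add: hu)
    have "E \<theta> s (u + \<tau>, \<sigma>) = E \<theta> s (u, 0) + E \<theta> s q" using add[of \<theta> "(u, 0)" q] by (simp add: qq)
    then have "\<bar>h * E \<theta>' s q - h * E \<theta> s q\<bar> \<le> 3 * (c * h\<^sup>2)" using 1 2 3 by (simp add: distrib_left)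
    then have "h * \<bar>E \<theta>' s q - E \<theta> s q\<bar> \<le> h * (3 * c * h)"
      using h by (simp add: abs_mult power2_eq_square ac_simps flip: right_diff_distrib)
    then show ?thesis using h by (simp add: h_def)
  qed simp
  show ?thesis
  proof (cases "q = 0")
    case True
    then show ?thesis using scale[of _ 0 q] by simp
  next
    case False
    define a where "a = 1 / (2 * norm q)"
    have a: "0 < a" using False by (simp add: a_def)
    have "norm (a *\<^sub>R q) = 1 / 2" using False by (simp add: a_def)
    from half[OF this] have "a * \<bar>E \<theta>' s q - E \<theta> s q\<bar> \<le> 6 * c * norm (\<theta>' - \<theta>)"
      using a by (simp add: scale abs_mult flip: right_diff_distrib)
    then show ?thesis using False by (simp add: a_def field_simps)
  qed
qed

text \<open>A sixth root, because \<open>interpolation\<close> consumes a bound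
  \<open>\<kappa> ^ 6\<close> and will be applied with \<open>\<kappa> = \<rho> ^ k\<close>.\<close>

definition \<rho> :: real where "\<rho> = root 6 rate"

lemma \<rho>: "0 < \<rho>" "\<rho> < 1" and \<rho>_rate: "rate ^ k = (\<rho> ^ k) ^ 6"
proof -
  show "0 < \<rho>" "\<rho> < 1" using rate by (simp_all add: \<rho>_def)
  have "\<rho> ^ 6 = rate" using rate by (simp add: \<rho>_def)
  then show "rate ^ k = (\<rho> ^ k) ^ 6" by (metis power_mult mult.commute)
qed

lemma \<rho>_power: "0 < \<rho> ^ k" "\<rho> ^ k \<le> 1"
  using \<rho> by (simp_all add: power_le_one)

text \<open>Dividing by \<open>\<Gamma>\<close> brings \<open>l (Suc k) - l k\<close> below
  \<open>(\<rho> ^ k) ^ 6\<close>; the lower bound 1 ensures that this division does not enlarge the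
  second and third order increments.\<close>

definition \<Gamma> :: real where "\<Gamma> = max 1 (4 * bl + 2 * Lip_gain bl al)"

lemma \<Gamma>: "1 \<le> \<Gamma>" by (simp add: \<Gamma>_def)

lemma l_Cauchy:
  assumes "infnorm s \<le> 2" "infnorm v \<le> 1"
  shows "\<bar>l (Suc k) \<theta> s v - l k \<theta> s v\<bar> \<le> \<Gamma> * (\<rho> ^ k) ^ 6"
proof -
  have "\<bar>l (Suc k) \<theta> s v - l k \<theta> s v\<bar> \<le> (4 * bl + 2 * Lip_gain bl al) * rate ^ k"
    unfolding l_def by (rule evol_iterate_Cauchy[OF l0_Lip bl al assms])
  also have "\<dots> \<le> \<Gamma> * rate ^ k" using rate by (intro mult_right_mono) (auto simp: \<Gamma>_def)
  finally show ?thesis by (simp add: \<rho>_rate)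
qed

lemma C0: "0 \<le> C0"
  using order_trans[OF abs_ge_zero l0_second[OF curve_line[of 0 0 0], of 0 1]] by (simp add: infnorm_0)

text \<open>\<open>interpolation\<close> is applied to the Taylor remainder \<open>A\<close> of
  \<open>(l (Suc k) - l k) / \<Gamma>\<close> along the bounded line. Its size is controlled by the
  Cauchy estimate, and the increments of order two and three are bounded by \<open>2 * C0\<close> as
  differences of two expansions with the same constant.\<close>

lemma increment_small:
  assumes \<tau>: "norm \<tau> \<le> 1" and \<sigma>: "norm \<sigma> \<le> 1" and s: "infnorm s \<le> 1" and v: "infnorm v \<le> 1"
  shows "\<bar>D (Suc k) \<theta> s (\<tau>, \<sigma>) v - D k \<theta> s (\<tau>, \<sigma>) v\<bar> \<le> \<Gamma> * (2 + 2 * C0) * \<rho> ^ k"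
    and "0 \<le> h \<Longrightarrow> \<bar>(l (Suc k) (\<theta> + h *\<^sub>R \<tau>) (s + sin h *\<^sub>R \<sigma>) v - l k (\<theta> + h *\<^sub>R \<tau>) (s + sin h *\<^sub>R \<sigma>) v)
      - (l (Suc k) \<theta> s v - l k \<theta> s v) - h * (D (Suc k) \<theta> s (\<tau>, \<sigma>) v - D k \<theta> s (\<tau>, \<sigma>) v)\<bar>
      \<le> \<Gamma> * (4 + 4 * C0) * \<rho> ^ k * h\<^sup>2"
proof -
  note c = curve_line[OF \<tau> \<sigma> s]
  define d where "d \<theta> s = (l (Suc k) \<theta> s v - l k \<theta> s v) / \<Gamma>" for \<theta> s
  define DD where "DD = (D (Suc k) \<theta> s (\<tau>, \<sigma>) v - D k \<theta> s (\<tau>, \<sigma>) v) / \<Gamma>"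
  define A where "A h = d (\<theta> + h *\<^sub>R \<tau>) (s + sin h *\<^sub>R \<sigma>) - d \<theta> s - h * DD" for h
  have scaled: "\<bar>x / \<Gamma>\<bar> \<le> y" if "\<bar>x\<bar> \<le> y" for x y
  proof -
    have "\<bar>x / \<Gamma>\<bar> \<le> \<bar>x\<bar> / 1" using \<Gamma> by (simp add: divide_le_eq mult_left_le_one_le abs_mult) (simp add: mult_le_cancel_left1)
    then show ?thesis using that by simp
  qed
  have 1: "\<bar>A h\<bar> \<le> (2 * C0) * h\<^sup>2" if h: "0 \<le> h" for h
  proof -
    have "\<bar>(l (Suc k) (\<theta> + h *\<^sub>R \<tau>) (s + sin h *\<^sub>R \<sigma>) v - l (Suc k) \<theta> s v - h * D (Suc k) \<theta> s (\<tau>, \<sigma>) v)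
      - (l k (\<theta> + h *\<^sub>R \<tau>) (s + sin h *\<^sub>R \<sigma>) v - l k \<theta> s v - h * D k \<theta> s (\<tau>, \<sigma>) v)\<bar> \<le> 2 * C0 * h\<^sup>2" (is "\<bar>?X\<bar> \<le> _")
      using curve_second[OF c v h, of "Suc k" \<theta>] curve_second[OF c v h, of k \<theta>] by simp
    moreover have "A h = ?X / \<Gamma>" unfolding A_def d_def DD_def by (simp add: diff_divide_distrib right_diff_distrib)
    ultimately show ?thesis using scaled[of ?X] by simp
  qed
  have 2: "\<bar>A (2 * h) - 4 * A h\<bar> \<le> (2 * C0) * h ^ 3" if h: "0 \<le> h" for h
  proof -
    have "\<bar>(l (Suc k) (\<theta> + (2 * h) *\<^sub>R \<tau>) (s + sin (2 * h) *\<^sub>R \<sigma>) v - 4 * l (Suc k) (\<theta> + h *\<^sub>R \<tau>) (s + sin h *\<^sub>R \<sigma>) v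
         + 3 * l (Suc k) \<theta> s v + 2 * h * D (Suc k) \<theta> s (\<tau>, \<sigma>) v)
      - (l k (\<theta> + (2 * h) *\<^sub>R \<tau>) (s + sin (2 * h) *\<^sub>R \<sigma>) v - 4 * l k (\<theta> + h *\<^sub>R \<tau>) (s + sin h *\<^sub>R \<sigma>) v
         + 3 * l k \<theta> s v + 2 * h * D k \<theta> s (\<tau>, \<sigma>) v)\<bar> \<le> 2 * C0 * h ^ 3" (is "\<bar>?X\<bar> \<le> _")
      using curve_third[OF c v h, of "Suc k" \<theta>] curve_third[OF c v h, of k \<theta>] by simp
    moreover have "A (2 * h) - 4 * A h = ?X / \<Gamma>"
      unfolding A_def d_def DD_def by (simp add: diff_divide_distrib add_divide_distrib algebra_simps)
    ultimately show ?thesis using scaled[of ?X] by simp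
  qed
  have db: "\<bar>d \<theta> s\<bar> \<le> (\<rho> ^ k) ^ 6" if "infnorm s \<le> 2" for \<theta> s
    using l_Cauchy[OF that v, of k \<theta>] \<Gamma> by (simp add: d_def divide_le_eq mult.commute)
  have 3: "\<bar>A h + h * DD\<bar> \<le> 2 * (\<rho> ^ k) ^ 6" if "0 \<le> h" for h
    using db[OF curve_box[OF c, of h], of "\<theta> + h *\<^sub>R \<tau>"] db[of s \<theta>] s by (simp add: A_def)
  have I1: "\<bar>DD\<bar> \<le> (2 + 2 * C0) * (\<rho> ^ k) ^ 3"
    by (rule interpolation(1)[of A "2 * C0" DD "\<rho> ^ k"]) (erule 2, erule 3, erule 1, rule \<rho>_power, rule \<rho>_power)
  have I2: "\<bar>A h\<bar> \<le> (4 + 2 * (2 * C0)) * \<rho> ^ k * h\<^sup>2" if "0 \<le> h" for h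
    by (rule interpolation(2)[of A "2 * C0" DD "\<rho> ^ k"]) (erule 2, erule 3, erule 1, rule \<rho>_power, rule \<rho>_power, rule that)
  have "\<bar>DD\<bar> \<le> (2 + 2 * C0) * \<rho> ^ k"
  proof -
    have "(\<rho> ^ k) ^ 3 \<le> \<rho> ^ k" using \<rho>_power[of k] power_decreasing[of 1 3 "\<rho> ^ k"] by simp
    then have "(2 + 2 * C0) * (\<rho> ^ k) ^ 3 \<le> (2 + 2 * C0) * \<rho> ^ k" using C0 by (intro mult_left_mono) auto
    then show ?thesis using I1 by linarith
  qed
  then have "\<Gamma> * \<bar>DD\<bar> \<le> \<Gamma> * ((2 + 2 * C0) * \<rho> ^ k)" using \<Gamma> by (intro mult_left_mono) auto
  moreover have "\<Gamma> * \<bar>DD\<bar> = \<bar>D (Suc k) \<theta> s (\<tau>, \<sigma>) v - D k \<theta> s (\<tau>, \<sigma>) v\<bar>" using \<Gamma> by (simp add: DD_def)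
  ultimately show "\<bar>D (Suc k) \<theta> s (\<tau>, \<sigma>) v - D k \<theta> s (\<tau>, \<sigma>) v\<bar> \<le> \<Gamma> * (2 + 2 * C0) * \<rho> ^ k"
    by (simp add: mult.assoc)
  assume h: "0 \<le> h"
  have "\<Gamma> * \<bar>A h\<bar> \<le> \<Gamma> * ((4 + 2 * (2 * C0)) * \<rho> ^ k * h\<^sup>2)" using \<Gamma> I2[OF h] by (intro mult_left_mono) auto
  moreover have "\<Gamma> * \<bar>A h\<bar> = \<bar>\<Gamma> * A h\<bar>" using \<Gamma> by (simp add: abs_mult)
  moreover have "\<Gamma> * A h = \<Gamma> * d (\<theta> + h *\<^sub>R \<tau>) (s + sin h *\<^sub>R \<sigma>) - \<Gamma> * d \<theta> s - h * (\<Gamma> * DD)"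
    by (simp add: A_def algebra_simps)
  moreover have "\<Gamma> * (x / \<Gamma>) = x" for x using \<Gamma> by simp
  ultimately show "\<bar>(l (Suc k) (\<theta> + h *\<^sub>R \<tau>) (s + sin h *\<^sub>R \<sigma>) v - l k (\<theta> + h *\<^sub>R \<tau>) (s + sin h *\<^sub>R \<sigma>) v)
      - (l (Suc k) \<theta> s v - l k \<theta> s v) - h * (D (Suc k) \<theta> s (\<tau>, \<sigma>) v - D k \<theta> s (\<tau>, \<sigma>) v)\<bar>
      \<le> \<Gamma> * (4 + 4 * C0) * \<rho> ^ k * h\<^sup>2" unfolding d_def DD_def by (simp add: mult.assoc)
qed

end

section \<open>The limiting loss and its gradient\<close>

lemma geometric_Cauchy:
  fixes a :: "nat \<Rightarrow> real"
  assumes \<rho>: "0 < \<rho>" "\<rho> < 1" and a: "\<And>k. \<bar>a (Suc k) - a k\<bar> \<le> c * \<rho> ^ k"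
  shows "a \<longlonglongrightarrow> lim a" "\<bar>a k - lim a\<bar> \<le> c / (1 - \<rho>) * \<rho> ^ k"
proof -
  have c: "0 \<le> c" using a[of 0] by simp
  have "summable (\<lambda>k. a (Suc k) - a k)"
    by (rule summable_comparison_test'[of "\<lambda>k. c * \<rho> ^ k" 0]) (use a \<rho> in \<open>auto intro!: summable_mult summable_geometric\<close>)
  then have "(\<lambda>n. \<Sum>k<n. a (Suc k) - a k) \<longlonglongrightarrow> (\<Sum>k. a (Suc k) - a k)" by (rule summable_LIMSEQ)
  then have "(\<lambda>n. a 0 + (a n - a 0)) \<longlonglongrightarrow> a 0 + (\<Sum>k. a (Suc k) - a k)"
    by (intro tendsto_intros) (simp add: sum_lessThan_telescope)
  then have "convergent a" by (auto simp: convergent_def)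
  then show lim: "a \<longlonglongrightarrow> lim a" by (simp add: convergent_LIMSEQ_iff)
  have step: "\<bar>a m - a k\<bar> \<le> c / (1 - \<rho>) * (\<rho> ^ k - \<rho> ^ m)" if "k \<le> m" for m
    using that
  proof (induction m rule: dec_induct)
    case (step m)
    have "\<bar>a (Suc m) - a k\<bar> \<le> c / (1 - \<rho>) * (\<rho> ^ k - \<rho> ^ m) + c * \<rho> ^ m"
      using step.IH a[of m] by linarith
    also have "\<dots> = c / (1 - \<rho>) * (\<rho> ^ k - \<rho> ^ Suc m)" using \<rho> by (simp add: divide_simps) (simp add: algebra_simps)
    finally show ?case .
  qed simp
  have "\<bar>a m - a k\<bar> \<le> c / (1 - \<rho>) * \<rho> ^ k" if "k \<le> m" for m
  proof -
    have "c / (1 - \<rho>) * (\<rho> ^ k - \<rho> ^ m) \<le> c / (1 - \<rho>) * \<rho> ^ k" using c \<rho> by (intro mult_left_mono) auto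
    then show ?thesis using step[OF that] by linarith
  qed
  moreover have "(\<lambda>m. \<bar>a m - a k\<bar>) \<longlonglongrightarrow> \<bar>lim a - a k\<bar>" by (intro tendsto_intros lim)
  ultimately have "\<bar>lim a - a k\<bar> \<le> c / (1 - \<rho>) * \<rho> ^ k"
    by (intro LIMSEQ_le_const2) auto
  then show "\<bar>a k - lim a\<bar> \<le> c / (1 - \<rho>) * \<rho> ^ k" by (simp add: abs_minus_commute)
qed

lemma GDERIV_of_quadratic_remainder:
  fixes f :: "'a::real_inner \<Rightarrow> real"
  assumes "\<And>y. \<bar>f (x + y) - f x - g \<bullet> y\<bar> \<le> C * (norm y)\<^sup>2"
  shows "GDERIV f x :> g"
  unfolding gderiv_def has_derivative_at
proof
  show "bounded_linear (\<lambda>h. h \<bullet> g)" by (rule bounded_linear_inner_left)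
  have "(\<lambda>h :: 'a. C * norm h) \<midarrow>0\<rightarrow> C * norm (0 :: 'a)"
    by (intro tendsto_mult tendsto_const tendsto_norm tendsto_ident_at)
  then have l: "(\<lambda>h :: 'a. C * norm h) \<midarrow>0\<rightarrow> 0" by simp
  show "(\<lambda>h. norm (f (x + h) - f x - h \<bullet> g) / norm h) \<midarrow>0\<rightarrow> 0"
  proof (rule tendsto_sandwich[OF _ _ tendsto_const l])
    show "\<forall>\<^sub>F h in at 0. 0 \<le> norm (f (x + h) - f x - h \<bullet> g) / norm h" by simp
    show "\<forall>\<^sub>F h in at 0. norm (f (x + h) - f x - h \<bullet> g) / norm h \<le> C * norm h"
    proof (intro always_eventually allI)
      fix h
      show "norm (f (x + h) - f x - h \<bullet> g) / norm h \<le> C * norm h"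
        using assms[of h] by (cases "h = 0") (auto simp: divide_le_eq power2_eq_square inner_commute mult.assoc)
    qed
  qed
qed

lemma norm_le_of_inner_le:
  fixes x :: "'a::real_inner"
  assumes "\<And>y. \<bar>x \<bullet> y\<bar> \<le> c * norm y" "0 \<le> c"
  shows "norm x \<le> c"
proof (cases "x = 0")
  case False
  have "norm x * norm x \<le> c * norm x" using assms(1)[of x] by (simp add: power2_norm_eq_inner flip: power2_eq_square)
  then show ?thesis using False by simp
qed (use assms in simp)

context smooth_system
begin

text \<open>Sums of the geometric increment bounds over all horizons; the 12 in \<open>K2\<close> is
  the constant of \<open>Lipschitz_of_remainder\<close>.\<close>

definition K1 :: real where "K1 = \<Gamma> * (2 + 2 * C0) / (1 - \<rho>)"
definition K2 :: real where "K2 = 12 * (\<Gamma> * (4 + 4 * C0)) / (1 - \<rho>)"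

lemma K1: "0 \<le> K1" and K2: "0 \<le> K2"
  using \<Gamma> C0 \<rho> by (auto simp: K1_def K2_def intro!: divide_nonneg_pos)

lemma D_Cauchy:
  assumes s: "infnorm s \<le> 1" and v: "infnorm v \<le> 1"
  shows "\<bar>D (Suc k) \<theta> s q v - D k \<theta> s q v\<bar> \<le> (\<Gamma> * (2 + 2 * C0) * norm q) * \<rho> ^ k"
proof (cases "q = 0")
  case True
  then show ?thesis using D_scale[of s v _ \<theta> 0 q] s v by (simp del: D.simps)
next
  case False
  let ?n = "norm q"
  define p where "p = (1 / ?n) *\<^sub>R q"
  have q: "q = ?n *\<^sub>R p" and n: "norm p = 1" using False by (simp_all add: p_def)
  have b: "norm (fst p) \<le> 1" "norm (snd p) \<le> 1"
    using n norm_fst_le[of "fst p" "snd p"] norm_snd_le[of "snd p" "fst p"] by simp_all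
  have "\<bar>D (Suc k) \<theta> s p v - D k \<theta> s p v\<bar> \<le> \<Gamma> * (2 + 2 * C0) * \<rho> ^ k"
    using increment_small(1)[OF b s v, of k \<theta>] by (simp del: D.simps)
  moreover have "D j \<theta> s q v = ?n * D j \<theta> s p v" for j
    by (subst q) (rule D_scale, use s v in auto)
  ultimately have "\<bar>D (Suc k) \<theta> s q v - D k \<theta> s q v\<bar> \<le> ?n * (\<Gamma> * (2 + 2 * C0) * \<rho> ^ k)"
    by (simp add: abs_mult mult_left_mono flip: right_diff_distrib del: D.simps)
  then show ?thesis by (simp only: ac_simps)
qed

text \<open>The second order remainder of the increment \<open>l (Suc k) - l k\<close> decays
  geometrically, and \<open>Lipschitz_of_remainder\<close> turns it into an equally small Lipschitz
  constant of the derivative.\<close>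

lemma D_Cauchy_Lipschitz:
  assumes s: "infnorm s \<le> 1" and v: "infnorm v \<le> 1"
  shows "\<bar>(D (Suc k) \<theta>' s q v - D (Suc k) \<theta> s q v) - (D k \<theta>' s q v - D k \<theta> s q v)\<bar>
    \<le> (12 * (\<Gamma> * (4 + 4 * C0)) * (norm (\<theta>' - \<theta>) * norm q)) * \<rho> ^ k"
proof -
  have s2: "infnorm s \<le> 2" using s by simp
  have "\<bar>(D (Suc k) \<theta>' s q v - D k \<theta>' s q v) - (D (Suc k) \<theta> s q v - D k \<theta> s q v)\<bar>
      \<le> 12 * (\<Gamma> * (4 + 4 * C0) * \<rho> ^ k) * norm (\<theta>' - \<theta>) * norm q"
  proof (rule Lipschitz_of_remainder[where e = "\<lambda>\<theta> s. l (Suc k) \<theta> s v - l k \<theta> s v"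
        and E = "\<lambda>\<theta> s q. D (Suc k) \<theta> s q v - D k \<theta> s q v"])
    show "D (Suc k) \<theta> s (q + q') v - D k \<theta> s (q + q') v
        = (D (Suc k) \<theta> s q v - D k \<theta> s q v) + (D (Suc k) \<theta> s q' v - D k \<theta> s q' v)" for \<theta> q q'
      using D_add[OF s2 v] by (simp del: D.simps)
    show "D (Suc k) \<theta> s (c *\<^sub>R q) v - D k \<theta> s (c *\<^sub>R q) v = c * (D (Suc k) \<theta> s q v - D k \<theta> s q v)" for \<theta> q c
      using D_scale[OF s2 v] by (simp add: right_diff_distrib del: D.simps)
  qed (rule increment_small(2)[OF _ _ s v])
  then show ?thesis by (simp add: algebra_simps del: D.simps)
qed

definition Linf :: "'p \<Rightarrow> real" where "Linf \<theta> = lim (\<lambda>k. l k \<theta> 0 0)"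

definition grad :: "'p \<Rightarrow> 'p" where
  "grad \<theta> = (\<Sum>b\<in>Basis. lim (\<lambda>k. D k \<theta> 0 (b, 0) 0) *\<^sub>R b)"

lemma l_tendsto:
  assumes s: "infnorm s \<le> 2" and v: "infnorm v \<le> 1"
  shows "(\<lambda>k. l k \<theta> s v) \<longlonglongrightarrow> Linf \<theta>"
proof -
  have "\<bar>l (Suc k) \<theta> 0 0 - l k \<theta> 0 0\<bar> \<le> \<Gamma> * rate ^ k" for k
    using l_Cauchy[of 0 0 k \<theta>] by (simp add: infnorm_0 \<rho>_rate)
  then have 1: "(\<lambda>k. l k \<theta> 0 0) \<longlonglongrightarrow> Linf \<theta>"
    unfolding Linf_def using rate by (intro geometric_Cauchy(1)[of rate _ \<Gamma>]) auto
  have "(\<lambda>k. (4 * bl + 2 * Lip_gain bl al) * rate ^ k) \<longlonglongrightarrow> (4 * bl + 2 * Lip_gain bl al) * 0"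
    using rate by (intro tendsto_intros LIMSEQ_power_zero) auto
  then have "(\<lambda>k. (4 * bl + 2 * Lip_gain bl al) * rate ^ k) \<longlonglongrightarrow> 0" by simp
  then have "(\<lambda>k. l k \<theta> s v - l k \<theta> 0 0) \<longlonglongrightarrow> 0"
    by (rule Lim_null_comparison[rotated])
      (use evol_iterate_forget[OF l0_Lip bl al s _ v] in \<open>auto simp: l_def infnorm_0\<close>)
  from tendsto_add[OF this 1] show ?thesis by simp
qed

lemma Linf_bound: "\<bar>Linf \<theta>\<bar> \<le> Bl"
  using l_bound[of 0 _ \<theta> 0] by (intro LIMSEQ_le_const2[OF tendsto_rabs[OF l_tendsto[of 0 0 \<theta>]]]) (auto simp: infnorm_0)

lemma D_tendsto:
  assumes s: "infnorm s \<le> 1" and v: "infnorm v \<le> 1"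
  shows "(\<lambda>k. D k \<theta> s q v) \<longlonglongrightarrow> lim (\<lambda>k. D k \<theta> s q v)"
  by (rule geometric_Cauchy(1)[OF \<rho> D_Cauchy[OF s v]])

lemma Linf_remainder:
  assumes \<tau>: "norm \<tau> \<le> 1" and \<sigma>: "norm \<sigma> \<le> 1" and s: "infnorm s \<le> 1" and v: "infnorm v \<le> 1" and h: "0 \<le> h"
  shows "\<bar>Linf (\<theta> + h *\<^sub>R \<tau>) - Linf \<theta> - h * lim (\<lambda>k. D k \<theta> s (\<tau>, \<sigma>) v)\<bar> \<le> C0 * h\<^sup>2"
proof -
  note c = curve_line[OF \<tau> \<sigma> s]
  have "(\<lambda>k. \<bar>l k (\<theta> + h *\<^sub>R \<tau>) (s + sin h *\<^sub>R \<sigma>) v - l k \<theta> s v - h * D k \<theta> s (\<tau>, \<sigma>) v\<bar>)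
      \<longlonglongrightarrow> \<bar>Linf (\<theta> + h *\<^sub>R \<tau>) - Linf \<theta> - h * lim (\<lambda>k. D k \<theta> s (\<tau>, \<sigma>) v)\<bar>"
    using s by (intro tendsto_intros l_tendsto D_tendsto v curve_box[OF c]) auto
  then show ?thesis
    using curve_second[OF c v h] by (intro LIMSEQ_le_const2) auto
qed

text \<open>Both limits are first order coefficients of the same function \<open>Linf\<close> in the
  direction \<open>\<tau>\<close>, each with a quadratic error, hence equal. The dependence on
  \<open>s\<close>, \<open>v\<close> and the memory part of the tangent is lost in the
  limit.\<close>

lemma lim_D_unique:
  assumes s: "infnorm s \<le> 1" and v: "infnorm v \<le> 1"
  shows "lim (\<lambda>k. D k \<theta> s q v) = lim (\<lambda>k. D k \<theta> 0 (fst q, 0) 0)"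
proof -
  have scale: "lim (\<lambda>k. D k \<theta> s (c *\<^sub>R q) v) = c * lim (\<lambda>k. D k \<theta> s q v)"
    if "infnorm s \<le> 1" "infnorm v \<le> 1" for s v c q
  proof -
    have "(\<lambda>k. c * D k \<theta> s q v) \<longlonglongrightarrow> c * lim (\<lambda>k. D k \<theta> s q v)" by (intro tendsto_intros D_tendsto that)
    moreover have "D k \<theta> s (c *\<^sub>R q) v = c * D k \<theta> s q v" for k using that by (intro D_scale) auto
    ultimately show ?thesis by (simp add: limI)
  qed
  have unit: "lim (\<lambda>k. D k \<theta> s (\<tau>, \<sigma>) v) = lim (\<lambda>k. D k \<theta> 0 (\<tau>, 0) 0)" (is "?x = ?y")
    if n: "norm \<tau> \<le> 1" "norm \<sigma> \<le> 1" for \<tau> \<sigma>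
  proof (rule ccontr)
    assume "?x \<noteq> ?y"
    define d where "d = \<bar>?x - ?y\<bar>"
    have d: "0 < d" using \<open>?x \<noteq> ?y\<close> by (simp add: d_def)
    \<comment> \<open>Chosen with \<open>2 * C0 * h < d\<close>, against the bound
      \<open>d \<le> 2 * C0 * h\<close> that the quadratic errors imply; the summand 1 keeps the
      denominator positive for \<open>C0 = 0\<close>.\<close>
    define h where "h = d / (2 * C0 + 1) / 2"
    have h: "0 < h" using d C0 by (simp add: h_def)
    have "\<bar>h * ?x - h * ?y\<bar> \<le> 2 * (C0 * h\<^sup>2)"
      using Linf_remainder[OF n s v, of h \<theta>] Linf_remainder[OF n(1), of 0 0 0 h \<theta>] h by (simp add: infnorm_0)
    then have "h * d \<le> h * (2 * C0 * h)" using h unfolding d_def by (simp add: power2_eq_square abs_mult ac_simps flip: right_diff_distrib)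
    then have "d \<le> 2 * C0 * h" using h by simp
    moreover have "(2 * C0 + 1) * h = d / 2" using C0 unfolding h_def by (simp add: field_simps)
    then have "2 * C0 * h + h = d / 2" by (simp add: algebra_simps)
    ultimately show False using h d by linarith
  qed
  define n where "n = norm q + 1"
  have n: "0 < n" by (simp add: n_def add_nonneg_pos)
  have le: "norm (fst q) \<le> n" "norm (snd q) \<le> n"
    using norm_fst_le[of "fst q" "snd q"] norm_snd_le[of "snd q" "fst q"] by (simp_all add: n_def)
  have eq: "lim (\<lambda>k. D k \<theta> s ((1 / n) *\<^sub>R q) v) = lim (\<lambda>k. D k \<theta> 0 ((1 / n) *\<^sub>R (fst q, 0)) 0)"
    using unit[of "(1 / n) *\<^sub>R fst q" "(1 / n) *\<^sub>R snd q"] le n by (simp add: scaleR_prod_def)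
  have "(1 / n) * lim (\<lambda>k. D k \<theta> s q v) = lim (\<lambda>k. D k \<theta> s ((1 / n) *\<^sub>R q) v)"
    by (rule scale[OF s v, symmetric])
  also note eq
  also have "lim (\<lambda>k. D k \<theta> 0 ((1 / n) *\<^sub>R (fst q, 0)) 0) = (1 / n) * lim (\<lambda>k. D k \<theta> 0 (fst q, 0) 0)"
    by (rule scale) (simp_all add: infnorm_0)
  finally show ?thesis using n by simp
qed

lemma lim_D:
  assumes s: "infnorm s \<le> 1" and v: "infnorm v \<le> 1"
  shows "lim (\<lambda>k. D k \<theta> s q v) = grad \<theta> \<bullet> fst q"
proof -
  define \<Lambda> where "\<Lambda> \<tau> = lim (\<lambda>k. D k \<theta> 0 (\<tau>, 0) 0)" for \<tau>
  have t: "(\<lambda>k. D k \<theta> 0 (\<tau>, 0) 0) \<longlonglongrightarrow> \<Lambda> \<tau>" for \<tau>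
    unfolding \<Lambda>_def by (rule D_tendsto) (simp_all add: infnorm_0)
  have "linear \<Lambda>"
  proof (rule linearI)
    fix x y c
    have "D k \<theta> 0 (x + y, 0) 0 = D k \<theta> 0 (x, 0) 0 + D k \<theta> 0 (y, 0) 0" for k
      using D_add[of 0 0 k \<theta> "(x, 0)" "(y, 0)"] by (simp add: infnorm_0)
    then show "\<Lambda> (x + y) = \<Lambda> x + \<Lambda> y" using tendsto_add[OF t[of x] t[of y]] t[of "x + y"] by (simp add: LIMSEQ_unique)
    have "D k \<theta> 0 (c *\<^sub>R x, 0) 0 = c * D k \<theta> 0 (x, 0) 0" for k
      using D_scale[of 0 0 k \<theta> c "(x, 0)"] by (simp add: infnorm_0)
    then show "\<Lambda> (c *\<^sub>R x) = c *\<^sub>R \<Lambda> x" using tendsto_mult_left[OF t[of x], of c] t[of "c *\<^sub>R x"] by (simp add: LIMSEQ_unique)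
  qed
  then have 1: "\<Lambda> \<tau> = (\<Sum>b\<in>Basis. (\<tau> \<bullet> b) * \<Lambda> b)" for \<tau>
    by (subst euclidean_representation[of \<tau>, symmetric]) (simp add: linear_sum linear_scale)
  have 2: "grad \<theta> \<bullet> \<tau> = (\<Sum>b\<in>Basis. (\<tau> \<bullet> b) * \<Lambda> b)" for \<tau>
    unfolding grad_def inner_sum_left by (intro sum.cong) (simp_all add: \<Lambda>_def inner_commute[of \<tau>])
  have "\<Lambda> \<tau> = grad \<theta> \<bullet> \<tau>" for \<tau> using 1[of \<tau>] 2[of \<tau>] by (rule trans[OF _ sym])
  then show ?thesis using lim_D_unique[OF s v] by (simp add: \<Lambda>_def)
qed

lemma D_grad:
  assumes s: "infnorm s \<le> 1" and v: "infnorm v \<le> 1"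
  shows "\<bar>D k \<theta> s q v - grad \<theta> \<bullet> fst q\<bar> \<le> K1 * \<rho> ^ k * norm q"
  using geometric_Cauchy(2)[OF \<rho>, where a = "\<lambda>k. D k \<theta> s q v" and k = k, OF D_Cauchy[OF s v]]
  by (simp add: lim_D[OF s v] K1_def ac_simps)

lemma D_grad_Lipschitz:
  assumes s: "infnorm s \<le> 1" and v: "infnorm v \<le> 1"
  shows "\<bar>(D k \<theta>' s q v - grad \<theta>' \<bullet> fst q) - (D k \<theta> s q v - grad \<theta> \<bullet> fst q)\<bar> \<le> K2 * \<rho> ^ k * (norm (\<theta>' - \<theta>) * norm q)"
proof -
  have "(\<lambda>k. D k \<theta>' s q v - D k \<theta> s q v) \<longlonglongrightarrow> grad \<theta>' \<bullet> fst q - grad \<theta> \<bullet> fst q"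
    using D_tendsto[OF s v] unfolding lim_D[OF s v] by (intro tendsto_intros) auto
  then have "lim (\<lambda>k. D k \<theta>' s q v - D k \<theta> s q v) = grad \<theta>' \<bullet> fst q - grad \<theta> \<bullet> fst q" by (rule limI)
  then show ?thesis
    using geometric_Cauchy(2)[OF \<rho>, where a = "\<lambda>k. D k \<theta>' s q v - D k \<theta> s q v" and k = k, OF D_Cauchy_Lipschitz[OF s v]]
    by (simp add: K2_def algebra_simps)
qed

text \<open>Yields both the differentiability of the limiting loss and the descent estimate for the
  algorithm.\<close>

lemma Linf_expansion: "\<bar>Linf (\<theta> + y) - Linf \<theta> - grad \<theta> \<bullet> y\<bar> \<le> C0 * (norm y)\<^sup>2"
proof (cases "y = 0")
  case False
  define \<tau> where "\<tau> = (1 / norm y) *\<^sub>R y"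
  have "norm \<tau> \<le> 1" "norm y *\<^sub>R \<tau> = y" using False by (simp_all add: \<tau>_def)
  then show ?thesis
    using Linf_remainder[of \<tau> 0 0 0 "norm y" \<theta>] lim_D[of 0 0 \<theta> "(\<tau>, 0)"] by (simp add: infnorm_0 flip: inner_scaleR_right)
qed simp

lemma GDERIV_Linf: "GDERIV Linf \<theta> :> grad \<theta>"
  by (rule GDERIV_of_quadratic_remainder[OF Linf_expansion])

lemma grad_Lipschitz: "norm (grad \<theta>' - grad \<theta>) \<le> 12 * C0 * norm (\<theta>' - \<theta>)"
proof (rule norm_le_of_inner_le)
  fix y
  have "\<bar>grad \<theta>' \<bullet> fst (y, 0 :: 's) - grad \<theta> \<bullet> fst (y, 0 :: 's)\<bar> \<le> 12 * C0 * norm (\<theta>' - \<theta>) * norm (y, 0 :: 's)"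
  proof (rule Lipschitz_of_remainder[where e = "\<lambda>\<theta> s. Linf \<theta>" and E = "\<lambda>\<theta> s q. grad \<theta> \<bullet> fst q" and s = "0 :: 's"])
    fix \<theta> \<tau> :: 'p and h and \<sigma> :: 's assume "norm \<tau> \<le> 1" "0 \<le> (h :: real)"
    then show "\<bar>Linf (\<theta> + h *\<^sub>R \<tau>) - Linf \<theta> - h * (grad \<theta> \<bullet> fst (\<tau>, \<sigma>))\<bar> \<le> C0 * h\<^sup>2"
      using Linf_remainder[of \<tau> 0 0 0 h \<theta>] lim_D[of 0 0 \<theta> "(\<tau>, 0)"] by (simp add: infnorm_0)
  qed (simp_all add: inner_add_right)
  then show "\<bar>(grad \<theta>' - grad \<theta>) \<bullet> y\<bar> \<le> 12 * C0 * norm (\<theta>' - \<theta>) * norm y"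
    by (simp add: inner_diff_left norm_Pair)
qed (use C0 in simp)

definition Kg :: real where "Kg = cD + K1"

lemma Kg: "0 \<le> Kg" using cD K1 by (simp add: Kg_def)

text \<open>The derivative at horizon 0 is bounded by \<open>cD\<close>, and \<open>K1\<close>
  bounds the sum of all later corrections.\<close>

lemma grad_bound: "norm (grad \<theta>) \<le> Kg"
proof (rule norm_le_of_inner_le[OF _ Kg])
  fix y
  have "\<bar>D 0 \<theta> 0 (y, 0) 0 - grad \<theta> \<bullet> y\<bar> \<le> K1 * norm y"
    using D_grad[of 0 0 0 \<theta> "(y, 0)"] by (simp add: infnorm_0 norm_Pair)
  moreover have "\<bar>D 0 \<theta> 0 (y, 0) 0\<bar> \<le> cD * norm y"
    using D_bound[of 0 0 0 \<theta> "(y, 0)"] by (simp add: infnorm_0 norm_Pair)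
  ultimately show "\<bar>grad \<theta> \<bullet> y\<bar> \<le> Kg * norm y" by (simp add: Kg_def algebra_simps)
qed

lemma grad_continuous: "continuous_on UNIV grad"
proof -
  have "(12 * C0)-lipschitz_on UNIV grad"
    by (rule lipschitz_onI) (use grad_Lipschitz C0 in \<open>simp_all add: dist_norm\<close>)
  then show ?thesis by (rule lipschitz_on_continuous_on)
qed

lemma grad_measurable[measurable]: "grad \<in> borel_measurable borel"
  using grad_continuous by (rule borel_measurable_continuous_onI)

end

section \<open>Stochastic gradient descent with forward differentiation\<close>

text \<open>Summation by parts: the boundary terms and the total variation of the decreasing weights
  together amount to at most \<open>2 * \<alpha> 0\<close>.\<close>

lemma Abel_bound:
  fixes \<alpha> x :: "nat \<Rightarrow> real"
  assumes \<alpha>: "\<And>t. 0 \<le> \<alpha> t" "decseq \<alpha>" and x: "\<And>t. \<bar>x t\<bar> \<le> X"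
  shows "(\<Sum>t<n. \<alpha> t * (x t - x (Suc t))) \<le> 2 * \<alpha> 0 * X"
proof -
  \<comment> \<open>The boundary term \<open>\<alpha> n * x n\<close> and the constant
    \<open>2 * \<alpha> 0 - \<alpha> n\<close>, which grows by the variation of the weights, are
    carried along to make the induction close.\<close>
  have "(\<Sum>t<n. \<alpha> t * (x t - x (Suc t))) + \<alpha> n * x n \<le> (2 * \<alpha> 0 - \<alpha> n) * X"
  proof (induction n)
    case 0
    show ?case using mult_left_mono[of "x 0" X "\<alpha> 0"] x[of 0] \<alpha>(1)[of 0] by simp
  next
    case (Suc n)
    have "0 \<le> \<alpha> n - \<alpha> (Suc n)" using decseqD[OF \<alpha>(2), of n "Suc n"] by simp
    then have "(\<alpha> n - \<alpha> (Suc n)) * (- x (Suc n)) \<le> (\<alpha> n - \<alpha> (Suc n)) * X"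
      using x[of "Suc n"] by (intro mult_left_mono) auto
    then show ?case using Suc by (simp add: algebra_simps)
  qed
  moreover have "\<alpha> n * (- x n) \<le> \<alpha> n * X" using x[of n] \<alpha>(1) by (intro mult_left_mono) auto
  ultimately show ?thesis by (simp add: algebra_simps)
qed

context smooth_system
begin

definition dev :: "nat \<Rightarrow> 'p \<Rightarrow> 's \<Rightarrow> 'p \<times> 's \<Rightarrow> 'v \<Rightarrow> real" where
  "dev k \<theta> s q v = D k \<theta> s q v - grad \<theta> \<bullet> fst q"

lemma dev_measurable[measurable (raw)]:
  assumes [measurable]: "f \<in> borel_measurable N" "g \<in> borel_measurable N" "h \<in> borel_measurable N" "j \<in> borel_measurable N"
  shows "(\<lambda>x. dev k (f x) (g x) (h x) (j x)) \<in> borel_measurable N"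
  unfolding dev_def by measurable

lemma dev_bound: "infnorm s \<le> 1 \<Longrightarrow> infnorm v \<le> 1 \<Longrightarrow> \<bar>dev k \<theta> s q v\<bar> \<le> K1 * \<rho> ^ k * norm q"
  unfolding dev_def by (rule D_grad)

lemma dev_perturb:
  assumes s: "infnorm s \<le> 1" and v: "infnorm v \<le> 1"
  shows "\<bar>dev k \<theta> s q v - dev k \<theta>' s q' v\<bar> \<le> K2 * \<rho> ^ k * (norm (\<theta>' - \<theta>) * norm q) + K1 * \<rho> ^ k * norm (q' - q)"
proof -
  have "dev k \<theta>' s q' v = dev k \<theta>' s q v + dev k \<theta>' s (q' - q) v"
    using D_add[of s v k \<theta>' q "q' - q"] s v by (simp add: dev_def inner_diff_right)
  then show ?thesis
    using D_grad_Lipschitz[OF s v, of k \<theta>' q \<theta>] dev_bound[OF s v, of k \<theta>' "q' - q"] unfolding dev_def by linarith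
qed

text \<open>Randomness enters through two identities between expectations,
  \<open>G_expectation\<close> and \<open>Markov\<close>, so that neither filtrations nor
  conditional expectations appear; all bounds are pathwise. \<open>T t \<omega>\<close> is the
  linear map from parameter tangents to memory tangents that the stored sensitivities
  represent.\<close>

theorem stochastic_gradient_convergence:
  fixes M :: "'w measure" and V :: "nat \<Rightarrow> 'w \<Rightarrow> 'v" and th G :: "nat \<Rightarrow> 'w \<Rightarrow> 'p"
    and S :: "nat \<Rightarrow> 'w \<Rightarrow> 's" and T :: "nat \<Rightarrow> 'w \<Rightarrow> 'p \<Rightarrow> 's" and \<alpha> :: "nat \<Rightarrow> real"
  assumes M: "prob_space M"
    and [measurable]: "\<And>t. V t \<in> borel_measurable M" "\<And>t. th t \<in> borel_measurable M"
      "\<And>t. S t \<in> borel_measurable M" "\<And>t. G t \<in> borel_measurable M"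
    and T_measurable: "\<And>t \<tau>. \<tau> \<in> borel_measurable M \<Longrightarrow> (\<lambda>\<omega>. T t \<omega> (\<tau> \<omega>)) \<in> borel_measurable M"
    and V: "\<And>t \<omega>. infnorm (V t \<omega>) \<le> 1" and S: "\<And>t \<omega>. infnorm (S t \<omega>) \<le> 1"
    and T_linear: "\<And>t \<omega>. linear (T t \<omega>)" and T_bound: "\<And>t \<omega> \<tau>. norm (T t \<omega> \<tau>) \<le> CT * norm \<tau>"
    and G: "\<And>t \<omega>. norm (G t \<omega>) \<le> CG"
    and th_Suc: "\<And>t \<omega>. th (Suc t) \<omega> = th t \<omega> - \<alpha> t *\<^sub>R G t \<omega>"
    and S_Suc: "\<And>t \<omega>. S (Suc t) \<omega> = F (th t \<omega>) (V t \<omega>) (S t \<omega>)"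
    and T_Suc: "\<And>t \<omega> \<tau>. T (Suc t) \<omega> \<tau> = F' (th t \<omega>) (V t \<omega>) (S t \<omega>) (\<tau>, T t \<omega> \<tau>)"
    and G_expectation: "\<And>t. (\<integral>\<omega>. grad (th t \<omega>) \<bullet> G t \<omega> \<partial>M) =
      (\<integral>\<omega>. D0 (th t \<omega>) (S t \<omega>) (grad (th t \<omega>), T t \<omega> (grad (th t \<omega>))) (V t \<omega>) \<partial>M)"
    and Markov: "\<And>t k. (\<integral>\<omega>. D k (th t \<omega>) (S (Suc t) \<omega>) (grad (th t \<omega>), T (Suc t) \<omega> (grad (th t \<omega>))) (V (Suc t) \<omega>) \<partial>M) =
      (\<integral>\<omega>. (\<integral>w. D k (th t \<omega>) (S (Suc t) \<omega>) (grad (th t \<omega>), T (Suc t) \<omega> (grad (th t \<omega>))) w \<partial>\<kappa> (V t \<omega>)) \<partial>M)"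
    and \<alpha>: "\<And>t. 0 < \<alpha> t" "decseq \<alpha>" "\<not> summable \<alpha>" "summable (\<lambda>t. (\<alpha> t)\<^sup>2)"
  shows "(\<lambda>t. \<integral>\<omega>. norm (grad (th t \<omega>)) \<partial>M) \<longlonglongrightarrow> 0"
proof -
  interpret prob_space M by (rule M)
  have CT: "0 \<le> CT"
  proof -
    obtain b :: 'p where b: "b \<in> Basis" using nonempty_Basis by blast
    then show ?thesis using order_trans[OF norm_ge_zero T_bound[of 0 undefined b]] by simp
  qed
  have CG: "0 \<le> CG" using order_trans[OF norm_ge_zero G] .
  note C0 [simp] = C0
  define g where "g t \<omega> = grad (th t \<omega>)" for t \<omega>
  \<comment> \<open>\<open>p\<close> lifts the gradient at time \<open>t\<close> to a tangent by the
    sensitivities of time \<open>t\<close>, and \<open>p'\<close> lifts the same gradient by those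
    of time \<open>Suc t\<close>. By \<open>T_Suc\<close>, \<open>p'\<close> is what one step of
    \<open>F'\<close> makes of \<open>p\<close>.\<close>
  define p where "p t \<omega> = (g t \<omega>, T t \<omega> (g t \<omega>))" for t \<omega>
  define p' where "p' t \<omega> = (g t \<omega>, T (Suc t) \<omega> (g t \<omega>))" for t \<omega>
  have gm[measurable]: "g t \<in> borel_measurable M" for t unfolding g_def by measurable
  have pm[measurable]: "p t \<in> borel_measurable M" "p' t \<in> borel_measurable M" for t
    unfolding p_def p'_def using T_measurable[OF gm] by measurable
  have gb: "norm (g t \<omega>) \<le> Kg" for t \<omega> unfolding g_def by (rule grad_bound)
  define Cp where "Cp = (1 + CT) * Kg"
  have Cp: "0 \<le> Cp" using CT Kg by (simp add: Cp_def)
  have pair: "norm (x, T t \<omega> x) \<le> (1 + CT) * norm x" for t \<omega> x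
  proof -
    have "norm (x, T t \<omega> x) \<le> norm x + norm (T t \<omega> x)" by (simp add: norm_Pair sqrt_sum_squares_le_sum)
    then show ?thesis using T_bound[of t \<omega> x] by (simp add: algebra_simps)
  qed
  have pb: "norm (p t \<omega>) \<le> Cp" "norm (p' t \<omega>) \<le> Cp" for t \<omega>
    unfolding p_def p'_def Cp_def
    using pair[of "g t \<omega>" t \<omega>] pair[of "g t \<omega>" "Suc t" \<omega>] mult_left_mono[OF gb[of t \<omega>], of "1 + CT"] CT by linarith+
  have thd: "norm (th (Suc t) \<omega> - th t \<omega>) \<le> \<alpha> t * CG" for t \<omega>
    using mult_left_mono[OF G[of t \<omega>], of "\<alpha> t"] \<alpha>(1)[of t] by (simp add: th_Suc)
  define Lg where "Lg = 12 * C0 * CG"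
  have gd: "norm (g (Suc t) \<omega> - g t \<omega>) \<le> \<alpha> t * Lg" for t \<omega>
  proof -
    have "norm (g (Suc t) \<omega> - g t \<omega>) \<le> 12 * C0 * norm (th (Suc t) \<omega> - th t \<omega>)" unfolding g_def by (rule grad_Lipschitz)
    also have "\<dots> \<le> 12 * C0 * (\<alpha> t * CG)" by (intro mult_left_mono thd) simp
    finally show ?thesis by (simp add: Lg_def ac_simps)
  qed
  have pd: "norm (p (Suc t) \<omega> - p' t \<omega>) \<le> \<alpha> t * ((1 + CT) * Lg)" for t \<omega>
  proof -
    have "p (Suc t) \<omega> - p' t \<omega> = (g (Suc t) \<omega> - g t \<omega>, T (Suc t) \<omega> (g (Suc t) \<omega> - g t \<omega>))"
      by (simp add: p_def p'_def linear_diff[OF T_linear])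
    also have "norm \<dots> \<le> (1 + CT) * norm (g (Suc t) \<omega> - g t \<omega>)" by (rule pair)
    also have "\<dots> \<le> (1 + CT) * (\<alpha> t * Lg)" using CT by (intro mult_left_mono gd) simp
    finally show ?thesis by (simp add: ac_simps)
  qed
  \<comment> \<open>By the Markov property \<open>E (Suc k) t\<close> is the error \<open>E' k t\<close> at horizon \<open>k\<close> and time \<open>Suc t\<close> with the old
    parameters, hence close to \<open>E k (Suc t)\<close>. Telescoping in \<open>k\<close> replaces the solution of a Poisson equation.\<close>
  define E where "E k t = (\<integral>\<omega>. dev k (th t \<omega>) (S t \<omega>) (p t \<omega>) (V t \<omega>) \<partial>M)" for k t
  define E' where "E' k t = (\<integral>\<omega>. dev k (th t \<omega>) (S (Suc t) \<omega>) (p' t \<omega>) (V (Suc t) \<omega>) \<partial>M)" for k t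
  have devb: "\<bar>dev k (th t \<omega>) (S t' \<omega>) q (V t'' \<omega>)\<bar> \<le> K1 * \<rho> ^ k * Cp" if "norm q \<le> Cp" for k t t' t'' \<omega> q
    using order_trans[OF dev_bound[OF S V] mult_left_mono[OF that]] K1 \<rho> by simp
  have int: "integrable M f" if "f \<in> borel_measurable M" "\<And>\<omega>. \<bar>f \<omega>\<bar> \<le> B" for f :: "'w \<Rightarrow> real" and B
    using that by (intro integrable_const_bound[where B = B]) auto
  have abs_le: "\<bar>\<integral>\<omega>. f \<omega> \<partial>M\<bar> \<le> B" if "f \<in> borel_measurable M" "\<And>\<omega>. \<bar>f \<omega>\<bar> \<le> B" for f :: "'w \<Rightarrow> real" and B
  proof -
    have "AE \<omega> in M. f \<omega> \<le> B" "AE \<omega> in M. -B \<le> f \<omega>" using that(2) by (auto simp: abs_le_iff minus_le_iff)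
    then have "(\<integral>\<omega>. f \<omega> \<partial>M) \<le> B" "-B \<le> (\<integral>\<omega>. f \<omega> \<partial>M)"
      using int[OF that] by (auto intro!: integral_le_const integral_ge_const)
    then show ?thesis by simp
  qed
  have int_p: "integrable M (\<lambda>\<omega>. dev k (th t \<omega>) (S t \<omega>) (p t \<omega>) (V t \<omega>))" for k t
    by (rule int[OF _ devb[OF pb(1)]]) measurable
  have int_p': "integrable M (\<lambda>\<omega>. dev k (th t \<omega>) (S (Suc t) \<omega>) (p' t \<omega>) (V (Suc t) \<omega>))" for k t
    by (rule int[OF _ devb[OF pb(2)]]) measurable
  have Eb: "\<bar>E k t\<bar> \<le> K1 * \<rho> ^ k * Cp" for k t
    unfolding E_def by (rule abs_le[OF _ devb[OF pb(1)]]) measurable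
  have inn: "\<bar>g t \<omega> \<bullet> g t \<omega>\<bar> \<le> Kg * Kg" for t \<omega>
    using gb[of t \<omega>] Kg by (intro order_trans[OF Cauchy_Schwarz_ineq2] mult_mono) auto
  have int_gg: "integrable M (\<lambda>\<omega>. g t \<omega> \<bullet> g t \<omega>)" for t
    by (rule int[OF _ inn]) measurable
  \<comment> \<open>The Markov property and the recursion for \<open>D (Suc k)\<close> match the
    expectations of the derivatives; the squared gradient that separates these from
    \<open>dev\<close> is the same on both sides and drops out.\<close>
  have E'_eq: "E' k t = E (Suc k) t" for k t
  proof -
    have 1: "D k (th t \<omega>) (S (Suc t) \<omega>) (p' t \<omega>) (V (Suc t) \<omega>)
        = dev k (th t \<omega>) (S (Suc t) \<omega>) (p' t \<omega>) (V (Suc t) \<omega>) + g t \<omega> \<bullet> g t \<omega>" for \<omega>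
      by (simp add: dev_def p'_def g_def)
    have 2: "D (Suc k) (th t \<omega>) (S t \<omega>) (p t \<omega>) (V t \<omega>)
        = dev (Suc k) (th t \<omega>) (S t \<omega>) (p t \<omega>) (V t \<omega>) + g t \<omega> \<bullet> g t \<omega>" for \<omega>
      by (simp add: dev_def p_def g_def)
    have "E' k t + (\<integral>\<omega>. g t \<omega> \<bullet> g t \<omega> \<partial>M) = (\<integral>\<omega>. D k (th t \<omega>) (S (Suc t) \<omega>) (p' t \<omega>) (V (Suc t) \<omega>) \<partial>M)"
      unfolding 1 E'_def using int_p' int_gg by simp
    also have "\<dots> = (\<integral>\<omega>. D (Suc k) (th t \<omega>) (S t \<omega>) (p t \<omega>) (V t \<omega>) \<partial>M)"
      using Markov[where k = k and t = t] unfolding p'_def p_def g_def D.simps fst_conv S_Suc T_Suc .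
    also have "\<dots> = E (Suc k) t + (\<integral>\<omega>. g t \<omega> \<bullet> g t \<omega> \<partial>M)"
      unfolding 2 E_def using int_p int_gg by simp
    finally show ?thesis by simp
  qed
  \<comment> \<open>The step of size \<open>\<alpha> t * CG\<close> enters twice: through the
    Lipschitz constant of \<open>dev k\<close> in the parameters, and through the new gradient
    inside the tangent.\<close>
  define c1 where "c1 = CG * Cp * K2 + (1 + CT) * Lg * K1"
  have c1: "0 \<le> c1" using CG Cp K1 K2 CT by (simp add: c1_def Lg_def)
  have E'_E: "\<bar>E' k t - E k (Suc t)\<bar> \<le> c1 * \<rho> ^ k * \<alpha> t" for k t
  proof -
    have "E' k t - E k (Suc t) = (\<integral>\<omega>. dev k (th t \<omega>) (S (Suc t) \<omega>) (p' t \<omega>) (V (Suc t) \<omega>)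
        - dev k (th (Suc t) \<omega>) (S (Suc t) \<omega>) (p (Suc t) \<omega>) (V (Suc t) \<omega>) \<partial>M)"
      unfolding E'_def E_def using int_p int_p' by simp
    also have "\<bar>\<dots>\<bar> \<le> c1 * \<rho> ^ k * \<alpha> t"
    proof (rule abs_le)
      fix \<omega>
      have "\<bar>dev k (th t \<omega>) (S (Suc t) \<omega>) (p' t \<omega>) (V (Suc t) \<omega>)
        - dev k (th (Suc t) \<omega>) (S (Suc t) \<omega>) (p (Suc t) \<omega>) (V (Suc t) \<omega>)\<bar>
        \<le> K2 * \<rho> ^ k * (norm (th (Suc t) \<omega> - th t \<omega>) * norm (p' t \<omega>)) + K1 * \<rho> ^ k * norm (p (Suc t) \<omega> - p' t \<omega>)"
        by (rule dev_perturb[OF S V])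
      also have "\<dots> \<le> K2 * \<rho> ^ k * (\<alpha> t * CG * Cp) + K1 * \<rho> ^ k * (\<alpha> t * ((1 + CT) * Lg))"
        using K1 K2 \<rho> \<alpha>(1)[of t] CG by (intro add_mono mult_left_mono mult_mono thd pd pb) auto
      also have "\<dots> = c1 * \<rho> ^ k * \<alpha> t" by (simp add: c1_def algebra_simps)
      finally show "\<bar>dev k (th t \<omega>) (S (Suc t) \<omega>) (p' t \<omega>) (V (Suc t) \<omega>)
        - dev k (th (Suc t) \<omega>) (S (Suc t) \<omega>) (p (Suc t) \<omega>) (V (Suc t) \<omega>)\<bar> \<le> c1 * \<rho> ^ k * \<alpha> t" .
    qed measurable
    finally show ?thesis .
  qed
  define A2 where "A2 = (\<Sum>t. (\<alpha> t)\<^sup>2)"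
  have A2: "(\<Sum>t<n. (\<alpha> t)\<^sup>2) \<le> A2" for n unfolding A2_def using \<alpha>(4) by (intro sum_le_suminf) auto
  have \<alpha>0: "0 \<le> \<alpha> t" for t using \<alpha>(1)[of t] by simp
  define R where "R k n = - (\<Sum>t<n. \<alpha> t * E k t)" for k n
  define c2 where "c2 = 2 * \<alpha> 0 * (K1 * Cp) + c1 * A2"
  \<comment> \<open>\<open>R k n\<close> is minus the accumulated bias at horizon \<open>k\<close>.
    Raising the horizon replaces \<open>E k t\<close> by \<open>E k (Suc t)\<close> up to
    \<open>O(\<alpha> t)\<close>; the shift in time costs only the boundary terms of
    \<open>Abel_bound\<close>.\<close>
  have step: "R k n \<le> R (Suc k) n + c2 * \<rho> ^ k" for k n
  proof -
    have "R k n - R (Suc k) n = (\<Sum>t<n. \<alpha> t * (E (Suc k) t - E k t))"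
      by (simp add: R_def right_diff_distrib sum_subtractf)
    also have "\<dots> \<le> (\<Sum>t<n. \<alpha> t * (- E k t - - E k (Suc t)) + c1 * \<rho> ^ k * (\<alpha> t)\<^sup>2)"
    proof (rule sum_mono)
      fix t
      have "\<alpha> t * (E (Suc k) t - E k (Suc t)) \<le> \<alpha> t * (c1 * \<rho> ^ k * \<alpha> t)"
        using E'_E[of k t] \<alpha>0 unfolding E'_eq by (intro mult_left_mono) auto
      then show "\<alpha> t * (E (Suc k) t - E k t) \<le> \<alpha> t * (- E k t - - E k (Suc t)) + c1 * \<rho> ^ k * (\<alpha> t)\<^sup>2"
        by (simp add: algebra_simps power2_eq_square)
    qed
    also have "\<dots> = (\<Sum>t<n. \<alpha> t * (- E k t - - E k (Suc t))) + c1 * \<rho> ^ k * (\<Sum>t<n. (\<alpha> t)\<^sup>2)"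
      by (simp only: sum.distrib sum_distrib_left)
    also have "\<dots> \<le> 2 * \<alpha> 0 * (K1 * \<rho> ^ k * Cp) + c1 * \<rho> ^ k * A2"
      using Abel_bound[OF \<alpha>0 \<alpha>(2), of "\<lambda>t. - E k t" "K1 * \<rho> ^ k * Cp" n] Eb A2[of n] c1 \<rho>
      by (intro add_mono mult_left_mono) auto
    also have "\<dots> = c2 * \<rho> ^ k" by (simp add: c2_def algebra_simps)
    finally show ?thesis by simp
  qed
  have c2: "0 \<le> c2" using K1 Cp c1 A2[of 0] \<alpha>0 by (simp add: c2_def)
  have Rk: "R 0 n \<le> R k n + c2 / (1 - \<rho>) * (1 - \<rho> ^ k)" for k n
  proof (induction k)
    case (Suc k)
    have "c2 / (1 - \<rho>) * (1 - \<rho> ^ Suc k) = c2 / (1 - \<rho>) * (1 - \<rho> ^ k) + c2 * \<rho> ^ k"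
      using \<rho> by (simp add: divide_simps) (simp add: algebra_simps)
    then show ?case using Suc step[of k n] by linarith
  qed simp
  \<comment> \<open>For fixed \<open>n\<close> the crude bound on \<open>R k n\<close> tends to 0 as
    \<open>k\<close> grows, however large the sum of the step sizes; what remains is the geometric
    sum of the costs, which is independent of \<open>n\<close>.\<close>
  have R0: "R 0 n \<le> c2 / (1 - \<rho>)" for n
  proof -
    have le: "R 0 n \<le> (\<Sum>t<n. \<alpha> t) * (K1 * Cp) * \<rho> ^ k + c2 / (1 - \<rho>)" for k
    proof -
      have "R k n \<le> (\<Sum>t<n. \<alpha> t * (K1 * \<rho> ^ k * Cp))"
        unfolding R_def sum_negf[symmetric]
      proof (rule sum_mono)
        fix t
        have "\<alpha> t * (- E k t) \<le> \<alpha> t * (K1 * \<rho> ^ k * Cp)" using Eb[of k t] \<alpha>0 by (intro mult_left_mono) auto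
        then show "- (\<alpha> t * E k t) \<le> \<alpha> t * (K1 * \<rho> ^ k * Cp)" by simp
      qed
      also have "\<dots> = (\<Sum>t<n. \<alpha> t) * (K1 * Cp) * \<rho> ^ k"
        unfolding sum_distrib_right by (intro sum.cong) (simp_all add: ac_simps)
      finally have "R k n \<le> \<dots>" .
      moreover have "c2 / (1 - \<rho>) * (1 - \<rho> ^ k) \<le> c2 / (1 - \<rho>) * 1"
        using c2 \<rho> by (intro mult_left_mono) auto
      ultimately show ?thesis using Rk[of n k] by simp
    qed
    have "(\<lambda>k. (\<Sum>t<n. \<alpha> t) * (K1 * Cp) * \<rho> ^ k + c2 / (1 - \<rho>)) \<longlonglongrightarrow> (\<Sum>t<n. \<alpha> t) * (K1 * Cp) * 0 + c2 / (1 - \<rho>)"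
      using \<rho> by (intro tendsto_intros LIMSEQ_power_zero) auto
    then have "R 0 n \<le> (\<Sum>t<n. \<alpha> t) * (K1 * Cp) * 0 + c2 / (1 - \<rho>)"
      by (rule LIMSEQ_le_const) (use le in blast)
    then show ?thesis by simp
  qed
  define a where "a t = (\<integral>\<omega>. g t \<omega> \<bullet> g t \<omega> \<partial>M)" for t
  define EL where "EL t = (\<integral>\<omega>. Linf (th t \<omega>) \<partial>M)" for t
  have Linf_m[measurable]: "Linf \<in> borel_measurable borel"
  proof (rule borel_measurable_continuous_onI)
    have "isCont Linf x" for x
      using GDERIV_Linf[of x] unfolding gderiv_def by (rule has_derivative_continuous)
    then show "continuous_on UNIV Linf" by (simp add: continuous_at_imp_continuous_on)
  qed
  have int_L: "integrable M (\<lambda>\<omega>. Linf (th t \<omega>))" for t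
    by (rule int[OF _ Linf_bound]) measurable
  have ELb: "\<bar>EL t\<bar> \<le> Bl" for t unfolding EL_def by (rule abs_le[OF _ Linf_bound]) measurable
  have gG: "\<bar>g t \<omega> \<bullet> G t \<omega>\<bar> \<le> Kg * CG" for t \<omega>
    using gb[of t \<omega>] G[of t \<omega>] Kg by (intro order_trans[OF Cauchy_Schwarz_ineq2] mult_mono) auto
  have int_gG: "integrable M (\<lambda>\<omega>. g t \<omega> \<bullet> G t \<omega>)" for t by (rule int[OF _ gG]) measurable
  have EgG: "(\<integral>\<omega>. g t \<omega> \<bullet> G t \<omega> \<partial>M) = a t + E 0 t" for t
  proof -
    have 1: "D0 (th t \<omega>) (S t \<omega>) (p t \<omega>) (V t \<omega>) = dev 0 (th t \<omega>) (S t \<omega>) (p t \<omega>) (V t \<omega>) + g t \<omega> \<bullet> g t \<omega>" for \<omega>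
      by (simp add: dev_def p_def g_def)
    have "(\<integral>\<omega>. g t \<omega> \<bullet> G t \<omega> \<partial>M) = (\<integral>\<omega>. D0 (th t \<omega>) (S t \<omega>) (p t \<omega>) (V t \<omega>) \<partial>M)"
      using G_expectation[of t] unfolding g_def p_def .
    also have "\<dots> = a t + E 0 t" unfolding 1 a_def E_def using int_p int_gg by simp
    finally show ?thesis .
  qed
  \<comment> \<open>The quadratic expansion read as a descent estimate: in expectation the update
    correlates with the gradient by its mean square \<open>a t\<close> plus the bias
    \<open>E 0 t\<close>.\<close>
  have descent: "EL (Suc t) \<le> EL t - \<alpha> t * (a t + E 0 t) + C0 * CG\<^sup>2 * (\<alpha> t)\<^sup>2" for t
  proof -
    have pt: "Linf (th (Suc t) \<omega>) \<le> Linf (th t \<omega>) - \<alpha> t * (g t \<omega> \<bullet> G t \<omega>) + C0 * CG\<^sup>2 * (\<alpha> t)\<^sup>2" for \<omega>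
    proof -
      have "\<bar>Linf (th (Suc t) \<omega>) - Linf (th t \<omega>) + \<alpha> t * (g t \<omega> \<bullet> G t \<omega>)\<bar> \<le> C0 * (norm (\<alpha> t *\<^sub>R G t \<omega>))\<^sup>2"
        using Linf_expansion[of "th t \<omega>" "- (\<alpha> t *\<^sub>R G t \<omega>)"] by (simp add: th_Suc g_def)
      also have "\<dots> \<le> C0 * (\<alpha> t * CG)\<^sup>2"
        using G[of t \<omega>] \<alpha>0[of t] by (intro mult_left_mono power_mono) (auto intro: mult_left_mono)
      finally show ?thesis by (simp add: power_mult_distrib algebra_simps)
    qed
    have "EL (Suc t) \<le> (\<integral>\<omega>. Linf (th t \<omega>) - \<alpha> t * (g t \<omega> \<bullet> G t \<omega>) + C0 * CG\<^sup>2 * (\<alpha> t)\<^sup>2 \<partial>M)"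
      unfolding EL_def by (rule integral_mono) (use int_L int_gG pt in auto)
    also have "\<dots> = EL t - \<alpha> t * (a t + E 0 t) + C0 * CG\<^sup>2 * (\<alpha> t)\<^sup>2"
      using int_L int_gG prob_space by (simp add: EL_def EgG)
    finally show ?thesis .
  qed
  have part: "(\<Sum>t<n. \<alpha> t * a t) \<le> 2 * Bl + C0 * CG\<^sup>2 * A2 + c2 / (1 - \<rho>)" for n
  proof -
    have "EL n + (\<Sum>t<n. \<alpha> t * a t) \<le> EL 0 + R 0 n + C0 * CG\<^sup>2 * (\<Sum>t<n. (\<alpha> t)\<^sup>2)"
    proof (induction n)
      case (Suc n)
      then show ?case using descent[of n] by (simp add: R_def algebra_simps)
    qed (simp add: R_def)
    moreover have "C0 * CG\<^sup>2 * (\<Sum>t<n. (\<alpha> t)\<^sup>2) \<le> C0 * CG\<^sup>2 * A2" using A2[of n] by (intro mult_left_mono) auto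
    ultimately show ?thesis using R0[of n] ELb[of n] ELb[of 0] by linarith
  qed
  have a0: "0 \<le> a t" for t unfolding a_def by (intro integral_nonneg_AE) auto
  have summ: "summable (\<lambda>t. \<alpha> t * a t)"
    by (rule bounded_imp_summable[where B = "2 * Bl + C0 * CG\<^sup>2 * A2 + c2 / (1 - \<rho>)"])
      (use part[of "Suc _"] a0 \<alpha>0 in \<open>auto simp: lessThan_Suc_atMost\<close>)
  have "(\<lambda>t. sqrt ((\<alpha> t)\<^sup>2)) \<longlonglongrightarrow> sqrt 0" by (intro tendsto_intros summable_LIMSEQ_zero \<alpha>)
  then have \<alpha>lim: "\<alpha> \<longlonglongrightarrow> 0" using \<alpha>0 by simp
  \<comment> \<open>Gradients are bounded and Lipschitz, hence their mean square varies slowly, as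
    the final summability argument requires.\<close>
  have inc: "a (Suc t) \<le> a t + (2 * Kg * Lg) * \<alpha> t" for t
  proof -
    have pt: "g (Suc t) \<omega> \<bullet> g (Suc t) \<omega> \<le> g t \<omega> \<bullet> g t \<omega> + (2 * Kg * Lg) * \<alpha> t" for \<omega>
    proof -
      have "g (Suc t) \<omega> \<bullet> g (Suc t) \<omega> - g t \<omega> \<bullet> g t \<omega> = (g (Suc t) \<omega> + g t \<omega>) \<bullet> (g (Suc t) \<omega> - g t \<omega>)"
        by (simp add: algebra_simps inner_commute)
      also have "\<dots> \<le> norm (g (Suc t) \<omega> + g t \<omega>) * norm (g (Suc t) \<omega> - g t \<omega>)" by (rule norm_cauchy_schwarz)
      also have "\<dots> \<le> (2 * Kg) * (\<alpha> t * Lg)"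
        using gd gb[of t \<omega>] gb[of "Suc t" \<omega>] norm_triangle_ineq[of "g (Suc t) \<omega>" "g t \<omega>"] Kg by (intro mult_mono) auto
      finally show ?thesis by (simp add: algebra_simps)
    qed
    have "a (Suc t) \<le> (\<integral>\<omega>. g t \<omega> \<bullet> g t \<omega> + (2 * Kg * Lg) * \<alpha> t \<partial>M)"
      unfolding a_def by (rule integral_mono) (use int_gg pt in auto)
    then show ?thesis using int_gg prob_space by (simp add: a_def)
  qed
  have "0 \<le> 2 * Kg * Lg" using Kg CG by (simp add: Lg_def)
  then have alim: "a \<longlonglongrightarrow> 0"
    by (rule tendsto_zero_of_weighted_summable[OF \<alpha>(1,3) \<alpha>lim a0 inc _ summ])
  have int_g: "integrable M (\<lambda>\<omega>. norm (g t \<omega>))" for t by (rule int[of _ Kg]) (use gb in auto)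
  \<comment> \<open>Jensen's inequality, obtained from the nonnegativity of the variance.\<close>
  have le: "(\<integral>\<omega>. norm (g t \<omega>) \<partial>M) \<le> sqrt (a t)" for t
  proof (rule real_le_rsqrt)
    have "0 \<le> variance (\<lambda>\<omega>. norm (g t \<omega>))" by (rule variance_positive)
    also have "\<dots> = a t - (\<integral>\<omega>. norm (g t \<omega>) \<partial>M)\<^sup>2"
      using int_g int_gg by (subst variance_eq) (auto simp: power2_norm_eq_inner a_def)
    finally show "(\<integral>\<omega>. norm (g t \<omega>) \<partial>M)\<^sup>2 \<le> a t" by simp
  qed
  have "(\<lambda>t. \<integral>\<omega>. norm (g t \<omega>) \<partial>M) \<longlonglongrightarrow> 0"
  proof (rule tendsto_sandwich[OF _ _ tendsto_const])
    show "(\<lambda>t. sqrt (a t)) \<longlonglongrightarrow> 0" using tendsto_real_sqrt[OF alim] by simp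
  qed (use le in \<open>auto intro!: always_eventually\<close>)
  then show ?thesis by (simp add: g_def)
qed

end

section \<open>Regularity of the network\<close>

lemma infnorm_le:
  fixes x :: "'a::euclidean_space"
  assumes "\<And>b. b \<in> Basis \<Longrightarrow> \<bar>x \<bullet> b\<bar> \<le> c"
  shows "infnorm x \<le> c"
  unfolding infnorm_Max using assms by (subst Max_le_iff) auto

lemma infnorm_vec_le:
  fixes x :: "real ^ 'n"
  assumes "\<And>k. \<bar>x $ k\<bar> \<le> c"
  shows "infnorm x \<le> c"
  by (rule infnorm_le) (use assms in \<open>auto simp: Basis_vec_def inner_axis\<close>)

lemma infnorm_fst_le: "infnorm (fst v) \<le> infnorm v" for v :: "'a::euclidean_space \<times> 'b::euclidean_space"
proof (rule infnorm_le)
  fix b :: 'a assume "b \<in> Basis"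
  then have "(b, 0) \<in> (Basis :: ('a \<times> 'b) set)" by (simp add: Basis_prod_def)
  from Basis_le_infnorm[OF this, of v] show "\<bar>fst v \<bullet> b\<bar> \<le> infnorm v" by (simp add: inner_prod_def)
qed

lemma infnorm_snd_le: "infnorm (snd v) \<le> infnorm v" for v :: "'a::euclidean_space \<times> 'b::euclidean_space"
proof (rule infnorm_le)
  fix b :: 'b assume "b \<in> Basis"
  then have "(0, b) \<in> (Basis :: ('a \<times> 'b) set)" by (simp add: Basis_prod_def)
  from Basis_le_infnorm[OF this, of v] show "\<bar>snd v \<bullet> b\<bar> \<le> infnorm v" by (simp add: inner_prod_def)
qed

lemma infnorm_Pair: "infnorm (x, y) = max (infnorm x) (infnorm y)" for x :: "'a::euclidean_space" and y :: "'b::euclidean_space"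
proof (rule antisym)
  show "infnorm (x, y) \<le> max (infnorm x) (infnorm y)"
    by (rule infnorm_le) (auto simp: Basis_prod_def inner_prod_def le_max_iff_disj Basis_le_infnorm)
  show "max (infnorm x) (infnorm y) \<le> infnorm (x, y)"
    using infnorm_fst_le[of "(x, y)"] infnorm_snd_le[of "(x, y)"] by simp
qed

lemma smooth_bounded_DERIV:
  assumes "smooth_bounded g"
  shows "((deriv ^^ k) g has_real_derivative (deriv ^^ Suc k) g x) (at x)"
  using assms unfolding smooth_bounded_def by (simp add: field_differentiable_derivI)

lemma smooth_bounded_C3:
  assumes g: "smooth_bounded g" and C: "\<And>y. \<bar>g y\<bar> \<le> C"
  obtains P1 P2 P3 where "C3_bdd C P1 P2 P3 g" "\<And>y. \<bar>deriv g y\<bar> \<le> P1"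
proof -
  have "\<exists>P. \<forall>y. \<bar>(deriv ^^ k) g y\<bar> \<le> P" for k
    using g unfolding smooth_bounded_def bounded_iff by auto
  then obtain P where P: "\<And>k y. \<bar>(deriv ^^ k) g y\<bar> \<le> P k" by metis
  show ?thesis
  proof
    show "C3_bdd C (P 1) (P 2) (P 3) g" unfolding C3_bdd_def
      using smooth_bounded_DERIV[OF g, of 0] smooth_bounded_DERIV[OF g, of 1] smooth_bounded_DERIV[OF g, of 2]
        P[of 1] P[of 2] P[of 3] C
      by (intro exI[of _ "(deriv ^^ 1) g"] exI[of _ "(deriv ^^ 2) g"] exI[of _ "(deriv ^^ 3) g"])
        (auto simp: numeral_2_eq_2 numeral_3_eq_3)
    show "\<bar>deriv g y\<bar> \<le> P 1" for y using P[of 1 y] by simp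
  qed
qed

lemma smooth_bounded_DERIV1: "smooth_bounded g \<Longrightarrow> (g has_real_derivative deriv g x) (at x)"
  using smooth_bounded_DERIV[of g 0 x] by simp

lemma smooth_bounded_continuous:
  assumes "smooth_bounded g"
  shows "continuous_on UNIV g" "continuous_on UNIV (deriv g)"
  using smooth_bounded_DERIV[OF assms, of 0] smooth_bounded_DERIV[OF assms, of 1]
  by (auto intro!: continuous_at_imp_continuous_on DERIV_isCont)

lemma sigmoid_bounds: "0 < sigmoid y" "sigmoid y < 1"
  by (auto simp: sigmoid_def divide_simps add_pos_pos)

lemma sigmoid_DERIV: "(sigmoid has_real_derivative sigmoid y * (1 - sigmoid y)) (at y)"
proof -
  have "0 < 1 + exp (- y)" by (simp add: add_pos_pos)
  then show ?thesis unfolding sigmoid_def[abs_def]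
    by (auto intro!: derivative_eq_intros simp: divide_simps power2_eq_square)
qed

lemma deriv_sigmoid: "deriv sigmoid y = sigmoid y * (1 - sigmoid y)"
  by (rule DERIV_imp_deriv[OF sigmoid_DERIV])

lemma sigmoid_continuous: "continuous_on UNIV sigmoid"
  by (auto intro!: continuous_at_imp_continuous_on DERIV_isCont[OF sigmoid_DERIV])

lemma sigmoid_product_le: "sigmoid y * (1 - sigmoid y) \<le> 1 / 4"
  using zero_le_power2[of "sigmoid y - 1 / 2"] by (simp add: power2_eq_square algebra_simps)

lemma deriv_sigmoid_bound: "0 \<le> deriv sigmoid y" "deriv sigmoid y \<le> 1 / 4"
  using sigmoid_bounds[of y] sigmoid_product_le[of y] by (auto simp: deriv_sigmoid)

text \<open>All derivatives are polynomials in the sigmoid itself. The bound \<open>1 / 4\<close> on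
  the first is kept sharp, since it is played against \<open>C < 4\<close>; the higher ones are
  rounded up to 1.\<close>

lemma sigmoid_C3: "C3_bdd 1 (1 / 4) 1 1 sigmoid"
  unfolding C3_bdd_def
proof (intro exI allI conjI)
  fix r :: real
  let ?s = "sigmoid r"
  let ?g1 = "\<lambda>r. sigmoid r * (1 - sigmoid r)"
  let ?g2 = "\<lambda>r. ?g1 r * (1 - 2 * sigmoid r)"
  let ?g3 = "\<lambda>r. ?g2 r * (1 - 2 * sigmoid r) - 2 * (?g1 r * ?g1 r)"
  show "(sigmoid has_real_derivative ?g1 r) (at r)" by (rule sigmoid_DERIV)
  show d1: "(?g1 has_real_derivative ?g2 r) (at r)"
    by (auto intro!: derivative_eq_intros sigmoid_DERIV simp: algebra_simps)
  show "(?g2 has_real_derivative ?g3 r) (at r)"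
    by (auto intro!: derivative_eq_intros sigmoid_DERIV simp: algebra_simps)
  have s: "0 < ?s" "?s < 1" by (rule sigmoid_bounds)+
  have g1: "0 \<le> ?g1 r" "?g1 r \<le> 1 / 4" using s sigmoid_product_le[of r] by auto
  have t: "\<bar>1 - 2 * ?s\<bar> \<le> 1" using s by auto
  show "\<bar>?s\<bar> \<le> 1" using s by simp
  show "\<bar>?g1 r\<bar> \<le> 1 / 4" using g1 by simp
  have g1a: "\<bar>?g1 r\<bar> \<le> 1 / 4" using g1 by simp
  have g2: "\<bar>?g2 r\<bar> \<le> 1 / 4 * 1" by (rule abs_mult_le[OF g1a t])
  then show "\<bar>?g2 r\<bar> \<le> 1" by simp
  have 3: "\<bar>?g2 r * (1 - 2 * ?s)\<bar> \<le> 1 / 4 * 1 * 1" by (rule abs_mult_le[OF g2 t])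
  have 4: "\<bar>?g1 r * ?g1 r\<bar> \<le> 1 / 4 * (1 / 4)" by (rule abs_mult_le[OF g1a g1a])
  have "\<bar>?g3 r\<bar> \<le> \<bar>?g2 r * (1 - 2 * ?s)\<bar> + 2 * \<bar>?g1 r * ?g1 r\<bar>"
    using abs_triangle_ineq4[of "?g2 r * (1 - 2 * ?s)" "2 * (?g1 r * ?g1 r)"] by (simp add: abs_mult)
  then show "\<bar>?g3 r\<bar> \<le> 1" using 3 4 by linarith
qed

lemma sigmoid_Lipschitz: "\<bar>sigmoid x - sigmoid y\<bar> \<le> 1 / 4 * \<bar>x - y\<bar>"
proof -
  have "norm (sigmoid x - sigmoid y) \<le> 1 / 4 * norm (x - y)"
  proof (rule field_differentiable_bound[where S = UNIV])
    show "(sigmoid has_field_derivative sigmoid z * (1 - sigmoid z)) (at z within UNIV)" for z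
      using sigmoid_DERIV by simp
    show "norm (sigmoid z * (1 - sigmoid z)) \<le> 1 / 4" for z
      using deriv_sigmoid_bound[of z] by (simp add: deriv_sigmoid)
  qed auto
  then show ?thesis by simp
qed

lemma average_le:
  assumes "\<And>i. \<bar>f i\<bar> \<le> c"
  shows "\<bar>1 / real CARD('i::finite) * (\<Sum>i::'i\<in>UNIV. f i)\<bar> \<le> c"
proof -
  have "\<bar>\<Sum>i::'i\<in>UNIV. f i\<bar> \<le> (\<Sum>i::'i\<in>UNIV. \<bar>f i\<bar>)" by (rule sum_abs)
  also have "\<dots> \<le> of_nat CARD('i) * c" by (rule sum_bounded_above) (use assms in auto)
  finally show ?thesis by (simp add: abs_mult divide_simps mult.commute)
qed

lemma average_has_real_derivative:
  assumes "\<And>i. (f i has_real_derivative f' i) (at x)"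
  shows "((\<lambda>r. 1 / real CARD('i::finite) * (\<Sum>i::'i\<in>UNIV. f i r)) has_real_derivative
    1 / real CARD('i) * (\<Sum>i::'i\<in>UNIV. f' i)) (at x)"
  by (intro DERIV_cmult DERIV_sum assms)

section \<open>The network step, its output and their differentials\<close>

definition weights_A :: "('d::finite, 'n::finite) params \<Rightarrow> real ^ 'd ^ 'n" where "weights_A \<theta> = fst \<theta>"
definition weights_W :: "('d::finite, 'n::finite) params \<Rightarrow> real ^ 'n ^ 'n" where "weights_W \<theta> = fst (snd \<theta>)"
definition weights_B :: "('d::finite, 'n::finite) params \<Rightarrow> real ^ 'n" where "weights_B \<theta> = fst (snd (snd \<theta>))"
definition bias :: "('d::finite, 'n::finite) params \<Rightarrow> real" where "bias \<theta> = snd (snd (snd \<theta>))"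

lemmas weights_defs = weights_A_def weights_W_def weights_B_def bias_def

lemma weights_Pair [simp]:
  "weights_A (A, W, B, c) = A" "weights_W (A, W, B, c) = W" "weights_B (A, W, B, c) = B" "bias (A, W, B, c) = c"
  by (simp_all add: weights_defs)

lemma weights_linear [simp]:
  "weights_A (\<theta> + \<tau>) = weights_A \<theta> + weights_A \<tau>" "weights_W (\<theta> + \<tau>) = weights_W \<theta> + weights_W \<tau>"
  "weights_B (\<theta> + \<tau>) = weights_B \<theta> + weights_B \<tau>" "bias (\<theta> + \<tau>) = bias \<theta> + bias \<tau>"
  "weights_A (r *\<^sub>R \<theta>) = r *\<^sub>R weights_A \<theta>" "weights_W (r *\<^sub>R \<theta>) = r *\<^sub>R weights_W \<theta>"
  "weights_B (r *\<^sub>R \<theta>) = r *\<^sub>R weights_B \<theta>" "bias (r *\<^sub>R \<theta>) = r * bias \<theta>"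
  by (simp_all add: weights_defs)

lemma weights_le_norm:
  "\<bar>weights_A \<theta> $ i $ j\<bar> \<le> norm \<theta>" "\<bar>weights_W \<theta> $ i $ k\<bar> \<le> norm \<theta>" "\<bar>weights_B \<theta> $ i\<bar> \<le> norm \<theta>" "\<bar>bias \<theta>\<bar> \<le> norm \<theta>"
proof -
  obtain A W B c where [simp]: "\<theta> = (A, W, B, c)" by (cases \<theta>)
  have 1: "norm A \<le> norm \<theta>" "norm (W, B, c) \<le> norm \<theta>" using norm_fst_le[of A "(W, B, c)"] norm_snd_le[of "(W, B, c)" A] by auto
  have 2: "norm W \<le> norm \<theta>" "norm (B, c) \<le> norm \<theta>"
    using norm_fst_le[of W "(B, c)"] norm_snd_le[of "(B, c)" W] 1 by auto
  have 3: "norm B \<le> norm \<theta>" "norm c \<le> norm \<theta>"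
    using norm_fst_le[of B c] norm_snd_le[of c B] 2 by auto
  have "\<bar>A $ i $ j\<bar> \<le> norm (A $ i)" "norm (A $ i) \<le> norm A" by (rule component_le_norm_cart, rule Finite_Cartesian_Product.norm_nth_le)
  then show "\<bar>weights_A \<theta> $ i $ j\<bar> \<le> norm \<theta>" using 1 by simp
  have "\<bar>W $ i $ k\<bar> \<le> norm (W $ i)" "norm (W $ i) \<le> norm W" by (rule component_le_norm_cart, rule Finite_Cartesian_Product.norm_nth_le)
  then show "\<bar>weights_W \<theta> $ i $ k\<bar> \<le> norm \<theta>" using 2 by simp
  have "\<bar>B $ i\<bar> \<le> norm B" by (rule component_le_norm_cart)
  then show "\<bar>weights_B \<theta> $ i\<bar> \<le> norm \<theta>" using 3 by simp
  show "\<bar>bias \<theta>\<bar> \<le> norm \<theta>" using 3 by simp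
qed

definition net_pre :: "(real \<Rightarrow> real) \<Rightarrow> ('d::finite, 'n::finite) params \<Rightarrow> real ^ 'd \<Rightarrow> real ^ 'n \<Rightarrow> 'n \<Rightarrow> real" where
  "net_pre \<phi> \<theta> x s k = 1 / real CARD('d) * (\<Sum>j\<in>UNIV. \<phi> (weights_A \<theta> $ k $ j) * x $ j)
     + 1 / real CARD('n) * (\<Sum>l\<in>UNIV. \<phi> (weights_W \<theta> $ k $ l) * s $ l)"

lemma preactivation_nth: "preactivation \<phi> (weights_A \<theta>) (weights_W \<theta>) x s $ k = net_pre \<phi> \<theta> x s k"
  by (simp add: preactivation_def net_pre_def entrywise_def inner_vec_def)

lemma rnn_step_nth: "rnn_step \<phi> \<theta> x s $ k = sigmoid (net_pre \<phi> \<theta> x s k)"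
proof -
  obtain A W B c where \<theta>: "\<theta> = (A, W, B, c)" by (cases \<theta>)
  show ?thesis using preactivation_nth[of \<phi> \<theta> x s k] by (simp add: \<theta> rnn_step_def entrywise_def)
qed

text \<open>The differential of \<open>net_pre\<close> in parameters and memory jointly:
  \<open>fst q\<close> is the direction of the parameters, \<open>snd q\<close> that of the
  memory.\<close>

definition net_pre_tangent ::
  "(real \<Rightarrow> real) \<Rightarrow> ('d::finite, 'n::finite) params \<Rightarrow> real ^ 'd \<Rightarrow> real ^ 'n \<Rightarrow> ('d, 'n) params \<times> (real ^ 'n) \<Rightarrow> 'n \<Rightarrow> real" where
  "net_pre_tangent \<phi> \<theta> x s q k =
     1 / real CARD('d) * (\<Sum>j\<in>UNIV. deriv \<phi> (weights_A \<theta> $ k $ j) * weights_A (fst q) $ k $ j * x $ j)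
     + 1 / real CARD('n) * (\<Sum>l\<in>UNIV. deriv \<phi> (weights_W \<theta> $ k $ l) * weights_W (fst q) $ k $ l * s $ l
         + \<phi> (weights_W \<theta> $ k $ l) * snd q $ l)"

definition rnn_tangent ::
  "(real \<Rightarrow> real) \<Rightarrow> ('d::finite, 'n::finite) params \<Rightarrow> real ^ 'd \<Rightarrow> real ^ 'n \<Rightarrow> ('d, 'n) params \<times> (real ^ 'n) \<Rightarrow> real ^ 'n" where
  "rnn_tangent \<phi> \<theta> x s q = (\<chi> k. deriv sigmoid (net_pre \<phi> \<theta> x s k) * net_pre_tangent \<phi> \<theta> x s q k)"

definition net_out :: "(real \<Rightarrow> real) \<Rightarrow> ('d::finite, 'n::finite) params \<Rightarrow> real ^ 'n \<Rightarrow> real" where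
  "net_out lam \<theta> s = (\<Sum>k\<in>UNIV. lam (weights_B \<theta> $ k) * s $ k) + lam (bias \<theta>)"

definition net_out_tangent ::
  "(real \<Rightarrow> real) \<Rightarrow> ('d::finite, 'n::finite) params \<Rightarrow> real ^ 'n \<Rightarrow> ('d, 'n) params \<times> (real ^ 'n) \<Rightarrow> real" where
  "net_out_tangent lam \<theta> s q =
     (\<Sum>k\<in>UNIV. deriv lam (weights_B \<theta> $ k) * weights_B (fst q) $ k * s $ k + lam (weights_B \<theta> $ k) * snd q $ k)
       + deriv lam (bias \<theta>) * bias (fst q)"

lemma net_pre_tangent_linear: "linear (\<lambda>q. net_pre_tangent \<phi> \<theta> x s q k)"
  by (rule linearI) (simp_all add: net_pre_tangent_def algebra_simps sum.distrib sum_distrib_left)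

lemma rnn_tangent_linear: "linear (rnn_tangent \<phi> \<theta> x s)"
  by (rule linearI)
    (simp_all add: rnn_tangent_def vec_eq_iff linear_add[OF net_pre_tangent_linear] linear_scale[OF net_pre_tangent_linear] distrib_left mult.left_commute)

lemma net_out_tangent_linear: "linear (net_out_tangent lam \<theta> s)"
  by (rule linearI) (simp_all add: net_out_tangent_def algebra_simps sum.distrib sum_distrib_left)

text \<open>The concrete notion of admissible path: componentwise bounds on three derivatives, with
  constants to be chosen such that a network step reproduces them. The value bound 2 fits lines of
  length one that start in the unit cube.\<close>

definition rnn_curve ::
  "real \<Rightarrow> real \<Rightarrow> real \<Rightarrow> ('d::finite, 'n::finite) params \<Rightarrow> (real \<Rightarrow> real ^ 'n) \<Rightarrow> real ^ 'n \<Rightarrow> bool" where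
  "rnn_curve m1 m2 m3 \<tau> \<gamma> \<sigma> \<longleftrightarrow> norm \<tau> \<le> 1 \<and>
     (\<forall>k. C3_bdd 2 m1 m2 m3 (\<lambda>r. \<gamma> r $ k) \<and> ((\<lambda>r. \<gamma> r $ k) has_real_derivative \<sigma> $ k) (at 0))"

lemma rnn_curve_line:
  fixes s0 \<sigma> :: "real ^ 'n"
  assumes \<tau>: "norm \<tau> \<le> 1" and \<sigma>: "norm \<sigma> \<le> 1" and s0: "infnorm s0 \<le> 1" and m: "1 \<le> m1" "1 \<le> m2" "1 \<le> m3"
  shows "rnn_curve m1 m2 m3 \<tau> (\<lambda>r. s0 + sin r *\<^sub>R \<sigma>) \<sigma>"
  unfolding rnn_curve_def
proof (intro conjI allI)
  fix k
  have s: "\<bar>\<sigma> $ k\<bar> \<le> 1" "\<bar>s0 $ k\<bar> \<le> 1"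
    using component_le_norm_cart[of \<sigma> k] component_le_infnorm_cart[of s0 k] \<sigma> s0 by simp_all
  have le: "\<bar>x * \<sigma> $ k\<bar> \<le> 1" if "\<bar>x\<bar> \<le> 1" for x
    using abs_mult_le[OF that s(1)] by simp
  have "C3_bdd 2 1 1 1 (\<lambda>r. (s0 + sin r *\<^sub>R \<sigma>) $ k)"
    unfolding C3_bdd_def
    apply (rule exI[of _ "\<lambda>r. cos r * \<sigma> $ k"], rule exI[of _ "\<lambda>r. - sin r * \<sigma> $ k"], rule exI[of _ "\<lambda>r. - cos r * \<sigma> $ k"])
    apply (intro allI conjI)
    subgoal by (auto intro!: derivative_eq_intros)
    subgoal by (auto intro!: derivative_eq_intros)
    subgoal by (auto intro!: derivative_eq_intros)
    subgoal for r using abs_add_le[OF s(2) le[OF abs_sin_le_one[of r]]] by simp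
    by (rule le; simp)+
  then show "C3_bdd 2 m1 m2 m3 (\<lambda>r. (s0 + sin r *\<^sub>R \<sigma>) $ k)" by (rule C3_bdd_mono) (use m in simp_all)
  show "((\<lambda>r. (s0 + sin r *\<^sub>R \<sigma>) $ k) has_real_derivative \<sigma> $ k) (at 0)"
    by (auto intro!: derivative_eq_intros)
qed (rule \<tau>)

lemma rnn_curve_box: "rnn_curve m1 m2 m3 \<tau> \<gamma> \<sigma> \<Longrightarrow> infnorm (\<gamma> r) \<le> 2"
  by (rule infnorm_vec_le) (auto simp: rnn_curve_def dest!: C3_bdd_le)

lemma affine_DERIV:
  assumes "\<And>x. (g has_real_derivative g' x) (at x)"
  shows "((\<lambda>r. g (x + r * \<tau>)) has_real_derivative g' x * \<tau>) (at (0::real))"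
proof -
  have "((\<lambda>r. x + r * \<tau>) has_real_derivative \<tau>) (at 0)" by (auto intro!: derivative_eq_intros)
  from DERIV_chain'[OF this assms] show ?thesis by simp
qed

text \<open>The sums over inputs and memory units are averages, so the dimensions do not enter. Each
  factor 3 is 1 from the input average and 2 from the memory average, the curve being bounded by 2.
  At each order the bound of the same order recurs with the factor \<open>P0 / 4\<close>, the 4
  being due to the slope of the sigmoid.\<close>

lemma rnn_curve_step:
  fixes x :: "real ^ 'd" and \<theta> \<tau> :: "('d::finite, 'n::finite) params"
  assumes \<phi>: "smooth_bounded \<phi>" "C3_bdd P0 P1 P2 P3 \<phi>"
    and m: "1 / 4 * (3 * P1 + P0 * m1) \<le> m1"
      "(3 * P1 + P0 * m1)\<^sup>2 + 1 / 4 * (3 * P2 + 2 * (P1 * m1) + P0 * m2) \<le> m2"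
      "(3 * P1 + P0 * m1) ^ 3 + 3 * ((3 * P1 + P0 * m1) * (3 * P2 + 2 * (P1 * m1) + P0 * m2))
        + 1 / 4 * (3 * P3 + 3 * (P2 * m1) + 3 * (P1 * m2) + P0 * m3) \<le> m3"
    and c: "rnn_curve m1 m2 m3 \<tau> \<gamma> \<sigma>" and x: "infnorm x \<le> 1"
  shows "rnn_curve m1 m2 m3 \<tau> (\<lambda>r. rnn_step \<phi> (\<theta> + r *\<^sub>R \<tau>) x (\<gamma> r)) (rnn_tangent \<phi> \<theta> x (\<gamma> 0) (\<tau>, \<sigma>))"
  unfolding rnn_curve_def rnn_step_nth
proof (intro conjI allI)
  have \<tau>: "norm \<tau> \<le> 1" using c by (simp add: rnn_curve_def)
  then show "norm \<tau> \<le> 1" .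
  have c3: "C3_bdd 2 m1 m2 m3 (\<lambda>r. \<gamma> r $ k)" and cd: "((\<lambda>r. \<gamma> r $ k) has_real_derivative \<sigma> $ k) (at 0)" for k
    using c by (auto simp: rnn_curve_def)
  note wl = order_trans[OF weights_le_norm(1) \<tau>] order_trans[OF weights_le_norm(2) \<tau>]
  have xj: "\<bar>x $ j\<bar> \<le> 1" for j using component_le_infnorm_cart[of x j] x by simp
  note nn = C3_bdd_nonneg[OF \<phi>(2)]
  fix k
  have 1: "C3_bdd P0 P1 P2 P3 (\<lambda>r. \<phi> (weights_A (\<theta> + r *\<^sub>R \<tau>) $ k $ j) * x $ j)" for j
  proof -
    have "C3_bdd (P0 * \<bar>x $ j\<bar>) (P1 * \<bar>x $ j\<bar>) (P2 * \<bar>x $ j\<bar>) (P3 * \<bar>x $ j\<bar>) (\<lambda>r. \<phi> (weights_A \<theta> $ k $ j + r * weights_A \<tau> $ k $ j) * x $ j)"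
      using C3_bdd_mult[OF C3_bdd_affine[OF \<phi>(2) wl(1)] C3_bdd_const[of "x $ j"]] by simp
    then have "C3_bdd P0 P1 P2 P3 (\<lambda>r. \<phi> (weights_A \<theta> $ k $ j + r * weights_A \<tau> $ k $ j) * x $ j)"
      by (rule C3_bdd_mono) (use xj[of j] nn in \<open>auto intro: mult_left_le\<close>)
    then show ?thesis by simp
  qed
  have 2: "C3_bdd (P0 * 2) (P1 * 2 + P0 * m1) (P2 * 2 + 2 * (P1 * m1) + P0 * m2)
      (P3 * 2 + 3 * (P2 * m1) + 3 * (P1 * m2) + P0 * m3)
      (\<lambda>r. \<phi> (weights_W (\<theta> + r *\<^sub>R \<tau>) $ k $ l) * \<gamma> r $ l)" for l
    using C3_bdd_mult[OF C3_bdd_affine[OF \<phi>(2) wl(2)] c3[of l]] by simp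
  have "C3_bdd (P0 + P0 * 2) (P1 + (P1 * 2 + P0 * m1)) (P2 + (P2 * 2 + 2 * (P1 * m1) + P0 * m2))
      (P3 + (P3 * 2 + 3 * (P2 * m1) + 3 * (P1 * m2) + P0 * m3)) (\<lambda>r. net_pre \<phi> (\<theta> + r *\<^sub>R \<tau>) x (\<gamma> r) k)"
    unfolding net_pre_def by (intro C3_bdd_add C3_bdd_average 1 2)
  then have 3: "C3_bdd (3 * P0) (3 * P1 + P0 * m1) (3 * P2 + 2 * (P1 * m1) + P0 * m2)
      (3 * P3 + 3 * (P2 * m1) + 3 * (P1 * m2) + P0 * m3) (\<lambda>r. net_pre \<phi> (\<theta> + r *\<^sub>R \<tau>) x (\<gamma> r) k)"
    by (rule C3_bdd_mono) simp_all
  show "C3_bdd 2 m1 m2 m3 (\<lambda>r. sigmoid (net_pre \<phi> (\<theta> + r *\<^sub>R \<tau>) x (\<gamma> r) k))"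
    by (rule C3_bdd_mono[OF C3_bdd_compose[OF sigmoid_C3 3]]) (use m in simp_all)
  have d1: "((\<lambda>r. \<phi> (weights_A (\<theta> + r *\<^sub>R \<tau>) $ k $ j) * x $ j) has_real_derivative
      deriv \<phi> (weights_A \<theta> $ k $ j) * weights_A \<tau> $ k $ j * x $ j) (at 0)" for j
    using DERIV_cmult_right[OF affine_DERIV[OF smooth_bounded_DERIV1[OF \<phi>(1)]]] by simp
  have d2: "((\<lambda>r. \<phi> (weights_W (\<theta> + r *\<^sub>R \<tau>) $ k $ l) * \<gamma> r $ l) has_real_derivative
      deriv \<phi> (weights_W \<theta> $ k $ l) * weights_W \<tau> $ k $ l * \<gamma> 0 $ l + \<phi> (weights_W \<theta> $ k $ l) * \<sigma> $ l) (at 0)" for l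
    using DERIV_mult'[OF affine_DERIV[OF smooth_bounded_DERIV1[OF \<phi>(1)]] cd[of l], of "weights_W \<theta> $ k $ l" "weights_W \<tau> $ k $ l"]
    by (simp add: add.commute)
  have "((\<lambda>r. net_pre \<phi> (\<theta> + r *\<^sub>R \<tau>) x (\<gamma> r) k) has_real_derivative net_pre_tangent \<phi> \<theta> x (\<gamma> 0) (\<tau>, \<sigma>) k) (at 0)"
    unfolding net_pre_def net_pre_tangent_def fst_conv snd_conv
    by (intro DERIV_add average_has_real_derivative d1 d2)
  from DERIV_chain'[OF this sigmoid_DERIV]
  show "((\<lambda>r. sigmoid (net_pre \<phi> (\<theta> + r *\<^sub>R \<tau>) x (\<gamma> r) k)) has_real_derivative rnn_tangent \<phi> \<theta> x (\<gamma> 0) (\<tau>, \<sigma>) $ k) (at 0)"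
    by (simp add: rnn_tangent_def deriv_sigmoid)
qed

text \<open>The affine map \<open>m \<mapsto> c + C / 4 * m\<close> has slope below one, so every
  number from its fixed point \<open>c / (1 - C / 4)\<close> upwards is admissible.\<close>

lemma ex_invariant_bound:
  fixes c C :: real
  assumes "C < 4"
  shows "\<exists>m\<ge>1. c + 1 / 4 * (C * m) \<le> m"
proof (intro exI conjI)
  let ?m = "max 1 (c / (1 - C / 4))"
  show "1 \<le> ?m" by simp
  have "c / (1 - C / 4) \<le> ?m" by simp
  then have "c \<le> ?m * (1 - C / 4)" by (subst (asm) pos_divide_le_eq) (use assms in simp_all)
  then show "c + 1 / 4 * (C * ?m) \<le> ?m" by (simp add: algebra_simps)
qed

text \<open>The conditions are triangular: once the bounds of lower order are fixed, each is affine
  in its own bound with slope \<open>P0 / 4\<close>.\<close>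

lemma ex_rnn_curve_bounds:
  fixes P0 P1 P2 P3 :: real
  assumes P0: "P0 < 4"
  obtains m1 m2 m3 where "1 \<le> m1" "1 \<le> m2" "1 \<le> m3"
    "1 / 4 * (3 * P1 + P0 * m1) \<le> m1"
    "(3 * P1 + P0 * m1)\<^sup>2 + 1 / 4 * (3 * P2 + 2 * (P1 * m1) + P0 * m2) \<le> m2"
    "(3 * P1 + P0 * m1) ^ 3 + 3 * ((3 * P1 + P0 * m1) * (3 * P2 + 2 * (P1 * m1) + P0 * m2))
        + 1 / 4 * (3 * P3 + 3 * (P2 * m1) + 3 * (P1 * m2) + P0 * m3) \<le> m3"
proof -
  obtain m1 where m1: "1 \<le> m1" "1 / 4 * (3 * P1) + 1 / 4 * (P0 * m1) \<le> m1"
    using ex_invariant_bound[OF P0] by blast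
  obtain m2 where m2: "1 \<le> m2" "(3 * P1 + P0 * m1)\<^sup>2 + 1 / 4 * (3 * P2 + 2 * (P1 * m1)) + 1 / 4 * (P0 * m2) \<le> m2"
    using ex_invariant_bound[OF P0] by blast
  obtain m3 where m3: "1 \<le> m3" "((3 * P1 + P0 * m1) ^ 3 + 3 * ((3 * P1 + P0 * m1) * (3 * P2 + 2 * (P1 * m1) + P0 * m2))
        + 1 / 4 * (3 * P3 + 3 * (P2 * m1) + 3 * (P1 * m2))) + 1 / 4 * (P0 * m3) \<le> m3"
    using ex_invariant_bound[OF P0] by blast
  show ?thesis
    by (rule that[OF m1(1) m2(1) m3(1)]) (use m1(2) m2(2) m3(2) in \<open>simp_all add: distrib_left add.assoc\<close>)
qed

section \<open>Continuity and Lipschitz estimates of the network\<close>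

lemma continuous_on_weights [continuous_intros]:
  assumes "continuous_on A f"
  shows "continuous_on A (\<lambda>p. weights_A (f p))" "continuous_on A (\<lambda>p. weights_W (f p))"
    "continuous_on A (\<lambda>p. weights_B (f p))" "continuous_on A (\<lambda>p. bias (f p))"
  unfolding weights_defs by (intro continuous_intros assms)+

lemma continuous_on_net_pre [continuous_intros]:
  assumes "continuous_on UNIV \<phi>" "continuous_on A f" "continuous_on A g" "continuous_on A h"
  shows "continuous_on A (\<lambda>p. net_pre \<phi> (f p) (g p) (h p) k)"
  unfolding net_pre_def by (intro continuous_intros assms continuous_on_compose2[OF assms(1)]) auto

lemma rnn_step_eq: "rnn_step \<phi> \<theta> x s = (\<chi> k. sigmoid (net_pre \<phi> \<theta> x s k))"
  by (simp add: vec_eq_iff rnn_step_nth)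

lemma continuous_on_rnn_step [continuous_intros]:
  assumes "continuous_on UNIV \<phi>" "continuous_on A f" "continuous_on A g" "continuous_on A h"
  shows "continuous_on A (\<lambda>p. rnn_step \<phi> (f p) (g p) (h p))"
  unfolding rnn_step_eq by (intro continuous_intros assms continuous_on_compose2[OF sigmoid_continuous]) auto

lemma continuous_on_rnn_tangent [continuous_intros]:
  assumes "smooth_bounded \<phi>" "continuous_on A f" "continuous_on A g" "continuous_on A h" "continuous_on A q"
  shows "continuous_on A (\<lambda>p. rnn_tangent \<phi> (f p) (g p) (h p) (q p))"
  unfolding rnn_tangent_def net_pre_tangent_def deriv_sigmoid
  by (intro continuous_intros assms continuous_on_compose2[OF sigmoid_continuous]
      continuous_on_compose2[OF smooth_bounded_continuous(1)[OF assms(1)]]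
      continuous_on_compose2[OF smooth_bounded_continuous(2)[OF assms(1)]] smooth_bounded_continuous(1)[OF assms(1)]) auto

lemma continuous_on_net_out [continuous_intros]:
  assumes "smooth_bounded lam" "continuous_on A f" "continuous_on A h"
  shows "continuous_on A (\<lambda>p. net_out lam (f p) (h p))"
  unfolding net_out_def
  by (intro continuous_intros assms continuous_on_compose2[OF smooth_bounded_continuous(1)[OF assms(1)]]) auto

lemma continuous_on_net_out_tangent [continuous_intros]:
  assumes "smooth_bounded lam" "continuous_on A f" "continuous_on A h" "continuous_on A q"
  shows "continuous_on A (\<lambda>p. net_out_tangent lam (f p) (h p) (q p))"
  unfolding net_out_tangent_def
  by (intro continuous_intros assms continuous_on_compose2[OF smooth_bounded_continuous(1)[OF assms(1)]]
      continuous_on_compose2[OF smooth_bounded_continuous(2)[OF assms(1)]]) auto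

lemma net_out_measurable:
  assumes "smooth_bounded lam" and [measurable]: "g \<in> borel_measurable N" "h \<in> borel_measurable N"
  shows "(\<lambda>x. net_out lam (g x) (h x)) \<in> borel_measurable N"
proof -
  have "(\<lambda>p. net_out lam (fst p) (snd p)) \<in> borel_measurable borel"
    by (intro borel_measurable_continuous_onI continuous_intros assms(1))
  from measurable_compose[OF borel_measurable_Pair[OF assms(2,3)] this] show ?thesis by simp
qed

lemma net_pre_Lipschitz:
  fixes x x' :: "real ^ 'd" and s s' :: "real ^ 'n"
  assumes \<phi>: "\<And>y. \<bar>\<phi> y\<bar> \<le> C"
  shows "\<bar>net_pre \<phi> \<theta> x s k - net_pre \<phi> \<theta> x' s' k\<bar> \<le> C * infnorm (x - x') + C * infnorm (s - s')"
proof -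
  have "net_pre \<phi> \<theta> x s k - net_pre \<phi> \<theta> x' s' k =
      1 / real CARD('d) * (\<Sum>j\<in>UNIV. \<phi> (weights_A \<theta> $ k $ j) * (x - x') $ j)
      + 1 / real CARD('n) * (\<Sum>l\<in>UNIV. \<phi> (weights_W \<theta> $ k $ l) * (s - s') $ l)"
    unfolding net_pre_def by (simp add: right_diff_distrib sum_subtractf diff_divide_distrib)
  also have "\<bar>\<dots>\<bar> \<le> C * infnorm (x - x') + C * infnorm (s - s')"
    by (intro abs_add_le average_le abs_mult_le \<phi> component_le_infnorm_cart)
  finally show ?thesis .
qed

lemma rnn_step_Lipschitz:
  fixes x x' :: "real ^ 'd" and s s' :: "real ^ 'n"
  assumes \<phi>: "\<And>y. \<bar>\<phi> y\<bar> \<le> C"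
  shows "infnorm (rnn_step \<phi> \<theta> x s - rnn_step \<phi> \<theta> x' s') \<le> C / 4 * infnorm (s - s') + C / 4 * infnorm (x - x')"
proof (rule infnorm_vec_le)
  fix k
  have "\<bar>(rnn_step \<phi> \<theta> x s - rnn_step \<phi> \<theta> x' s') $ k\<bar> \<le> 1 / 4 * \<bar>net_pre \<phi> \<theta> x s k - net_pre \<phi> \<theta> x' s' k\<bar>"
    by (simp add: rnn_step_nth sigmoid_Lipschitz[simplified])
  then show "\<bar>(rnn_step \<phi> \<theta> x s - rnn_step \<phi> \<theta> x' s') $ k\<bar> \<le> C / 4 * infnorm (s - s') + C / 4 * infnorm (x - x')"
    using net_pre_Lipschitz[of \<phi> C \<theta> x s k x' s', OF \<phi>] by (simp add: algebra_simps)
qed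

lemma rnn_step_box: "infnorm (rnn_step \<phi> \<theta> x s) \<le> 1"
  by (rule infnorm_vec_le) (use sigmoid_bounds in \<open>auto simp: rnn_step_nth abs_le_iff less_imp_le intro: order_trans[OF _ less_imp_le]\<close>)

lemma rnn_contractive_system:
  fixes \<kappa> :: "(real ^ 'd) \<times> (real ^ 'z) \<Rightarrow> ((real ^ 'd) \<times> (real ^ 'z)) measure"
  assumes \<kappa>: "\<kappa> \<in> borel \<rightarrow>\<^sub>M prob_algebra borel" "\<And>v. AE w in \<kappa> v. infnorm w \<le> 1"
    "\<And>g B L v w. (\<And>x. \<bar>g x\<bar> \<le> B) \<Longrightarrow> 0 \<le> L \<Longrightarrow>
      (\<And>x y. \<bar>g x - g y\<bar> \<le> L * infnorm (x - y)) \<Longrightarrow> g \<in> borel_measurable borel \<Longrightarrow>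
      \<bar>(\<integral>x. g x \<partial>\<kappa> v) - (\<integral>x. g x \<partial>\<kappa> w)\<bar> \<le> Lp * L * infnorm (v - w)"
    and Lp: "0 \<le> Lp" "Lp < 1"
    and \<phi>: "smooth_bounded \<phi>" "\<And>y. \<bar>\<phi> y\<bar> \<le> C" and C: "C < 4"
  shows "contractive_system \<kappa> (\<lambda>(\<theta> :: ('d, 'n::finite) params) v s. rnn_step \<phi> \<theta> (fst v) s) Lp (C / 4) (C / 4)"
proof
  have C0: "0 \<le> C" using \<phi>(2)[of 0] by simp
  show "(\<lambda>(\<theta> :: ('d, 'n) params, v :: (real ^ 'd) \<times> (real ^ 'z), s). rnn_step \<phi> \<theta> (fst v) s) \<in> borel_measurable borel"
    unfolding case_prod_beta
    by (intro borel_measurable_continuous_onI continuous_intros smooth_bounded_continuous(1)[OF \<phi>(1)])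
  show "infnorm (rnn_step \<phi> \<theta> (fst v) s - rnn_step \<phi> \<theta> (fst w) s') \<le> C / 4 * infnorm (s - s') + C / 4 * infnorm (v - w)"
    for \<theta> :: "('d, 'n) params" and v w :: "(real ^ 'd) \<times> (real ^ 'z)" and s s'
  proof -
    have "C / 4 * infnorm (fst v - fst w) \<le> C / 4 * infnorm (v - w)"
      using infnorm_fst_le[of "v - w"] C0 by (intro mult_left_mono) auto
    then show ?thesis using rnn_step_Lipschitz[of \<phi> C \<theta> "fst v" s "fst w" s', OF \<phi>(2)] by linarith
  qed
  show "infnorm (rnn_step \<phi> \<theta> (fst v) s) \<le> 1" for \<theta> :: "('d, 'n) params" and v :: "(real ^ 'd) \<times> (real ^ 'z)" and s
    by (rule rnn_step_box)
  show "\<bar>(\<integral>x. g x \<partial>\<kappa> v) - (\<integral>x. g x \<partial>\<kappa> w)\<bar> \<le> Lp * L * infnorm (v - w)"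
    if "\<And>x. \<bar>g x\<bar> \<le> B" "0 \<le> L" "\<And>x y. \<bar>g x - g y\<bar> \<le> L * infnorm (x - y)" "g \<in> borel_measurable borel"
    for g :: "(real ^ 'd) \<times> (real ^ 'z) \<Rightarrow> real" and B L v w
    using that by (rule \<kappa>(3))
  show "C / 4 < 1" using C by simp
qed (use assms order_trans[OF abs_ge_zero \<phi>(2)[of 0]] in auto)

section \<open>The one-step loss averaged over the noise\<close>

definition mean_loss ::
  "(real \<Rightarrow> real) \<Rightarrow> (real ^ 'd \<Rightarrow> real ^ 'z \<Rightarrow> real \<Rightarrow> real) \<Rightarrow> real measure \<Rightarrow>
   ('d::finite, 'n::finite) params \<Rightarrow> real ^ 'n \<Rightarrow> (real ^ 'd) \<times> (real ^ 'z) \<Rightarrow> real" where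
  "mean_loss lam f \<mu>\<eta> \<theta> s v = (\<integral>e. 1 / 2 * (f (fst v) (snd v) e - net_out lam \<theta> s)\<^sup>2 \<partial>\<mu>\<eta>)"

definition mean_loss_tangent ::
  "(real \<Rightarrow> real) \<Rightarrow> (real ^ 'd \<Rightarrow> real ^ 'z \<Rightarrow> real \<Rightarrow> real) \<Rightarrow> real measure \<Rightarrow>
   ('d::finite, 'n::finite) params \<Rightarrow> real ^ 'n \<Rightarrow> ('d, 'n) params \<times> (real ^ 'n) \<Rightarrow> (real ^ 'd) \<times> (real ^ 'z) \<Rightarrow> real" where
  "mean_loss_tangent lam f \<mu>\<eta> \<theta> s q v =
     (\<integral>e. - (f (fst v) (snd v) e - net_out lam \<theta> s) * net_out_tangent lam \<theta> s q \<partial>\<mu>\<eta>)"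

lemma net_out_bound:
  fixes s :: "real ^ 'n"
  assumes lam: "\<And>y. \<bar>lam y\<bar> \<le> Clam" and s: "infnorm s \<le> 2"
  shows "\<bar>net_out lam \<theta> s\<bar> \<le> real CARD('n) * (Clam * 2) + Clam"
proof -
  have "\<bar>lam (weights_B \<theta> $ k) * s $ k\<bar> \<le> Clam * 2" for k
    using component_le_infnorm_cart[of s k] s by (intro abs_mult_le lam) simp
  then have "(\<Sum>k\<in>UNIV. \<bar>lam (weights_B \<theta> $ k) * s $ k\<bar>) \<le> of_nat CARD('n) * (Clam * 2)"
    by (intro sum_bounded_above) auto
  then have "\<bar>\<Sum>k\<in>UNIV. lam (weights_B \<theta> $ k) * s $ k\<bar> \<le> real CARD('n) * (Clam * 2)"
    by (rule order_trans[OF sum_abs])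
  then show ?thesis unfolding net_out_def by (intro abs_add_le lam)
qed

lemma net_out_Lipschitz:
  fixes s s' :: "real ^ 'n"
  assumes lam: "\<And>y. \<bar>lam y\<bar> \<le> Clam"
  shows "\<bar>net_out lam \<theta> s - net_out lam \<theta> s'\<bar> \<le> real CARD('n) * Clam * infnorm (s - s')"
proof -
  have "\<bar>lam (weights_B \<theta> $ k) * (s - s') $ k\<bar> \<le> Clam * infnorm (s - s')" for k
    by (intro abs_mult_le lam component_le_infnorm_cart)
  then have "(\<Sum>k\<in>UNIV. \<bar>lam (weights_B \<theta> $ k) * (s - s') $ k\<bar>) \<le> of_nat CARD('n) * (Clam * infnorm (s - s'))"
    by (intro sum_bounded_above) auto
  then have "\<bar>\<Sum>k\<in>UNIV. lam (weights_B \<theta> $ k) * (s - s') $ k\<bar> \<le> real CARD('n) * (Clam * infnorm (s - s'))"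
    by (rule order_trans[OF sum_abs])
  moreover have "net_out lam \<theta> s - net_out lam \<theta> s' = (\<Sum>k\<in>UNIV. lam (weights_B \<theta> $ k) * (s - s') $ k)"
    by (simp add: net_out_def right_diff_distrib sum_subtractf)
  ultimately show ?thesis by (simp add: mult.assoc)
qed

lemma net_out_tangent_bound:
  fixes s :: "real ^ 'n"
  assumes lam: "\<And>y. \<bar>lam y\<bar> \<le> Clam" "\<And>y. \<bar>deriv lam y\<bar> \<le> L1" and s: "infnorm s \<le> 2"
  shows "\<bar>net_out_tangent lam \<theta> s q\<bar> \<le> (real CARD('n) * (L1 * 2 + Clam) + L1) * norm q"
proof -
  have q: "norm (fst q) \<le> norm q" "norm (snd q) \<le> norm q"
    using norm_fst_le[of "fst q" "snd q"] norm_snd_le[of "snd q" "fst q"] by simp_all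
  have sk: "\<bar>s $ k\<bar> \<le> 2" for k using component_le_infnorm_cart[of s k] s by simp
  have "\<bar>deriv lam (weights_B \<theta> $ k) * weights_B (fst q) $ k * s $ k + lam (weights_B \<theta> $ k) * snd q $ k\<bar>
      \<le> L1 * norm q * 2 + Clam * norm q" for k
    by (intro abs_add_le abs_mult_le lam sk order_trans[OF weights_le_norm(3) q(1)] order_trans[OF component_le_norm_cart q(2)])
  then have "(\<Sum>k\<in>UNIV. \<bar>deriv lam (weights_B \<theta> $ k) * weights_B (fst q) $ k * s $ k + lam (weights_B \<theta> $ k) * snd q $ k\<bar>)
      \<le> of_nat CARD('n) * (L1 * norm q * 2 + Clam * norm q)"
    by (intro sum_bounded_above) auto
  then have 1: "\<bar>\<Sum>k\<in>UNIV. deriv lam (weights_B \<theta> $ k) * weights_B (fst q) $ k * s $ k + lam (weights_B \<theta> $ k) * snd q $ k\<bar>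
      \<le> real CARD('n) * (L1 * norm q * 2 + Clam * norm q)"
    by (rule order_trans[OF sum_abs])
  have "\<bar>deriv lam (bias \<theta>) * bias (fst q)\<bar> \<le> L1 * norm q"
    by (intro abs_mult_le lam order_trans[OF weights_le_norm(4) q(1)])
  from abs_add_le[OF 1 this] show ?thesis unfolding net_out_tangent_def by (simp add: algebra_simps)
qed

lemma rnn_tangent_bound:
  fixes s :: "real ^ 'n" and x :: "real ^ 'd"
  assumes \<phi>: "\<And>y. \<bar>\<phi> y\<bar> \<le> C" "\<And>y. \<bar>deriv \<phi> y\<bar> \<le> P1" and s: "infnorm s \<le> 2" and x: "infnorm x \<le> 1"
  shows "norm (rnn_tangent \<phi> \<theta> x s q) \<le> real CARD('n) * (1 / 4 * (3 * P1 + C)) * norm q"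
proof -
  have q: "norm (fst q) \<le> norm q" "norm (snd q) \<le> norm q"
    using norm_fst_le[of "fst q" "snd q"] norm_snd_le[of "snd q" "fst q"] by simp_all
  have sk: "\<bar>s $ k\<bar> \<le> 2" for k using component_le_infnorm_cart[of s k] s by simp
  have xk: "\<bar>x $ k\<bar> \<le> 1" for k using component_le_infnorm_cart[of x k] x by simp
  have "\<bar>net_pre_tangent \<phi> \<theta> x s q k\<bar> \<le> P1 * norm q * 1 + (P1 * norm q * 2 + C * norm q)" for k
    unfolding net_pre_tangent_def
    by (intro abs_add_le average_le abs_mult_le \<phi> sk xk order_trans[OF weights_le_norm(1) q(1)]
        order_trans[OF weights_le_norm(2) q(1)] order_trans[OF component_le_norm_cart q(2)])
  then have "\<bar>rnn_tangent \<phi> \<theta> x s q $ k\<bar> \<le> 1 / 4 * (P1 * norm q * 1 + (P1 * norm q * 2 + C * norm q))" for k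
    unfolding rnn_tangent_def vec_lambda_beta
    by (intro abs_mult_le) (use deriv_sigmoid_bound[of "net_pre \<phi> \<theta> x s k"] in auto)
  then have "(\<Sum>k\<in>UNIV. \<bar>rnn_tangent \<phi> \<theta> x s q $ k\<bar>) \<le> of_nat CARD('n) * (1 / 4 * (P1 * norm q * 1 + (P1 * norm q * 2 + C * norm q)))"
    by (intro sum_bounded_above) auto
  then have "norm (rnn_tangent \<phi> \<theta> x s q) \<le> of_nat CARD('n) * (1 / 4 * (P1 * norm q * 1 + (P1 * norm q * 2 + C * norm q)))"
    by (rule order_trans[OF norm_le_l1_cart])
  then show ?thesis by (simp add: algebra_simps)
qed

lemma net_out_curve:
  fixes \<gamma> :: "real \<Rightarrow> real ^ 'n" and \<theta> :: "('d::finite, 'n::finite) params"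
  assumes lam: "smooth_bounded lam" "C3_bdd L0 L1 L2 L3 lam" and c: "rnn_curve m1 m2 m3 \<tau> \<gamma> \<sigma>"
  shows "C3_bdd (real CARD('n) * (L0 * 2) + L0) (real CARD('n) * (L1 * 2 + L0 * m1) + L1)
      (real CARD('n) * (L2 * 2 + 2 * (L1 * m1) + L0 * m2) + L2)
      (real CARD('n) * (L3 * 2 + 3 * (L2 * m1) + 3 * (L1 * m2) + L0 * m3) + L3)
      (\<lambda>r. net_out lam (\<theta> + r *\<^sub>R \<tau>) (\<gamma> r))"
    and "((\<lambda>r. net_out lam (\<theta> + r *\<^sub>R \<tau>) (\<gamma> r)) has_real_derivative net_out_tangent lam \<theta> (\<gamma> 0) (\<tau>, \<sigma>)) (at 0)"
proof -
  have \<tau>: "norm \<tau> \<le> 1" using c by (simp add: rnn_curve_def)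
  have c3: "C3_bdd 2 m1 m2 m3 (\<lambda>r. \<gamma> r $ k)" and cd: "((\<lambda>r. \<gamma> r $ k) has_real_derivative \<sigma> $ k) (at 0)" for k
    using c by (auto simp: rnn_curve_def)
  note wl = order_trans[OF weights_le_norm(3) \<tau>] order_trans[OF weights_le_norm(4) \<tau>]
  have 1: "C3_bdd (L0 * 2) (L1 * 2 + L0 * m1) (L2 * 2 + 2 * (L1 * m1) + L0 * m2)
      (L3 * 2 + 3 * (L2 * m1) + 3 * (L1 * m2) + L0 * m3)
      (\<lambda>r. lam (weights_B (\<theta> + r *\<^sub>R \<tau>) $ l) * \<gamma> r $ l)" for l
    using C3_bdd_mult[OF C3_bdd_affine[OF lam(2) wl(1)] c3[of l]] by simp
  have 2: "C3_bdd L0 L1 L2 L3 (\<lambda>r. lam (bias (\<theta> + r *\<^sub>R \<tau>)))"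
    using C3_bdd_affine[OF lam(2) wl(2)] by simp
  show "C3_bdd (real CARD('n) * (L0 * 2) + L0) (real CARD('n) * (L1 * 2 + L0 * m1) + L1)
      (real CARD('n) * (L2 * 2 + 2 * (L1 * m1) + L0 * m2) + L2)
      (real CARD('n) * (L3 * 2 + 3 * (L2 * m1) + 3 * (L1 * m2) + L0 * m3) + L3)
      (\<lambda>r. net_out lam (\<theta> + r *\<^sub>R \<tau>) (\<gamma> r))"
    unfolding net_out_def by (intro C3_bdd_add C3_bdd_sum 1 2) simp
  have d1: "((\<lambda>r. lam (weights_B (\<theta> + r *\<^sub>R \<tau>) $ l) * \<gamma> r $ l) has_real_derivative
      deriv lam (weights_B \<theta> $ l) * weights_B \<tau> $ l * \<gamma> 0 $ l + lam (weights_B \<theta> $ l) * \<sigma> $ l) (at 0)" for l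
    using DERIV_mult'[OF affine_DERIV[OF smooth_bounded_DERIV1[OF lam(1)]] cd[of l], of "weights_B \<theta> $ l" "weights_B \<tau> $ l"]
    by (simp add: add.commute)
  have d2: "((\<lambda>r. lam (bias (\<theta> + r *\<^sub>R \<tau>))) has_real_derivative deriv lam (bias \<theta>) * bias \<tau>) (at 0)"
    using affine_DERIV[OF smooth_bounded_DERIV1[OF lam(1)], of "bias \<theta>" "bias \<tau>"] by simp
  show "((\<lambda>r. net_out lam (\<theta> + r *\<^sub>R \<tau>) (\<gamma> r)) has_real_derivative net_out_tangent lam \<theta> (\<gamma> 0) (\<tau>, \<sigma>)) (at 0)"
    unfolding net_out_def net_out_tangent_def fst_conv snd_conv by (intro DERIV_add DERIV_sum d1 d2)
qed

text \<open>The residual is bounded by \<open>U\<close> on memories up to radius 2. Half its square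
  is expanded along admissible curves with constants that do not depend on the noise value, so the
  expansions survive averaging over the noise.\<close>

lemma rnn_smooth_system:
  fixes \<kappa> :: "(real ^ 'd) \<times> (real ^ 'z) \<Rightarrow> ((real ^ 'd) \<times> (real ^ 'z)) measure"
    and f :: "real ^ 'd \<Rightarrow> real ^ 'z \<Rightarrow> real \<Rightarrow> real"
  assumes sys: "contractive_system \<kappa> (\<lambda>(\<theta> :: ('d, 'n::finite) params) v s. rnn_step \<phi> \<theta> (fst v) s) Lp (C / 4) (C / 4)"
    and \<phi>: "smooth_bounded \<phi>" "\<And>y. \<bar>\<phi> y\<bar> \<le> C" and C: "C < 4"
    and lam: "smooth_bounded lam" "\<And>y. \<bar>lam y\<bar> \<le> Clam"
    and \<mu>\<eta>: "prob_space \<mu>\<eta>" "sets \<mu>\<eta> = sets borel"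
    and f_Lip: "\<And>x z e x' z' e'. \<bar>f x z e - f x' z' e'\<bar> \<le> Lf * infnorm ((x, z, e) - (x', z', e'))"
    and f_bound: "\<And>x z e. \<bar>f x z e\<bar> \<le> Lf"
    and f_measurable: "(\<lambda>(v, e). f (fst v) (snd v) e) \<in> borel_measurable borel"
  shows "\<exists>curve Bl bl al C0 cD. smooth_system \<kappa> (\<lambda>(\<theta> :: ('d, 'n::finite) params) v s. rnn_step \<phi> \<theta> (fst v) s)
      Lp (C / 4) (C / 4) (\<lambda>\<theta> v s q. rnn_tangent \<phi> \<theta> (fst v) s q)
      (mean_loss lam f \<mu>\<eta>) (mean_loss_tangent lam f \<mu>\<eta>) curve Bl bl al C0 cD"
proof -
  interpret contractive_system \<kappa> "\<lambda>(\<theta> :: ('d, 'n::finite) params) v s. rnn_step \<phi> \<theta> (fst v) s" Lp "C / 4" "C / 4"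
    by (rule sys)
  interpret \<mu>\<eta>: prob_space \<mu>\<eta> by (rule \<mu>\<eta>)
  note [measurable_cong] = \<mu>\<eta>(2)
  have Lf: "0 \<le> Lf" using order_trans[OF abs_ge_zero f_bound] .
  have f_m[measurable (raw)]: "(\<lambda>x. f (fst (g x)) (snd (g x)) (h x)) \<in> borel_measurable N"
    if [measurable]: "g \<in> borel_measurable N" "h \<in> borel_measurable N" for g h and N :: "'x measure"
    using measurable_compose[OF borel_measurable_Pair[OF that] f_measurable] by simp
  note [measurable (raw)] = net_out_measurable[OF lam(1)]
  obtain P1 P2 P3 where P: "C3_bdd C P1 P2 P3 \<phi>" and P1: "\<And>y. \<bar>deriv \<phi> y\<bar> \<le> P1"
    using smooth_bounded_C3[OF \<phi>] by blast
  obtain L1 L2 L3 where L: "C3_bdd Clam L1 L2 L3 lam" and L1: "\<And>y. \<bar>deriv lam y\<bar> \<le> L1"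
    using smooth_bounded_C3[OF lam] by blast
  obtain m1 m2 m3 where m: "1 \<le> m1" "1 \<le> m2" "1 \<le> m3"
    and m': "1 / 4 * (3 * P1 + C * m1) \<le> m1"
      "(3 * P1 + C * m1)\<^sup>2 + 1 / 4 * (3 * P2 + 2 * (P1 * m1) + C * m2) \<le> m2"
      "(3 * P1 + C * m1) ^ 3 + 3 * ((3 * P1 + C * m1) * (3 * P2 + 2 * (P1 * m1) + C * m2))
        + 1 / 4 * (3 * P3 + 3 * (P2 * m1) + 3 * (P1 * m2) + C * m3) \<le> m3"
    by (rule ex_rnn_curve_bounds[OF C]) blast
  define NN where "NN = real CARD('n)"
  define U where "U = Lf + (NN * (Clam * 2) + Clam)"
  have U: "\<bar>f x z e - net_out lam \<theta> s\<bar> \<le> U" if "infnorm s \<le> 2" for x z e and \<theta> :: "('d, 'n) params" and s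
    using f_bound[of x z e] net_out_bound[of lam Clam s \<theta>, OF lam(2) that] unfolding U_def NN_def by linarith
  have "\<bar>f 0 0 0 - net_out lam (0 :: ('d, 'n) params) 0\<bar> \<le> U" by (rule U) (simp add: infnorm_0)
  then have U0: "0 \<le> U" by (rule order_trans[OF abs_ge_zero])
  have \<mu>int: "integrable \<mu>\<eta> g" if "g \<in> borel_measurable \<mu>\<eta>" "\<And>e. \<bar>g e\<bar> \<le> B" for g :: "real \<Rightarrow> real" and B
    using that by (intro \<mu>\<eta>.integrable_const_bound[where B = B]) auto
  have \<mu>abs: "\<bar>\<integral>e. g e \<partial>\<mu>\<eta>\<bar> \<le> B" if "g \<in> borel_measurable \<mu>\<eta>" "\<And>e. \<bar>g e\<bar> \<le> B" for g :: "real \<Rightarrow> real" and B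
  proof -
    have "AE e in \<mu>\<eta>. g e \<le> B" "AE e in \<mu>\<eta>. -B \<le> g e" using that(2) by (auto simp: abs_le_iff minus_le_iff)
    then have "(\<integral>e. g e \<partial>\<mu>\<eta>) \<le> B" "-B \<le> (\<integral>e. g e \<partial>\<mu>\<eta>)"
      using \<mu>int[OF that] by (auto intro!: \<mu>\<eta>.integral_le_const \<mu>\<eta>.integral_ge_const)
    then show ?thesis by simp
  qed
  have sq: "\<bar>1 / 2 * a\<^sup>2\<bar> \<le> U\<^sup>2 / 2" if "\<bar>a\<bar> \<le> U" for a :: real
    using power_mono[OF that, of 2] by simp
  have l_int: "integrable \<mu>\<eta> (\<lambda>e. 1 / 2 * (f (fst v) (snd v) e - net_out lam \<theta> s)\<^sup>2)"
    if "infnorm s \<le> 2" for v s and \<theta> :: "('d, 'n) params"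
    by (rule \<mu>int[OF _ sq[OF U[OF that]]]) measurable
  define cO where "cO = NN * (L1 * 2 + Clam) + L1"
  have out: "\<bar>net_out_tangent lam \<theta> s q\<bar> \<le> cO * norm q" if "infnorm s \<le> 2" for \<theta> :: "('d, 'n) params" and s q
    unfolding cO_def NN_def using net_out_tangent_bound[of lam Clam L1 s \<theta> q, OF lam(2) L1 that] .
  have D_abs: "\<bar>- (f x z e - net_out lam \<theta> s) * net_out_tangent lam \<theta> s q\<bar> \<le> U * (cO * norm q)"
    if "infnorm s \<le> 2" for x z e s q and \<theta> :: "('d, 'n) params"
    by (intro abs_mult_le out that) (use U[OF that] in \<open>simp only: abs_minus_cancel\<close>)
  have D_int: "integrable \<mu>\<eta> (\<lambda>e. - (f (fst v) (snd v) e - net_out lam \<theta> s) * net_out_tangent lam \<theta> s q)"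
    if "infnorm s \<le> 2" for v s q and \<theta> :: "('d, 'n) params"
    by (rule \<mu>int[OF _ D_abs[OF that]]) measurable
  define cF where "cF = NN * (1 / 4 * (3 * P1 + C))"
  define o0 where "o0 = NN * (Clam * 2) + Clam"
  define o1 where "o1 = NN * (L1 * 2 + Clam * m1) + L1"
  define o2 where "o2 = NN * (L2 * 2 + 2 * (L1 * m1) + Clam * m2) + L2"
  define o3 where "o3 = NN * (L3 * 2 + 3 * (L2 * m1) + 3 * (L1 * m2) + Clam * m3) + L3"
  define h0 where "h0 = 1 / 2 * (U * U)"
  define h1 where "h1 = 1 / 2 * (o1 * U + U * o1)"
  define h2 where "h2 = 1 / 2 * (o2 * U + 2 * (o1 * o1) + U * o2)"
  define h3 where "h3 = 1 / 2 * (o3 * U + 3 * (o2 * o1) + 3 * (o1 * o2) + U * o3)"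
  \<comment> \<open>The target \<open>y\<close> is held fixed along the curve and enters the
    constants only through \<open>Lf\<close>. So regularity of \<open>f\<close> in its arguments is
    not differentiated here; the loss varies through the network output alone.\<close>
  have loss_curve: "C3_bdd h0 h1 h2 h3 (\<lambda>r. 1 / 2 * (y - net_out lam (\<theta> + r *\<^sub>R \<tau>) (\<gamma> r))\<^sup>2)"
    and loss_deriv: "((\<lambda>r. 1 / 2 * (y - net_out lam (\<theta> + r *\<^sub>R \<tau>) (\<gamma> r))\<^sup>2) has_real_derivative
      - (y - net_out lam \<theta> (\<gamma> 0)) * net_out_tangent lam \<theta> (\<gamma> 0) (\<tau>, \<sigma>)) (at 0)"
    if c: "rnn_curve m1 m2 m3 \<tau> \<gamma> \<sigma>" and y: "\<bar>y\<bar> \<le> Lf" for \<tau> \<gamma> \<sigma> y and \<theta> :: "('d, 'n) params"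
  proof -
    let ?o = "\<lambda>r. net_out lam (\<theta> + r *\<^sub>R \<tau>) (\<gamma> r)"
    note o = net_out_curve[OF lam(1) L c, of \<theta>]
    have "C3_bdd (\<bar>y\<bar> + \<bar>-1\<bar> * o0) (0 + (0 * o0 + \<bar>-1\<bar> * o1)) (0 + (0 * o0 + 2 * (0 * o1) + \<bar>-1\<bar> * o2))
       (0 + (0 * o0 + 3 * (0 * o1) + 3 * (0 * o2) + \<bar>-1\<bar> * o3)) (\<lambda>r. y + -1 * ?o r)"
      unfolding o0_def o1_def o2_def o3_def NN_def by (intro C3_bdd_add C3_bdd_const C3_bdd_mult o(1))
    then have u: "C3_bdd U o1 o2 o3 (\<lambda>r. y - ?o r)"
      using C3_bdd_mono[of "\<bar>y\<bar> + o0" o1 o2 o3 "\<lambda>r. y - ?o r" U o1 o2 o3] y by (simp add: U_def o0_def)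
    have "C3_bdd (\<bar>1 / 2\<bar> * (U * U)) (0 * (U * U) + \<bar>1 / 2\<bar> * (o1 * U + U * o1))
      (0 * (U * U) + 2 * (0 * (o1 * U + U * o1)) + \<bar>1 / 2\<bar> * (o2 * U + 2 * (o1 * o1) + U * o2))
      (0 * (U * U) + 3 * (0 * (o1 * U + U * o1)) + 3 * (0 * (o2 * U + 2 * (o1 * o1) + U * o2))
        + \<bar>1 / 2\<bar> * (o3 * U + 3 * (o2 * o1) + 3 * (o1 * o2) + U * o3))
      (\<lambda>r. 1 / 2 * ((y - ?o r) * (y - ?o r)))"
      by (rule C3_bdd_mult[OF C3_bdd_const C3_bdd_mult[OF u u]])
    then show "C3_bdd h0 h1 h2 h3 (\<lambda>r. 1 / 2 * (y - ?o r)\<^sup>2)"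
      by (simp add: h0_def h1_def h2_def h3_def power2_eq_square)
    have "((\<lambda>r. y - ?o r) has_real_derivative 0 - net_out_tangent lam \<theta> (\<gamma> 0) (\<tau>, \<sigma>)) (at 0)"
      by (intro DERIV_diff DERIV_const o(2))
    from DERIV_cmult[OF DERIV_power[OF this, of 2], of "1 / 2"]
    show "((\<lambda>r. 1 / 2 * (y - ?o r)\<^sup>2) has_real_derivative
      - (y - net_out lam \<theta> (\<gamma> 0)) * net_out_tangent lam \<theta> (\<gamma> 0) (\<tau>, \<sigma>)) (at 0)"
      by (rule DERIV_cong) (simp add: algebra_simps)
  qed
  \<comment> \<open>\<open>C3_bdd_Taylor\<close> yields \<open>h2\<close> for the second order
    remainder and \<open>2 * h3\<close> for the third order combination.\<close>
  define C0 where "C0 = max h2 (2 * h3)"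
  define cD where "cD = max cF (U * cO)"
  have "smooth_system \<kappa> (\<lambda>(\<theta> :: ('d, 'n::finite) params) v s. rnn_step \<phi> \<theta> (fst v) s)
      Lp (C / 4) (C / 4) (\<lambda>\<theta> v s q. rnn_tangent \<phi> \<theta> (fst v) s q)
      (mean_loss lam f \<mu>\<eta>) (mean_loss_tangent lam f \<mu>\<eta>) (rnn_curve m1 m2 m3) (U\<^sup>2 / 2) (U * (NN * Clam)) (U * Lf) C0 cD"
  proof (intro smooth_system.intro smooth_system_axioms.intro)
    show "contractive_system \<kappa> (\<lambda>(\<theta> :: ('d, 'n) params) v s. rnn_step \<phi> \<theta> (fst v) s) Lp (C / 4) (C / 4)"
      by (rule sys)
    show "(\<lambda>(\<theta> :: ('d, 'n) params, v :: (real ^ 'd) \<times> (real ^ 'z), s, q). rnn_tangent \<phi> \<theta> (fst v) s q) \<in> borel_measurable borel"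
      unfolding case_prod_beta by (intro borel_measurable_continuous_onI continuous_intros \<phi>(1))
    show "(\<lambda>(\<theta> :: ('d, 'n) params, s, v). mean_loss lam f \<mu>\<eta> \<theta> s v) \<in> borel_measurable borel"
      unfolding mean_loss_def case_prod_beta by measurable
    have [measurable (raw)]: "(\<lambda>x. net_out_tangent lam (g x) (h x) (k x)) \<in> borel_measurable N"
      if [measurable]: "g \<in> borel_measurable N" "h \<in> borel_measurable N" "k \<in> borel_measurable N"
      for g :: "'x \<Rightarrow> ('d, 'n) params" and h k and N :: "'x measure"
    proof -
      have "(\<lambda>p :: ('d, 'n) params \<times> (real ^ 'n) \<times> ('d, 'n) params \<times> (real ^ 'n).
          net_out_tangent lam (fst p) (fst (snd p)) (snd (snd p))) \<in> borel_measurable borel"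
        by (intro borel_measurable_continuous_onI continuous_intros lam(1))
      from measurable_compose[OF borel_measurable_Pair[OF that(1) borel_measurable_Pair[OF that(2,3)]] this]
      show ?thesis by simp
    qed
    show "(\<lambda>(\<theta> :: ('d, 'n) params, s, q, v). mean_loss_tangent lam f \<mu>\<eta> \<theta> s q v) \<in> borel_measurable borel"
      unfolding mean_loss_tangent_def case_prod_beta by measurable
    show "0 \<le> U * (NN * Clam)" using U0 order_trans[OF abs_ge_zero lam(2)] by (simp add: NN_def)
    show "0 \<le> U * Lf" using U0 Lf by simp
    show "linear (rnn_tangent \<phi> \<theta> (fst v) s)" for \<theta> :: "('d, 'n) params" and v :: "(real ^ 'd) \<times> (real ^ 'z)" and s
      by (rule rnn_tangent_linear)
    show "linear (\<lambda>q. mean_loss_tangent lam f \<mu>\<eta> \<theta> s q v)" for \<theta> :: "('d, 'n) params" and s v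
      unfolding mean_loss_tangent_def integral_mult_left_zero
      by (rule linearI)
        (simp_all add: linear_add[OF net_out_tangent_linear] linear_scale[OF net_out_tangent_linear] distrib_left del: minus_diff_eq)
    show "Lip_bdd (U\<^sup>2 / 2) (U * (NN * Clam)) (U * Lf) (mean_loss lam f \<mu>\<eta> \<theta>)" for \<theta> :: "('d, 'n) params"
      unfolding Lip_bdd_def
    proof (intro conjI allI impI)
      show "(\<lambda>(s, v). mean_loss lam f \<mu>\<eta> \<theta> s v) \<in> borel_measurable borel"
        unfolding mean_loss_def case_prod_beta by measurable
      show "\<bar>mean_loss lam f \<mu>\<eta> \<theta> s v\<bar> \<le> U\<^sup>2 / 2" if "infnorm s \<le> 2" for s v
        unfolding mean_loss_def by (rule \<mu>abs[OF _ sq[OF U[OF that]]]) measurable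
      fix s s' :: "real ^ 'n" and v w :: "(real ^ 'd) \<times> (real ^ 'z)"
      assume s: "infnorm s \<le> 2" "infnorm s' \<le> 2"
      have pt: "\<bar>1 / 2 * (f (fst v) (snd v) e - net_out lam \<theta> s)\<^sup>2 - 1 / 2 * (f (fst w) (snd w) e - net_out lam \<theta> s')\<^sup>2\<bar>
          \<le> U * (NN * Clam) * infnorm (s - s') + U * Lf * infnorm (v - w)" for e
      proof -
        let ?a = "f (fst v) (snd v) e - net_out lam \<theta> s" and ?b = "f (fst w) (snd w) e - net_out lam \<theta> s'"
        have "infnorm ((fst v, snd v, e) - (fst w, snd w, e)) = infnorm (v - w)"
          unfolding minus_prod_def[of v w] by (simp add: infnorm_Pair infnorm_0 infnorm_pos_le max.absorb1)
        then have "\<bar>f (fst v) (snd v) e - f (fst w) (snd w) e\<bar> \<le> Lf * infnorm (v - w)"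
          using f_Lip[of "fst v" "snd v" e "fst w" "snd w" e] by simp
        then have d: "\<bar>?a - ?b\<bar> \<le> Lf * infnorm (v - w) + NN * Clam * infnorm (s - s')"
          using net_out_Lipschitz[of lam Clam \<theta> s s', OF lam(2)] unfolding NN_def by linarith
        have "\<bar>?a + ?b\<bar> \<le> 2 * U" using abs_add_le[OF U[OF s(1)] U[OF s(2)]] by simp
        from abs_mult_le[OF this d]
        have "\<bar>(?a + ?b) * (?a - ?b)\<bar> \<le> 2 * U * (Lf * infnorm (v - w) + NN * Clam * infnorm (s - s'))" .
        moreover have "1 / 2 * ?a\<^sup>2 - 1 / 2 * ?b\<^sup>2 = 1 / 2 * ((?a + ?b) * (?a - ?b))"
          by (simp add: power2_eq_square algebra_simps)
        ultimately show ?thesis by (simp add: abs_mult algebra_simps)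
      qed
      have "mean_loss lam f \<mu>\<eta> \<theta> s v - mean_loss lam f \<mu>\<eta> \<theta> s' w =
        (\<integral>e. 1 / 2 * (f (fst v) (snd v) e - net_out lam \<theta> s)\<^sup>2 - 1 / 2 * (f (fst w) (snd w) e - net_out lam \<theta> s')\<^sup>2 \<partial>\<mu>\<eta>)"
        unfolding mean_loss_def by (rule Bochner_Integration.integral_diff[symmetric]) (intro l_int s)+
      also have "\<bar>\<dots>\<bar> \<le> U * (NN * Clam) * infnorm (s - s') + U * Lf * infnorm (v - w)"
        by (rule \<mu>abs[OF _ pt]) measurable
      finally show "\<bar>mean_loss lam f \<mu>\<eta> \<theta> s v - mean_loss lam f \<mu>\<eta> \<theta> s' w\<bar>
        \<le> U * (NN * Clam) * infnorm (s - s') + U * Lf * infnorm (v - w)" .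
    qed
    show "norm (rnn_tangent \<phi> \<theta> (fst v) s q) \<le> cD * norm q"
      if "infnorm s \<le> 2" "infnorm v \<le> 1" for \<theta> :: "('d, 'n) params" and v :: "(real ^ 'd) \<times> (real ^ 'z)" and s q
    proof -
      have "infnorm (fst v) \<le> 1" using infnorm_fst_le[of v] that(2) by simp
      from rnn_tangent_bound[of \<phi> C P1 s "fst v" \<theta> q, OF \<phi>(2) P1 that(1) this]
      have "norm (rnn_tangent \<phi> \<theta> (fst v) s q) \<le> cF * norm q" unfolding cF_def NN_def .
      also have "\<dots> \<le> cD * norm q" unfolding cD_def by (intro mult_right_mono) auto
      finally show ?thesis .
    qed
    show "\<bar>mean_loss_tangent lam f \<mu>\<eta> \<theta> s q v\<bar> \<le> cD * norm q"
      if "infnorm s \<le> 2" "infnorm v \<le> 1" for \<theta> :: "('d, 'n) params" and v :: "(real ^ 'd) \<times> (real ^ 'z)" and s q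
    proof -
      have "\<bar>mean_loss_tangent lam f \<mu>\<eta> \<theta> s q v\<bar> \<le> U * (cO * norm q)"
        unfolding mean_loss_tangent_def by (rule \<mu>abs[OF _ D_abs[OF that(1)]]) measurable
      also have "\<dots> = U * cO * norm q" by simp
      also have "\<dots> \<le> cD * norm q" unfolding cD_def by (intro mult_right_mono) auto
      finally show ?thesis .
    qed
    show "rnn_curve m1 m2 m3 \<tau> (\<lambda>r. s0 + sin r *\<^sub>R \<sigma>) \<sigma>" if "norm \<tau> \<le> 1" "norm \<sigma> \<le> 1" "infnorm s0 \<le> 1"
      for \<tau> :: "('d, 'n) params" and \<sigma> s0
      by (rule rnn_curve_line[OF that m])
    show "infnorm (\<gamma> r) \<le> 2" if "rnn_curve m1 m2 m3 \<tau> \<gamma> \<sigma>" for \<tau> :: "('d, 'n) params" and \<gamma> \<sigma> r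
      using that by (rule rnn_curve_box)
    fix \<tau> \<theta> :: "('d, 'n) params" and \<gamma> \<sigma> and v :: "(real ^ 'd) \<times> (real ^ 'z)"
    assume c: "rnn_curve m1 m2 m3 \<tau> \<gamma> \<sigma>" and v: "infnorm v \<le> 1"
    show "rnn_curve m1 m2 m3 \<tau> (\<lambda>r. rnn_step \<phi> (\<theta> + r *\<^sub>R \<tau>) (fst v) (\<gamma> r)) (rnn_tangent \<phi> \<theta> (fst v) (\<gamma> 0) (\<tau>, \<sigma>))"
      by (rule rnn_curve_step[OF \<phi>(1) P m' c]) (use infnorm_fst_le[of v] v in simp)
    fix h :: real assume h: "0 \<le> h"
    note box = rnn_curve_box[OF c]
    let ?u = "\<lambda>e r. 1 / 2 * (f (fst v) (snd v) e - net_out lam (\<theta> + r *\<^sub>R \<tau>) (\<gamma> r))\<^sup>2"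
    let ?d = "\<lambda>e. - (f (fst v) (snd v) e - net_out lam \<theta> (\<gamma> 0)) * net_out_tangent lam \<theta> (\<gamma> 0) (\<tau>, \<sigma>)"
    note T = C3_bdd_Taylor[OF loss_curve[OF c f_bound] loss_deriv[OF c f_bound] h, of "fst v" "snd v" _ \<theta>]
    have u_int: "integrable \<mu>\<eta> (\<lambda>e. ?u e r)" for r by (rule l_int[OF box])
    have d_int: "integrable \<mu>\<eta> ?d" by (rule D_int[OF box])
    have l: "mean_loss lam f \<mu>\<eta> (\<theta> + r *\<^sub>R \<tau>) (\<gamma> r) v = (\<integral>e. ?u e r \<partial>\<mu>\<eta>)" for r by (simp add: mean_loss_def)
    have l0: "mean_loss lam f \<mu>\<eta> \<theta> (\<gamma> 0) v = (\<integral>e. ?u e 0 \<partial>\<mu>\<eta>)" by (simp add: mean_loss_def)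
    have d: "mean_loss_tangent lam f \<mu>\<eta> \<theta> (\<gamma> 0) (\<tau>, \<sigma>) v = (\<integral>e. ?d e \<partial>\<mu>\<eta>)" by (simp only: mean_loss_tangent_def)
    have "\<bar>\<integral>e. ?u e h - ?u e 0 - h * ?d e \<partial>\<mu>\<eta>\<bar> \<le> h2 * h\<^sup>2"
      by (rule \<mu>abs[OF _ T(1)]) measurable
    moreover have "(\<integral>e. ?u e h - ?u e 0 - h * ?d e \<partial>\<mu>\<eta>) = (\<integral>e. ?u e h \<partial>\<mu>\<eta>) - (\<integral>e. ?u e 0 \<partial>\<mu>\<eta>) - h * (\<integral>e. ?d e \<partial>\<mu>\<eta>)"
      by (simp only: Bochner_Integration.integral_diff u_int d_int Bochner_Integration.integrable_diff
          Bochner_Integration.integrable_mult_right integral_mult_right_zero)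
    moreover have "h2 * h\<^sup>2 \<le> C0 * h\<^sup>2" unfolding C0_def by (intro mult_right_mono) auto
    ultimately show "\<bar>mean_loss lam f \<mu>\<eta> (\<theta> + h *\<^sub>R \<tau>) (\<gamma> h) v - mean_loss lam f \<mu>\<eta> \<theta> (\<gamma> 0) v
        - h * mean_loss_tangent lam f \<mu>\<eta> \<theta> (\<gamma> 0) (\<tau>, \<sigma>) v\<bar> \<le> C0 * h\<^sup>2"
      unfolding l l0 d by linarith
    have "\<bar>\<integral>e. ?u e (2 * h) - 4 * ?u e h + 3 * ?u e 0 + 2 * h * ?d e \<partial>\<mu>\<eta>\<bar> \<le> 2 * h3 * h ^ 3"
      by (rule \<mu>abs[OF _ T(2)]) measurable
    moreover have "(\<integral>e. ?u e (2 * h) - 4 * ?u e h + 3 * ?u e 0 + 2 * h * ?d e \<partial>\<mu>\<eta>)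
        = (\<integral>e. ?u e (2 * h) \<partial>\<mu>\<eta>) - 4 * (\<integral>e. ?u e h \<partial>\<mu>\<eta>) + 3 * (\<integral>e. ?u e 0 \<partial>\<mu>\<eta>) + 2 * h * (\<integral>e. ?d e \<partial>\<mu>\<eta>)"
      by (simp only: Bochner_Integration.integral_diff Bochner_Integration.integral_add u_int d_int Bochner_Integration.integrable_diff
          Bochner_Integration.integrable_add Bochner_Integration.integrable_mult_right integral_mult_right_zero)
    moreover have "2 * h3 * h ^ 3 \<le> C0 * h ^ 3" unfolding C0_def using h by (intro mult_right_mono) auto
    ultimately show "\<bar>mean_loss lam f \<mu>\<eta> (\<theta> + (2 * h) *\<^sub>R \<tau>) (\<gamma> (2 * h)) v - 4 * mean_loss lam f \<mu>\<eta> (\<theta> + h *\<^sub>R \<tau>) (\<gamma> h) v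
        + 3 * mean_loss lam f \<mu>\<eta> \<theta> (\<gamma> 0) v + 2 * h * mean_loss_tangent lam f \<mu>\<eta> \<theta> (\<gamma> 0) (\<tau>, \<sigma>) v\<bar> \<le> C0 * h ^ 3"
      unfolding l l0 d by linarith
  qed
  then show ?thesis by blast
qed

text \<open>The stored tensors contracted with a parameter direction, that is, the map from
  parameter tangents to memory tangents that the algorithm keeps.\<close>

definition sensitivity ::
  "real ^ 'n ^ 'd ^ 'n \<Rightarrow> real ^ 'n ^ 'n ^ 'n \<Rightarrow> ('d::finite, 'n::finite) params \<Rightarrow> real ^ 'n" where
  "sensitivity SA SW \<tau> = (\<chi> k. (\<Sum>i\<in>UNIV. \<Sum>j\<in>UNIV. SA $ i $ j $ k * weights_A \<tau> $ i $ j)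
     + (\<Sum>i\<in>UNIV. \<Sum>j\<in>UNIV. SW $ i $ j $ k * weights_W \<tau> $ i $ j))"

lemma sensitivity_linear: "linear (sensitivity SA SW)"
  by (rule linearI) (simp_all add: sensitivity_def vec_eq_iff algebra_simps sum.distrib sum_distrib_left)

text \<open>The Kronecker delta collapses the sum over \<open>i\<close>, and exchanging sums brings
  the contraction with \<open>t\<close> next to the old tensor. The index types are generic, so that
  the sensitivities to \<open>A\<close> and to \<open>W\<close> are covered alike.\<close>

lemma double_sum_step:
  fixes S :: "real ^ 'n::finite ^ 'm::finite ^ 'n"
  shows "(\<Sum>i\<in>UNIV. \<Sum>j\<in>UNIV. s * (a * (if i = k then 1 else 0) * p i j * x j + b * (\<Sum>l\<in>UNIV. w l * S $ i $ j $ l)) * t i j)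
    = s * (a * (\<Sum>j\<in>UNIV. p k j * t k j * x j) + b * (\<Sum>l\<in>UNIV. w l * (\<Sum>i\<in>UNIV. \<Sum>j\<in>UNIV. S $ i $ j $ l * t i j)))"
proof -
  have "(\<Sum>i\<in>UNIV. \<Sum>j\<in>UNIV. s * (a * (if i = k then 1 else 0) * p i j * x j + b * (\<Sum>l\<in>UNIV. w l * S $ i $ j $ l)) * t i j)
    = (\<Sum>i\<in>UNIV. if i = k then (\<Sum>j\<in>UNIV. s * (a * (p i j * t i j * x j))) else 0)
      + (\<Sum>i\<in>UNIV. \<Sum>j\<in>UNIV. \<Sum>l\<in>UNIV. s * (b * (w l * (S $ i $ j $ l * t i j))))"
    unfolding sum.distrib[symmetric]
    by (intro sum.cong refl) (auto simp: algebra_simps sum_distrib_left sum.distrib)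
  also have "(\<Sum>i\<in>UNIV. \<Sum>j\<in>UNIV. \<Sum>l\<in>UNIV. s * (b * (w l * (S $ i $ j $ l * t i j))))
      = (\<Sum>i\<in>UNIV. \<Sum>l\<in>UNIV. \<Sum>j\<in>UNIV. s * (b * (w l * (S $ i $ j $ l * t i j))))"
    by (intro sum.cong refl sum.swap)
  also have "\<dots> = (\<Sum>l\<in>UNIV. \<Sum>i\<in>UNIV. \<Sum>j\<in>UNIV. s * (b * (w l * (S $ i $ j $ l * t i j))))"
    by (rule sum.swap)
  finally show ?thesis by (simp add: sum_distrib_left distrib_left)
qed

text \<open>Forward differentiation: updating the tensors and then contracting agrees with
  contracting first and then applying the differential of the network step. This supplies
  \<open>T_Suc\<close> in the convergence theorem.\<close>

lemma sensitivity_step: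
  "sensitivity (sensitivity_A_step \<phi> (weights_A \<theta>) (weights_W \<theta>) x s SA) (sensitivity_W_step \<phi> (weights_A \<theta>) (weights_W \<theta>) x s SW) \<tau>
    = rnn_tangent \<phi> \<theta> x s (\<tau>, sensitivity SA SW \<tau>)"
  unfolding vec_eq_iff sensitivity_def sensitivity_A_step_def sensitivity_W_step_def rnn_tangent_def net_pre_tangent_def
    preactivation_nth vec_lambda_beta double_sum_step fst_conv snd_conv
  by (simp add: sum.distrib distrib_left add_divide_distrib)

lemma inner_params:
  "\<tau> \<bullet> \<tau>' = (\<Sum>i\<in>UNIV. \<Sum>j\<in>UNIV. weights_A \<tau> $ i $ j * weights_A \<tau>' $ i $ j)
    + (\<Sum>i\<in>UNIV. \<Sum>j\<in>UNIV. weights_W \<tau> $ i $ j * weights_W \<tau>' $ i $ j)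
    + (\<Sum>k\<in>UNIV. weights_B \<tau> $ k * weights_B \<tau>' $ k) + bias \<tau> * bias \<tau>'"
  by (simp add: weights_defs inner_prod_def inner_vec_def)

lemma triple_sum_swap:
  fixes S :: "real ^ 'n::finite ^ 'm::finite ^ 'n"
  shows "(\<Sum>i\<in>UNIV. \<Sum>j\<in>UNIV. t i j * (\<Sum>k\<in>UNIV. w k * S $ i $ j $ k)) = (\<Sum>k\<in>UNIV. w k * (\<Sum>i\<in>UNIV. \<Sum>j\<in>UNIV. S $ i $ j $ k * t i j))"
proof -
  have "(\<Sum>i\<in>UNIV. \<Sum>j\<in>UNIV. t i j * (\<Sum>k\<in>UNIV. w k * S $ i $ j $ k)) = (\<Sum>i\<in>UNIV. \<Sum>j\<in>UNIV. \<Sum>k\<in>UNIV. w k * (S $ i $ j $ k * t i j))"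
    by (simp add: sum_distrib_left ac_simps)
  also have "\<dots> = (\<Sum>i\<in>UNIV. \<Sum>k\<in>UNIV. \<Sum>j\<in>UNIV. w k * (S $ i $ j $ k * t i j))"
    by (intro sum.cong refl sum.swap)
  also have "\<dots> = (\<Sum>k\<in>UNIV. \<Sum>i\<in>UNIV. \<Sum>j\<in>UNIV. w k * (S $ i $ j $ k * t i j))"
    by (rule sum.swap)
  finally show ?thesis by (simp add: sum_distrib_left)
qed

text \<open>Pairing the update direction with \<open>\<tau>\<close> differentiates the output along
  \<open>\<tau>\<close> together with the memory tangent that the sensitivities assign to
  it.\<close>

lemma output_direction_inner:
  "\<tau> \<bullet> output_direction lam (\<theta>, s, SA, SW) = net_out_tangent lam \<theta> s (\<tau>, sensitivity SA SW \<tau>)"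
proof -
  obtain A W B c where \<theta>: "\<theta> = (A, W, B, c)" by (cases \<theta>)
  show ?thesis
    unfolding inner_params \<theta>
    by (simp add: output_direction_def net_out_tangent_def sensitivity_def triple_sum_swap sum.distrib distrib_left ac_simps)
qed

lemma rtrl_gradient_eq:
  "rtrl_gradient lam y (\<theta>, s, SA, SW) = - (y - net_out lam \<theta> s) *\<^sub>R output_direction lam (\<theta>, s, SA, SW)"
proof -
  obtain A W B c where \<theta>: "\<theta> = (A, W, B, c)" by (cases \<theta>)
  show ?thesis
    by (simp add: \<theta> rtrl_gradient_def net_out_def entrywise_def inner_vec_def diff_diff_eq)
qed

lemma rtrl_step_eq:
  "rtrl_step \<phi> lam a x y (\<theta>, s, SA, SW) =
    (\<theta> - a *\<^sub>R rtrl_gradient lam y (\<theta>, s, SA, SW), rnn_step \<phi> \<theta> x s,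
     sensitivity_A_step \<phi> (weights_A \<theta>) (weights_W \<theta>) x s SA, sensitivity_W_step \<phi> (weights_A \<theta>) (weights_W \<theta>) x s SW)"
proof -
  obtain A W B c where \<theta>: "\<theta> = (A, W, B, c)" by (cases \<theta>)
  show ?thesis by (simp add: \<theta> rtrl_step_def rnn_step_def)
qed

section \<open>Wasserstein duality and independence\<close>

text \<open>Under any coupling the difference of the two means is the mean of
  \<open>g (fst z) - g (snd z)\<close>, hence at most \<open>L\<close> times the mean
  distance.\<close>

lemma Wass2_dual:
  fixes P Q :: "'a::euclidean_space measure" and g :: "'a \<Rightarrow> real"
  assumes W: "Wass2 P Q \<le> ennreal c" and c: "0 \<le> c"
    and g: "\<And>x. \<bar>g x\<bar> \<le> B" "\<And>x y. \<bar>g x - g y\<bar> \<le> L * infnorm (x - y)" "0 \<le> L"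
    and [measurable]: "g \<in> borel_measurable borel"
  shows "\<bar>(\<integral>x. g x \<partial>P) - (\<integral>x. g x \<partial>Q)\<bar> \<le> L * c"
proof -
  \<comment> \<open>The slack \<open>\<delta>\<close> gives a coupling strictly below the bound, as
    the infimum over couplings need not be attained.\<close>
  have "\<bar>(\<integral>x. g x \<partial>P) - (\<integral>x. g x \<partial>Q)\<bar> \<le> L * (c + \<delta>)" if \<delta>: "0 < \<delta>" for \<delta>
  proof -
    define a where "a = c + \<delta>"
    have a: "0 < a" using c \<delta> by (simp add: a_def)
    have "Wass2 P Q < ennreal a" using W c \<delta> by (auto intro: le_less_trans simp: ennreal_less_iff a_def)
    then obtain \<pi> where \<pi>: "\<pi> \<in> couplings P Q"
      and lt: "ennreal_sqrt (\<integral>\<^sup>+ (x, y). ennreal ((infnorm (x - y))\<^sup>2) \<partial>\<pi>) < ennreal a"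
      unfolding Wass2_def Inf_less_iff by auto
    then have \<pi>_prob: "prob_space \<pi>" and \<pi>_sets[measurable_cong]: "sets \<pi> = sets borel"
      and fst: "distr \<pi> borel fst = P" and snd: "distr \<pi> borel snd = Q" by (auto simp: couplings_def)
    interpret \<pi>: prob_space \<pi> by (rule \<pi>_prob)
    define I where "I = (\<integral>\<^sup>+ z. ennreal ((infnorm (fst z - snd z))\<^sup>2) \<partial>\<pi>)"
    have I: "ennreal_sqrt I < ennreal a" using lt by (simp add: I_def case_prod_beta')
    then have fin: "I < \<infinity>" by (auto simp: ennreal_sqrt_def less_top split: if_splits)
    then have "I \<noteq> \<infinity>" by simp
    then have "ennreal (sqrt (enn2real I)) < ennreal a" using I unfolding ennreal_sqrt_def by (simp only: if_False)
    then have "sqrt (enn2real I) < a" by (simp add: ennreal_less_iff)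
    then have Ia: "enn2real I \<le> a\<^sup>2" by (intro sqrt_le_D less_imp_le)
    have inf_m[measurable]: "(\<lambda>z. infnorm (fst z - snd z)) \<in> borel_measurable \<pi>"
    proof -
      have "(\<lambda>z :: 'a \<times> 'a. infnorm (fst z - snd z)) \<in> borel_measurable borel"
        by (intro borel_measurable_continuous_onI continuous_intros)
      then show ?thesis by measurable
    qed
    have g_m: "(\<lambda>z. g (fst z)) \<in> borel_measurable \<pi>" "(\<lambda>z. g (snd z)) \<in> borel_measurable \<pi>" by measurable
    have int2: "integrable \<pi> (\<lambda>z. (infnorm (fst z - snd z))\<^sup>2)"
      by (rule integrableI_nonneg) (use fin in \<open>auto simp: I_def\<close>)
    have val2: "(\<integral>z. (infnorm (fst z - snd z))\<^sup>2 \<partial>\<pi>) = enn2real I"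
      unfolding I_def by (rule integral_eq_nn_integral) auto
    have int_g: "integrable \<pi> (\<lambda>z. g (fst z))" "integrable \<pi> (\<lambda>z. g (snd z))"
      using g_m g(1) by (auto intro!: \<pi>.integrable_const_bound[where B = B])
    have "(\<integral>x. g x \<partial>P) - (\<integral>x. g x \<partial>Q) = (\<integral>z. g (fst z) - g (snd z) \<partial>\<pi>)"
      using int_g by (simp add: fst[symmetric] snd[symmetric] integral_distr)
    also have "\<bar>\<dots>\<bar> \<le> (\<integral>z. \<bar>g (fst z) - g (snd z)\<bar> \<partial>\<pi>)" by (rule integral_abs_bound)
    also have "\<dots> \<le> (\<integral>z. L * (a / 2 + (infnorm (fst z - snd z))\<^sup>2 / (2 * a)) \<partial>\<pi>)"
    proof (rule integral_mono)
      fix z :: "'a \<times> 'a"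
      \<comment> \<open>Completing the square bounds the distance by its square directly; since the
        second moment is at most \<open>a\<^sup>2\<close>, nothing is lost against the
        Cauchy-Schwarz inequality.\<close>
      have "0 \<le> (infnorm (fst z - snd z) - a)\<^sup>2" by simp
      then have "infnorm (fst z - snd z) \<le> a / 2 + (infnorm (fst z - snd z))\<^sup>2 / (2 * a)"
        using a by (simp add: field_simps power2_eq_square)
      then show "\<bar>g (fst z) - g (snd z)\<bar> \<le> L * (a / 2 + (infnorm (fst z - snd z))\<^sup>2 / (2 * a))"
        using g(2)[of "fst z" "snd z"] g(3) by (meson mult_left_mono order_trans)
    qed (use int_g int2 in auto)
    also have "\<dots> = L * (a / 2 + enn2real I / (2 * a))"
      using int2 \<pi>.prob_space by (simp add: val2)
    also have "\<dots> \<le> L * a"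
    proof (rule mult_left_mono[OF _ g(3)])
      have "enn2real I / (2 * a) \<le> a\<^sup>2 / (2 * a)" using Ia a by (intro divide_right_mono) auto
      also have "\<dots> = a / 2" using a by (simp add: power2_eq_square)
      finally show "a / 2 + enn2real I / (2 * a) \<le> a" by simp
    qed
    finally show ?thesis by (simp only: a_def)
  qed
  then have "\<bar>(\<integral>x. g x \<partial>P) - (\<integral>x. g x \<partial>Q)\<bar> \<le> L * c + e" if "0 < e" for e
  proof (cases "L = 0")
    case False
    then have "0 < e / L" using that g(3) by simp
    from \<open>\<And>\<delta>. 0 < \<delta> \<Longrightarrow> _\<close>[OF this] show ?thesis using False by (simp add: distrib_left)
  qed (use that \<open>\<And>\<delta>. 0 < \<delta> \<Longrightarrow> _\<close>[of 1] in simp)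
  then show ?thesis by (rule field_le_epsilon)
qed

section \<open>Clipping to the unit cube\<close>

definition clip :: "'a::euclidean_space \<Rightarrow> 'a" where
  "clip x = (\<Sum>b\<in>Basis. max (-1) (min 1 (x \<bullet> b)) *\<^sub>R b)"

lemma clip_inner: "b \<in> Basis \<Longrightarrow> clip x \<bullet> b = max (-1) (min 1 (x \<bullet> b))"
  by (simp add: clip_def inner_sum_left inner_Basis if_distrib cong: if_cong)

lemma clip_box: "infnorm (clip x) \<le> 1"
  by (rule infnorm_le) (auto simp: clip_inner)

lemma clip_id: "infnorm x \<le> 1 \<Longrightarrow> clip x = x"
proof (rule euclidean_eqI)
  fix b :: 'a assume b: "b \<in> Basis" and "infnorm x \<le> 1"
  then have "\<bar>x \<bullet> b\<bar> \<le> 1" using Basis_le_infnorm[OF b, of x] by simp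
  then show "clip x \<bullet> b = x \<bullet> b" by (simp add: clip_inner[OF b])
qed

lemma clip_contraction: "infnorm (clip x - clip y) \<le> infnorm (x - y)"
proof (rule infnorm_le)
  fix b :: 'a assume b: "b \<in> Basis"
  have "\<bar>(clip x - clip y) \<bullet> b\<bar> \<le> \<bar>(x - y) \<bullet> b\<bar>"
    by (simp add: inner_diff_left clip_inner[OF b] max_def min_def)
  also have "\<dots> \<le> infnorm (x - y)" by (rule Basis_le_infnorm[OF b])
  finally show "\<bar>(clip x - clip y) \<bullet> b\<bar> \<le> infnorm (x - y)" .
qed

lemma clip_continuous: "continuous_on UNIV clip"
  unfolding clip_def by (intro continuous_intros)

lemma clip_measurable[measurable]: "clip \<in> borel_measurable borel"
  using clip_continuous by (rule borel_measurable_continuous_onI)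

text \<open>The data lie in the unit cube only almost surely, and \<open>K v\<close> may charge its complement for \<open>v\<close> in a null set;
  clipping keeps every starting point in the cube and does not increase distances.\<close>

definition clipped_kernel :: "('a::euclidean_space \<Rightarrow> 'a measure) \<Rightarrow> 'a \<Rightarrow> 'a measure" where
  "clipped_kernel K v = distr (K (clip v)) borel clip"

lemma clipped_kernel_measurable:
  assumes [measurable]: "K \<in> borel \<rightarrow>\<^sub>M prob_algebra borel"
  shows "clipped_kernel K \<in> borel \<rightarrow>\<^sub>M prob_algebra borel"
  unfolding clipped_kernel_def by measurable

lemma kernel_sets:
  assumes "K \<in> borel \<rightarrow>\<^sub>M prob_algebra borel"
  shows "sets (K v) = sets borel" "prob_space (K v)"
  using measurable_space[OF assms, of v] by (auto simp: space_prob_algebra)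

lemma clipped_kernel_cube:
  assumes K: "K \<in> borel \<rightarrow>\<^sub>M prob_algebra borel"
  shows "AE w in clipped_kernel K v. infnorm w \<le> 1"
proof -
  note [measurable_cong] = kernel_sets(1)[OF K]
  have [measurable]: "(infnorm :: 'a \<Rightarrow> real) \<in> borel_measurable borel"
    by (intro borel_measurable_continuous_onI continuous_intros)
  have "Measurable.pred borel (\<lambda>w :: 'a. infnorm w \<le> 1)" by measurable
  then show ?thesis unfolding clipped_kernel_def by (subst AE_distr_iff) (auto simp: clip_box pred_def)
qed

lemma clipped_kernel_integral:
  fixes g :: "'a::euclidean_space \<Rightarrow> real"
  assumes K: "K \<in> borel \<rightarrow>\<^sub>M prob_algebra borel" and [measurable]: "g \<in> borel_measurable borel"
  shows "(\<integral>w. g w \<partial>clipped_kernel K v) = (\<integral>w. g (clip w) \<partial>K (clip v))"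
proof -
  note [measurable_cong] = kernel_sets(1)[OF K]
  show ?thesis unfolding clipped_kernel_def by (rule integral_distr) measurable
qed

lemma clipped_kernel_contraction:
  fixes g :: "'a::euclidean_space \<Rightarrow> real"
  assumes K: "K \<in> borel \<rightarrow>\<^sub>M prob_algebra borel"
    and W: "\<And>w w'. Wass2 (K w) (K w') \<le> ennreal (Lp * infnorm (w - w'))" and Lp: "0 \<le> Lp"
    and g: "\<And>x. \<bar>g x\<bar> \<le> B" "0 \<le> L" "\<And>x y. \<bar>g x - g y\<bar> \<le> L * infnorm (x - y)" "g \<in> borel_measurable borel"
  shows "\<bar>(\<integral>x. g x \<partial>clipped_kernel K v) - (\<integral>x. g x \<partial>clipped_kernel K w)\<bar> \<le> Lp * L * infnorm (v - w)"
proof -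
  note [measurable] = g(4)
  have "\<bar>(\<integral>x. g (clip x) \<partial>K (clip v)) - (\<integral>x. g (clip x) \<partial>K (clip w))\<bar> \<le> L * (Lp * infnorm (clip v - clip w))"
  proof (rule Wass2_dual[OF W])
    show "\<bar>g (clip x) - g (clip y)\<bar> \<le> L * infnorm (x - y)" for x y
      using g(3)[of "clip x" "clip y"] mult_left_mono[OF clip_contraction[of x y] g(2)] by linarith
  qed (use g Lp in \<open>auto simp: infnorm_pos_le\<close>)
  also have "\<dots> \<le> L * (Lp * infnorm (v - w))" using g(2) Lp clip_contraction by (intro mult_left_mono) auto
  finally show ?thesis by (simp add: clipped_kernel_integral[OF K g(4)] ac_simps)
qed

section \<open>Independence and the Markov property as identities between expectations\<close>

lemma (in prob_space) independent_expectation: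
  fixes g :: "'b \<Rightarrow> 'c \<Rightarrow> real"
  assumes [measurable]: "U \<in> M \<rightarrow>\<^sub>M A" "H \<in> M \<rightarrow>\<^sub>M B"
    and ind: "distr M (A \<Otimes>\<^sub>M B) (\<lambda>\<omega>. (U \<omega>, H \<omega>)) = distr M A U \<Otimes>\<^sub>M distr M B H"
    and [measurable]: "(\<lambda>(u, h). g u h) \<in> borel_measurable (A \<Otimes>\<^sub>M B)"
    and b: "\<And>u h. \<bar>g u h\<bar> \<le> c"
  shows "(\<integral>\<omega>. g (U \<omega>) (H \<omega>) \<partial>M) = (\<integral>\<omega>. (\<integral>h. g (U \<omega>) h \<partial>distr M B H) \<partial>M)"
    and "(\<integral>\<omega>. g (U \<omega>) (H \<omega>) \<partial>M) = (\<integral>h. (\<integral>\<omega>. g (U \<omega>) h \<partial>M) \<partial>distr M B H)"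
proof -
  interpret A: prob_space "distr M A U" by (rule prob_space_distr) measurable
  interpret B: prob_space "distr M B H" by (rule prob_space_distr) measurable
  interpret AB: pair_prob_space "distr M A U" "distr M B H" ..
  have int: "integrable (distr M A U \<Otimes>\<^sub>M distr M B H) (\<lambda>(u, h). g u h)"
    by (rule AB.integrable_const_bound[where B = c]) (use b in auto)
  have "(\<integral>\<omega>. g (U \<omega>) (H \<omega>) \<partial>M) = (\<integral>z. (\<lambda>(u, h). g u h) z \<partial>distr M (A \<Otimes>\<^sub>M B) (\<lambda>\<omega>. (U \<omega>, H \<omega>)))"
    by (subst integral_distr) auto
  also have "\<dots> = (\<integral>z. (\<lambda>(u, h). g u h) z \<partial>(distr M A U \<Otimes>\<^sub>M distr M B H))" by (simp only: ind)
  finally have 1: "(\<integral>\<omega>. g (U \<omega>) (H \<omega>) \<partial>M) = \<dots>" .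
  have [measurable]: "(\<lambda>u. \<integral>h. g u h \<partial>distr M B H) \<in> borel_measurable A"
    by measurable
  have [measurable]: "(\<lambda>h. \<integral>\<omega>. g (U \<omega>) h \<partial>M) \<in> borel_measurable B"
    by measurable
  have "(\<integral>z. (\<lambda>(u, h). g u h) z \<partial>(distr M A U \<Otimes>\<^sub>M distr M B H)) = (\<integral>u. (\<integral>h. g u h \<partial>distr M B H) \<partial>distr M A U)"
    using AB.integral_fst[OF int] by simp
  also have "\<dots> = (\<integral>\<omega>. (\<integral>h. g (U \<omega>) h \<partial>distr M B H) \<partial>M)" by (rule integral_distr) measurable
  finally show "(\<integral>\<omega>. g (U \<omega>) (H \<omega>) \<partial>M) = (\<integral>\<omega>. (\<integral>h. g (U \<omega>) h \<partial>distr M B H) \<partial>M)" using 1 by simp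
  have "(\<integral>z. (\<lambda>(u, h). g u h) z \<partial>(distr M A U \<Otimes>\<^sub>M distr M B H)) = (\<integral>h. (\<integral>u. g u h \<partial>distr M A U) \<partial>distr M B H)"
    using AB.integral_snd[OF int] by simp
  also have "\<dots> = (\<integral>h. (\<integral>\<omega>. g (U \<omega>) h \<partial>M) \<partial>distr M B H)"
    by (intro Bochner_Integration.integral_cong refl integral_distr) (auto simp: space_pair_measure)
  finally show "(\<integral>\<omega>. g (U \<omega>) (H \<omega>) \<partial>M) = (\<integral>h. (\<integral>\<omega>. g (U \<omega>) h \<partial>M) \<partial>distr M B H)" using 1 by simp
qed

lemma (in prob_space) independent_of_distr:
  assumes "independent_of M A U B H"
  shows "distr M (A \<Otimes>\<^sub>M B) (\<lambda>\<omega>. (U \<omega>, H \<omega>)) = distr M A U \<Otimes>\<^sub>M distr M B H"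
proof -
  from assms have [measurable]: "U \<in> M \<rightarrow>\<^sub>M A" "H \<in> M \<rightarrow>\<^sub>M B"
    and ind: "indep_set {U -` E \<inter> space M | E. E \<in> sets A} {H -` E \<inter> space M | E. E \<in> sets B}"
    by (auto simp: independent_of_def)
  interpret A: prob_space "distr M A U" by (rule prob_space_distr) measurable
  interpret B: prob_space "distr M B H" by (rule prob_space_distr) measurable
  show ?thesis
  proof (rule pair_measure_eqI[symmetric])
    show "sigma_finite_measure (distr M A U)" "sigma_finite_measure (distr M B H)" by unfold_locales
    show "sets (distr M A U \<Otimes>\<^sub>M distr M B H) = sets (distr M (A \<Otimes>\<^sub>M B) (\<lambda>\<omega>. (U \<omega>, H \<omega>)))"
      by (simp cong: sets_pair_measure_cong)
    fix a b assume ab: "a \<in> sets (distr M A U)" "b \<in> sets (distr M B H)"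
    then have [measurable]: "a \<in> sets A" "b \<in> sets B" by simp_all
    have "prob ((U -` a \<inter> space M) \<inter> (H -` b \<inter> space M)) = prob (U -` a \<inter> space M) * prob (H -` b \<inter> space M)"
      by (rule indep_setD[OF ind]) auto
    moreover have "(\<lambda>\<omega>. (U \<omega>, H \<omega>)) -` (a \<times> b) \<inter> space M = (U -` a \<inter> space M) \<inter> (H -` b \<inter> space M)" by auto
    ultimately show "emeasure (distr M A U) a * emeasure (distr M B H) b
        = emeasure (distr M (A \<Otimes>\<^sub>M B) (\<lambda>\<omega>. (U \<omega>, H \<omega>))) (a \<times> b)"
      by (simp add: emeasure_distr emeasure_eq_measure ennreal_mult)
  qed
qed

abbreviation path_space :: "(nat \<Rightarrow> 'a::topological_space) measure" where
  "path_space \<equiv> PiM UNIV (\<lambda>_. borel)"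

text \<open>The Markov property, given for indicators of the next state, determines the joint law of
  past and next state on rectangles and hence everywhere. The past up to \<open>t\<close> is coded
  as the stopped path \<open>V (min s t)\<close>, so that all times share one path space.\<close>

lemma (in prob_space) Markov_past_expectation:
  fixes V :: "nat \<Rightarrow> 'a \<Rightarrow> 'b::second_countable_topology" and g :: "(nat \<Rightarrow> 'b) \<Rightarrow> 'b \<Rightarrow> real"
  assumes chain: "markov_chain M K V"
    and [measurable]: "(\<lambda>(p, w). g p w) \<in> borel_measurable (path_space \<Otimes>\<^sub>M borel)" and b: "\<And>p w. \<bar>g p w\<bar> \<le> c"
  shows "(\<integral>\<omega>. g (\<lambda>s. V (min s t) \<omega>) (V (Suc t) \<omega>) \<partial>M)
    = (\<integral>\<omega>. (\<integral>w. g (\<lambda>s. V (min s t) \<omega>) w \<partial>K (V t \<omega>)) \<partial>M)"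
proof -
  from chain have K[measurable]: "K \<in> borel \<rightarrow>\<^sub>M prob_algebra borel" and V[measurable]: "\<And>t. V t \<in> borel_measurable M"
    and ce: "\<And>t C. C \<in> sets borel \<Longrightarrow> AE \<omega> in M. real_cond_exp M (past_algebra M V t) (\<lambda>\<omega>'. indicator C (V (Suc t) \<omega>')) \<omega>
          = measure (K (V t \<omega>)) C"
    by (auto simp: markov_chain_def)
  note [measurable_cong] = kernel_sets(1)[OF K]
  define F where "F = past_algebra M V t"
  define P where "P \<omega> = (\<lambda>s. V (min s t) \<omega>)" for \<omega>
  have P[measurable]: "P \<in> M \<rightarrow>\<^sub>M path_space" unfolding P_def by (rule measurable_PiM_single') auto
  have gen: "(\<Union>s\<in>{..t}. {V s -` C \<inter> space M | C. C \<in> sets borel}) \<subseteq> Pow (space M)" by auto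
  have spF: "space F = space M" and setsF: "sets F = sigma_sets (space M) (\<Union>s\<in>{..t}. {V s -` C \<inter> space M | C. C \<in> sets borel})"
    unfolding F_def past_algebra_def by (simp_all add: space_measure_of_conv sets_measure_of[OF gen])
  have VF: "V s \<in> borel_measurable F" if "s \<le> t" for s
  proof (rule measurableI)
    show "V s -` C \<inter> space F \<in> sets F" if "C \<in> sets borel" for C
      unfolding spF setsF using that \<open>s \<le> t\<close> by (intro sigma_sets.Basic) auto
  qed simp
  have PF: "P \<in> F \<rightarrow>\<^sub>M path_space" unfolding P_def by (rule measurable_PiM_single') (auto intro: VF)
  have "sets F \<subseteq> sets M" unfolding setsF
    by (rule sets.sigma_sets_subset) auto
  then have "subalgebra M F" using spF by (simp add: subalgebra_def)
  then interpret F: finite_measure_subalgebra M F by unfold_locales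
  \<comment> \<open>\<open>Q1\<close> is the true joint law of past and next state;
    \<open>Q2\<close>, defined below, keeps the past and draws the next state from the
    kernel.\<close>
  define Q1 where "Q1 = distr M (path_space \<Otimes>\<^sub>M borel) (\<lambda>\<omega>. (P \<omega>, V (Suc t) \<omega>))"
  define Kp where "Kp \<omega> = distr (K (V t \<omega>)) (path_space \<Otimes>\<^sub>M borel) (\<lambda>w. (P \<omega>, w))" for \<omega>
  have Kp: "Kp \<in> M \<rightarrow>\<^sub>M subprob_algebra (path_space \<Otimes>\<^sub>M borel)"
    unfolding Kp_def by (rule measurable_prob_algebraD) measurable
  define Q2 where "Q2 = M \<bind> Kp"
  have sQ2: "sets Q2 = sets (path_space \<Otimes>\<^sub>M borel)"
    unfolding Q2_def by (rule sets_bind[OF sets_kernel[OF Kp] not_empty])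
  have "Q1 = Q2"
  proof (rule measure_eqI_generator_eq[OF Int_stable_pair_measure_generator[of path_space borel], where \<Omega> = UNIV and A = "\<lambda>_. UNIV"])
    show "sets Q1 = sigma_sets UNIV {a \<times> b |a b. a \<in> sets path_space \<and> b \<in> sets borel}"
      "sets Q2 = sigma_sets UNIV {a \<times> b |a b. a \<in> sets path_space \<and> b \<in> sets borel}"
      unfolding sQ2 by (simp_all add: Q1_def sets_pair_measure space_PiM)
    show "range (\<lambda>_. UNIV) \<subseteq> {a \<times> b |a b. a \<in> sets path_space \<and> b \<in> sets borel}"
      using sets.top[of "path_space"] by (auto simp: space_PiM intro!: exI[of _ UNIV])
    interpret Q1: prob_space Q1 unfolding Q1_def by (rule prob_space_distr) measurable
    show "emeasure Q1 UNIV \<noteq> \<infinity>" by simp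
    fix X assume "X \<in> {a \<times> b |a b. a \<in> sets (path_space :: (nat \<Rightarrow> 'b) measure) \<and> b \<in> sets (borel :: 'b measure)}"
    then obtain a b where X: "X = a \<times> b" and [measurable]: "a \<in> sets path_space" "b \<in> sets borel" by auto
    have Pa: "P -` a \<inter> space M \<in> sets F" using measurable_sets[OF PF, of a] by (simp add: spF)
    have "emeasure Q1 X = emeasure M {\<omega> \<in> space M. P \<omega> \<in> a \<and> V (Suc t) \<omega> \<in> b}"
      unfolding Q1_def X by (subst emeasure_distr) (auto intro!: arg_cong[where f = "emeasure M"])
    also have "\<dots> = ennreal (\<integral>\<omega>. indicator {\<omega> \<in> space M. P \<omega> \<in> a \<and> V (Suc t) \<omega> \<in> b} \<omega> \<partial>M)"
      by (simp add: emeasure_eq_measure)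
    also have "(\<integral>\<omega>. indicator {\<omega> \<in> space M. P \<omega> \<in> a \<and> V (Suc t) \<omega> \<in> b} \<omega> \<partial>M)
        = (\<integral>\<omega>\<in>(P -` a \<inter> space M). indicator b (V (Suc t) \<omega>) \<partial>M :: real)"
      unfolding set_lebesgue_integral_def by (intro Bochner_Integration.integral_cong) (auto simp: indicator_def)
    \<comment> \<open>The preimage of \<open>a\<close> under \<open>P\<close> is an event of the
      past, so the indicator may be replaced by its conditional expectation.\<close>
    also have "\<dots> = (\<integral>\<omega>\<in>(P -` a \<inter> space M). real_cond_exp M F (\<lambda>\<omega>. indicator b (V (Suc t) \<omega>)) \<omega> \<partial>M)"
      by (rule F.real_cond_exp_intA[OF _ Pa]) (auto intro!: integrable_const_bound[where B = 1])
    also have "\<dots> = (\<integral>\<omega>\<in>(P -` a \<inter> space M). measure (K (V t \<omega>)) b \<partial>M)"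
      unfolding set_lebesgue_integral_def
    proof (rule integral_cong_AE)
      show "AE \<omega> in M. indicator (P -` a \<inter> space M) \<omega> *\<^sub>R real_cond_exp M F (\<lambda>\<omega>. indicator b (V (Suc t) \<omega>)) \<omega>
        = indicator (P -` a \<inter> space M) \<omega> *\<^sub>R measure (K (V t \<omega>)) b"
        using ce[of b t] unfolding F_def by auto
    next
      have [measurable]: "real_cond_exp M F (\<lambda>\<omega>. indicator b (V (Suc t) \<omega>)) \<in> borel_measurable M"
        by (rule measurable_from_subalg[OF F.subalg borel_measurable_cond_exp])
      show "(\<lambda>\<omega>. indicator (P -` a \<inter> space M) \<omega> *\<^sub>R real_cond_exp M F (\<lambda>\<omega>. indicator b (V (Suc t) \<omega>)) \<omega>) \<in> borel_measurable M"
        "(\<lambda>\<omega>. indicator (P -` a \<inter> space M) \<omega> *\<^sub>R measure (K (V t \<omega>)) b) \<in> borel_measurable M"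
        by measurable
    qed
    also have "ennreal \<dots> = (\<integral>\<^sup>+\<omega>. indicator (P -` a \<inter> space M) \<omega> * measure (K (V t \<omega>)) b \<partial>M)"
      unfolding set_lebesgue_integral_def
      by (subst nn_integral_eq_integral[symmetric])
        (auto intro!: integrable_const_bound[where B = 1] nn_integral_cong simp: indicator_def prob_space.prob_le_1[OF kernel_sets(2)[OF K]])
    also have "\<dots> = (\<integral>\<^sup>+\<omega>. emeasure (Kp \<omega>) X \<partial>M)"
    proof (rule nn_integral_cong)
      fix \<omega> assume "\<omega> \<in> space M"
      interpret K: prob_space "K (V t \<omega>)" by (rule kernel_sets(2)[OF K])
      have sp: "space (K (V t \<omega>)) = UNIV" using sets_eq_imp_space_eq[OF kernel_sets(1)[OF K, of "V t \<omega>"]] by simp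
      have "emeasure (Kp \<omega>) X = emeasure (K (V t \<omega>)) {w. P \<omega> \<in> a \<and> w \<in> b}"
        unfolding Kp_def X by (subst emeasure_distr) (auto simp: sp space_PiM intro!: arg_cong[where f = "emeasure (K (V t \<omega>))"])
      then show "ennreal (indicator (P -` a \<inter> space M) \<omega> * measure (K (V t \<omega>)) b) = emeasure (Kp \<omega>) X"
        using \<open>\<omega> \<in> space M\<close> by (auto simp: indicator_def K.emeasure_eq_measure)
    qed
    also have "\<dots> = emeasure Q2 X"
      unfolding Q2_def by (rule emeasure_bind[OF not_empty Kp, symmetric]) (simp add: X)
    finally show "emeasure Q1 X = emeasure Q2 X" .
  next
    show "{a \<times> b |a b. a \<in> sets (path_space :: (nat \<Rightarrow> 'b) measure) \<and> b \<in> sets (borel :: 'b measure)} \<subseteq> Pow UNIV" by simp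
    show "(\<Union>i :: nat. UNIV) = (UNIV :: ((nat \<Rightarrow> 'b) \<times> 'b) set)" by simp
  qed
  have "(\<integral>\<omega>. g (P \<omega>) (V (Suc t) \<omega>) \<partial>M) = (\<integral>z. (\<lambda>(p, w). g p w) z \<partial>Q1)"
    unfolding Q1_def by (subst integral_distr) auto
  also have "\<dots> = (\<integral>z. (\<lambda>(p, w). g p w) z \<partial>(M \<bind> Kp))" unfolding \<open>Q1 = Q2\<close> Q2_def ..
  also have "\<dots> = (\<integral>\<omega>. (\<integral>z. (\<lambda>(p, w). g p w) z \<partial>Kp \<omega>) \<partial>M)"
  proof (rule integral_bind[OF _ _ Kp, where B = c and B' = 1])
    show "finite_measure M" by unfold_locales
    show "AE x in M. emeasure (Kp x) (space (Kp x)) \<le> ennreal 1"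
    proof (rule AE_I2)
      fix x assume "x \<in> space M"
      then have "subprob_space (Kp x)" by (rule subprob_space_kernel[OF Kp])
      then show "emeasure (Kp x) (space (Kp x)) \<le> ennreal 1" using subprob_space.emeasure_space_le_1 by simp
    qed
  qed (use b in auto)
  also have "\<dots> = (\<integral>\<omega>. (\<integral>w. g (P \<omega>) w \<partial>K (V t \<omega>)) \<partial>M)"
    unfolding Kp_def by (intro Bochner_Integration.integral_cong refl, subst integral_distr) (auto simp: space_PiM)
  finally show ?thesis unfolding P_def .
qed

section \<open>Weak limits of measures with bounded support\<close>

text \<open>Closed sets are stable under intersection and generate the Borel sets, and the indicator
  of a nonempty closed set is the limit of the Lipschitz functions
  \<open>max 0 (1 - real n * infdist x C)\<close>.\<close>

lemma measure_eqI_Lipschitz: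
  fixes P Q :: "'a::metric_space measure"
  assumes "prob_space P" "prob_space Q" and sP: "sets P = sets borel" and sQ: "sets Q = sets borel"
    and eq: "\<And>(g :: 'a \<Rightarrow> real) B L. (\<And>x. \<bar>g x\<bar> \<le> B) \<Longrightarrow> (\<And>x y. \<bar>g x - g y\<bar> \<le> L * dist x y) \<Longrightarrow>
      (\<integral>x. g x \<partial>P) = (\<integral>x. g x \<partial>Q)"
  shows "P = Q"
proof (rule measure_eqI_generator_eq[where E = "Collect closed" and \<Omega> = UNIV and A = "\<lambda>_. UNIV"])
  interpret P: prob_space P by fact
  interpret Q: prob_space Q by fact
  note [measurable_cong] = sP sQ
  show "Int_stable (Collect closed :: 'a set set)" by (auto simp: Int_stable_def)
  show "sets P = sigma_sets UNIV (Collect closed)" "sets Q = sigma_sets UNIV (Collect closed)"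
    unfolding sP sQ borel_eq_closed by simp_all
  show "emeasure P UNIV \<noteq> \<infinity>" by simp
  fix C :: "'a set" assume "C \<in> Collect closed"
  then have C: "closed C" by simp
  show "emeasure P C = emeasure Q C"
  proof (cases "C = {}")
    case False
    define g where "g n x = max 0 (1 - real n * infdist x C)" for n x
    have gm[measurable]: "g n \<in> borel_measurable borel" for n unfolding g_def
      by (intro borel_measurable_continuous_onI continuous_intros)
    have g01: "\<bar>g n x\<bar> \<le> 1" for n x
      using infdist_nonneg[of x C] by (simp add: g_def)
    have gL: "\<bar>g n x - g n y\<bar> \<le> real n * dist x y" for n x y
    proof -
      have "\<bar>g n x - g n y\<bar> \<le> \<bar>real n * infdist y C - real n * infdist x C\<bar>"
        unfolding g_def by linarith
      also have "\<dots> = real n * \<bar>infdist x C - infdist y C\<bar>"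
        by (simp flip: right_diff_distrib add: abs_mult abs_minus_commute)
      also have "\<dots> \<le> real n * dist x y"
        by (intro mult_left_mono infdist_triangle_abs) auto
      finally show ?thesis .
    qed
    have lim: "(\<lambda>n. g n x) \<longlonglongrightarrow> indicator C x" for x
    proof (cases "x \<in> C")
      case True
      then show ?thesis by (simp add: g_def)
    next
      case False
      then have pos: "0 < infdist x C" using C \<open>C \<noteq> {}\<close> by (simp add: infdist_pos_not_in_closed)
      obtain N where N: "1 < real N * infdist x C" using reals_Archimedean3[OF pos] by blast
      have "g n x = 0" if "n \<ge> N" for n
      proof -
        have "real N * infdist x C \<le> real n * infdist x C" using that pos by (intro mult_right_mono) auto
        then show ?thesis using N by (simp add: g_def)
      qed
      then have "\<forall>\<^sub>F n in sequentially. g n x = indicator C x"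
        using False by (auto simp: eventually_sequentially)
      then show ?thesis by (rule tendsto_eventually)
    qed
    have Cm[measurable]: "C \<in> sets borel" using C by simp
    have "(\<lambda>n. \<integral>x. g n x \<partial>P) \<longlonglongrightarrow> (\<integral>x. indicator C x \<partial>P)"
      by (rule integral_dominated_convergence[where w = "\<lambda>_. 1"]) (use g01 lim in auto)
    moreover have "(\<lambda>n. \<integral>x. g n x \<partial>Q) \<longlonglongrightarrow> (\<integral>x. indicator C x \<partial>Q)"
      by (rule integral_dominated_convergence[where w = "\<lambda>_. 1"]) (use g01 lim in auto)
    moreover have "(\<integral>x. g n x \<partial>P) = (\<integral>x. g n x \<partial>Q)" for n
      by (rule eq[OF g01 gL])
    ultimately have "(\<integral>x. indicator C x \<partial>P) = (\<integral>x. indicator C x \<partial>Q :: real)"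
      by (simp add: LIMSEQ_unique)
    then show ?thesis
      using Cm sP sQ by (simp add: P.emeasure_eq_measure Q.emeasure_eq_measure sets_eq_imp_space_eq[OF sP] sets_eq_imp_space_eq[OF sQ])
  qed simp
qed auto

text \<open>Schoenberg's space-filling curve, by which Helly's selection theorem on the real line yields compactness
  of laws on a cube of any dimension. The profile vanishes on \<open>[0, 1/3] + 2\<int>\<close> and equals one on
  \<open>[2/3, 1] + 2\<int>\<close>, so that evaluating it at \<open>3\<^sup>k y\<close> reads off the \<open>k\<close>-th digit of a point \<open>y\<close> of the
  Cantor set.\<close>

definition schoenberg :: "real \<Rightarrow> real" where
  "schoenberg y = max 0 (min 1 (3 * (arccos (cos (pi * y)) / pi) - 1))"

lemma schoenberg_continuous: "continuous_on UNIV schoenberg"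
  unfolding schoenberg_def by (intro continuous_intros) auto

lemma schoenberg_bounds: "0 \<le> schoenberg y" "schoenberg y \<le> 1"
  by (auto simp: schoenberg_def)

lemma schoenberg_periodic: "schoenberg (y + 2 * real m) = schoenberg y"
proof -
  have "cos (pi * (y + 2 * real m)) = cos (pi * y + (2 * pi) * real m)"
    by (simp add: algebra_simps)
  also have "\<dots> = cos (pi * y)"
    using cos.plus_of_nat[of "pi * y" m] by (simp add: mult.commute mult.left_commute)
  finally show ?thesis by (simp add: schoenberg_def)
qed

lemma schoenberg_low: "0 \<le> y \<Longrightarrow> y \<le> 1 / 3 \<Longrightarrow> schoenberg y = 0"
  by (simp add: schoenberg_def arccos_cos field_simps)

lemma schoenberg_high: "2 / 3 \<le> y \<Longrightarrow> y \<le> 1 \<Longrightarrow> schoenberg y = 1"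
  by (simp add: schoenberg_def arccos_cos field_simps)

definition cantor_point :: "(nat \<Rightarrow> real) \<Rightarrow> real" where
  "cantor_point b = (\<Sum>m. 2 * b m / 3 ^ Suc m)"

lemma cantor_point_summable:
  assumes "\<And>m. 0 \<le> b m" "\<And>m. b m \<le> 1"
  shows "summable (\<lambda>m. 2 * b m / 3 ^ Suc m :: real)"
proof (rule summable_comparison_test')
  show "summable (\<lambda>m. 2 / 3 * (1 / 3 :: real) ^ m)" by (intro summable_mult summable_geometric) auto
  show "norm (2 * b m / 3 ^ Suc m) \<le> 2 / 3 * (1 / 3) ^ m" for m
    using assms[of m] by (simp add: power_one_over field_simps)
qed

lemma cantor_point_bounds:
  assumes "\<And>m. 0 \<le> b m" "\<And>m. b m \<le> 1"
  shows "0 \<le> cantor_point b" "cantor_point b \<le> 1"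
proof -
  note s = cantor_point_summable[of b, OF assms]
  show "0 \<le> cantor_point b" unfolding cantor_point_def
    using s assms by (intro suminf_nonneg) auto
  have g: "(\<lambda>m. 2 / 3 * (1 / 3 :: real) ^ m) sums (2 / 3 * (1 / (1 - 1 / 3)))"
    by (intro sums_mult geometric_sums) auto
  have "cantor_point b \<le> (\<Sum>m. 2 / 3 * (1 / 3) ^ m)" unfolding cantor_point_def
  proof (rule suminf_le[OF _ s])
    show "2 * b m / 3 ^ Suc m \<le> 2 / 3 * (1 / 3) ^ m" for m
      using assms[of m] by (simp add: power_one_over field_simps)
    show "summable (\<lambda>m. 2 / 3 * (1 / 3 :: real) ^ m)" using g by (simp add: sums_iff)
  qed
  then show "cantor_point b \<le> 1" using g by (simp add: sums_iff)
qed

text \<open>Multiplication by 3 shifts the ternary digits. The digit split off is 0 or 2, so the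
  integer part stays even and is invisible to the profile of period 2. The remaining point lies in
  the first or the last third according to its leading digit, and there the profile is
  constant.\<close>

lemma schoenberg_cantor_point:
  assumes b: "\<And>m. b m = 0 \<or> b m = (1::real)"
  shows "schoenberg (3 ^ k * cantor_point b) = b k"
proof -
  have b01: "0 \<le> b m" "b m \<le> 1" for m using b[of m] by auto
  note s = cantor_point_summable[of b, OF b01]
  have shift: "3 * cantor_point b = 2 * b 0 + cantor_point (\<lambda>m. b (Suc m))"
    if b: "\<And>m. b m = 0 \<or> b m = 1" for b :: "nat \<Rightarrow> real"
  proof -
    have b01: "0 \<le> b m" "b m \<le> 1" for m using b[of m] by auto
    have "cantor_point b = 2 * b 0 / 3 + (\<Sum>m. 2 * b (Suc m) / 3 ^ Suc (Suc m))"
      unfolding cantor_point_def using suminf_split_head[OF cantor_point_summable[of b, OF b01]] by simp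
    also have "(\<Sum>m. 2 * b (Suc m) / 3 ^ Suc (Suc m)) = (\<Sum>m. 1 / 3 * (2 * b (Suc m) / 3 ^ Suc m))"
      by simp
    also have "\<dots> = 1 / 3 * cantor_point (\<lambda>m. b (Suc m))"
      unfolding cantor_point_def using b01 by (intro suminf_mult cantor_point_summable) auto
    finally show ?thesis by simp
  qed
  have "\<exists>n. 3 ^ k * cantor_point b = 2 * real n + cantor_point (\<lambda>m. b (k + m))"
  proof (induction k)
    case 0
    then show ?case by (auto intro: exI[of _ 0])
  next
    case (Suc k)
    then obtain n where "3 ^ k * cantor_point b = 2 * real n + cantor_point (\<lambda>m. b (k + m))" by blast
    then have "3 ^ Suc k * cantor_point b = 6 * real n + 3 * cantor_point (\<lambda>m. b (k + m))" by simp
    also have "\<dots> = 6 * real n + 2 * b k + cantor_point (\<lambda>m. b (Suc k + m))"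
      using shift[of "\<lambda>m. b (k + m)"] b by simp
    also have "\<dots> = 2 * real (3 * n + (if b k = 0 then 0 else 1)) + cantor_point (\<lambda>m. b (Suc k + m))"
      using b[of k] by auto
    finally show ?case by blast
  qed
  then obtain n where "3 ^ k * cantor_point b = cantor_point (\<lambda>m. b (k + m)) + 2 * real n" by (auto simp: add.commute)
  then have "schoenberg (3 ^ k * cantor_point b) = schoenberg (cantor_point (\<lambda>m. b (k + m)))"
    by (simp add: schoenberg_periodic)
  also have "\<dots> = b k"
  proof -
    have 1: "3 * cantor_point (\<lambda>m. b (k + m)) = 2 * b k + cantor_point (\<lambda>m. b (Suc k + m))"
      using shift[of "\<lambda>m. b (k + m)"] b by simp
    have 2: "0 \<le> cantor_point (\<lambda>m. b (Suc k + m))" "cantor_point (\<lambda>m. b (Suc k + m)) \<le> 1"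
      using b01 by (intro cantor_point_bounds; simp)+
    from b[of k] show ?thesis
    proof
      assume "b k = 0"
      then show ?thesis using 1 2 by (subst schoenberg_low) auto
    next
      assume "b k = 1"
      then show ?thesis using 1 2 by (subst schoenberg_high) auto
    qed
  qed
  finally show ?thesis .
qed

text \<open>Digits by floors, which makes measurability immediate; they recover \<open>u\<close>
  when it is nonnegative and less than 1.\<close>

definition binary_digit :: "nat \<Rightarrow> real \<Rightarrow> real" where
  "binary_digit i u = real_of_int (\<lfloor>2 ^ Suc i * u\<rfloor> - 2 * \<lfloor>2 ^ i * u\<rfloor>)"

lemma binary_digit_cases: "binary_digit i u = 0 \<or> binary_digit i u = 1"
proof -
  have "2 * \<lfloor>2 ^ i * u\<rfloor> \<le> \<lfloor>2 ^ Suc i * u\<rfloor>"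
    by (simp add: le_floor_iff)
  moreover have "\<lfloor>2 ^ Suc i * u\<rfloor> < 2 * \<lfloor>2 ^ i * u\<rfloor> + 2"
    by (simp add: floor_less_iff) (use floor_correct[of "2 ^ i * u"] in linarith)
  ultimately have "\<lfloor>2 ^ Suc i * u\<rfloor> - 2 * \<lfloor>2 ^ i * u\<rfloor> \<in> {0, 1}" by auto
  then show ?thesis unfolding binary_digit_def by auto
qed

lemma binary_digit_measurable[measurable]: "binary_digit i \<in> borel_measurable borel"
  unfolding binary_digit_def by measurable

lemma binary_digits_sums:
  assumes u: "0 \<le> u" "u < 1"
  shows "(\<lambda>i. binary_digit i u / 2 ^ Suc i) sums u"
proof -
  have part: "(\<Sum>i<n. binary_digit i u / 2 ^ Suc i) = \<lfloor>2 ^ n * u\<rfloor> / 2 ^ n" for n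
  proof (induction n)
    case 0
    have "\<lfloor>u\<rfloor> = 0" using u by (simp add: floor_eq_iff)
    then show ?case by simp
  next
    case (Suc n)
    then show ?case by (simp add: binary_digit_def field_simps)
  qed
  have "(\<lambda>n. u - (1 / 2) ^ n) \<longlonglongrightarrow> u - 0" by (intro tendsto_intros LIMSEQ_power_zero) auto
  then have l: "(\<lambda>n. u - (1 / 2) ^ n) \<longlonglongrightarrow> u" by simp
  have "(\<lambda>n. \<lfloor>2 ^ n * u\<rfloor> / 2 ^ n) \<longlonglongrightarrow> u"
  proof (rule tendsto_sandwich[OF _ _ l tendsto_const])
    show "\<forall>\<^sub>F n in sequentially. u - (1 / 2) ^ n \<le> \<lfloor>2 ^ n * u\<rfloor> / 2 ^ n"
    proof (intro always_eventually allI)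
      fix n
      have "2 ^ n * u - 1 \<le> \<lfloor>2 ^ n * u\<rfloor>" by linarith
      then have "(2 ^ n * u - 1) / 2 ^ n \<le> \<lfloor>2 ^ n * u\<rfloor> / 2 ^ n" by (intro divide_right_mono) auto
      then show "u - (1 / 2) ^ n \<le> \<lfloor>2 ^ n * u\<rfloor> / 2 ^ n" by (simp add: diff_divide_distrib power_one_over)
    qed
    show "\<forall>\<^sub>F n in sequentially. \<lfloor>2 ^ n * u\<rfloor> / 2 ^ n \<le> u"
      by (intro always_eventually allI) (simp add: divide_le_eq mult.commute)
  qed
  then show ?thesis unfolding sums_def part .
qed

text \<open>\<open>T\<close> interleaves the binary digits of all coordinates into one Cantor point,
  and \<open>\<psi>\<close> reads them off again with Schoenberg's profile. The decoder
  \<open>\<psi>\<close> is continuous, the encoder \<open>T\<close> merely measurable; weak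
  convergence asks for no more.\<close>

lemma space_filling:
  obtains T :: "'a::euclidean_space \<Rightarrow> real" and \<psi> :: "real \<Rightarrow> 'a" where
    "T \<in> borel_measurable borel" "\<And>x. 0 \<le> T x" "\<And>x. T x \<le> 1"
    "continuous_on UNIV \<psi>" "\<And>x. infnorm x \<le> 1 \<Longrightarrow> \<psi> (T x) = x"
proof -
  define n where "n = DIM('a)"
  have n: "0 < n" by (simp add: n_def)
  obtain \<beta> where \<beta>: "bij_betw \<beta> {..<n} (Basis :: 'a set)"
    using ex_bij_betw_nat_finite[OF finite_Basis] by (auto simp: n_def atLeast0LessThan)
  define idx where "idx = inv_into {..<n} \<beta>"
  have idx: "idx b < n" "\<beta> (idx b) = b" if "b \<in> Basis" for b
    using that \<beta> bij_betw_inv_into_right[OF \<beta>] bij_betw_apply[OF bij_betw_inv_into[OF \<beta>], of b]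
    by (auto simp: idx_def)
  \<comment> \<open>Digit \<open>i\<close> of the coordinate with index \<open>j\<close> is stored
    at position \<open>n * i + j\<close>. The rescaling sends coordinates between -1 and 1 into the
    interval from 1/4 to 3/4, safely below 1, where the expansion would fail.\<close>
  define B where "B x m = binary_digit (m div n) ((x \<bullet> \<beta> (m mod n) + 2) / 4)" for x :: 'a and m
  define T where "T x = cantor_point (B x)" for x
  define \<psi> where "\<psi> y = (\<Sum>b\<in>Basis. (4 * (\<Sum>i. schoenberg (3 ^ (n * i + idx b) * y) / 2 ^ Suc i) - 2) *\<^sub>R b)" for y
  have B01: "B x m = 0 \<or> B x m = 1" for x m unfolding B_def by (rule binary_digit_cases)
  then have B01': "0 \<le> B x m" "B x m \<le> 1" for x m by (metis order_refl zero_le_one)+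
  show ?thesis
  proof
    show "T \<in> borel_measurable borel" unfolding T_def cantor_point_def B_def
      by measurable
    show "0 \<le> T x" "T x \<le> 1" for x unfolding T_def using B01' by (intro cantor_point_bounds; simp)+
    have "continuous_on UNIV (\<lambda>y. \<Sum>i. schoenberg (3 ^ (n * i + j) * y) / 2 ^ Suc i)" for j
    proof (rule uniform_limit_theorem[OF _ Weierstrass_m_test])
      show "\<forall>\<^sub>F k in sequentially. continuous_on UNIV (\<lambda>y. \<Sum>i<k. schoenberg (3 ^ (n * i + j) * y) / 2 ^ Suc i)"
        by (intro always_eventually allI continuous_intros continuous_on_compose2[OF schoenberg_continuous]) auto
      show "summable (\<lambda>i. (1 / 2) ^ Suc i :: real)"
        by (subst summable_Suc_iff) (rule summable_geometric, simp)
      show "norm (schoenberg (3 ^ (n * i + j) * y) / 2 ^ Suc i) \<le> (1 / 2) ^ Suc i" for i y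
        using schoenberg_bounds[of "3 ^ (n * i + j) * y"] by (simp add: power_one_over divide_simps)
    qed simp
    then show "continuous_on UNIV \<psi>" unfolding \<psi>_def by (intro continuous_intros)
    show "\<psi> (T x) = x" if x: "infnorm x \<le> 1" for x
    proof -
      have "4 * (\<Sum>i. schoenberg (3 ^ (n * i + idx b) * T x) / 2 ^ Suc i) - 2 = x \<bullet> b" if b: "b \<in> Basis" for b
      proof -
        have "schoenberg (3 ^ (n * i + idx b) * T x) = binary_digit i ((x \<bullet> b + 2) / 4)" for i
          unfolding T_def by (subst schoenberg_cantor_point) (use B01 idx[OF b] n in \<open>auto simp: B_def\<close>)
        moreover have "\<bar>x \<bullet> b\<bar> \<le> 1" using Basis_le_infnorm[OF b, of x] x by simp
        then have "(\<lambda>i. binary_digit i ((x \<bullet> b + 2) / 4) / 2 ^ Suc i) sums ((x \<bullet> b + 2) / 4)"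
          by (intro binary_digits_sums) auto
        ultimately show ?thesis by (simp add: sums_iff)
      qed
      then show ?thesis unfolding \<psi>_def by (simp add: euclidean_representation)
    qed
  qed
qed

section \<open>Compactness and weak limits of laws on the cube\<close>

lemma tendsto_of_subsubsequences:
  fixes X :: "nat \<Rightarrow> real"
  assumes "\<And>s. strict_mono s \<Longrightarrow> \<exists>r. strict_mono (r :: nat \<Rightarrow> nat) \<and> (\<lambda>n. X (s (r n))) \<longlonglongrightarrow> l"
  shows "X \<longlonglongrightarrow> l"
proof (rule ccontr)
  assume "\<not> X \<longlonglongrightarrow> l"
  then obtain e where e: "0 < e" "\<And>N. \<exists>n\<ge>N. e \<le> dist (X n) l"
    unfolding lim_sequentially by (meson not_le)
  then have "infinite {n. e \<le> dist (X n) l}" by (simp add: infinite_nat_iff_unbounded_le)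
  then obtain s :: "nat \<Rightarrow> nat" where s: "strict_mono s" "\<And>n. e \<le> dist (X (s n)) l"
    using infinite_enumerate by (metis mem_Collect_eq)
  then obtain r where "(\<lambda>n. X (s (r n))) \<longlonglongrightarrow> l" using assms by blast
  then obtain N where "dist (X (s (r N))) l < e" using e unfolding lim_sequentially by blast
  with s(2)[of "r N"] show False by simp
qed

text \<open>The images under \<open>T\<close> live on the unit interval and are tight; a limit on
  the real line is sent back by \<open>\<psi>\<close>. For continuous \<open>g\<close> the
  composition with \<open>\<psi>\<close> is continuous, and on the cube \<open>\<psi>\<close> undoes
  \<open>T\<close>, so the integrals of \<open>g\<close> converge.\<close>

lemma bounded_support_convergent_subsequence:
  fixes \<mu> :: "nat \<Rightarrow> 'a::euclidean_space measure"
  assumes \<mu>: "\<And>n. prob_space (\<mu> n)" "\<And>n. sets (\<mu> n) = sets borel" "\<And>n. AE x in \<mu> n. infnorm x \<le> 1"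
  obtains r :: "nat \<Rightarrow> nat" and \<pi> where "strict_mono r" "prob_space \<pi>" "sets \<pi> = sets borel"
    "weakly_converges (\<lambda>n. \<mu> (r n)) \<pi>"
proof -
  obtain T :: "'a \<Rightarrow> real" and \<psi> where [measurable]: "T \<in> borel_measurable borel"
    and T: "\<And>x. 0 \<le> T x" "\<And>x. T x \<le> 1"
    and \<psi>: "continuous_on UNIV \<psi>" "\<And>x. infnorm x \<le> 1 \<Longrightarrow> \<psi> (T x) = x"
    by (rule space_filling) blast
  have [measurable]: "\<psi> \<in> borel_measurable borel" using \<psi>(1) by (rule borel_measurable_continuous_onI)
  note [measurable_cong] = \<mu>(2)
  define \<nu> where "\<nu> n = distr (\<mu> n) borel T" for n
  have \<nu>: "real_distribution (\<nu> n)" for n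
  proof -
    interpret prob_space "\<mu> n" by (rule \<mu>)
    show ?thesis unfolding \<nu>_def by (rule real_distribution_distr) measurable
  qed
  have "tight \<nu>" unfolding tight_def
  proof (intro conjI allI impI)
    show "real_distribution (\<nu> n)" for n by (rule \<nu>)
    fix \<epsilon> :: real assume "0 < \<epsilon>"
    have "measure (\<nu> n) {-1<..2} = 1" for n
    proof -
      interpret prob_space "\<mu> n" by (rule \<mu>)
      have "-1 < T x" "T x \<le> 2" for x using T(1)[of x] T(2)[of x] by linarith+
      then have "T -` {-1<..2} = UNIV" by auto
      then show ?thesis using prob_space by (simp add: \<nu>_def measure_distr sets_eq_imp_space_eq[OF \<mu>(2)])
    qed
    then show "\<exists>a b. a < b \<and> (\<forall>n. 1 - \<epsilon> < measure (\<nu> n) {a<..b})"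
      using \<open>0 < \<epsilon>\<close> by (intro exI[of _ "-1"] exI[of _ 2]) auto
  qed
  then obtain r N where r: "strict_mono r" and N: "real_distribution N" and w: "weak_conv_m (\<nu> \<circ> id \<circ> r) N"
    using tight_imp_convergent_subsubsequence[of \<nu> id] by (auto simp: strict_mono_id)
  interpret N: real_distribution N by (rule N)
  show ?thesis
  proof
    show "strict_mono r" by (rule r)
    show "prob_space (distr N borel \<psi>)" by (rule N.prob_space_distr) measurable
    show "sets (distr N borel \<psi>) = sets borel" by simp
    show "weakly_converges (\<lambda>n. \<mu> (r n)) (distr N borel \<psi>)" unfolding weakly_converges_def
    proof (intro allI impI)
    fix g :: "'a \<Rightarrow> real" assume g1: "continuous_on UNIV g" and "bounded (range g)"
    then obtain B where "\<And>x. \<bar>g x\<bar> \<le> B" by (auto simp: bounded_iff)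
    note g = g1 this
    have [measurable]: "g \<in> borel_measurable borel" using g(1) by (rule borel_measurable_continuous_onI)
    have "continuous_on UNIV (\<lambda>y. g (\<psi> y))"
      using continuous_on_compose2[OF g(1) \<psi>(1)] by simp
    then have "isCont (\<lambda>y. g (\<psi> y)) y" for y by (simp add: continuous_on_eq_continuous_at)
    then have "(\<lambda>n. \<integral>y. g (\<psi> y) \<partial>\<nu> (r n)) \<longlonglongrightarrow> (\<integral>y. g (\<psi> y) \<partial>N)"
      using weak_conv_imp_integral_bdd_continuous_conv[OF _ N w, of "\<lambda>y. g (\<psi> y)" B] \<nu> g(2) by simp
    moreover have "(\<integral>y. g (\<psi> y) \<partial>\<nu> n) = (\<integral>x. g x \<partial>\<mu> n)" for n
    proof -
      have "(\<integral>y. g (\<psi> y) \<partial>\<nu> n) = (\<integral>x. g (\<psi> (T x)) \<partial>\<mu> n)"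
        unfolding \<nu>_def by (rule integral_distr) measurable
      also have "\<dots> = (\<integral>x. g x \<partial>\<mu> n)"
        by (rule integral_cong_AE) (use \<mu>(3)[of n] \<psi>(2) in auto)
      finally show ?thesis .
    qed
    ultimately show "(\<lambda>n. \<integral>x. g x \<partial>\<mu> (r n)) \<longlonglongrightarrow> (\<integral>x. g x \<partial>distr N borel \<psi>)"
      by (simp add: integral_distr)
    qed
  qed
qed

lemma weakly_convergesD:
  fixes g :: "'a::topological_space \<Rightarrow> real"
  assumes "weakly_converges P Q" "continuous_on UNIV g" "\<And>x. \<bar>g x\<bar> \<le> B"
  shows "(\<lambda>n. \<integral>x. g x \<partial>P n) \<longlonglongrightarrow> (\<integral>x. g x \<partial>Q)"
proof -
  have "bounded (range g)" using assms(3) by (auto simp: bounded_iff)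
  then show ?thesis using assms(1,2) unfolding weakly_converges_def by blast
qed

text \<open>Each subsequence has a further weakly convergent one, and convergence of the integrals
  of Lipschitz functions forces all these limits to agree.\<close>

lemma bounded_support_weak_limit:
  fixes \<mu> :: "nat \<Rightarrow> 'a::euclidean_space measure"
  assumes \<mu>: "\<And>n. prob_space (\<mu> n)" "\<And>n. sets (\<mu> n) = sets borel" "\<And>n. AE x in \<mu> n. infnorm x \<le> 1"
    and conv: "\<And>(g :: 'a \<Rightarrow> real) B L. (\<And>x. \<bar>g x\<bar> \<le> B) \<Longrightarrow> (\<And>x y. \<bar>g x - g y\<bar> \<le> L * dist x y) \<Longrightarrow>
      convergent (\<lambda>n. \<integral>x. g x \<partial>\<mu> n)"
  obtains \<pi> where "prob_space \<pi>" "sets \<pi> = sets borel" "weakly_converges \<mu> \<pi>" "AE x in \<pi>. infnorm x \<le> 1"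
proof -
  obtain r :: "nat \<Rightarrow> nat" and \<pi> where r: "strict_mono r" and \<pi>: "prob_space \<pi>" "sets \<pi> = sets borel"
    and "weakly_converges (\<lambda>n. \<mu> (r n)) \<pi>"
    by (rule bounded_support_convergent_subsequence[of \<mu>, OF \<mu>])
  note c = weakly_convergesD[OF this(4)]
  have Lcont: "continuous_on UNIV g" if "\<And>x y. \<bar>g x - g y\<bar> \<le> L * dist x y" for g :: "'a \<Rightarrow> real" and L
  proof -
    have "(max L 0)-lipschitz_on UNIV g"
    proof (rule lipschitz_onI)
      fix x y :: 'a
      have "L * dist x y \<le> max L 0 * dist x y" by (intro mult_right_mono) auto
      then show "dist (g x) (g y) \<le> max L 0 * dist x y" using that[of x y] by (simp add: dist_real_def)
    qed simp
    then show ?thesis by (rule lipschitz_on_continuous_on)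
  qed
  have lim: "(\<lambda>n. \<integral>x. g x \<partial>\<mu> n) \<longlonglongrightarrow> (\<integral>x. g x \<partial>\<pi>)"
    if g: "continuous_on UNIV g" "\<And>x. \<bar>g x\<bar> \<le> B" for g :: "'a \<Rightarrow> real" and B
  proof (rule tendsto_of_subsubsequences)
    fix s :: "nat \<Rightarrow> nat" assume s: "strict_mono s"
    obtain r' :: "nat \<Rightarrow> nat" and \<pi>' where r': "strict_mono r'" and \<pi>': "prob_space \<pi>'" "sets \<pi>' = sets borel"
      and "weakly_converges (\<lambda>n. \<mu> (s (r' n))) \<pi>'"
      by (rule bounded_support_convergent_subsequence[of "\<lambda>n. \<mu> (s n)", OF \<mu>(1) \<mu>(2) \<mu>(3)])
    note c' = weakly_convergesD[OF this(4)]
    have "\<pi>' = \<pi>"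
    proof (rule measure_eqI_Lipschitz[OF \<pi>'(1) \<pi>(1) \<pi>'(2) \<pi>(2)])
      fix g :: "'a \<Rightarrow> real" and B L
      assume gB: "\<And>x. \<bar>g x\<bar> \<le> B" and gL: "\<And>x y. \<bar>g x - g y\<bar> \<le> L * dist x y"
      obtain l where l: "(\<lambda>n. \<integral>x. g x \<partial>\<mu> n) \<longlonglongrightarrow> l"
        using conv[OF gB gL] by (auto simp: convergent_def)
      have "(\<lambda>n. \<integral>x. g x \<partial>\<mu> (r n)) \<longlonglongrightarrow> l"
        using LIMSEQ_subseq_LIMSEQ[OF l r] by (simp add: o_def)
      then have "l = (\<integral>x. g x \<partial>\<pi>)" using c[OF Lcont[OF gL] gB] by (rule LIMSEQ_unique)
      moreover have "(\<lambda>n. \<integral>x. g x \<partial>\<mu> (s (r' n))) \<longlonglongrightarrow> l"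
        using LIMSEQ_subseq_LIMSEQ[OF l strict_mono_o[OF s r']] by (simp add: o_def)
      then have "l = (\<integral>x. g x \<partial>\<pi>')" using c'[OF Lcont[OF gL] gB] by (rule LIMSEQ_unique)
      ultimately show "(\<integral>x. g x \<partial>\<pi>') = (\<integral>x. g x \<partial>\<pi>)" by simp
    qed
    then show "\<exists>r. strict_mono r \<and> (\<lambda>n. \<integral>x. g x \<partial>\<mu> (s (r n))) \<longlonglongrightarrow> (\<integral>x. g x \<partial>\<pi>)"
      using r' c'[OF g] by blast
  qed
  interpret \<pi>: prob_space \<pi> by (rule \<pi>)
  note [measurable_cong] = \<pi>(2) \<mu>(2)
  have "AE x in \<pi>. infnorm x \<le> 1"
  proof -
    \<comment> \<open>A bounded continuous function that vanishes exactly on the cube carries the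
      support condition over to the limit.\<close>
    define g :: "'a \<Rightarrow> real" where "g x = min 1 (max 0 (infnorm x - 1))" for x
    have gc: "continuous_on UNIV g" unfolding g_def by (intro continuous_intros)
    then have [measurable]: "g \<in> borel_measurable borel" by (rule borel_measurable_continuous_onI)
    have g01: "\<bar>g x\<bar> \<le> 1" "0 \<le> g x" for x by (auto simp: g_def)
    have "(\<integral>x. g x \<partial>\<mu> n) = (\<integral>x. 0 \<partial>\<mu> n)" for n
    proof (rule integral_cong_AE)
      show "AE x in \<mu> n. g x = 0" using \<mu>(3)[of n] by eventually_elim (simp add: g_def)
    qed measurable
    then have "(\<lambda>n. 0) \<longlonglongrightarrow> (\<integral>x. g x \<partial>\<pi>)" using lim[OF gc g01(1)] by simp
    then have "(\<integral>x. g x \<partial>\<pi>) = 0" by (simp add: LIMSEQ_const_iff)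
    moreover have "integrable \<pi> g" by (rule \<pi>.integrable_const_bound[where B = 1]) (use g01 in auto)
    ultimately have "AE x in \<pi>. g x = 0" using g01 by (subst (asm) integral_nonneg_eq_0_iff_AE) auto
    then show ?thesis by eventually_elim (auto simp: g_def)
  qed
  moreover have "weakly_converges \<mu> \<pi>"
    unfolding weakly_converges_def bounded_iff using lim by auto
  ultimately show ?thesis using that[OF \<pi>] by blast
qed

lemma weak_limit_unique:
  fixes P :: "nat \<Rightarrow> 'a::metric_space measure"
  assumes "prob_space Q" "sets Q = sets borel" "weakly_converges P Q"
    and "prob_space R" "sets R = sets borel" "weakly_converges P R"
  shows "Q = R"
proof (rule measure_eqI_Lipschitz[OF assms(1,4,2,5)])
  fix g :: "'a \<Rightarrow> real" and B L
  assume gB: "\<And>x. \<bar>g x\<bar> \<le> B" and gL: "\<And>x y. \<bar>g x - g y\<bar> \<le> L * dist x y"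
  have "(max L 0)-lipschitz_on UNIV g"
  proof (rule lipschitz_onI)
    fix x y :: 'a
    have "L * dist x y \<le> max L 0 * dist x y" by (intro mult_right_mono) auto
    then show "dist (g x) (g y) \<le> max L 0 * dist x y" using gL[of x y] by (simp add: dist_real_def)
  qed simp
  then have "continuous_on UNIV g" by (rule lipschitz_on_continuous_on)
  moreover have "bounded (range g)" using gB by (auto simp: bounded_iff)
  ultimately show "(\<integral>x. g x \<partial>Q) = (\<integral>x. g x \<partial>R)"
    using assms(3,6) LIMSEQ_unique unfolding weakly_converges_def by blast
qed

section \<open>The learning recursion\<close>

lemma continuous_on_output_direction [continuous_intros]:
  fixes f :: "'a::topological_space \<Rightarrow> ('d::finite, 'n::finite) rtrl_state"
  assumes lam: "smooth_bounded lam" and f: "continuous_on A f"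
  shows "continuous_on A (\<lambda>x. output_direction lam (f x))"
proof -
  have eq: "output_direction lam st =
      ((\<chi> i j. \<Sum>k\<in>UNIV. lam (weights_B (fst st) $ k) * fst (snd (snd st)) $ i $ j $ k),
       (\<chi> i j. \<Sum>k\<in>UNIV. lam (weights_B (fst st) $ k) * snd (snd (snd st)) $ i $ j $ k),
       (\<chi> k. deriv lam (weights_B (fst st) $ k) * fst (snd st) $ k), deriv lam (bias (fst st)))" for st :: "('d, 'n) rtrl_state"
    by (simp add: output_direction_def weights_defs split: prod.split)
  show ?thesis unfolding eq
    by (intro continuous_intros f continuous_on_compose2[OF smooth_bounded_continuous(1)[OF lam]]
        continuous_on_compose2[OF smooth_bounded_continuous(2)[OF lam]]) auto
qed

lemma continuous_on_rtrl_step: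
  fixes f :: "'a::topological_space \<Rightarrow> ('d::finite, 'n::finite) rtrl_state"
  assumes \<phi>: "smooth_bounded \<phi>" and lam: "smooth_bounded lam"
    and x: "continuous_on A x" and y: "continuous_on A y" and f: "continuous_on A f"
  shows "continuous_on A (\<lambda>p. rtrl_step \<phi> lam a (x p) (y p) (f p))"
proof -
  have eq: "rtrl_step \<phi> lam a x y st =
      (fst st - a *\<^sub>R (- (y - net_out lam (fst st) (fst (snd st))) *\<^sub>R output_direction lam st),
       rnn_step \<phi> (fst st) x (fst (snd st)),
       (\<chi> i j k. deriv sigmoid (net_pre \<phi> (fst st) x (fst (snd st)) k) *
       (1 / real CARD('d) * (if i = k then 1 else 0) * deriv \<phi> (weights_A (fst st) $ i $ j) * x $ j
        + 1 / real CARD('n) * (\<Sum>l\<in>UNIV. \<phi> (weights_W (fst st) $ k $ l) * fst (snd (snd st)) $ i $ j $ l))),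
       (\<chi> i j k. deriv sigmoid (net_pre \<phi> (fst st) x (fst (snd st)) k) *
       (1 / real CARD('n) * (if i = k then 1 else 0) * deriv \<phi> (weights_W (fst st) $ i $ j) * fst (snd st) $ j
        + 1 / real CARD('n) * (\<Sum>l\<in>UNIV. \<phi> (weights_W (fst st) $ k $ l) * snd (snd (snd st)) $ i $ j $ l))))"
    for st :: "('d, 'n) rtrl_state" and x y
    using rtrl_step_eq[of \<phi> lam a x y "fst st" "fst (snd st)" "fst (snd (snd st))" "snd (snd (snd st))"]
      rtrl_gradient_eq[of lam y "fst st" "fst (snd st)" "fst (snd (snd st))" "snd (snd (snd st))"]
    by (simp add: sensitivity_A_step_def sensitivity_W_step_def preactivation_nth)
  show ?thesis unfolding eq deriv_sigmoid
    by (intro continuous_intros x y f lam continuous_on_compose2[OF smooth_bounded_continuous(1)[OF \<phi>]]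
        continuous_on_compose2[OF smooth_bounded_continuous(2)[OF \<phi>]] continuous_on_compose2[OF sigmoid_continuous]
        smooth_bounded_continuous(1)[OF \<phi>]) auto
qed

lemma sensitivity_bound:
  fixes SA :: "real ^ 'n::finite ^ 'd::finite ^ 'n" and SW :: "real ^ 'n ^ 'n ^ 'n"
  assumes SA: "\<And>i j k. \<bar>SA $ i $ j $ k\<bar> \<le> m" and SW: "\<And>i j k. \<bar>SW $ i $ j $ k\<bar> \<le> m"
  shows "norm (sensitivity SA SW \<tau>) \<le> real CARD('n) * (real CARD('n) * (real CARD('d) * m) + real CARD('n) * (real CARD('n) * m)) * norm \<tau>"
proof -
  have "\<bar>\<Sum>i\<in>UNIV. \<Sum>j\<in>UNIV. SA $ i $ j $ k * weights_A \<tau> $ i $ j\<bar> \<le> (\<Sum>i\<in>(UNIV :: 'n set). \<Sum>j\<in>(UNIV :: 'd set). m * norm \<tau>)" for k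
    by (rule order_trans[OF sum_abs sum_mono[OF order_trans[OF sum_abs sum_mono]]]) (intro abs_mult_le SA weights_le_norm)
  moreover have "\<bar>\<Sum>i\<in>UNIV. \<Sum>j\<in>UNIV. SW $ i $ j $ k * weights_W \<tau> $ i $ j\<bar> \<le> (\<Sum>i\<in>(UNIV :: 'n set). \<Sum>j\<in>(UNIV :: 'n set). m * norm \<tau>)" for k
    by (rule order_trans[OF sum_abs sum_mono[OF order_trans[OF sum_abs sum_mono]]]) (intro abs_mult_le SW weights_le_norm)
  ultimately have "\<bar>sensitivity SA SW \<tau> $ k\<bar> \<le> real CARD('n) * (real CARD('d) * (m * norm \<tau>)) + real CARD('n) * (real CARD('n) * (m * norm \<tau>))" for k
    unfolding sensitivity_def vec_lambda_beta by (intro abs_add_le) simp_all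
  then have "(\<Sum>k\<in>UNIV. \<bar>sensitivity SA SW \<tau> $ k\<bar>) \<le> of_nat CARD('n) * (real CARD('n) * (real CARD('d) * (m * norm \<tau>)) + real CARD('n) * (real CARD('n) * (m * norm \<tau>)))"
    by (intro sum_bounded_above) auto
  then have "norm (sensitivity SA SW \<tau>) \<le> \<dots>" by (rule order_trans[OF norm_le_l1_cart])
  then show ?thesis by (simp add: algebra_simps)
qed

text \<open>The old sensitivities return with the factor \<open>C / 4\<close>, as the memory does,
  so a bound \<open>m\<close> beyond the fixed point of the affine recursion is preserved entry by
  entry.\<close>

lemma sensitivity_step_bound:
  assumes \<phi>: "\<And>y. \<bar>\<phi> y\<bar> \<le> C" "\<And>y. \<bar>deriv \<phi> y\<bar> \<le> P1" and m: "1 / 4 * P1 + 1 / 4 * (C * m) \<le> m"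
    and x: "infnorm x \<le> 1" and s: "infnorm s \<le> 1"
    and SA: "\<And>i j k. \<bar>SA $ i $ j $ k\<bar> \<le> m" and SW: "\<And>i j k. \<bar>SW $ i $ j $ k\<bar> \<le> m"
  shows "\<bar>sensitivity_A_step \<phi> (weights_A \<theta>) (weights_W \<theta>) x s SA $ i $ j $ k\<bar> \<le> m"
    and "\<bar>sensitivity_W_step \<phi> (weights_A \<theta>) (weights_W \<theta>) x s SW $ i $ l $ k\<bar> \<le> m"
proof -
  have ds: "\<bar>deriv sigmoid y\<bar> \<le> 1 / 4" for y using deriv_sigmoid_bound[of y] by simp
  have xj: "\<bar>x $ j\<bar> \<le> 1" for j using component_le_infnorm_cart[of x j] x by simp
  have sj: "\<bar>s $ j\<bar> \<le> 1" for j using component_le_infnorm_cart[of s j] s by simp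
  have one: "\<bar>1 / real CARD('y::finite) * (if b then 1 else 0)\<bar> \<le> 1" for b by (simp add: divide_le_eq)
  have "1 / 4 * (1 * P1 * 1 + C * m) \<le> m" using m by (simp add: distrib_left)
  moreover have "\<bar>sensitivity_A_step \<phi> (weights_A \<theta>) (weights_W \<theta>) x s SA $ i $ j $ k\<bar> \<le> 1 / 4 * (1 * P1 * 1 + C * m)"
    unfolding sensitivity_A_step_def vec_lambda_beta
    by (intro abs_mult_le abs_add_le average_le ds one \<phi> xj SA)
  moreover have "\<bar>sensitivity_W_step \<phi> (weights_A \<theta>) (weights_W \<theta>) x s SW $ i $ l $ k\<bar> \<le> 1 / 4 * (1 * P1 * 1 + C * m)"
    unfolding sensitivity_W_step_def vec_lambda_beta
    by (intro abs_mult_le abs_add_le average_le ds one \<phi> sj SW)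
  ultimately show "\<bar>sensitivity_A_step \<phi> (weights_A \<theta>) (weights_W \<theta>) x s SA $ i $ j $ k\<bar> \<le> m"
    "\<bar>sensitivity_W_step \<phi> (weights_A \<theta>) (weights_W \<theta>) x s SW $ i $ l $ k\<bar> \<le> m" by linarith+
qed

section \<open>The data process and its one-step expectations\<close>

locale recurrent_learning = prob_space M
  for M :: "'w measure" +
  fixes X :: "nat \<Rightarrow> 'w \<Rightarrow> real ^ 'd::finite" and Z :: "nat \<Rightarrow> 'w \<Rightarrow> real ^ 'z::finite" and \<eta> :: "nat \<Rightarrow> 'w \<Rightarrow> real"
    and K :: "(real ^ 'd) \<times> (real ^ 'z) \<Rightarrow> ((real ^ 'd) \<times> (real ^ 'z)) measure" and \<mu>\<eta> :: "real measure"
    and f :: "real ^ 'd \<Rightarrow> real ^ 'z \<Rightarrow> real \<Rightarrow> real" and \<phi> lam :: "real \<Rightarrow> real" and Lp Lf C Clam :: real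
  assumes chain: "markov_chain M K (\<lambda>t \<omega>. (X t \<omega>, Z t \<omega>))"
    and \<eta>_indep: "indep_vars (\<lambda>_. borel) \<eta> UNIV" and \<eta>_law: "\<And>t. distr M borel (\<eta> t) = \<mu>\<eta>"
    and data_indep: "independent_of M path_space (\<lambda>\<omega> t. (X t \<omega>, Z t \<omega>)) path_space (\<lambda>\<omega> t. \<eta> t \<omega>)"
    and Lp0: "0 \<le> Lp" and Lp1: "Lp < 1"
    and Wass: "\<And>w w'. Wass2 (K w) (K w') \<le> ennreal (Lp * infnorm (w - w'))"
    and f_Lip: "\<And>x z e x' z' e'. \<bar>f x z e - f x' z' e'\<bar> \<le> Lf * infnorm ((x, z, e) - (x', z', e'))"
    and data_box: "\<And>t. AE \<omega> in M. infnorm (X t \<omega>, Z t \<omega>) \<le> 1"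
    and f_bound: "\<And>x z e. \<bar>f x z e\<bar> \<le> Lf"
    and \<phi>_smooth: "smooth_bounded \<phi>" and lam_smooth: "smooth_bounded lam"
    and \<phi>_bound: "\<And>y. \<bar>\<phi> y\<bar> \<le> C" and lam_bound: "\<And>y. \<bar>lam y\<bar> \<le> Clam" and C4: "C < 4"
begin

text \<open>\<open>VV \<omega>\<close> and \<open>H \<omega>\<close> are the complete paths of data
  and noise; quantities of the algorithm become measurable functions of this pair. \<open>v\<close>
  is the clipped datum, almost surely equal to the datum.\<close>

definition VV :: "'w \<Rightarrow> nat \<Rightarrow> (real ^ 'd) \<times> (real ^ 'z)" where "VV \<omega> t = (X t \<omega>, Z t \<omega>)"
definition H :: "'w \<Rightarrow> nat \<Rightarrow> real" where "H \<omega> t = \<eta> t \<omega>"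
definition v :: "nat \<Rightarrow> 'w \<Rightarrow> (real ^ 'd) \<times> (real ^ 'z)" where "v t \<omega> = clip (X t \<omega>, Z t \<omega>)"

lemma K_measurable[measurable]: "K \<in> borel \<rightarrow>\<^sub>M prob_algebra borel"
  using chain by (simp add: markov_chain_def)

lemma XZ_measurable[measurable]: "(\<lambda>\<omega>. (X t \<omega>, Z t \<omega>)) \<in> borel_measurable M"
  using chain by (simp add: markov_chain_def)

lemma \<eta>_measurable[measurable]: "\<eta> t \<in> borel_measurable M"
  using \<eta>_indep by (simp add: indep_vars_def)

lemma \<mu>\<eta>_prob: "prob_space \<mu>\<eta>" and \<mu>\<eta>_sets[measurable_cong]: "sets \<mu>\<eta> = sets borel"
proof -
  have "prob_space (distr M borel (\<eta> 0))" by (rule prob_space_distr) measurable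
  then show "prob_space \<mu>\<eta>" by (simp add: \<eta>_law)
  have "sets (distr M borel (\<eta> 0)) = sets borel" by simp
  then show "sets \<mu>\<eta> = sets borel" by (simp only: \<eta>_law)
qed

lemma VV_measurable[measurable]: "VV \<in> M \<rightarrow>\<^sub>M path_space"
  unfolding VV_def[abs_def] by (rule measurable_PiM_single') auto

lemma H_measurable[measurable]: "H \<in> M \<rightarrow>\<^sub>M path_space"
  unfolding H_def[abs_def] by (rule measurable_PiM_single') auto

lemma v_measurable[measurable]: "v t \<in> borel_measurable M"
  unfolding v_def by measurable

lemma v_box: "infnorm (v t \<omega>) \<le> 1"
  by (simp add: v_def clip_box)

lemma v_eq: "AE \<omega> in M. \<forall>t. v t \<omega> = (X t \<omega>, Z t \<omega>)"
  unfolding AE_all_countable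
proof
  show "AE \<omega> in M. v t \<omega> = (X t \<omega>, Z t \<omega>)" for t
    using data_box[of t] by eventually_elim (simp add: v_def clip_id)
qed

lemma VH_distr: "distr M (path_space \<Otimes>\<^sub>M path_space) (\<lambda>\<omega>. (VV \<omega>, H \<omega>)) = distr M path_space VV \<Otimes>\<^sub>M distr M path_space H"
  using independent_of_distr[OF data_indep] by (simp add: VV_def[abs_def] H_def[abs_def])

definition \<kappa> :: "(real ^ 'd) \<times> (real ^ 'z) \<Rightarrow> ((real ^ 'd) \<times> (real ^ 'z)) measure" where
  "\<kappa> = clipped_kernel K"

sublocale contractive_system \<kappa> "\<lambda>(\<theta> :: ('d, 'n::finite) params) v s. rnn_step \<phi> \<theta> (fst v) s" Lp "C / 4" "C / 4"
  unfolding \<kappa>_def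
  by (rule rnn_contractive_system[OF clipped_kernel_measurable[OF K_measurable] clipped_kernel_cube[OF K_measurable]
        clipped_kernel_contraction[OF K_measurable Wass Lp0] Lp0 Lp1 \<phi>_smooth \<phi>_bound C4])

text \<open>The noise path is independent of the data path and may be frozen, after which the Markov
  property of the data alone applies. Hence \<open>g\<close> may look at all of the noise, but at
  the data only up to time \<open>t\<close>. Passing from \<open>K\<close> to the clipped kernel is
  an almost sure equality.\<close>

lemma Markov_step:
  fixes g :: "(nat \<Rightarrow> (real ^ 'd) \<times> (real ^ 'z)) \<Rightarrow> (nat \<Rightarrow> real) \<Rightarrow> (real ^ 'd) \<times> (real ^ 'z) \<Rightarrow> real"
  assumes g[measurable]: "(\<lambda>((p, h), w). g p h w) \<in> borel_measurable ((path_space \<Otimes>\<^sub>M path_space) \<Otimes>\<^sub>M borel)"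
    and b: "\<And>p h w. infnorm w \<le> 1 \<Longrightarrow> \<bar>g p h w\<bar> \<le> c"
    and past: "\<And>p p' h w. (\<And>s. s \<le> t \<Longrightarrow> p s = p' s) \<Longrightarrow> g p h w = g p' h w"
  shows "(\<integral>\<omega>. g (VV \<omega>) (H \<omega>) (v (Suc t) \<omega>) \<partial>M) = (\<integral>\<omega>. (\<integral>w. g (VV \<omega>) (H \<omega>) w \<partial>\<kappa> (v t \<omega>)) \<partial>M)"
proof -
  note [measurable_cong] = kernel_sets(1)[OF K_measurable]
  have gm[measurable (raw)]: "(\<lambda>x. g (a x) (b x) (c x)) \<in> borel_measurable N"
    if "a \<in> N \<rightarrow>\<^sub>M path_space" "b \<in> N \<rightarrow>\<^sub>M path_space" "c \<in> borel_measurable N" for a b c and N :: "'x measure"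
    using measurable_compose[OF measurable_Pair[OF measurable_Pair[OF that(1,2)] that(3)] g] by simp
  have bc: "\<bar>g p h (clip w)\<bar> \<le> c" for p h w by (rule b[OF clip_box])
  have tr: "g (\<lambda>s. p (min s t)) h w = g p h w" for p h w by (rule past) (simp add: min_absorb1)
  interpret HD: prob_space "distr M path_space H" by (rule prob_space_distr) measurable
  have past_h: "(\<integral>\<omega>. g (VV \<omega>) h (clip (VV \<omega> (Suc t))) \<partial>M) = (\<integral>\<omega>. (\<integral>w. g (VV \<omega>) h (clip w) \<partial>K (VV \<omega> t)) \<partial>M)" for h
  proof -
    have [measurable]: "h \<in> space path_space" by (simp add: space_PiM)
    have "(\<integral>\<omega>. g (\<lambda>s. VV \<omega> (min s t)) h (clip (VV \<omega> (Suc t))) \<partial>M)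
        = (\<integral>\<omega>. (\<integral>w. g (\<lambda>s. VV \<omega> (min s t)) h (clip w) \<partial>K (VV \<omega> t)) \<partial>M)"
      using Markov_past_expectation[OF chain, of "\<lambda>p w. g p h (clip w)" c t] bc by (simp add: VV_def)
    then show ?thesis by (simp add: tr)
  qed
  have [measurable]: "(\<lambda>p. p t) \<in> borel_measurable (path_space :: (nat \<Rightarrow> (real ^ 'd) \<times> (real ^ 'z)) measure)" for t
    by (rule measurable_component_singleton) simp
  have Km[measurable]: "(\<lambda>p. K (p t)) \<in> path_space \<rightarrow>\<^sub>M prob_algebra borel"
    by (rule measurable_compose[OF _ K_measurable]) measurable
  have intm: "(\<lambda>(p, h). \<integral>w. g p h (clip w) \<partial>K (p t)) \<in> borel_measurable (path_space \<Otimes>\<^sub>M path_space)"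
    unfolding case_prod_beta by (rule integral_measurable_kernel[where N = borel]) measurable
  have intb: "\<bar>\<integral>w. g p h (clip w) \<partial>K (p t)\<bar> \<le> c" for p h
  proof -
    interpret P: prob_space "K (p t)" by (rule kernel_sets(2)[OF K_measurable])
    have [measurable]: "p \<in> space path_space" "h \<in> space path_space" by (simp_all add: space_PiM)
    have "(\<lambda>w. g p h (clip w)) \<in> borel_measurable (K (p t))"
      by (rule gm[OF measurable_const measurable_const])
        (simp_all add: space_PiM measurable_cong_sets[OF kernel_sets(1)[OF K_measurable] refl] clip_measurable)
    then have "integrable (K (p t)) (\<lambda>w. g p h (clip w))"
      using bc[of p h] by (intro P.integrable_const_bound[where B = c]) (simp_all only: real_norm_def AE_I2)
    then have "(\<integral>w. g p h (clip w) \<partial>K (p t)) \<le> c" "-c \<le> (\<integral>w. g p h (clip w) \<partial>K (p t))"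
      using bc by (auto intro!: P.integral_le_const P.integral_ge_const AE_I2 simp: abs_le_iff minus_le_iff)
    then show ?thesis by simp
  qed
  have "(\<integral>\<omega>. g (VV \<omega>) (H \<omega>) (v (Suc t) \<omega>) \<partial>M) = (\<integral>\<omega>. (\<lambda>p h. g p h (clip (p (Suc t)))) (VV \<omega>) (H \<omega>) \<partial>M)"
    by (simp add: v_def VV_def)
  also have "\<dots> = (\<integral>h. (\<integral>\<omega>. g (VV \<omega>) h (clip (VV \<omega> (Suc t))) \<partial>M) \<partial>distr M path_space H)"
    by (rule independent_expectation(2)[OF VV_measurable H_measurable VH_distr _ bc]) measurable
  also have "\<dots> = (\<integral>h. (\<integral>\<omega>. (\<lambda>p h. \<integral>w. g p h (clip w) \<partial>K (p t)) (VV \<omega>) h \<partial>M) \<partial>distr M path_space H)"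
    by (simp add: past_h)
  also have "\<dots> = (\<integral>\<omega>. (\<lambda>p h. \<integral>w. g p h (clip w) \<partial>K (p t)) (VV \<omega>) (H \<omega>) \<partial>M)"
    by (rule independent_expectation(2)[OF VV_measurable H_measurable VH_distr intm intb, symmetric])
  also have "\<dots> = (\<integral>\<omega>. (\<integral>w. g (VV \<omega>) (H \<omega>) w \<partial>\<kappa> (v t \<omega>)) \<partial>M)"
  proof (rule integral_cong_AE)
    show "AE \<omega> in M. (\<integral>w. g (VV \<omega>) (H \<omega>) (clip w) \<partial>K (VV \<omega> t)) = (\<integral>w. g (VV \<omega>) (H \<omega>) w \<partial>\<kappa> (v t \<omega>))"
      using data_box[of t]
    proof eventually_elim
      case (elim \<omega>)
      have [measurable]: "VV \<omega> \<in> space path_space" "H \<omega> \<in> space path_space" by (simp_all add: space_PiM)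
      show ?case unfolding \<kappa>_def
        by (subst clipped_kernel_integral[OF K_measurable]) (use elim in \<open>simp_all add: v_def VV_def clip_id clip_box\<close>)
    qed
    show "(\<lambda>\<omega>. \<integral>w. g (VV \<omega>) (H \<omega>) (clip w) \<partial>K (VV \<omega> t)) \<in> borel_measurable M"
      using measurable_compose[OF measurable_Pair[OF VV_measurable H_measurable] intm] by simp
    show "(\<lambda>\<omega>. \<integral>w. g (VV \<omega>) (H \<omega>) w \<partial>\<kappa> (v t \<omega>)) \<in> borel_measurable M"
      by (rule \<kappa>_integral_measurable) measurable
  qed
  finally show ?thesis .
qed

text \<open>The counterpart of \<open>Markov_step\<close> with the roles exchanged: the complete
  data path is frozen, and \<open>\<eta> t\<close> is independent of the earlier noise, on which
  alone \<open>g\<close> may depend otherwise.\<close>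

lemma noise_step:
  fixes g :: "(nat \<Rightarrow> (real ^ 'd) \<times> (real ^ 'z)) \<Rightarrow> (nat \<Rightarrow> real) \<Rightarrow> real \<Rightarrow> real"
  assumes g[measurable]: "(\<lambda>((p, h), e). g p h e) \<in> borel_measurable ((path_space \<Otimes>\<^sub>M path_space) \<Otimes>\<^sub>M borel)"
    and b: "\<And>p h e. \<bar>g p h e\<bar> \<le> c"
    and past: "\<And>p h h' e. (\<And>s. s < t \<Longrightarrow> h s = h' s) \<Longrightarrow> g p h e = g p h' e"
  shows "(\<integral>\<omega>. g (VV \<omega>) (H \<omega>) (\<eta> t \<omega>) \<partial>M) = (\<integral>\<omega>. (\<integral>e. g (VV \<omega>) (H \<omega>) e \<partial>\<mu>\<eta>) \<partial>M)"
proof -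
  have gm[measurable (raw)]: "(\<lambda>x. g (a x) (b x) (c x)) \<in> borel_measurable N"
    if "a \<in> N \<rightarrow>\<^sub>M path_space" "b \<in> N \<rightarrow>\<^sub>M path_space" "c \<in> borel_measurable N" for a b c and N :: "'x measure"
    using measurable_compose[OF measurable_Pair[OF measurable_Pair[OF that(1,2)] that(3)] g] by simp
  have [measurable]: "(\<lambda>p. p t) \<in> borel_measurable (path_space :: (nat \<Rightarrow> real) measure)" for t
    by (rule measurable_component_singleton) simp
  interpret VD: prob_space "distr M path_space VV" by (rule prob_space_distr) measurable
  interpret \<mu>\<eta>: prob_space \<mu>\<eta> by (rule \<mu>\<eta>_prob)
  \<comment> \<open>Truncation to the noise before \<open>t\<close>, filled up with 0; by
    \<open>past\<close> it leaves \<open>g\<close> unchanged.\<close>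
  define R where "R = (\<lambda>h :: nat \<Rightarrow> real. \<lambda>s. if s < t then h s else 0)"
  have R1: "R \<in> PiM {..<t} (\<lambda>_. borel) \<rightarrow>\<^sub>M path_space" unfolding R_def
  proof (rule measurable_PiM_single')
    show "(\<lambda>h. if s < t then h s else 0) \<in> borel_measurable (PiM {..<t} (\<lambda>_. borel))" for s
      by (cases "s < t") auto
  qed auto
  \<comment> \<open>\<open>\<eta> t\<close> as a constant path, which gives it the same codomain as
    the truncated noise path, as \<open>indep_var\<close> asks; it is read off again at index
    0.\<close>
  define E where "E = (\<lambda>\<omega>. \<lambda>s :: nat. \<eta> t \<omega>)"
  have E[measurable]: "E \<in> M \<rightarrow>\<^sub>M path_space" unfolding E_def by (rule measurable_PiM_single') auto
  have RH: "R (H \<omega>) = (R \<circ> (\<lambda>\<omega>. restrict (\<lambda>i. \<eta> i \<omega>) {..<t})) \<omega>" for \<omega> by (auto simp: R_def H_def)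
  have "indep_var (PiM {..<t} (\<lambda>_. borel)) (\<lambda>\<omega>. restrict (\<lambda>i. \<eta> i \<omega>) {..<t}) (PiM {t} (\<lambda>_. borel)) (\<lambda>\<omega>. restrict (\<lambda>i. \<eta> i \<omega>) {t})"
    by (rule indep_var_restrict[OF \<eta>_indep]) auto
  then have "indep_var path_space (R \<circ> (\<lambda>\<omega>. restrict (\<lambda>i. \<eta> i \<omega>) {..<t})) path_space ((\<lambda>h s. h t) \<circ> (\<lambda>\<omega>. restrict (\<lambda>i. \<eta> i \<omega>) {t}))"
    by (rule indep_var_compose[OF _ R1]) (rule measurable_PiM_single', rule measurable_component_singleton, auto)
  then have "indep_var path_space (\<lambda>\<omega>. R (H \<omega>)) path_space E"
    unfolding RH by (simp add: o_def E_def)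
  then have ind: "distr M (path_space \<Otimes>\<^sub>M path_space) (\<lambda>\<omega>. (R (H \<omega>), E \<omega>)) = distr M path_space (\<lambda>\<omega>. R (H \<omega>)) \<Otimes>\<^sub>M distr M path_space E"
    by (simp add: indep_var_distribution_eq)
  have R2[measurable]: "R \<in> path_space \<rightarrow>\<^sub>M path_space" unfolding R_def
    by (rule measurable_PiM_single') auto
  have tr: "g p (R h) e = g p h e" for p h e by (rule past) (simp add: R_def)
  have HV: "distr M (path_space \<Otimes>\<^sub>M path_space) (\<lambda>\<omega>. (H \<omega>, VV \<omega>)) = distr M path_space H \<Otimes>\<^sub>M distr M path_space VV"
  proof -
    interpret HD: prob_space "distr M path_space H" by (rule prob_space_distr) measurable
    interpret P: pair_prob_space "distr M path_space H" "distr M path_space VV" ..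
    have "distr M path_space H \<Otimes>\<^sub>M distr M path_space VV
      = distr (distr M path_space VV \<Otimes>\<^sub>M distr M path_space H) (distr M path_space H \<Otimes>\<^sub>M distr M path_space VV) (\<lambda>(x, y). (y, x))"
      by (rule P.distr_pair_swap)
    also have "\<dots> = distr (distr M (path_space \<Otimes>\<^sub>M path_space) (\<lambda>\<omega>. (VV \<omega>, H \<omega>))) (path_space \<Otimes>\<^sub>M path_space) (\<lambda>(x, y). (y, x))"
      unfolding VH_distr by (intro distr_cong refl) (simp cong: sets_pair_measure_cong)
    also have "\<dots> = distr M (path_space \<Otimes>\<^sub>M path_space) (\<lambda>\<omega>. (H \<omega>, VV \<omega>))"
      by (subst distr_distr) (auto simp: o_def)
    finally show ?thesis ..
  qed
  have past_v: "(\<integral>\<omega>. g p (H \<omega>) (H \<omega> t) \<partial>M) = (\<integral>\<omega>. (\<integral>e. g p (H \<omega>) e \<partial>\<mu>\<eta>) \<partial>M)" for p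
  proof -
    have [measurable]: "p \<in> space path_space" by (simp add: space_PiM)
    have "(\<integral>\<omega>. g p (R (H \<omega>)) (E \<omega> 0) \<partial>M) = (\<integral>\<omega>. (\<integral>h. g p (R (H \<omega>)) (h 0) \<partial>distr M path_space E) \<partial>M)"
      by (rule independent_expectation(1)[OF _ E ind _ b]) measurable
    moreover have "(\<integral>h. g p q (h 0) \<partial>distr M path_space E) = (\<integral>e. g p q e \<partial>distr M borel (\<eta> t))" for q
    proof -
      have [measurable]: "q \<in> space path_space" by (simp add: space_PiM)
      have "(\<integral>h. g p q (h 0) \<partial>distr M path_space E) = (\<integral>\<omega>. g p q (E \<omega> 0) \<partial>M)"
        by (rule integral_distr) measurable
      also have "\<dots> = (\<integral>e. g p q e \<partial>distr M borel (\<eta> t))"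
        unfolding E_def by (rule integral_distr[symmetric]) measurable
      finally show ?thesis .
    qed
    ultimately have "(\<integral>\<omega>. g p (R (H \<omega>)) (\<eta> t \<omega>) \<partial>M) = (\<integral>\<omega>. (\<integral>e. g p (R (H \<omega>)) e \<partial>distr M borel (\<eta> t)) \<partial>M)"
      by (simp add: E_def)
    then show ?thesis by (simp add: tr \<eta>_law H_def)
  qed
  have intb: "\<bar>\<integral>e. g p h e \<partial>\<mu>\<eta>\<bar> \<le> c" for p h
  proof -
    have [measurable]: "p \<in> space path_space" "h \<in> space path_space" by (simp_all add: space_PiM)
    have "(\<lambda>e. g p h e) \<in> borel_measurable \<mu>\<eta>"
      by (rule gm[OF measurable_const measurable_const])
        (simp_all add: space_PiM measurable_ident_sets[OF \<mu>\<eta>_sets])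
    then have "integrable \<mu>\<eta> (\<lambda>e. g p h e)"
      using b[of p h] by (intro \<mu>\<eta>.integrable_const_bound[where B = c]) (simp_all only: real_norm_def AE_I2)
    then have "(\<integral>e. g p h e \<partial>\<mu>\<eta>) \<le> c" "-c \<le> (\<integral>e. g p h e \<partial>\<mu>\<eta>)"
      using b by (auto intro!: \<mu>\<eta>.integral_le_const \<mu>\<eta>.integral_ge_const AE_I2 simp: abs_le_iff minus_le_iff)
    then show ?thesis by simp
  qed
  have "(\<integral>\<omega>. g (VV \<omega>) (H \<omega>) (\<eta> t \<omega>) \<partial>M) = (\<integral>\<omega>. (\<lambda>h p. g p h (h t)) (H \<omega>) (VV \<omega>) \<partial>M)" by (simp add: H_def)
  also have "\<dots> = (\<integral>p. (\<integral>\<omega>. g p (H \<omega>) (H \<omega> t) \<partial>M) \<partial>distr M path_space VV)"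
    by (rule independent_expectation(2)[OF H_measurable VV_measurable HV _ b]) measurable
  also have "\<dots> = (\<integral>p. (\<integral>\<omega>. (\<lambda>h p. \<integral>e. g p h e \<partial>\<mu>\<eta>) (H \<omega>) p \<partial>M) \<partial>distr M path_space VV)"
    by (simp add: past_v)
  also have "\<dots> = (\<integral>\<omega>. (\<lambda>h p. \<integral>e. g p h e \<partial>\<mu>\<eta>) (H \<omega>) (VV \<omega>) \<partial>M)"
    by (rule independent_expectation(2)[OF H_measurable VV_measurable HV _ intb, symmetric]) measurable
  finally show ?thesis .
qed

end

section \<open>The stationary law\<close>

lemma continuous_on_integral_bounded:
  fixes g :: "'a::metric_space \<times> 'b::metric_space \<Rightarrow> real"
  assumes N: "prob_space N" "sets N = sets borel" and g: "continuous_on UNIV g" "\<And>z. \<bar>g z\<bar> \<le> B"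
    and meas: "\<And>y. (\<lambda>e. g (y, e)) \<in> borel_measurable borel"
  shows "continuous_on UNIV (\<lambda>y. \<integral>e. g (y, e) \<partial>N)"
proof (rule continuous_at_imp_continuous_on, rule ballI)
  interpret prob_space N by (rule N)
  note [measurable_cong] = N(2)
  note [measurable] = meas
  fix y :: 'a
  show "isCont (\<lambda>y. \<integral>e. g (y, e) \<partial>N) y"
  proof (rule continuous_at_sequentiallyI)
    fix u assume u: "u \<longlonglongrightarrow> y"
    show "(\<lambda>n. \<integral>e. g (u n, e) \<partial>N) \<longlonglongrightarrow> (\<integral>e. g (y, e) \<partial>N)"
    proof (rule integral_dominated_convergence[where w = "\<lambda>_. B"])
      show "AE e in N. (\<lambda>n. g (u n, e)) \<longlonglongrightarrow> g (y, e)"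
      proof (rule AE_I2)
        fix e :: 'b
        have "(\<lambda>n. (u n, e)) \<longlonglongrightarrow> (y, e)" using u by (intro tendsto_intros)
        moreover have "isCont g (y, e)" using g(1) by (simp add: continuous_on_eq_continuous_at)
        ultimately show "(\<lambda>n. g (u n, e)) \<longlonglongrightarrow> g (y, e)" by (rule isCont_tendsto_compose[rotated])
      qed
    qed (use g(2) in auto)
  qed
qed

context recurrent_learning
begin

definition hid :: "('d, 'n::finite) params \<Rightarrow> nat \<Rightarrow> 'w \<Rightarrow> real ^ 'n" where
  "hid \<theta> t \<omega> = rnn_state \<phi> \<theta> (\<lambda>s. fst (v s \<omega>)) t"

lemma rnn_state_past:
  "(\<And>s. s < t \<Longrightarrow> x s = y s) \<Longrightarrow> rnn_state \<phi> \<theta> x t = rnn_state \<phi> \<theta> y t"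
  by (induction t) auto

lemma rnn_state_measurable[measurable]:
  "(\<lambda>p. rnn_state \<phi> \<theta> (\<lambda>s. fst (clip (p s))) t) \<in> borel_measurable (path_space :: (nat \<Rightarrow> (real ^ 'd) \<times> (real ^ 'z)) measure)"
proof (induction t)
  case (Suc t)
  note [measurable] = Suc
  have [measurable]: "(\<lambda>p. p t) \<in> borel_measurable (path_space :: (nat \<Rightarrow> (real ^ 'd) \<times> (real ^ 'z)) measure)" for t
    by (rule measurable_component_singleton) simp
  show ?case unfolding rnn_state.simps by measurable
qed simp

lemma rnn_state_measurable'[measurable (raw)]:
  fixes a :: "'x \<Rightarrow> nat \<Rightarrow> (real ^ 'd) \<times> (real ^ 'z)"
  assumes "a \<in> N \<rightarrow>\<^sub>M path_space"
  shows "(\<lambda>x. rnn_state \<phi> \<theta> (\<lambda>s. fst (clip (a x s))) t) \<in> borel_measurable N"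
  by (rule measurable_compose[OF assms rnn_state_measurable])

lemma hid_VV: "hid \<theta> t \<omega> = rnn_state \<phi> \<theta> (\<lambda>s. fst (clip (VV \<omega> s))) t"
  by (simp add: hid_def v_def VV_def)

lemma hid_measurable[measurable]: "hid \<theta> t \<in> borel_measurable M"
  unfolding hid_VV[abs_def] by measurable

lemma hid_box: "infnorm (hid \<theta> t \<omega>) \<le> 1"
  unfolding hid_def by (cases t) (simp_all add: infnorm_0 rnn_step_box)

text \<open>The Markov step applies because the memory at time \<open>Suc t\<close> is a function of
  the data up to time \<open>t\<close>.\<close>

lemma expectation_evol:
  fixes \<theta> :: "('d, 'n::finite) params"
  assumes h: "Lip_bdd B b a h" and b: "0 \<le> b" and a: "0 \<le> a"
  shows "(\<integral>\<omega>. h (hid \<theta> (Suc t) \<omega>) (v (Suc t) \<omega>) \<partial>M) = (\<integral>\<omega>. evol \<theta> h (hid \<theta> t \<omega>) (v t \<omega>) \<partial>M)"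
proof -
  note [measurable (raw)] = Lip_bdd_measurable[OF h]
  have hB: "\<bar>h s w\<bar> \<le> B" if "infnorm s \<le> 2" for s w using h that unfolding Lip_bdd_def by blast
  have "(\<integral>\<omega>. (\<lambda>p k w. h (rnn_state \<phi> \<theta> (\<lambda>s. fst (clip (p s))) (Suc t)) w) (VV \<omega>) (H \<omega>) (v (Suc t) \<omega>) \<partial>M)
      = (\<integral>\<omega>. (\<integral>w. (\<lambda>p k w. h (rnn_state \<phi> \<theta> (\<lambda>s. fst (clip (p s))) (Suc t)) w) (VV \<omega>) (H \<omega>) w \<partial>\<kappa> (v t \<omega>)) \<partial>M)"
  proof (rule Markov_step[where c = B])
    show "(\<lambda>((p :: nat \<Rightarrow> (real ^ 'd) \<times> (real ^ 'z), k :: nat \<Rightarrow> real), w). h (rnn_state \<phi> \<theta> (\<lambda>s. fst (clip (p s))) (Suc t)) w)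
        \<in> borel_measurable ((path_space \<Otimes>\<^sub>M path_space) \<Otimes>\<^sub>M borel)"
      unfolding case_prod_beta case_prod_beta'
      by (rule Lip_bdd_measurable[OF h rnn_state_measurable'[OF measurable_compose[OF measurable_fst measurable_fst]] measurable_snd])
    show "\<bar>h (rnn_state \<phi> \<theta> (\<lambda>s. fst (clip (p s))) (Suc t)) w\<bar> \<le> B" for p :: "nat \<Rightarrow> (real ^ 'd) \<times> (real ^ 'z)" and w
      by (rule hB) (use rnn_step_box[of \<phi> \<theta>] in \<open>simp add: order_trans[OF rnn_step_box]\<close>)
    show "h (rnn_state \<phi> \<theta> (\<lambda>s. fst (clip (p s))) (Suc t)) w = h (rnn_state \<phi> \<theta> (\<lambda>s. fst (clip (p' s))) (Suc t)) w"
      if "\<And>s. s \<le> t \<Longrightarrow> p s = p' s" for p p' :: "nat \<Rightarrow> (real ^ 'd) \<times> (real ^ 'z)" and w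
      using rnn_state_past[of "Suc t" "\<lambda>s. fst (clip (p s))" "\<lambda>s. fst (clip (p' s))" \<theta>] that by simp
  qed
  then show ?thesis by (simp add: hid_VV[symmetric] evol_def) (simp add: hid_VV v_def VV_def)
qed

lemma expectation_evol_iterate:
  fixes \<theta> :: "('d, 'n::finite) params"
  assumes h: "Lip_bdd B b a h" and b: "0 \<le> b" and a: "0 \<le> a"
  shows "(\<integral>\<omega>. (evol \<theta> ^^ k) h (hid \<theta> t \<omega>) (v t \<omega>) \<partial>M) = (\<integral>\<omega>. (evol \<theta> ^^ (k + t)) h 0 (v 0 \<omega>) \<partial>M)"
proof (induction t arbitrary: k)
  case 0
  then show ?case by (simp add: hid_def)
next
  case (Suc t)
  have "(\<integral>\<omega>. (evol \<theta> ^^ k) h (hid \<theta> (Suc t) \<omega>) (v (Suc t) \<omega>) \<partial>M) = (\<integral>\<omega>. evol \<theta> ((evol \<theta> ^^ k) h) (hid \<theta> t \<omega>) (v t \<omega>) \<partial>M)"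
    by (rule expectation_evol[OF Lip_bdd_evol_iterate[OF h b a]]) (use b rate Lip_gain_nonneg[OF b a] in auto)
  also have "\<dots> = (\<integral>\<omega>. (evol \<theta> ^^ Suc k) h (hid \<theta> t \<omega>) (v t \<omega>) \<partial>M)" by simp
  finally show ?case using Suc[of "Suc k"] by simp
qed

text \<open>Moving all \<open>t\<close> steps onto the function leaves the fixed start
  \<open>0\<close>, \<open>v 0\<close>, where the iterates are geometrically Cauchy.\<close>

lemma expectation_Lip_convergent:
  fixes \<theta> :: "('d, 'n::finite) params"
  assumes h: "Lip_bdd B b a h" and b: "0 \<le> b" and a: "0 \<le> a"
  shows "convergent (\<lambda>t. \<integral>\<omega>. h (hid \<theta> t \<omega>) (v t \<omega>) \<partial>M)"
proof -
  let ?c = "4 * b + 2 * Lip_gain b a"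
  have eq: "(\<integral>\<omega>. h (hid \<theta> t \<omega>) (v t \<omega>) \<partial>M) = (\<integral>\<omega>. (evol \<theta> ^^ t) h 0 (v 0 \<omega>) \<partial>M)" for t
    using expectation_evol_iterate[OF h b a, where k = 0 and t = t and \<theta> = \<theta>] by simp
  have [measurable]: "(\<lambda>\<omega>. (evol \<theta> ^^ t) h 0 (v 0 \<omega>)) \<in> borel_measurable M" for t
    using Lip_bdd_measurable[OF Lip_bdd_evol_iterate[OF h b a]] by measurable
  have i: "integrable M (\<lambda>\<omega>. (evol \<theta> ^^ t) h 0 (v 0 \<omega>))" for t
    by (rule integrable_const_bound[where B = B]) (use evol_iterate_bound[OF h b a, of 0] in \<open>auto simp: infnorm_0\<close>)
  have "\<bar>(\<integral>\<omega>. (evol \<theta> ^^ Suc t) h 0 (v 0 \<omega>) \<partial>M) - (\<integral>\<omega>. (evol \<theta> ^^ t) h 0 (v 0 \<omega>) \<partial>M)\<bar> \<le> ?c * rate ^ t" for t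
  proof -
    have pt: "\<bar>(evol \<theta> ^^ Suc t) h 0 (v 0 \<omega>) - (evol \<theta> ^^ t) h 0 (v 0 \<omega>)\<bar> \<le> ?c * rate ^ t" for \<omega>
      by (rule evol_iterate_Cauchy[OF h b a]) (simp_all add: infnorm_0 v_box)
    have "\<bar>\<integral>\<omega>. (evol \<theta> ^^ Suc t) h 0 (v 0 \<omega>) - (evol \<theta> ^^ t) h 0 (v 0 \<omega>) \<partial>M\<bar>
        \<le> (\<integral>\<omega>. \<bar>(evol \<theta> ^^ Suc t) h 0 (v 0 \<omega>) - (evol \<theta> ^^ t) h 0 (v 0 \<omega>)\<bar> \<partial>M)"
      by (rule integral_abs_bound)
    also have "\<dots> \<le> ?c * rate ^ t"
      by (rule integral_le_const) (use i[of t] i[of "Suc t"] pt in auto)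
    finally show ?thesis by (subst (asm) Bochner_Integration.integral_diff) (rule i)+
  qed
  from geometric_Cauchy(1)[OF rate(3,4) this] show ?thesis unfolding eq by (auto simp: convergent_def)
qed

lemma Lip_bdd_of_Lipschitz:
  fixes g :: "((real ^ 'd) \<times> (real ^ 'z)) \<times> (real ^ 'n::finite) \<Rightarrow> real"
  assumes g: "\<And>x. \<bar>g x\<bar> \<le> B" "\<And>x y. \<bar>g x - g y\<bar> \<le> L * dist x y"
  shows "\<exists>b a. 0 \<le> b \<and> 0 \<le> a \<and> Lip_bdd B b a (\<lambda>s w. g (w, s))"
proof (intro exI conjI)
  let ?b = "\<bar>L\<bar> * sqrt DIM(real ^ 'n)" and ?a = "\<bar>L\<bar> * sqrt DIM((real ^ 'd) \<times> (real ^ 'z))"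
  show "0 \<le> ?b" "0 \<le> ?a" by simp_all
  have "\<bar>L\<bar>-lipschitz_on UNIV g"
  proof (rule lipschitz_onI)
    fix x y :: "((real ^ 'd) \<times> (real ^ 'z)) \<times> (real ^ 'n)"
    have "L * dist x y \<le> \<bar>L\<bar> * dist x y" by (intro mult_right_mono) auto
    then show "dist (g x) (g y) \<le> \<bar>L\<bar> * dist x y" using g(2)[of x y] by (simp add: dist_real_def)
  qed simp
  note gc = lipschitz_on_continuous_on[OF this]
  show "Lip_bdd B ?b ?a (\<lambda>s w. g (w, s))" unfolding Lip_bdd_def
  proof (intro conjI allI impI)
    show "(\<lambda>(s, w). g (w, s)) \<in> borel_measurable borel"
      unfolding case_prod_beta
      by (intro borel_measurable_continuous_onI continuous_on_compose2[OF gc] continuous_intros) auto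
    show "\<bar>g (w, s)\<bar> \<le> B" for w s by (rule g)
    fix s s' :: "real ^ 'n" and w w' :: "(real ^ 'd) \<times> (real ^ 'z)"
    have "dist (w, s) (w', s') \<le> norm (w - w') + norm (s - s')"
      by (simp add: dist_norm norm_Pair sqrt_sum_squares_le_sum)
    also have "\<dots> \<le> sqrt DIM((real ^ 'd) \<times> (real ^ 'z)) * infnorm (w - w') + sqrt DIM(real ^ 'n) * infnorm (s - s')"
      by (intro add_mono norm_le_infnorm)
    finally have "\<bar>L\<bar> * dist (w, s) (w', s') \<le> \<bar>L\<bar> * \<dots>" by (intro mult_left_mono) auto
    moreover have "L * dist (w, s) (w', s') \<le> \<bar>L\<bar> * dist (w, s) (w', s')" by (intro mult_right_mono) auto
    ultimately show "\<bar>g (w, s) - g (w', s')\<bar> \<le> ?b * infnorm (s - s') + ?a * infnorm (w - w')"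
      using g(2)[of "(w, s)" "(w', s')"] by (simp add: algebra_simps)
  qed
qed

definition ylaw :: "('d, 'n::finite) params \<Rightarrow> nat \<Rightarrow> (((real ^ 'd) \<times> (real ^ 'z)) \<times> (real ^ 'n)) measure" where
  "ylaw \<theta> t = distr M borel (\<lambda>\<omega>. (v t \<omega>, hid \<theta> t \<omega>))"

lemma ylaw_integral:
  fixes g :: "((real ^ 'd) \<times> (real ^ 'z)) \<times> (real ^ 'n::finite) \<Rightarrow> real"
  assumes "g \<in> borel_measurable borel"
  shows "(\<integral>y. g y \<partial>ylaw \<theta> t) = (\<integral>\<omega>. g (v t \<omega>, hid \<theta> t \<omega>) \<partial>M)"
  unfolding ylaw_def by (rule integral_distr) (use assms in measurable)

lemma ylaw_limit:
  fixes \<theta> :: "('d, 'n::finite) params"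
  obtains \<pi> where "prob_space \<pi>" "sets \<pi> = sets borel" "weakly_converges (ylaw \<theta>) \<pi>" "AE y in \<pi>. infnorm y \<le> 1"
proof (rule bounded_support_weak_limit[of "ylaw \<theta>"])
  show "prob_space (ylaw \<theta> n)" for n unfolding ylaw_def by (rule prob_space_distr) measurable
  show "sets (ylaw \<theta> n) = sets borel" for n by (simp add: ylaw_def)
  have [measurable]: "(infnorm :: ((real ^ 'd) \<times> (real ^ 'z)) \<times> (real ^ 'n) \<Rightarrow> real) \<in> borel_measurable borel"
    by (intro borel_measurable_continuous_onI continuous_intros)
  show "AE y in ylaw \<theta> n. infnorm y \<le> 1" for n
    unfolding ylaw_def by (subst AE_distr_iff) (auto simp: infnorm_Pair v_box hid_box)
  fix g :: "((real ^ 'd) \<times> (real ^ 'z)) \<times> (real ^ 'n) \<Rightarrow> real" and B L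
  assume g: "\<And>x. \<bar>g x\<bar> \<le> B" "\<And>x y. \<bar>g x - g y\<bar> \<le> L * dist x y"
  obtain b a where ba: "0 \<le> b" "0 \<le> a" and h: "Lip_bdd B b a (\<lambda>s w. g (w, s))"
    using Lip_bdd_of_Lipschitz[OF g] by blast
  have "(\<lambda>x. (\<lambda>s w. g (w, s)) (snd x) (fst x)) \<in> borel_measurable borel"
    by (rule Lip_bdd_measurable[OF h]) measurable
  then have "g \<in> borel_measurable borel" by simp
  then show "convergent (\<lambda>n. \<integral>y. g y \<partial>ylaw \<theta> n)"
    using expectation_Lip_convergent[OF h ba, of \<theta>] by (simp add: ylaw_integral)
qed (rule that)

definition noisy :: "(((real ^ 'd) \<times> (real ^ 'z)) \<times> (real ^ 'n::finite)) measure \<Rightarrow> ((real ^ 'd) \<times> (real ^ 'z) \<times> (real ^ 'n) \<times> real) measure" where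
  "noisy \<pi> = distr (\<pi> \<Otimes>\<^sub>M \<mu>\<eta>) borel (\<lambda>(y, e). (fst (fst y), snd (fst y), snd y, e))"

lemma noisy_prob:
  assumes \<pi>: "prob_space \<pi>" and s: "sets \<pi> = sets borel"
  shows "prob_space (noisy \<pi>)" and "sets (noisy \<pi>) = sets borel"
proof -
  note [measurable_cong] = s
  interpret \<pi>: prob_space \<pi> by (rule \<pi>)
  interpret \<mu>\<eta>: prob_space \<mu>\<eta> by (rule \<mu>\<eta>_prob)
  interpret P: pair_prob_space \<pi> \<mu>\<eta> ..
  show "prob_space (noisy \<pi>)" unfolding noisy_def by (rule P.prob_space_distr) measurable
  show "sets (noisy \<pi>) = sets borel" by (simp add: noisy_def)
qed

lemma noisy_integral:
  fixes g :: "(real ^ 'd) \<times> (real ^ 'z) \<times> (real ^ 'n::finite) \<times> real \<Rightarrow> real"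
  assumes \<pi>: "prob_space \<pi>" and s: "sets \<pi> = sets borel" and g[measurable]: "g \<in> borel_measurable borel"
    and b: "AE y in \<pi>. \<forall>e. \<bar>g (fst (fst y), snd (fst y), snd y, e)\<bar> \<le> B"
  shows "(\<integral>z. g z \<partial>noisy \<pi>) = (\<integral>y. (\<integral>e. g (fst (fst y), snd (fst y), snd y, e) \<partial>\<mu>\<eta>) \<partial>\<pi>)"
proof -
  note [measurable_cong] = s
  interpret \<pi>: prob_space \<pi> by (rule \<pi>)
  interpret \<mu>\<eta>: prob_space \<mu>\<eta> by (rule \<mu>\<eta>_prob)
  interpret P: pair_prob_space \<pi> \<mu>\<eta> ..
  have "(\<integral>z. g z \<partial>noisy \<pi>) = (\<integral>z. (\<lambda>(y, e). g (fst (fst y), snd (fst y), snd y, e)) z \<partial>(\<pi> \<Otimes>\<^sub>M \<mu>\<eta>))"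
    unfolding noisy_def by (subst integral_distr) (auto simp: case_prod_beta')
  also have "\<dots> = (\<integral>y. (\<integral>e. g (fst (fst y), snd (fst y), snd y, e) \<partial>\<mu>\<eta>) \<partial>\<pi>)"
  proof (rule P.integral_fst[symmetric])
    have "AE z in \<pi> \<Otimes>\<^sub>M \<mu>\<eta>. norm ((\<lambda>(y, e). g (fst (fst y), snd (fst y), snd y, e)) z) \<le> B"
    proof (rule P.AE_pair_measure)
      show "AE x in \<pi>. AE y in \<mu>\<eta>. norm ((\<lambda>(y, e). g (fst (fst y), snd (fst y), snd y, e)) (x, y)) \<le> B"
        using b by eventually_elim simp
    qed measurable
    then show "integrable (\<pi> \<Otimes>\<^sub>M \<mu>\<eta>) (\<lambda>(y, e). g (fst (fst y), snd (fst y), snd y, e))"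
      by (intro P.integrable_const_bound[where B = B]) auto
  qed
  finally show ?thesis .
qed

lemma hid_AE: "AE \<omega> in M. \<forall>t. v t \<omega> = (X t \<omega>, Z t \<omega>) \<and> hid \<theta> t \<omega> = rnn_state \<phi> \<theta> (\<lambda>s. X s \<omega>) t"
  using v_eq by eventually_elim (simp add: hid_def)

text \<open>The noise at time \<open>t\<close> is independent of datum and memory at that time and
  can be integrated out, which leaves a function of the bounded pair.\<close>

lemma joint_law_integral:
  fixes g :: "(real ^ 'd) \<times> (real ^ 'z) \<times> (real ^ 'n::finite) \<times> real \<Rightarrow> real"
  assumes g: "continuous_on UNIV g" and b: "\<And>z. \<bar>g z\<bar> \<le> B"
  shows "(\<integral>z. g z \<partial>joint_law M \<phi> X Z \<eta> \<theta> t) = (\<integral>y. (\<integral>e. g (fst (fst y), snd (fst y), snd y, e) \<partial>\<mu>\<eta>) \<partial>ylaw \<theta> t)"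
proof -
  have [measurable]: "g \<in> borel_measurable borel" using g by (rule borel_measurable_continuous_onI)
  have [measurable]: "X s \<in> borel_measurable M" "Z s \<in> borel_measurable M" for s
    using measurable_compose[OF XZ_measurable[of s], of fst borel] measurable_compose[OF XZ_measurable[of s], of snd borel]
    by (simp_all add: borel_measurable_continuous_onI continuous_intros)
  have [measurable]: "rnn_state \<phi> \<theta> (\<lambda>s. X s \<omega>) t \<in> space borel" for \<omega> by simp
  have [measurable]: "(\<lambda>\<omega>. rnn_state \<phi> \<theta> (\<lambda>s. X s \<omega>) t) \<in> borel_measurable M" for t
  proof (induction t)
    case (Suc t)
    note [measurable] = Suc
    have "(\<lambda>\<omega>. rnn_step \<phi> \<theta> (fst (X t \<omega>, Z t \<omega>)) (rnn_state \<phi> \<theta> (\<lambda>s. X s \<omega>) t)) \<in> borel_measurable M"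
      by (rule F_measurable) measurable
    then show ?case by simp
  qed simp
  have [measurable]: "(\<lambda>p. p t) \<in> borel_measurable (path_space :: (nat \<Rightarrow> (real ^ 'd) \<times> (real ^ 'z)) measure)" for t
    by (rule measurable_component_singleton) simp
  interpret \<mu>\<eta>: prob_space \<mu>\<eta> by (rule \<mu>\<eta>_prob)
  have "(\<integral>z. g z \<partial>joint_law M \<phi> X Z \<eta> \<theta> t) = (\<integral>\<omega>. g (X t \<omega>, Z t \<omega>, rnn_state \<phi> \<theta> (\<lambda>s. X s \<omega>) t, \<eta> t \<omega>) \<partial>M)"
    unfolding joint_law_def by (rule integral_distr) measurable
  also have "\<dots> = (\<integral>\<omega>. g (fst (v t \<omega>), snd (v t \<omega>), hid \<theta> t \<omega>, \<eta> t \<omega>) \<partial>M)"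
  proof (rule integral_cong_AE)
    show "AE \<omega> in M. g (X t \<omega>, Z t \<omega>, rnn_state \<phi> \<theta> (\<lambda>s. X s \<omega>) t, \<eta> t \<omega>) = g (fst (v t \<omega>), snd (v t \<omega>), hid \<theta> t \<omega>, \<eta> t \<omega>)"
      using hid_AE[of \<theta>] by eventually_elim simp
  qed measurable
  also have "\<dots> = (\<integral>\<omega>. (\<lambda>p h e. g (fst (clip (p t)), snd (clip (p t)), rnn_state \<phi> \<theta> (\<lambda>s. fst (clip (p s))) t, e)) (VV \<omega>) (H \<omega>) (\<eta> t \<omega>) \<partial>M)"
    by (simp add: v_def VV_def hid_VV)
  also have "\<dots> = (\<integral>\<omega>. (\<integral>e. (\<lambda>p h e. g (fst (clip (p t)), snd (clip (p t)), rnn_state \<phi> \<theta> (\<lambda>s. fst (clip (p s))) t, e)) (VV \<omega>) (H \<omega>) e \<partial>\<mu>\<eta>) \<partial>M)"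
  proof (rule noise_step[OF _ b])
    show "(\<lambda>((p, h), e). g (fst (clip (p t)), snd (clip (p t)), rnn_state \<phi> \<theta> (\<lambda>s. fst (clip (p s))) t, e))
        \<in> borel_measurable ((path_space \<Otimes>\<^sub>M path_space) \<Otimes>\<^sub>M borel)"
      unfolding case_prod_beta case_prod_beta' by measurable
  qed simp
  also have "\<dots> = (\<integral>\<omega>. (\<lambda>y. \<integral>e. g (fst (fst y), snd (fst y), snd y, e) \<partial>\<mu>\<eta>) (v t \<omega>, hid \<theta> t \<omega>) \<partial>M)"
    by (simp add: v_def VV_def hid_VV)
  also have "\<dots> = (\<integral>y. (\<integral>e. g (fst (fst y), snd (fst y), snd y, e) \<partial>\<mu>\<eta>) \<partial>ylaw \<theta> t)"
    by (rule ylaw_integral[symmetric]) measurable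
  finally show ?thesis .
qed

lemma mean_continuous:
  fixes g :: "(real ^ 'd) \<times> (real ^ 'z) \<times> (real ^ 'n::finite) \<times> real \<Rightarrow> real"
  assumes g: "continuous_on UNIV g" and b: "\<And>z. \<bar>g z\<bar> \<le> B"
  shows "continuous_on UNIV (\<lambda>y. \<integral>e. g (fst (fst y), snd (fst y), snd y, e) \<partial>\<mu>\<eta>)"
    and "\<bar>\<integral>e. g (fst (fst y), snd (fst y), snd y, e) \<partial>\<mu>\<eta>\<bar> \<le> B"
proof -
  have "continuous_on UNIV (\<lambda>z :: (((real ^ 'd) \<times> (real ^ 'z)) \<times> (real ^ 'n)) \<times> real. g (fst (fst (fst z)), snd (fst (fst z)), snd (fst z), snd z))"
    by (intro continuous_on_compose2[OF g] continuous_intros) auto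
  from continuous_on_integral_bounded[OF \<mu>\<eta>_prob \<mu>\<eta>_sets this b]
  show "continuous_on UNIV (\<lambda>y. \<integral>e. g (fst (fst y), snd (fst y), snd y, e) \<partial>\<mu>\<eta>)"
    using borel_measurable_continuous_onI[OF g] by simp
  have [measurable]: "g \<in> borel_measurable borel" using g by (rule borel_measurable_continuous_onI)
  interpret \<mu>\<eta>: prob_space \<mu>\<eta> by (rule \<mu>\<eta>_prob)
  have "\<bar>\<integral>e. g (fst (fst y), snd (fst y), snd y, e) \<partial>\<mu>\<eta>\<bar> \<le> (\<integral>e. \<bar>g (fst (fst y), snd (fst y), snd y, e)\<bar> \<partial>\<mu>\<eta>)"
    by (rule integral_abs_bound)
  also have "\<dots> \<le> B"
    by (rule \<mu>\<eta>.integral_le_const) (use b in \<open>auto intro!: \<mu>\<eta>.integrable_const_bound[where B = B]\<close>)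
  finally show "\<bar>\<integral>e. g (fst (fst y), snd (fst y), snd y, e) \<partial>\<mu>\<eta>\<bar> \<le> B" .
qed

lemma joint_law_weak:
  fixes \<theta> :: "('d, 'n::finite) params"
  assumes \<pi>: "prob_space \<pi>" "sets \<pi> = sets borel" "weakly_converges (ylaw \<theta>) \<pi>"
  shows "weakly_converges (joint_law M \<phi> X Z \<eta> \<theta>) (noisy \<pi>)"
  unfolding weakly_converges_def
proof (intro allI impI)
  fix g :: "(real ^ 'd) \<times> (real ^ 'z) \<times> (real ^ 'n) \<times> real \<Rightarrow> real"
  assume g: "continuous_on UNIV g" and "bounded (range g)"
  then obtain B where b: "\<And>z. \<bar>g z\<bar> \<le> B" by (auto simp: bounded_iff)
  have gm: "g \<in> borel_measurable borel" using g by (rule borel_measurable_continuous_onI)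
  have "(\<lambda>t. \<integral>y. (\<integral>e. g (fst (fst y), snd (fst y), snd y, e) \<partial>\<mu>\<eta>) \<partial>ylaw \<theta> t) \<longlonglongrightarrow> (\<integral>y. (\<integral>e. g (fst (fst y), snd (fst y), snd y, e) \<partial>\<mu>\<eta>) \<partial>\<pi>)"
    by (rule weakly_convergesD[OF \<pi>(3) mean_continuous[OF g b]])
  then show "(\<lambda>t. \<integral>z. g z \<partial>joint_law M \<phi> X Z \<eta> \<theta> t) \<longlonglongrightarrow> (\<integral>z. g z \<partial>noisy \<pi>)"
    using noisy_integral[OF \<pi>(1,2) gm, of B] b by (simp add: joint_law_integral[OF g b])
qed

end

lemma gradient_eqI: "GDERIV F x :> D \<Longrightarrow> gradient F x = D"
proof -
  assume D: "GDERIV F x :> D"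
  have "D' = D" if "GDERIV F x :> D'" for D'
  proof -
    have "(\<lambda>h. h \<bullet> D') = (\<lambda>h. h \<bullet> D)"
      using that D unfolding gderiv_def by (rule has_derivative_unique)
    then have "(D' - D) \<bullet> (D' - D) = 0" by (metis cancel_comm_monoid_add_class.diff_cancel inner_diff_right)
    then show ?thesis by simp
  qed
  with D show ?thesis unfolding gradient_def by blast
qed

context recurrent_learning
begin

section \<open>Invariance of the limit law\<close>

lemma joint_kernel_eq:
  "joint_kernel K \<mu>\<eta> \<phi> \<theta> u = distr (K (fst u, fst (snd u)) \<Otimes>\<^sub>M \<mu>\<eta>) borel
     (\<lambda>z. (fst (fst z), snd (fst z), rnn_step \<phi> \<theta> (fst u) (fst (snd (snd u))), snd z))"
  by (simp add: joint_kernel_def case_prod_beta')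

lemma joint_kernel_measurable:
  fixes \<theta> :: "('d, 'n::finite) params"
  shows "joint_kernel K \<mu>\<eta> \<phi> \<theta> \<in> borel \<rightarrow>\<^sub>M prob_algebra borel"
  unfolding joint_kernel_eq[abs_def]
proof (rule measurable_distr_prob_space2[where M = "borel \<Otimes>\<^sub>M borel"])
  have [measurable]: "(\<lambda>u. \<mu>\<eta>) \<in> borel \<rightarrow>\<^sub>M prob_algebra borel"
    using \<mu>\<eta>_prob \<mu>\<eta>_sets by (auto simp: space_prob_algebra)
  have [measurable]: "(\<lambda>u. K (fst u, fst (snd u))) \<in> borel \<rightarrow>\<^sub>M prob_algebra borel"
    by (rule measurable_compose[OF _ K_measurable]) (intro borel_measurable_continuous_onI continuous_intros)
  show "(\<lambda>u. K (fst u, fst (snd u)) \<Otimes>\<^sub>M \<mu>\<eta>) \<in> borel \<rightarrow>\<^sub>M prob_algebra (borel \<Otimes>\<^sub>M borel)"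
    by measurable
  show "(\<lambda>(u :: (real ^ 'd) \<times> (real ^ 'z) \<times> (real ^ 'n) \<times> real, z :: ((real ^ 'd) \<times> (real ^ 'z)) \<times> real). (fst (fst z), snd (fst z), rnn_step \<phi> \<theta> (fst u) (fst (snd (snd u))), snd z))
      \<in> borel_measurable (borel \<Otimes>\<^sub>M (borel \<Otimes>\<^sub>M borel))"
    unfolding case_prod_beta' borel_prod
    by (intro borel_measurable_continuous_onI continuous_intros smooth_bounded_continuous(1)[OF \<phi>_smooth])
qed

definition push :: "((real ^ 'd) \<times> (real ^ 'z) \<times> (real ^ 'n::finite) \<times> real \<Rightarrow> real) \<Rightarrow> ((real ^ 'd) \<times> (real ^ 'z)) \<times> (real ^ 'n) \<Rightarrow> real" where
  "push g y = (\<integral>e. g (fst (fst y), snd (fst y), snd y, e) \<partial>\<mu>\<eta>)"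

lemma joint_kernel_integral:
  fixes g :: "(real ^ 'd) \<times> (real ^ 'z) \<times> (real ^ 'n::finite) \<times> real \<Rightarrow> real"
  assumes [measurable]: "g \<in> borel_measurable borel" and b: "\<And>z. \<bar>g z\<bar> \<le> B"
  shows "(\<integral>z. g z \<partial>joint_kernel K \<mu>\<eta> \<phi> \<theta> u)
    = (\<integral>w. push g (w, rnn_step \<phi> \<theta> (fst u) (fst (snd (snd u)))) \<partial>K (fst u, fst (snd u)))"
proof -
  note [measurable_cong] = kernel_sets(1)[OF K_measurable]
  interpret K: prob_space "K (fst u, fst (snd u))" by (rule kernel_sets(2)[OF K_measurable])
  interpret \<mu>\<eta>: prob_space \<mu>\<eta> by (rule \<mu>\<eta>_prob)
  interpret P: pair_prob_space "K (fst u, fst (snd u))" \<mu>\<eta> ..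
  let ?s = "rnn_step \<phi> \<theta> (fst u) (fst (snd (snd u)))"
  have "(\<integral>z. g z \<partial>joint_kernel K \<mu>\<eta> \<phi> \<theta> u)
      = (\<integral>z. (\<lambda>(w, e). g (fst w, snd w, ?s, e)) z \<partial>(K (fst u, fst (snd u)) \<Otimes>\<^sub>M \<mu>\<eta>))"
    unfolding joint_kernel_eq by (subst integral_distr) (auto simp: case_prod_beta')
  also have "\<dots> = (\<integral>w. (\<integral>e. g (fst w, snd w, ?s, e) \<partial>\<mu>\<eta>) \<partial>K (fst u, fst (snd u)))"
    by (rule P.integral_fst[symmetric], rule P.integrable_const_bound[where B = B]) (use b in auto)
  finally show ?thesis by (simp add: push_def)
qed

lemma push_Lipschitz:
  fixes g :: "(real ^ 'd) \<times> (real ^ 'z) \<times> (real ^ 'n::finite) \<times> real \<Rightarrow> real"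
  assumes g: "continuous_on UNIV g" and b: "\<And>z. \<bar>g z\<bar> \<le> B" and L: "\<And>x y. \<bar>g x - g y\<bar> \<le> L * dist x y"
  shows "\<bar>push g x - push g y\<bar> \<le> \<bar>L\<bar> * dist x y"
proof -
  interpret \<mu>\<eta>: prob_space \<mu>\<eta> by (rule \<mu>\<eta>_prob)
  have [measurable]: "g \<in> borel_measurable borel" using g by (rule borel_measurable_continuous_onI)
  have i: "integrable \<mu>\<eta> (\<lambda>e. g (fst (fst x), snd (fst x), snd x, e))" for x
    using b by (intro \<mu>\<eta>.integrable_const_bound[where B = B]) auto
  have "push g x - push g y = (\<integral>e. g (fst (fst x), snd (fst x), snd x, e) - g (fst (fst y), snd (fst y), snd y, e) \<partial>\<mu>\<eta>)"
    unfolding push_def by (rule Bochner_Integration.integral_diff[symmetric]) (rule i)+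
  also have "\<bar>\<dots>\<bar> \<le> (\<integral>e. \<bar>g (fst (fst x), snd (fst x), snd x, e) - g (fst (fst y), snd (fst y), snd y, e)\<bar> \<partial>\<mu>\<eta>)"
    by (rule integral_abs_bound)
  also have "\<dots> \<le> \<bar>L\<bar> * dist x y"
  proof (rule \<mu>\<eta>.integral_le_const)
    show "AE e in \<mu>\<eta>. \<bar>g (fst (fst x), snd (fst x), snd x, e) - g (fst (fst y), snd (fst y), snd y, e)\<bar> \<le> \<bar>L\<bar> * dist x y"
    proof (rule AE_I2)
      fix e :: real
      have "dist (fst (fst x), snd (fst x), snd x, e) (fst (fst y), snd (fst y), snd y, e) = dist x y"
        by (simp add: dist_prod_def)
      moreover have "L * dist x y \<le> \<bar>L\<bar> * dist x y" by (intro mult_right_mono) auto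
      ultimately show "\<bar>g (fst (fst x), snd (fst x), snd x, e) - g (fst (fst y), snd (fst y), snd y, e)\<bar> \<le> \<bar>L\<bar> * dist x y"
        using L[of "(fst (fst x), snd (fst x), snd x, e)" "(fst (fst y), snd (fst y), snd y, e)"] by simp
    qed
  qed (use i[of x] i[of y] in auto)
  finally show ?thesis .
qed

text \<open>A Feller property for the original kernel on the whole space: invariance is required
  with respect to \<open>K\<close>, so the clipped kernel cannot serve here. The Wasserstein bound
  makes the average Lipschitz.\<close>

lemma kernel_average_continuous:
  fixes h :: "((real ^ 'd) \<times> (real ^ 'z)) \<times> (real ^ 'n::finite) \<Rightarrow> real" and \<theta> :: "('d, 'n) params"
  assumes h: "Lip_bdd B b a (\<lambda>s w. h (w, s))" and ba: "0 \<le> b" "0 \<le> a" and hB: "\<And>y. \<bar>h y\<bar> \<le> B"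
  shows "continuous_on UNIV (\<lambda>y. \<integral>w. h (w, rnn_step \<phi> \<theta> (fst (fst y)) (snd y)) \<partial>K (fst y))"
    and "\<bar>\<integral>w. h (w, rnn_step \<phi> \<theta> (fst (fst y)) (snd y)) \<partial>K (fst y)\<bar> \<le> B"
proof -
  note [measurable_cong] = kernel_sets(1)[OF K_measurable]
  have hL: "\<bar>h (u, s) - h (w, s')\<bar> \<le> b * infnorm (s - s') + a * infnorm (u - w)"
    if "infnorm s \<le> 2" "infnorm s' \<le> 2" for s s' u w
    using h that unfolding Lip_bdd_def by blast
  have [measurable]: "(\<lambda>w. h (w, s)) \<in> borel_measurable borel" for s
    using Lip_bdd_measurable[OF h, of "\<lambda>_. s" borel "\<lambda>w. w"] by simp
  let ?F = "\<lambda>y. rnn_step \<phi> \<theta> (fst (fst y)) (snd y)"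
  let ?P = "\<lambda>y :: ((real ^ 'd) \<times> (real ^ 'z)) \<times> (real ^ 'n). \<integral>w. h (w, ?F y) \<partial>K (fst y)"
  have i: "integrable (K u) (\<lambda>w. h (w, s))" for u s
  proof -
    interpret P: prob_space "K u" by (rule kernel_sets(2)[OF K_measurable])
    have "(\<lambda>w. h (w, s)) \<in> borel_measurable (K u)" by measurable
    then show ?thesis by (rule P.integrable_const_bound[where B = B, rotated]) (simp add: hB)
  qed
  have le: "\<bar>\<integral>w. k w \<partial>K u\<bar> \<le> c" if "integrable (K u) k" "\<And>w. \<bar>k w\<bar> \<le> c" for k :: "(real ^ 'd) \<times> (real ^ 'z) \<Rightarrow> real" and u c
  proof -
    interpret P: prob_space "K u" by (rule kernel_sets(2)[OF K_measurable])
    have "\<bar>\<integral>w. k w \<partial>K u\<bar> \<le> (\<integral>w. \<bar>k w\<bar> \<partial>K u)" by (rule integral_abs_bound)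
    also have "\<dots> \<le> c" by (rule P.integral_le_const) (use that in auto)
    finally show ?thesis .
  qed
  show "\<bar>?P y\<bar> \<le> B" for y by (rule le[OF i hB])
  let ?c = "b * (C / 4 + C / 4) + a * Lp"
  have box: "infnorm (?F y) \<le> 2" for y using rnn_step_box[of \<phi> \<theta> "fst (fst y)" "snd y"] by simp
  have c: "0 \<le> C" using order_trans[OF abs_ge_zero \<phi>_bound] .
  have "\<bar>?P x - ?P y\<bar> \<le> ?c * dist x y" for x y
  proof -
    have "\<bar>(\<integral>w. h (w, ?F x) \<partial>K (fst x)) - (\<integral>w. h (w, ?F y) \<partial>K (fst x))\<bar> = \<bar>\<integral>w. h (w, ?F x) - h (w, ?F y) \<partial>K (fst x)\<bar>"
      by (subst Bochner_Integration.integral_diff) (rule i | simp)+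
    also have "\<dots> \<le> b * infnorm (?F x - ?F y)"
    proof (rule le)
      show "\<bar>h (w, ?F x) - h (w, ?F y)\<bar> \<le> b * infnorm (?F x - ?F y)" for w
        using hL[of "?F x" "?F y" w w, OF box box] by (simp add: infnorm_0)
    qed (intro Bochner_Integration.integrable_diff i)
    also have "\<dots> \<le> b * (C / 4 * infnorm (snd x - snd y) + C / 4 * infnorm (fst x - fst y))"
      using F_Lipschitz[of \<theta> "fst x" "snd x" "fst y" "snd y"] ba by (intro mult_left_mono) auto
    finally have 1: "\<bar>(\<integral>w. h (w, ?F x) \<partial>K (fst x)) - (\<integral>w. h (w, ?F y) \<partial>K (fst x))\<bar> \<le> \<dots>" .
    have 2: "\<bar>(\<integral>w. h (w, ?F y) \<partial>K (fst x)) - (\<integral>w. h (w, ?F y) \<partial>K (fst y))\<bar> \<le> a * (Lp * infnorm (fst x - fst y))"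
    proof (rule Wass2_dual[OF Wass])
      show "\<bar>h (u, ?F y) - h (w, ?F y)\<bar> \<le> a * infnorm (u - w)" for u w
        using hL[of "?F y" "?F y" u w, OF box box] by (simp add: infnorm_0)
    qed (use hB ba Lp0 in \<open>auto simp: infnorm_pos_le\<close>)
    have n: "infnorm (snd x - snd y) \<le> dist x y" "infnorm (fst x - fst y) \<le> dist x y"
      using infnorm_snd_le[of "x - y"] infnorm_fst_le[of "x - y"] infnorm_le_norm[of "x - y"] by (simp_all add: dist_norm)
    have "\<bar>?P x - ?P y\<bar> \<le> b * (C / 4 * infnorm (snd x - snd y) + C / 4 * infnorm (fst x - fst y)) + a * (Lp * infnorm (fst x - fst y))"
      using 1 2 by linarith
    also have "\<dots> \<le> b * (C / 4 * dist x y + C / 4 * dist x y) + a * (Lp * dist x y)"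
      using n ba c Lp0 by (intro add_mono mult_left_mono) auto
    finally show ?thesis by (simp add: algebra_simps)
  qed
  then have "?c-lipschitz_on UNIV ?P"
    using ba c Lp0 by (intro lipschitz_onI) (auto simp: dist_real_def)
  then show "continuous_on UNIV ?P" by (rule lipschitz_on_continuous_on)
qed

text \<open>Tested on a Lipschitz \<open>g\<close>, the kernel average at time \<open>t\<close> has
  the same expectation as \<open>push g\<close> at time \<open>Suc t\<close>, the noise of the next
  state being drawn afresh. Both sides converge, the kernel average because it is
  continuous.\<close>

lemma noisy_invariant:
  fixes \<theta> :: "('d, 'n::finite) params"
  assumes \<pi>: "prob_space \<pi>" "sets \<pi> = sets borel" "weakly_converges (ylaw \<theta>) \<pi>"
  shows "noisy \<pi> \<bind> joint_kernel K \<mu>\<eta> \<phi> \<theta> = noisy \<pi>"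
proof -
  interpret N: prob_space "noisy \<pi>" by (rule noisy_prob[OF \<pi>(1,2)])
  note sN = noisy_prob(2)[OF \<pi>(1,2)]
  have J: "joint_kernel K \<mu>\<eta> \<phi> \<theta> \<in> noisy \<pi> \<rightarrow>\<^sub>M prob_algebra borel"
    using joint_kernel_measurable by (simp cong: measurable_cong_sets add: sN)
  note J' = measurable_prob_algebraD[OF J]
  show ?thesis
  proof (rule measure_eqI_Lipschitz)
    show "prob_space (noisy \<pi> \<bind> joint_kernel K \<mu>\<eta> \<phi> \<theta>)"
      by (rule prob_space_bind'[OF _ J]) (auto simp: space_prob_algebra N.prob_space_axioms)
    show "sets (noisy \<pi> \<bind> joint_kernel K \<mu>\<eta> \<phi> \<theta>) = sets borel"
      by (rule sets_bind[OF sets_kernel[OF J'] N.not_empty])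
    fix g :: "(real ^ 'd) \<times> (real ^ 'z) \<times> (real ^ 'n) \<times> real \<Rightarrow> real" and B L
    assume b: "\<And>x. \<bar>g x\<bar> \<le> B" and L: "\<And>x y. \<bar>g x - g y\<bar> \<le> L * dist x y"
    have "\<bar>L\<bar>-lipschitz_on UNIV g"
    proof (rule lipschitz_onI)
      fix x y :: "(real ^ 'd) \<times> (real ^ 'z) \<times> (real ^ 'n) \<times> real"
      have "L * dist x y \<le> \<bar>L\<bar> * dist x y" by (intro mult_right_mono) auto
      then show "dist (g x) (g y) \<le> \<bar>L\<bar> * dist x y" using L[of x y] by (simp add: dist_real_def)
    qed simp
    then have gc: "continuous_on UNIV g" by (rule lipschitz_on_continuous_on)
    then have gm[measurable]: "g \<in> borel_measurable borel" by (rule borel_measurable_continuous_onI)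
    have pb: "\<bar>push g y\<bar> \<le> B" for y unfolding push_def by (rule mean_continuous(2)[OF gc b])
    have pc: "continuous_on UNIV (push g)" using mean_continuous(1)[OF gc b] by (simp add: push_def[abs_def])
    obtain b' a where ba: "0 \<le> b'" "0 \<le> a" and h: "Lip_bdd B b' a (\<lambda>s w. push g (w, s))"
      using Lip_bdd_of_Lipschitz[of "push g" B "\<bar>L\<bar>", OF pb push_Lipschitz[OF gc b L]] by blast
    let ?P = "\<lambda>y. \<integral>w. push g (w, rnn_step \<phi> \<theta> (fst (fst y)) (snd y)) \<partial>K (fst y)"
    note Pc = kernel_average_continuous(1)[OF h ba pb, where \<theta> = \<theta>] and Pb = kernel_average_continuous(2)[OF h ba pb, where \<theta> = \<theta>]
    have Pm[measurable]: "?P \<in> borel_measurable borel" using Pc by (rule borel_measurable_continuous_onI)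
    have Pm': "(\<lambda>u :: (real ^ 'd) \<times> (real ^ 'z) \<times> (real ^ 'n) \<times> real. ?P ((fst u, fst (snd u)), fst (snd (snd u)))) \<in> borel_measurable borel"
      by (rule measurable_compose[OF _ Pm]) (intro borel_measurable_continuous_onI continuous_intros)
    have [measurable]: "push g \<in> borel_measurable borel" using pc by (rule borel_measurable_continuous_onI)
    have "(\<integral>z. g z \<partial>(noisy \<pi> \<bind> joint_kernel K \<mu>\<eta> \<phi> \<theta>)) = (\<integral>u. (\<integral>z. g z \<partial>joint_kernel K \<mu>\<eta> \<phi> \<theta> u) \<partial>noisy \<pi>)"
    proof (rule integral_bind[OF gm b J', where B' = 1])
      show "finite_measure (noisy \<pi>)" by unfold_locales
      show "AE u in noisy \<pi>. emeasure (joint_kernel K \<mu>\<eta> \<phi> \<theta> u) (space (joint_kernel K \<mu>\<eta> \<phi> \<theta> u)) \<le> ennreal 1"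
      proof (rule AE_I2)
        fix u assume "u \<in> space (noisy \<pi>)"
        then have "subprob_space (joint_kernel K \<mu>\<eta> \<phi> \<theta> u)" by (rule subprob_space_kernel[OF J'])
        then show "emeasure (joint_kernel K \<mu>\<eta> \<phi> \<theta> u) (space (joint_kernel K \<mu>\<eta> \<phi> \<theta> u)) \<le> ennreal 1"
          using subprob_space.emeasure_space_le_1 by simp
      qed
    qed
    also have "\<dots> = (\<integral>u. ?P ((fst u, fst (snd u)), fst (snd (snd u))) \<partial>noisy \<pi>)"
      by (simp add: joint_kernel_integral[OF gm b])
    also have "\<dots> = (\<integral>y. (\<integral>e. ?P y \<partial>\<mu>\<eta>) \<partial>\<pi>)"
      using Pb by (subst noisy_integral[OF \<pi>(1,2) Pm', where B = B]) auto
    also have "\<dots> = (\<integral>y. ?P y \<partial>\<pi>)" using prob_space.prob_space[OF \<mu>\<eta>_prob] by simp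
    finally have lhs: "(\<integral>z. g z \<partial>(noisy \<pi> \<bind> joint_kernel K \<mu>\<eta> \<phi> \<theta>)) = (\<integral>y. ?P y \<partial>\<pi>)" .
    \<comment> \<open>The Markov property is applied to the original chain; clipped and original
      data are exchanged almost surely before and after.\<close>
    have step: "(\<integral>y. ?P y \<partial>ylaw \<theta> t) = (\<integral>y. push g y \<partial>ylaw \<theta> (Suc t))" for t
    proof -
      let ?S = "\<lambda>p. rnn_state \<phi> \<theta> (\<lambda>s. fst (clip (p s))) (Suc t)"
      have "(\<integral>\<omega>. (\<lambda>p w. push g (w, ?S p)) (\<lambda>s. VV \<omega> (min s t)) (VV \<omega> (Suc t)) \<partial>M)
          = (\<integral>\<omega>. (\<integral>w. (\<lambda>p w. push g (w, ?S p)) (\<lambda>s. VV \<omega> (min s t)) w \<partial>K (VV \<omega> t)) \<partial>M)"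
        using Markov_past_expectation[OF chain, of "\<lambda>p w. push g (w, ?S p)" B t] pb by (simp add: VV_def del: rnn_state.simps)
      moreover have "?S (\<lambda>s. VV \<omega> (min s t)) = hid \<theta> (Suc t) \<omega>" for \<omega>
        unfolding hid_VV by (rule rnn_state_past) (simp add: min_absorb1)
      ultimately have eq: "(\<integral>\<omega>. push g (VV \<omega> (Suc t), hid \<theta> (Suc t) \<omega>) \<partial>M) = (\<integral>\<omega>. (\<integral>w. push g (w, hid \<theta> (Suc t) \<omega>) \<partial>K (VV \<omega> t)) \<partial>M)"
        by simp
      have VVm[measurable]: "(\<lambda>\<omega>. VV \<omega> t) \<in> borel_measurable M" for t by (simp add: VV_def)
      have vV: "AE \<omega> in M. v t \<omega> = VV \<omega> t" for t using v_eq by eventually_elim (simp add: VV_def)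
      have "(\<integral>y. ?P y \<partial>ylaw \<theta> t) = (\<integral>\<omega>. ?P (v t \<omega>, hid \<theta> t \<omega>) \<partial>M)" by (rule ylaw_integral) measurable
      also have "\<dots> = (\<integral>\<omega>. (\<lambda>y. \<integral>w. push g (w, snd y) \<partial>K (fst y)) (VV \<omega> t, hid \<theta> (Suc t) \<omega>) \<partial>M)"
      proof (rule integral_cong_AE)
        show "AE \<omega> in M. ?P (v t \<omega>, hid \<theta> t \<omega>) = (\<lambda>y. \<integral>w. push g (w, snd y) \<partial>K (fst y)) (VV \<omega> t, hid \<theta> (Suc t) \<omega>)"
          using vV[of t] by eventually_elim (simp add: hid_def)
        have [measurable]: "(\<lambda>\<omega>. K (VV \<omega> t)) \<in> M \<rightarrow>\<^sub>M prob_algebra borel"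
          by (rule measurable_compose[OF VVm K_measurable])
        show "(\<lambda>\<omega>. (\<lambda>y. \<integral>w. push g (w, snd y) \<partial>K (fst y)) (VV \<omega> t, hid \<theta> (Suc t) \<omega>)) \<in> borel_measurable M"
          unfolding fst_conv snd_conv
          by (rule integral_measurable_kernel[where N = borel]) measurable
        show "(\<lambda>\<omega>. ?P (v t \<omega>, hid \<theta> t \<omega>)) \<in> borel_measurable M"
          by (rule measurable_compose[OF _ \<open>?P \<in> borel_measurable borel\<close>]) measurable
      qed
      also have "\<dots> = (\<integral>\<omega>. push g (VV \<omega> (Suc t), hid \<theta> (Suc t) \<omega>) \<partial>M)" by (simp add: eq)
      also have "\<dots> = (\<integral>\<omega>. push g (v (Suc t) \<omega>, hid \<theta> (Suc t) \<omega>) \<partial>M)"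
      proof (rule integral_cong_AE)
        show "AE \<omega> in M. push g (VV \<omega> (Suc t), hid \<theta> (Suc t) \<omega>) = push g (v (Suc t) \<omega>, hid \<theta> (Suc t) \<omega>)"
          using vV[of "Suc t"] by eventually_elim simp
      qed measurable
      also have "\<dots> = (\<integral>y. push g y \<partial>ylaw \<theta> (Suc t))" by (rule ylaw_integral[symmetric]) measurable
      finally show ?thesis .
    qed
    have "(\<lambda>t. \<integral>y. ?P y \<partial>ylaw \<theta> t) \<longlonglongrightarrow> (\<integral>y. ?P y \<partial>\<pi>)" by (rule weakly_convergesD[OF \<pi>(3) Pc Pb])
    moreover have "(\<lambda>t. \<integral>y. ?P y \<partial>ylaw \<theta> t) \<longlonglongrightarrow> (\<integral>y. push g y \<partial>\<pi>)"
      unfolding step by (rule LIMSEQ_Suc[OF weakly_convergesD[OF \<pi>(3) pc pb]])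
    ultimately have "(\<integral>y. ?P y \<partial>\<pi>) = (\<integral>y. push g y \<partial>\<pi>)" by (rule LIMSEQ_unique)
    also have "\<dots> = (\<integral>z. g z \<partial>noisy \<pi>)"
      unfolding push_def using b by (subst noisy_integral[OF \<pi>(1,2) gm, where B = B]) auto
    finally show "(\<integral>z. g z \<partial>(noisy \<pi> \<bind> joint_kernel K \<mu>\<eta> \<phi> \<theta>)) = (\<integral>z. g z \<partial>noisy \<pi>)" using lhs by simp
  qed (rule N.prob_space_axioms, rule sN)
qed

lemma limit_law_eq:
  fixes \<theta> :: "('d, 'n::finite) params"
  assumes \<pi>: "prob_space \<pi>" "sets \<pi> = sets borel" "weakly_converges (ylaw \<theta>) \<pi>"
  shows "limit_law M K \<mu>\<eta> \<phi> X Z \<eta> \<theta> = noisy \<pi>"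
  unfolding limit_law_def
proof (rule the_equality)
  show *: "prob_space (noisy \<pi>) \<and> sets (noisy \<pi>) = sets borel \<and> noisy \<pi> \<bind> joint_kernel K \<mu>\<eta> \<phi> \<theta> = noisy \<pi> \<and>
     weakly_converges (joint_law M \<phi> X Z \<eta> \<theta>) (noisy \<pi>)"
    using noisy_prob[OF \<pi>(1,2)] noisy_invariant[OF \<pi>] joint_law_weak[OF \<pi>] by blast
  fix \<mu> assume "prob_space \<mu> \<and> sets \<mu> = sets borel \<and> \<mu> \<bind> joint_kernel K \<mu>\<eta> \<phi> \<theta> = \<mu> \<and>
     weakly_converges (joint_law M \<phi> X Z \<eta> \<theta>) \<mu>"
  with * show "\<mu> = noisy \<pi>" by (intro weak_limit_unique) auto
qed

lemma f_measurable: "(\<lambda>(u, e). f (fst u) (snd u) e) \<in> borel_measurable borel"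
proof -
  have Lf: "0 \<le> Lf" using order_trans[OF abs_ge_zero f_bound] .
  have "Lf-lipschitz_on UNIV (\<lambda>(u, e). f (fst u) (snd u) e)"
  proof (rule lipschitz_onI)
    fix x y :: "((real ^ 'd) \<times> (real ^ 'z)) \<times> real"
    have "infnorm ((fst (fst x), snd (fst x), snd x) - (fst (fst y), snd (fst y), snd y))
        \<le> norm ((fst (fst x), snd (fst x), snd x) - (fst (fst y), snd (fst y), snd y))" by (rule infnorm_le_norm)
    also have "\<dots> = dist x y" by (simp add: dist_prod_def dist_norm norm_prod_def)
    finally have "Lf * infnorm ((fst (fst x), snd (fst x), snd x) - (fst (fst y), snd (fst y), snd y)) \<le> Lf * dist x y"
      using Lf by (rule mult_left_mono)
    then show "dist (case x of (u, e) \<Rightarrow> f (fst u) (snd u) e) (case y of (u, e) \<Rightarrow> f (fst u) (snd u) e) \<le> Lf * dist x y"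
      using f_Lip[of "fst (fst x)" "snd (fst x)" "snd x" "fst (fst y)" "snd (fst y)" "snd y"]
      by (simp add: dist_real_def case_prod_beta)
  qed (rule Lf)
  then show ?thesis by (intro borel_measurable_continuous_onI lipschitz_on_continuous_on)
qed

text \<open>The squared error is unbounded in the memory, so weak convergence does not apply to it
  directly. Clipping the memory makes it bounded and Lipschitz without changing it on the cube that
  carries the laws and their limit.\<close>

lemma limiting_loss_tendsto:
  fixes \<theta> :: "('d, 'n::finite) params"
  assumes h: "Lip_bdd B b a (mean_loss lam f \<mu>\<eta> \<theta>)" and ba: "0 \<le> b" "0 \<le> a"
  shows "(\<lambda>t. \<integral>\<omega>. mean_loss lam f \<mu>\<eta> \<theta> (hid \<theta> t \<omega>) (v t \<omega>) \<partial>M) \<longlonglongrightarrow> limiting_loss M K \<mu>\<eta> \<phi> lam X Z \<eta> f \<theta>"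
proof -
  obtain \<pi> where \<pi>: "prob_space \<pi>" "sets \<pi> = sets borel" "weakly_converges (ylaw \<theta>) \<pi>" and box: "AE y in \<pi>. infnorm y \<le> 1"
    by (rule ylaw_limit)
  note [measurable_cong] = \<pi>(2)
  let ?l = "mean_loss lam f \<mu>\<eta> \<theta>"
  define m where "m y = ?l (clip (snd y)) (fst y)" for y
  have lB: "\<bar>?l s w\<bar> \<le> B" if "infnorm s \<le> 2" for s w using h that unfolding Lip_bdd_def by blast
  have clip2: "infnorm (clip s) \<le> 2" for s :: "real ^ 'n" using clip_box[of s] by simp
  have mb: "\<bar>m y\<bar> \<le> B" for y unfolding m_def by (rule lB[OF clip2])
  have "(b + a)-lipschitz_on UNIV m"
  proof (rule lipschitz_onI)
    fix x y
    have "\<bar>m x - m y\<bar> \<le> b * infnorm (clip (snd x) - clip (snd y)) + a * infnorm (fst x - fst y)"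
      using h clip2 unfolding Lip_bdd_def m_def by blast
    also have "\<dots> \<le> b * dist x y + a * dist x y"
      using ba clip_contraction[of "snd x" "snd y"] infnorm_snd_le[of "x - y"] infnorm_fst_le[of "x - y"] infnorm_le_norm[of "x - y"]
      by (intro add_mono mult_left_mono) (auto simp: dist_norm)
    finally show "dist (m x) (m y) \<le> (b + a) * dist x y" by (simp add: dist_real_def algebra_simps)
  qed (use ba in simp)
  then have mc: "continuous_on UNIV m" by (rule lipschitz_on_continuous_on)
  have mm: "m \<in> borel_measurable borel" using mc by (rule borel_measurable_continuous_onI)
  have "(\<integral>y. m y \<partial>ylaw \<theta> t) = (\<integral>\<omega>. ?l (hid \<theta> t \<omega>) (v t \<omega>) \<partial>M)" for t
    unfolding ylaw_integral[OF mm] by (simp add: m_def clip_id[OF hid_box])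
  moreover have "(\<integral>y. m y \<partial>\<pi>) = limiting_loss M K \<mu>\<eta> \<phi> lam X Z \<eta> f \<theta>"
  proof -
    let ?g = "\<lambda>z. 1 / 2 * (f (fst z) (fst (snd z)) (snd (snd (snd z))) - net_out lam \<theta> (fst (snd (snd z))))\<^sup>2"
    have "(\<lambda>z :: (real ^ 'd) \<times> (real ^ 'z) \<times> (real ^ 'n) \<times> real. (\<lambda>(u, e). f (fst u) (snd u) e) ((fst z, fst (snd z)), snd (snd (snd z)))) \<in> borel_measurable borel"
      by (rule measurable_compose[OF _ f_measurable]) measurable
    then have [measurable]: "(\<lambda>z :: (real ^ 'd) \<times> (real ^ 'z) \<times> (real ^ 'n) \<times> real. f (fst z) (fst (snd z)) (snd (snd (snd z)))) \<in> borel_measurable borel" by simp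
    note [measurable] = net_out_measurable[OF lam_smooth]
    have gm: "?g \<in> borel_measurable borel" by measurable
    have "limiting_loss M K \<mu>\<eta> \<phi> lam X Z \<eta> f \<theta> = (\<integral>z. ?g z \<partial>noisy \<pi>)"
    proof -
      obtain A W B c where \<theta>: "\<theta> = (A, W, B, c)" by (cases \<theta>)
      show ?thesis using limit_law_eq[OF \<pi>]
        by (simp add: \<theta> limiting_loss_def net_out_def entrywise_def inner_vec_def case_prod_beta' diff_diff_eq)
    qed
    also have "\<dots> = (\<integral>y. (\<integral>e. ?g (fst (fst y), snd (fst y), snd y, e) \<partial>\<mu>\<eta>) \<partial>\<pi>)"
    proof (rule noisy_integral[OF \<pi>(1,2) gm, where B = "1 / 2 * (Lf + (real CARD('n) * (Clam * 2) + Clam))\<^sup>2"])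
      show "AE y in \<pi>. \<forall>e. \<bar>?g (fst (fst y), snd (fst y), snd y, e)\<bar> \<le> 1 / 2 * (Lf + (real CARD('n) * (Clam * 2) + Clam))\<^sup>2"
        using box
      proof eventually_elim
        case (elim y)
        then have "infnorm (snd y) \<le> 2" using infnorm_snd_le[of y] by simp
        then have o: "\<bar>net_out lam \<theta> (snd y)\<bar> \<le> real CARD('n) * (Clam * 2) + Clam" by (rule net_out_bound[OF lam_bound])
        show ?case
        proof
          fix e
          have "\<bar>f (fst (fst y)) (snd (fst y)) e - net_out lam \<theta> (snd y)\<bar> \<le> Lf + (real CARD('n) * (Clam * 2) + Clam)"
            using f_bound[of "fst (fst y)" "snd (fst y)" e] o by linarith
          from power_mono[OF this, of 2]
          show "\<bar>?g (fst (fst y), snd (fst y), snd y, e)\<bar> \<le> 1 / 2 * (Lf + (real CARD('n) * (Clam * 2) + Clam))\<^sup>2" by simp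
        qed
      qed
    qed
    also have "\<dots> = (\<integral>y. ?l (snd y) (fst y) \<partial>\<pi>)" by (simp add: mean_loss_def)
    also have "\<dots> = (\<integral>y. m y \<partial>\<pi>)"
    proof (rule integral_cong_AE)
      show "AE y in \<pi>. ?l (snd y) (fst y) = m y"
        using box
      proof eventually_elim
        case (elim y)
        then have "infnorm (snd y) \<le> 1" using infnorm_snd_le[of y] by simp
        then show ?case by (simp add: m_def clip_id)
      qed
      show "(\<lambda>y. ?l (snd y) (fst y)) \<in> borel_measurable \<pi>" by (rule Lip_bdd_measurable[OF h]) measurable
    qed (use mm in measurable)
    finally show ?thesis ..
  qed
  ultimately show ?thesis using weakly_convergesD[OF \<pi>(3) mc mb] by simp
qed

end

section \<open>Convergence\<close>

context recurrent_learning
begin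

text \<open>The algorithm as a function of a data path and a noise path, run on clipped data so that
  its bounds hold for every path and not just almost surely.\<close>

definition rstate ::
  "(nat \<Rightarrow> real) \<Rightarrow> ('d, 'n::finite) params \<Rightarrow> nat \<Rightarrow> (nat \<Rightarrow> (real ^ 'd) \<times> (real ^ 'z)) \<Rightarrow> (nat \<Rightarrow> real) \<Rightarrow> ('d, 'n) rtrl_state" where
  "rstate \<alpha> \<theta>0 t p h = rtrl \<phi> lam \<alpha> \<theta>0 (\<lambda>s. fst (clip (p s))) (\<lambda>s. f (fst (clip (p s))) (snd (clip (p s))) (h s)) t"

lemma rstate_Suc:
  "rstate \<alpha> \<theta>0 (Suc t) p h =
    rtrl_step \<phi> lam (\<alpha> t) (fst (clip (p t))) (f (fst (clip (p t))) (snd (clip (p t))) (h t)) (rstate \<alpha> \<theta>0 t p h)"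
  by (simp add: rstate_def)

lemma rtrl_past:
  "(\<And>s. s < t \<Longrightarrow> x s = x' s \<and> y s = y' s) \<Longrightarrow> rtrl \<phi> lam \<alpha> \<theta>0 x y t = rtrl \<phi> lam \<alpha> \<theta>0 x' y' t"
  by (induction t) auto

lemma rstate_past:
  "(\<And>s. s < t \<Longrightarrow> p s = p' s) \<Longrightarrow> (\<And>s. s < t \<Longrightarrow> h s = h' s) \<Longrightarrow> rstate \<alpha> \<theta>0 t p h = rstate \<alpha> \<theta>0 t p' h'"
  unfolding rstate_def by (rule rtrl_past) simp

lemma f_measurable_raw[measurable (raw)]:
  assumes "a \<in> borel_measurable N" "b \<in> borel_measurable N"
  shows "(\<lambda>x. f (fst (a x)) (snd (a x)) (b x)) \<in> borel_measurable N"
  using measurable_compose[OF borel_measurable_Pair[OF assms] f_measurable] by simp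

lemma rstate_measurable[measurable (raw)]:
  fixes \<theta>0 :: "('d, 'n::finite) params"
  assumes a: "a \<in> N \<rightarrow>\<^sub>M path_space" and b: "b \<in> N \<rightarrow>\<^sub>M path_space"
  shows "(\<lambda>x. rstate \<alpha> \<theta>0 t (a x) (b x)) \<in> borel_measurable N"
proof (induction t)
  case 0
  then show ?case by (simp add: rstate_def)
next
  case (Suc t)
  have step: "(\<lambda>q :: (real ^ 'd) \<times> real \<times> ('d, 'n) rtrl_state. rtrl_step \<phi> lam (\<alpha> t) (fst q) (fst (snd q)) (snd (snd q))) \<in> borel_measurable borel"
    by (intro borel_measurable_continuous_onI continuous_on_rtrl_step[OF \<phi>_smooth lam_smooth] continuous_intros)
  have [measurable]: "(\<lambda>x. a x t) \<in> borel_measurable N" "(\<lambda>x. b x t) \<in> borel_measurable N"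
    by (rule measurable_compose[OF a], rule measurable_component_singleton, simp)
      (rule measurable_compose[OF b], rule measurable_component_singleton, simp)
  have "(\<lambda>x. (fst (clip (a x t)), f (fst (clip (a x t))) (snd (clip (a x t))) (b x t), rstate \<alpha> \<theta>0 t (a x) (b x))) \<in> borel_measurable N"
    using Suc by measurable
  from measurable_compose[OF this step] show ?case by (simp add: rstate_Suc)
qed

text \<open>The hypotheses of \<open>stochastic_gradient_convergence\<close> are verified for the
  algorithm on clipped data, whose parameters agree with the actual ones almost surely.\<close>

theorem loss_gradient_vanishes:
  fixes \<alpha> :: "nat \<Rightarrow> real" and \<theta>0 :: "('d, 'n::finite) params"
  assumes \<alpha>: "\<And>t. 0 < \<alpha> t" "decseq \<alpha>" "\<not> summable \<alpha>" "summable (\<lambda>t. (\<alpha> t)\<^sup>2)"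
  defines "\<theta> t \<omega> \<equiv> rtrl_params \<phi> lam \<alpha> \<theta>0 (\<lambda>s. X s \<omega>) (\<lambda>s. f (X s \<omega>) (Z s \<omega>) (\<eta> s \<omega>)) t"
    and "L \<equiv> limiting_loss M K \<mu>\<eta> \<phi> lam X Z \<eta> f"
  shows "(\<forall>p. \<exists>D. GDERIV L p :> D) \<and> (\<forall>t. integrable M (\<lambda>\<omega>. norm (gradient L (\<theta> t \<omega>)))) \<and>
    (\<lambda>t. \<integral>\<omega>. norm (gradient L (\<theta> t \<omega>)) \<partial>M) \<longlonglongrightarrow> 0"
proof -
  obtain curve Bl bl al C0 cD where
    SS: "smooth_system \<kappa> (\<lambda>(\<theta> :: ('d, 'n) params) v s. rnn_step \<phi> \<theta> (fst v) s)
      Lp (C / 4) (C / 4) (\<lambda>\<theta> v s q. rnn_tangent \<phi> \<theta> (fst v) s q)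
      (mean_loss lam f \<mu>\<eta>) (mean_loss_tangent lam f \<mu>\<eta>) curve Bl bl al C0 cD"
    using rnn_smooth_system[OF contractive_system_axioms \<phi>_smooth \<phi>_bound C4 lam_smooth lam_bound \<mu>\<eta>_prob \<mu>\<eta>_sets f_Lip f_bound f_measurable]
    by blast
  interpret SS: smooth_system \<kappa> "\<lambda>(\<theta> :: ('d, 'n) params) v s. rnn_step \<phi> \<theta> (fst v) s" Lp "C / 4" "C / 4"
    "\<lambda>\<theta> v s q. rnn_tangent \<phi> \<theta> (fst v) s q" "mean_loss lam f \<mu>\<eta>" "mean_loss_tangent lam f \<mu>\<eta>" curve Bl bl al C0 cD
    by (rule SS)
  have L_eq: "L p = SS.Linf p" for p
  proof -
    have "(\<integral>\<omega>. mean_loss lam f \<mu>\<eta> p (hid p t \<omega>) (v t \<omega>) \<partial>M) = (\<integral>\<omega>. SS.l t p 0 (v 0 \<omega>) \<partial>M)" for t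
      using expectation_evol_iterate[OF SS.l0_Lip SS.bl SS.al, where k = 0 and t = t and \<theta> = p] by (simp add: SS.l_def)
    then have 1: "(\<lambda>t. \<integral>\<omega>. SS.l t p 0 (v 0 \<omega>) \<partial>M) \<longlonglongrightarrow> L p"
      using limiting_loss_tendsto[OF SS.l0_Lip SS.bl SS.al, of p] by (simp add: L_def)
    have "(\<lambda>t. \<integral>\<omega>. SS.l t p 0 (v 0 \<omega>) \<partial>M) \<longlonglongrightarrow> (\<integral>\<omega>. SS.Linf p \<partial>M)"
    proof (rule integral_dominated_convergence[where w = "\<lambda>_. Bl"])
      show "AE \<omega> in M. (\<lambda>t. SS.l t p 0 (v 0 \<omega>)) \<longlonglongrightarrow> SS.Linf p"
        by (intro AE_I2 SS.l_tendsto v_box) (simp add: infnorm_0)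
      show "AE \<omega> in M. norm (SS.l t p 0 (v 0 \<omega>)) \<le> Bl" for t
        using SS.l_bound[of 0 t p] by (simp add: infnorm_0)
      show "(\<lambda>\<omega>. SS.l t p 0 (v 0 \<omega>)) \<in> borel_measurable M" for t
        by (rule SS.l_measurable) measurable
    qed auto
    then have "(\<lambda>t. \<integral>\<omega>. SS.l t p 0 (v 0 \<omega>) \<partial>M) \<longlonglongrightarrow> SS.Linf p" using prob_space by simp
    with 1 show ?thesis by (rule LIMSEQ_unique)
  qed
  then have LL: "L = SS.Linf" by blast
  have grad: "gradient L p = SS.grad p" for p
    unfolding LL by (rule gradient_eqI[OF SS.GDERIV_Linf])
  obtain P1 P2 P3 where P1: "\<And>y. \<bar>deriv \<phi> y\<bar> \<le> P1"
    using smooth_bounded_C3[OF \<phi>_smooth \<phi>_bound] by blast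
  obtain L1 L2 L3 where L1: "\<And>y. \<bar>deriv lam y\<bar> \<le> L1"
    using smooth_bounded_C3[OF lam_smooth lam_bound] by blast
  \<comment> \<open>An entrywise bound for both sensitivity tensors that the recursion preserves and
    that holds at their start 0.\<close>
  obtain m where m: "1 \<le> m" "1 / 4 * P1 + 1 / 4 * (C * m) \<le> m" using ex_invariant_bound[OF C4] by blast
  let ?r = "rstate \<alpha> \<theta>0"
  let ?th = "\<lambda>t p h. fst (?r t p h)" and ?S = "\<lambda>t p h. fst (snd (?r t p h))"
  let ?SA = "\<lambda>t p h. fst (snd (snd (?r t p h)))" and ?SW = "\<lambda>t p h. snd (snd (snd (?r t p h)))"
  let ?T = "\<lambda>t p h. sensitivity (?SA t p h) (?SW t p h)"
  let ?y = "\<lambda>t p h. f (fst (clip (p t))) (snd (clip (p t))) (h t)"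
  have r: "?r t p h = (?th t p h, ?S t p h, ?SA t p h, ?SW t p h)" for t p h by simp
  have r_Suc: "?r (Suc t) p h = (?th t p h - \<alpha> t *\<^sub>R rtrl_gradient lam (?y t p h) (?r t p h),
      rnn_step \<phi> (?th t p h) (fst (clip (p t))) (?S t p h),
      sensitivity_A_step \<phi> (weights_A (?th t p h)) (weights_W (?th t p h)) (fst (clip (p t))) (?S t p h) (?SA t p h),
      sensitivity_W_step \<phi> (weights_A (?th t p h)) (weights_W (?th t p h)) (fst (clip (p t))) (?S t p h) (?SW t p h))" for t p h
    unfolding rstate_Suc using rtrl_step_eq[of \<phi> lam "\<alpha> t" "fst (clip (p t))" "?y t p h" "?th t p h" "?S t p h" "?SA t p h" "?SW t p h"]
    by simp
  have xb: "infnorm (fst (clip (p t))) \<le> 1" for p :: "nat \<Rightarrow> (real ^ 'd) \<times> (real ^ 'z)" and t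
    using infnorm_fst_le[of "clip (p t)"] clip_box[of "p t"] by simp
  have S1: "infnorm (?S t p h) \<le> 1" for t p h
  proof (cases t)
    case 0
    then show ?thesis by (simp add: rstate_def infnorm_0)
  next
    case (Suc s)
    then show ?thesis by (simp add: r_Suc rnn_step_box)
  qed
  have S2: "infnorm (?S t p h) \<le> 2" for t p h using S1[of t p h] by simp
  have SAW: "(\<forall>i j k. \<bar>?SA t p h $ i $ j $ k\<bar> \<le> m) \<and> (\<forall>i j k. \<bar>?SW t p h $ i $ j $ k\<bar> \<le> m)" for t p h
  proof (induction t)
    case 0
    then show ?case using m by (simp add: rstate_def)
  next
    case (Suc t)
    then have 1: "\<And>i j k. \<bar>?SA t p h $ i $ j $ k\<bar> \<le> m" "\<And>i j k. \<bar>?SW t p h $ i $ j $ k\<bar> \<le> m" by auto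
    show ?case unfolding r_Suc fst_conv snd_conv
      using sensitivity_step_bound[OF \<phi>_bound P1 m(2) xb S1 1] by blast
  qed
  define CT where "CT = real CARD('n) * (real CARD('n) * (real CARD('d) * m) + real CARD('n) * (real CARD('n) * m))"
  have CT0: "0 \<le> CT" using m by (simp add: CT_def)
  have Tb: "norm (?T t p h \<tau>) \<le> CT * norm \<tau>" for t p h \<tau>
    unfolding CT_def using SAW[of t p h] by (intro sensitivity_bound) auto
  have pair: "norm (\<tau>, ?T t p h \<tau>) \<le> (1 + CT) * norm \<tau>" for t p h \<tau>
  proof -
    have "norm (\<tau>, ?T t p h \<tau>) \<le> norm \<tau> + norm (?T t p h \<tau>)" by (simp add: norm_Pair sqrt_sum_squares_le_sum)
    then show ?thesis using Tb[of t p h \<tau>] by (simp add: algebra_simps)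
  qed
  define cO where "cO = real CARD('n) * (L1 * 2 + Clam) + L1"
  have cO0: "0 \<le> cO" using order_trans[OF abs_ge_zero L1] order_trans[OF abs_ge_zero lam_bound] by (simp add: cO_def)
  have out_b: "\<bar>net_out_tangent lam (?th t p h) (?S t p h) (\<tau>, ?T t' p' h' \<tau>)\<bar> \<le> cO * ((1 + CT) * norm \<tau>)" for t p h t' p' h' \<tau>
    using order_trans[OF net_out_tangent_bound[of lam Clam L1 "?S t p h", OF lam_bound L1 S2] mult_left_mono[OF pair cO0[unfolded cO_def]]]
    unfolding cO_def .
  define U where "U = Lf + (real CARD('n) * (Clam * 2) + Clam)"
  have Ub: "\<bar>- (f x z e - net_out lam (?th t p h) (?S t p h))\<bar> \<le> U" for x z e t p h
    using f_bound[of x z e] net_out_bound[of lam Clam "?S t p h" "?th t p h", OF lam_bound S2] unfolding U_def by linarith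
  have U0: "0 \<le> U" using order_trans[OF abs_ge_zero Ub] .
  have G_inner: "\<tau> \<bullet> rtrl_gradient lam y (?r t p h) = - (y - net_out lam (?th t p h) (?S t p h)) * net_out_tangent lam (?th t p h) (?S t p h) (\<tau>, ?T t p h \<tau>)"
    for \<tau> y t p h
    by (subst r) (simp only: rtrl_gradient_eq inner_scaleR_right output_direction_inner)
  have Gb: "norm (rtrl_gradient lam (f x z e) (?r t p h)) \<le> U * (cO * (1 + CT))" for x z e t p h
  proof (rule norm_le_of_inner_le)
    fix \<tau>
    have "\<bar>\<tau> \<bullet> rtrl_gradient lam (f x z e) (?r t p h)\<bar> \<le> U * (cO * ((1 + CT) * norm \<tau>))"
      unfolding G_inner by (rule abs_mult_le[OF Ub out_b])
    then show "\<bar>rtrl_gradient lam (f x z e) (?r t p h) \<bullet> \<tau>\<bar> \<le> U * (cO * (1 + CT)) * norm \<tau>"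
      by (simp add: inner_commute mult.assoc)
  qed (use U0 cO0 CT0 in simp)
  have T_cont: "continuous_on UNIV (\<lambda>q :: (real ^ 'n ^ 'd ^ 'n) \<times> (real ^ 'n ^ 'n ^ 'n) \<times> ('d, 'n) params. sensitivity (fst q) (fst (snd q)) (snd (snd q)))"
    unfolding sensitivity_def by (intro continuous_intros)
  have T_m[measurable (raw)]: "(\<lambda>x. sensitivity (a x) (b x) (c x)) \<in> borel_measurable N"
    if "a \<in> borel_measurable N" "b \<in> borel_measurable N" "c \<in> borel_measurable N"
    for a :: "'x \<Rightarrow> real ^ 'n ^ 'd ^ 'n" and b :: "'x \<Rightarrow> real ^ 'n ^ 'n ^ 'n" and c :: "'x \<Rightarrow> ('d, 'n) params" and N :: "'x measure"
    using measurable_compose[OF borel_measurable_Pair[OF that(1) borel_measurable_Pair[OF that(2,3)]] borel_measurable_continuous_onI[OF T_cont]]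
    by simp
  have out_m[measurable (raw)]: "(\<lambda>x. net_out_tangent lam (g x) (h x) (k x)) \<in> borel_measurable N"
    if "g \<in> borel_measurable N" "h \<in> borel_measurable N" "k \<in> borel_measurable N"
    for g :: "'x \<Rightarrow> ('d, 'n) params" and h k and N :: "'x measure"
  proof -
    have "(\<lambda>p :: ('d, 'n) params \<times> (real ^ 'n) \<times> ('d, 'n) params \<times> (real ^ 'n).
        net_out_tangent lam (fst p) (fst (snd p)) (snd (snd p))) \<in> borel_measurable borel"
      by (intro borel_measurable_continuous_onI continuous_intros lam_smooth)
    from measurable_compose[OF borel_measurable_Pair[OF that(1) borel_measurable_Pair[OF that(2,3)]] this]
    show ?thesis by simp
  qed
  note [measurable (raw)] = net_out_measurable[OF lam_smooth]
  have gm[measurable (raw)]: "(\<lambda>x. SS.grad (c x)) \<in> borel_measurable N" if "c \<in> borel_measurable N"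
    for c :: "'x \<Rightarrow> ('d, 'n) params" and N :: "'x measure"
    by (rule measurable_compose[OF that SS.grad_measurable])
  let ?u = "\<lambda>t \<omega>. ?r t (VV \<omega>) (H \<omega>)"
  define th where "th t \<omega> = ?th t (VV \<omega>) (H \<omega>)" for t \<omega>
  define S where "S t \<omega> = ?S t (VV \<omega>) (H \<omega>)" for t \<omega>
  define T where "T t \<omega> = ?T t (VV \<omega>) (H \<omega>)" for t \<omega>
  define G where "G t \<omega> = rtrl_gradient lam (f (fst (v t \<omega>)) (snd (v t \<omega>)) (\<eta> t \<omega>)) (?u t \<omega>)" for t \<omega>
  have clipV: "clip (VV \<omega> t) = v t \<omega>" for t \<omega> by (simp add: v_def VV_def)
  have um[measurable]: "(\<lambda>\<omega>. ?u t \<omega>) \<in> borel_measurable M" for t by measurable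
  have thM[measurable]: "th t \<in> borel_measurable M" for t unfolding th_def[abs_def] by measurable
  have lim: "(\<lambda>t. \<integral>\<omega>. norm (SS.grad (th t \<omega>)) \<partial>M) \<longlonglongrightarrow> 0"
  proof (rule SS.stochastic_gradient_convergence[where V = v and G = G and S = S and T = T and CT = CT and CG = "U * (cO * (1 + CT))" and \<alpha> = \<alpha>])
    show "prob_space M" by (rule prob_space_axioms)
    show "v t \<in> borel_measurable M" for t by (rule v_measurable)
    show "th t \<in> borel_measurable M" for t by (rule thM)
    show "S t \<in> borel_measurable M" for t unfolding S_def[abs_def] by measurable
    show "G t \<in> borel_measurable M" for t
    proof -
      have cont: "continuous_on UNIV (\<lambda>q :: real \<times> ('d, 'n) rtrl_state. - (fst q - net_out lam (fst (snd q)) (fst (snd (snd q)))) *\<^sub>R output_direction lam (snd q))"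
        by (intro continuous_intros lam_smooth)
      have "rtrl_gradient lam y st = - (y - net_out lam (fst st) (fst (snd st))) *\<^sub>R output_direction lam st" for y and st :: "('d, 'n) rtrl_state"
        using rtrl_gradient_eq[of lam y "fst st" "fst (snd st)" "fst (snd (snd st))" "snd (snd (snd st))"] by simp
      then have g: "(\<lambda>q :: real \<times> ('d, 'n) rtrl_state. rtrl_gradient lam (fst q) (snd q)) \<in> borel_measurable borel"
        using borel_measurable_continuous_onI[OF cont] by simp
      show ?thesis unfolding G_def[abs_def]
        using measurable_compose[OF borel_measurable_Pair[OF f_measurable_raw[OF v_measurable[of t] \<eta>_measurable[of t]] um[of t]] g] by simp
    qed
    show "(\<lambda>\<omega>. T t \<omega> (\<tau> \<omega>)) \<in> borel_measurable M" if [measurable]: "\<tau> \<in> borel_measurable M" for t \<tau>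
      unfolding T_def by measurable
    show "infnorm (v t \<omega>) \<le> 1" for t \<omega> by (rule v_box)
    show "infnorm (S t \<omega>) \<le> 1" for t \<omega> unfolding S_def by (rule S1)
    show "linear (T t \<omega>)" for t \<omega> unfolding T_def by (rule sensitivity_linear)
    show "norm (T t \<omega> \<tau>) \<le> CT * norm \<tau>" for t \<omega> \<tau> unfolding T_def by (rule Tb)
    show "norm (G t \<omega>) \<le> U * (cO * (1 + CT))" for t \<omega> unfolding G_def by (rule Gb)
    show "th (Suc t) \<omega> = th t \<omega> - \<alpha> t *\<^sub>R G t \<omega>" for t \<omega>
      unfolding th_def G_def r_Suc fst_conv clipV by (simp add: H_def)
    show "S (Suc t) \<omega> = rnn_step \<phi> (th t \<omega>) (fst (v t \<omega>)) (S t \<omega>)" for t \<omega>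
      unfolding S_def th_def r_Suc fst_conv snd_conv clipV by simp
    show "T (Suc t) \<omega> \<tau> = rnn_tangent \<phi> (th t \<omega>) (fst (v t \<omega>)) (S t \<omega>) (\<tau>, T t \<omega> \<tau>)" for t \<omega> \<tau>
      unfolding T_def S_def th_def r_Suc fst_conv snd_conv clipV by (rule sensitivity_step)
    show "0 < \<alpha> t" for t by (rule \<alpha>)
    show "decseq \<alpha>" "\<not> summable \<alpha>" "summable (\<lambda>t. (\<alpha> t)\<^sup>2)" by (rule \<alpha>)+
    \<comment> \<open>Parameters, memory and sensitivities at time \<open>t\<close> depend on the
      noise strictly before \<open>t\<close>. The noise in the observed output can therefore be
      averaged out, which turns the update into the differential of the mean loss.\<close>
    show "(\<integral>\<omega>. SS.grad (th t \<omega>) \<bullet> G t \<omega> \<partial>M) =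
      (\<integral>\<omega>. mean_loss_tangent lam f \<mu>\<eta> (th t \<omega>) (S t \<omega>) (SS.grad (th t \<omega>), T t \<omega> (SS.grad (th t \<omega>))) (v t \<omega>) \<partial>M)" for t
    proof -
      define g where "g p h e = - (f (fst (clip (p t))) (snd (clip (p t))) e - net_out lam (?th t p h) (?S t p h))
          * net_out_tangent lam (?th t p h) (?S t p h) (SS.grad (?th t p h), ?T t p h (SS.grad (?th t p h)))"
        for p :: "nat \<Rightarrow> (real ^ 'd) \<times> (real ^ 'z)" and h e
      have "(\<integral>\<omega>. SS.grad (th t \<omega>) \<bullet> G t \<omega> \<partial>M) = (\<integral>\<omega>. g (VV \<omega>) (H \<omega>) (\<eta> t \<omega>) \<partial>M)"
        unfolding g_def G_def th_def G_inner clipV ..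
      also have "\<dots> = (\<integral>\<omega>. (\<integral>e. g (VV \<omega>) (H \<omega>) e \<partial>\<mu>\<eta>) \<partial>M)"
      proof (rule noise_step[where c = "U * (cO * ((1 + CT) * SS.Kg))"])
        have [measurable]: "(\<lambda>x :: ((nat \<Rightarrow> (real ^ 'd) \<times> (real ^ 'z)) \<times> (nat \<Rightarrow> real)) \<times> real. fst (fst x) t) \<in> borel_measurable ((path_space \<Otimes>\<^sub>M path_space) \<Otimes>\<^sub>M borel)"
          by (rule measurable_compose[OF measurable_compose[OF measurable_fst measurable_fst] measurable_component_singleton]) simp
        show "(\<lambda>((p, h), e). g p h e) \<in> borel_measurable ((path_space \<Otimes>\<^sub>M path_space) \<Otimes>\<^sub>M borel)"
          unfolding g_def case_prod_beta case_prod_beta' by measurable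
        show "\<bar>g p h e\<bar> \<le> U * (cO * ((1 + CT) * SS.Kg))" for p h e
          unfolding g_def
          by (rule abs_mult_le[OF Ub order_trans[OF out_b mult_left_mono[OF mult_left_mono[OF SS.grad_bound]]]]) (use cO0 CT0 in simp_all)
        show "g p h e = g p h' e" if "\<And>s. s < t \<Longrightarrow> h s = h' s" for p h h' e
          using rstate_past[of t p p h h' \<alpha> \<theta>0] that by (simp add: g_def)
      qed
      also have "\<dots> = (\<integral>\<omega>. mean_loss_tangent lam f \<mu>\<eta> (th t \<omega>) (S t \<omega>) (SS.grad (th t \<omega>), T t \<omega> (SS.grad (th t \<omega>))) (v t \<omega>) \<partial>M)"
        unfolding g_def mean_loss_tangent_def th_def S_def T_def clipV ..
      finally show ?thesis .
    qed
    \<comment> \<open>The parameters are those of time \<open>t\<close>, memory and sensitivities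
      those of time \<open>Suc t\<close>; all of them are functions of the noise and of the data up
      to time \<open>t\<close>, as \<open>Markov_step\<close> requires.\<close>
    show "(\<integral>\<omega>. SS.D k (th t \<omega>) (S (Suc t) \<omega>) (SS.grad (th t \<omega>), T (Suc t) \<omega> (SS.grad (th t \<omega>))) (v (Suc t) \<omega>) \<partial>M) =
      (\<integral>\<omega>. (\<integral>w. SS.D k (th t \<omega>) (S (Suc t) \<omega>) (SS.grad (th t \<omega>), T (Suc t) \<omega> (SS.grad (th t \<omega>))) w \<partial>\<kappa> (v t \<omega>)) \<partial>M)" for t k
    proof -
      define g where "g p h w = SS.D k (?th t p h) (?S (Suc t) p h) (SS.grad (?th t p h), ?T (Suc t) p h (SS.grad (?th t p h))) w" for p h w
      have "(\<integral>\<omega>. g (VV \<omega>) (H \<omega>) (v (Suc t) \<omega>) \<partial>M) = (\<integral>\<omega>. (\<integral>w. g (VV \<omega>) (H \<omega>) w \<partial>\<kappa> (v t \<omega>)) \<partial>M)"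
      proof (rule Markov_step[where c = "cD * (1 + cD) ^ k * ((1 + CT) * SS.Kg)"])
        show "(\<lambda>((p, h), w). g p h w) \<in> borel_measurable ((path_space \<Otimes>\<^sub>M path_space) \<Otimes>\<^sub>M borel)"
          unfolding g_def case_prod_beta case_prod_beta' by (rule SS.D_measurable) measurable
        show "\<bar>g p h w\<bar> \<le> cD * (1 + cD) ^ k * ((1 + CT) * SS.Kg)" if "infnorm w \<le> 1" for p h w
          unfolding g_def
          by (rule order_trans[OF SS.D_bound[OF S2 that] mult_left_mono[OF order_trans[OF pair mult_left_mono[OF SS.grad_bound]]]])
            (use SS.cD CT0 in auto)
        show "g p h w = g p' h w" if "\<And>s. s \<le> t \<Longrightarrow> p s = p' s" for p p' h w
          using rstate_past[of t p p' h h \<alpha> \<theta>0] rstate_past[of "Suc t" p p' h h \<alpha> \<theta>0] that by (simp add: g_def)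
      qed
      then show ?thesis unfolding g_def th_def S_def T_def .
    qed
  qed
  \<comment> \<open>For almost every outcome clipping alters no datum at any time, so the clipped
    run is the actual one.\<close>
  have AE_th: "AE \<omega> in M. th t \<omega> = \<theta> t \<omega>" for t
    using v_eq
  proof eventually_elim
    case (elim \<omega>)
    then show ?case unfolding th_def \<theta>_def rtrl_params_def rstate_def clipV by (simp add: H_def)
  qed
  have XZ: "X s \<in> borel_measurable M" "Z s \<in> borel_measurable M" for s
    using borel_measurable_fst_borel[OF XZ_measurable[of s]] by simp_all
  have \<theta>_m: "\<theta> t \<in> borel_measurable M" for t
  proof -
    note [measurable] = XZ
    have step: "(\<lambda>q :: (real ^ 'd) \<times> real \<times> ('d, 'n) rtrl_state. rtrl_step \<phi> lam (\<alpha> t) (fst q) (fst (snd q)) (snd (snd q))) \<in> borel_measurable borel" for t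
      by (intro borel_measurable_continuous_onI continuous_on_rtrl_step[OF \<phi>_smooth lam_smooth] continuous_intros)
    have fm[measurable]: "(\<lambda>\<omega>. f (X s \<omega>) (Z s \<omega>) (\<eta> s \<omega>)) \<in> borel_measurable M" for s
      using f_measurable_raw[OF XZ_measurable[of s] \<eta>_measurable[of s]] by simp
    have "(\<lambda>\<omega>. rtrl \<phi> lam \<alpha> \<theta>0 (\<lambda>s. X s \<omega>) (\<lambda>s. f (X s \<omega>) (Z s \<omega>) (\<eta> s \<omega>)) t) \<in> borel_measurable M" for t
    proof (induction t)
      case (Suc t)
      from measurable_compose[OF borel_measurable_Pair[OF XZ(1) borel_measurable_Pair[OF fm Suc]] step]
      show ?case by simp
    qed simp
    from borel_measurable_fst_borel(1)[OF this] show ?thesis unfolding \<theta>_def[abs_def] rtrl_params_def by simp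
  qed
  have gnm: "(\<lambda>\<omega>. norm (SS.grad (\<theta> t \<omega>))) \<in> borel_measurable M" for t
    using measurable_compose[OF gm[OF \<theta>_m] borel_measurable_norm] by simp
  have int: "integrable M (\<lambda>\<omega>. norm (SS.grad (\<theta> t \<omega>)))" for t
    by (rule integrable_const_bound[where B = SS.Kg]) (use SS.grad_bound gnm in auto)
  have "(\<integral>\<omega>. norm (SS.grad (\<theta> t \<omega>)) \<partial>M) = (\<integral>\<omega>. norm (SS.grad (th t \<omega>)) \<partial>M)" for t
  proof (rule integral_cong_AE[OF gnm])
    show "AE \<omega> in M. norm (SS.grad (\<theta> t \<omega>)) = norm (SS.grad (th t \<omega>))" using AE_th[of t] by eventually_elim simp
    show "(\<lambda>\<omega>. norm (SS.grad (th t \<omega>))) \<in> borel_measurable M"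
      using measurable_compose[OF gm[OF thM] borel_measurable_norm] by simp
  qed
  then have "(\<lambda>t. \<integral>\<omega>. norm (SS.grad (\<theta> t \<omega>)) \<partial>M) \<longlonglongrightarrow> 0" using lim by simp
  moreover have "\<forall>p. \<exists>D. GDERIV L p :> D" unfolding LL using SS.GDERIV_Linf by blast
  ultimately show ?thesis using int by (simp add: grad)
qed

end

theorem theorem6p1:
  fixes M :: "'w measure"
    and X :: "nat \<Rightarrow> 'w \<Rightarrow> real ^ 'd" and Z :: "nat \<Rightarrow> 'w \<Rightarrow> real ^ 'z"
    and \<eta> Y :: "nat \<Rightarrow> 'w \<Rightarrow> real"
    and K :: "(real ^ 'd) \<times> (real ^ 'z) \<Rightarrow> ((real ^ 'd) \<times> (real ^ 'z)) measure"
    and \<mu>\<eta> :: "real measure"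
    and f :: "real ^ 'd \<Rightarrow> real ^ 'z \<Rightarrow> real \<Rightarrow> real"
    and \<phi> lam :: "real \<Rightarrow> real"
    and Lp Lf C C1 C2 Clam :: real
    and \<alpha> :: "nat \<Rightarrow> real"
    and \<theta>0 :: "('d, 'n::finite) params"
    and \<theta> :: "nat \<Rightarrow> 'w \<Rightarrow> ('d, 'n) params"
    and L :: "('d, 'n) params \<Rightarrow> real"
  assumes "prob_space M"
    \<comment> \<open>data\<close>
    and "markov_chain M K (\<lambda>t \<omega>. (X t \<omega>, Z t \<omega>))"
    and "prob_space.indep_vars M (\<lambda>_. borel) \<eta> UNIV"
    and "\<And>t. distr M borel (\<eta> t) = \<mu>\<eta>"
    and "independent_of M
           (PiM UNIV (\<lambda>_. borel)) (\<lambda>\<omega> t. (X t \<omega>, Z t \<omega>))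
           (PiM UNIV (\<lambda>_. borel)) (\<lambda>\<omega> t. \<eta> t \<omega>)"
    and Y_def: "\<And>t \<omega>. Y t \<omega> = f (X t \<omega>) (Z t \<omega>) (\<eta> t \<omega>)"
    \<comment> \<open>data assumption\<close>
    and "0 \<le> Lp" and "Lp < 1"
    and "\<And>w w'. Wass2 (K w) (K w') \<le> ennreal (Lp * infnorm (w - w'))"
    and "\<And>x z e x' z' e'. \<bar>f x z e - f x' z' e'\<bar> \<le> Lf * infnorm ((x, z, e) - (x', z', e'))"
    and "\<And>t. AE \<omega> in M. infnorm (X t \<omega>, Z t \<omega>) \<le> 1"
    and "\<And>x z e. \<bar>f x z e\<bar> \<le> Lf"
    \<comment> \<open>network\<close>
    and "smooth_bounded \<phi>" and "smooth_bounded lam"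
    and "\<And>y. \<bar>\<phi> y\<bar> \<le> C" and "\<And>y. \<bar>deriv \<phi> y\<bar> \<le> C1" and "\<And>y. \<bar>deriv (deriv \<phi>) y\<bar> \<le> C2"
    and "\<And>y. \<bar>lam y\<bar> \<le> Clam"
    \<comment> \<open>smallness assumption\<close>
    and "C < 4"
    and "0 < sqrt ((Lbar_const CARD('n) CARD('d) C C1 C2)\<^sup>2 + Lp\<^sup>2)"
    and "sqrt ((Lbar_const CARD('n) CARD('d) C C1 C2)\<^sup>2 + Lp\<^sup>2) < 1"
    \<comment> \<open>learning-rate assumption\<close>
    and "\<And>t. 0 < \<alpha> t" and "decseq \<alpha>" and "\<not> summable \<alpha>" and "summable (\<lambda>t. (\<alpha> t)\<^sup>2)"
    \<comment> \<open>algorithm and limiting loss\<close>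
    and \<theta>_def: "\<And>t \<omega>. \<theta> t \<omega> = rtrl_params \<phi> lam \<alpha> \<theta>0 (\<lambda>s. X s \<omega>) (\<lambda>s. Y s \<omega>) t"
    and L_def: "L = limiting_loss M K \<mu>\<eta> \<phi> lam X Z \<eta> f"
  shows "(\<forall>p. \<exists>D. GDERIV L p :> D) \<and>
         (\<forall>t. integrable M (\<lambda>\<omega>. norm (gradient L (\<theta> t \<omega>)))) \<and>
         (\<lambda>t. \<integral>\<omega>. norm (gradient L (\<theta> t \<omega>)) \<partial>M) \<longlonglongrightarrow> 0"
proof -
  interpret recurrent_learning M X Z \<eta> K \<mu>\<eta> f \<phi> lam Lp Lf C Clam
    by (intro recurrent_learning.intro recurrent_learning_axioms.intro) (fact assms)+
  show ?thesis
    unfolding \<theta>_def L_def Y_def by (rule loss_gradient_vanishes) (fact assms)+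
qed

end
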